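(* Let $(M,\omega,\tau,\Phi)$ be a compact connected Hamiltonian $(U,\sigma)$-manifold with a compatible complex structure for which $\tau$ is antiholomorphic, and with a $(U,\sigma)$-equivariant holomorphic prequantum line bundle $L$. Then for every $m\in M^\tau$, $$\Delta(\overline{Gm})=\Delta(\overline{U^{\mathbb C}m})\cap\mathfrak a^*.$$
   Context: $U$ is a compact connected Lie group with Lie algebra $\mathfrak u$, and $\sigma\colon U\to U$ is an automorphism with $\sigma^2=\mathrm{id}$; the induced involutions on $\mathfrak u,\mathfrak u^*$ are also denoted $\sigma$. A Hamiltonian $(U,\sigma)$-manifold is a quadruple $(M,\omega,\tau,\Phi)$ where $M$ is a smooth manifold with a $U$-action, $\omega$ is a symplectic form, $\tau$ is a diffeomorphism of $M$ with $\tau^2=\mathrm{id}_M$, $\tau^*\omega=-\omega$, and $\Phi\colon M\to\mathfrak u^*$ is a $U$-equivariant moment map ($d\Phi^\xi=\iota(\xi_M)\omega$, with $\xi_M$ the vector field induced by $\xi\in\mathfrak u$ and $\Phi^\xi=\langle\Phi,\xi\rangle$) such that $\Phi(\tau(m))=-\sigma(\Phi(m))$ and $\tau(um)=\sigma(u)\tau(m)$. $M^\tau$ is the fixed-point set of $\tau$. $K$ is the identity component of $U^\sigma$, $\mathfrak k=\mathrm{Lie}(K)$, $\mathfrak q$ the $-1$-eigenspace of $\sigma$ on $\mathfrak u$; $\mathfrak a\subseteq\mathfrak q$ is maximal abelian, $\mathfrak t\supseteq\mathfrak a$ a maximal abelian subalgebra of $\mathfrak u$ (automatically $\sigma$-stable,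 $\mathfrak t=\mathfrak t'\oplus\mathfrak a$ with $\mathfrak t'=\mathfrak t\cap\mathfrak k$), $T=\exp\mathfrak t$. $\mathfrak t^*$ is regarded as the $T$-fixed subspace of $\mathfrak u^*$, $\mathfrak a^*$ as the annihilator of $\mathfrak t'$ in $\mathfrak t^*$. $R$ is the root system of $(U,T)$, $R'\subseteq R$ the roots vanishing on $\mathfrak a$, $R^{\mathfrak a}=\{\alpha|_{\mathfrak a}:\alpha\in R\setminus R'\}$. Positive systems $R'_+$, $R^{\mathfrak a}_+$ are fixed and $R_+=R'_+\cup\{\alpha\in R:\alpha|_{\mathfrak a}\in R^{\mathfrak a}_+\}$; $\mathfrak t^*_+$ is the closed Weyl chamber of $R_+$. For $X\subseteq M$, $\Delta(X)=\Phi(X)\cap\mathfrak t^*_+$. Kähler setting: $M$ has an integrable complex structure $J$, $U$-invariant and compatible with $\omega$ (i.e. $J$ preserves $\omega$ and $\omega(\cdot,J\cdot)$ is positive definite), for which $\tau$ is antiholomorphic. $L\to M$ is a holomorphic line bundle with Hermitian metric and compatible Hermitian connection $\nabla$ of curvature $-2\pi i\omega$; the $U$-action lifts to a unitary action on $L$ with generating vector fields $\xi_L=(\xi_M)_{\mathrm{hor}}+2\pi\Phi^\xi\nu_L$ ($\nu_L$ the generator of the scalar $S^1$-action), and $\tau$ lifts to a conjugate-linear antiholomorphic involution $\tau_L$ of $L$ preserving $\nabla$. The $U$-action on $M$ extends to a holomorphic action of the complexification $U^{\mathbb C}$. Put $\mathfrak p=i\mathfrak q$ and $\mathfrak g=\mathfrak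 k\oplus\mathfrak p\subseteq\mathfrak u^{\mathbb C}$; $G$ is the connected real reductive subgroup of $U^{\mathbb C}$ generated by $\exp\mathfrak g$. It acts on $M$ by restriction. Bars denote closures in $M$. *)

theory Defs
  imports "HOL-Analysis.Analysis" "HOL-Algebra.Generated_Groups" "HOL-Algebra.Group_Action"
begin

section \<open>Smooth manifolds\<close>

text \<open>Smooth means \<open>C\<^sup>\<infinity>\<close>. The model spaces below are finite-dimensional, so that all
  directional derivatives of order \<open>n\<close> being continuous is the same as being of class \<open>C\<^sup>n\<close>.
  The set \<open>S\<close> is always open where these notions are used.\<close>

fun Ck_on :: "nat \<Rightarrow> ('e::real_normed_vector \<Rightarrow> 'f::real_normed_vector) \<Rightarrow> 'e set \<Rightarrow> bool" where
  "Ck_on 0 f S \<longleftrightarrow> continuous_on S f"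
| "Ck_on (Suc n) f S \<longleftrightarrow> (\<forall>x\<in>S. f differentiable (at x)) \<and>
     (\<forall>v. Ck_on n (\<lambda>x. frechet_derivative f (at x) v) S)"

definition smooth_on :: "'e set \<Rightarrow> ('e::real_normed_vector \<Rightarrow> 'f::real_normed_vector) \<Rightarrow> bool" where
  "smooth_on S f \<longleftrightarrow> (\<forall>n. Ck_on n f S)"

text \<open>An atlas is given as a family of charts indexed by the points of the manifold, the chart with
  index \<open>p\<close> being defined around \<open>p\<close>. The tangent space at \<open>p\<close> is then the model space \<open>'e\<close>
  itself: a tangent vector at \<open>p\<close> is represented by its coordinates in the chart with index \<open>p\<close>.
  The model space is a finite-dimensional normed space instead of a \<open>euclidean_space\<close>, because the
  latter class excludes dimension zero.\<close>

type_synonym ('a, 'e) charts = "'a \<Rightarrow> 'a set \<times> ('a \<Rightarrow> 'e)"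

definition cdom :: "('a, 'e) charts \<Rightarrow> 'a \<Rightarrow> 'a set" where
  "cdom A p = fst (A p)"

definition cmap :: "('a, 'e) charts \<Rightarrow> 'a \<Rightarrow> 'a \<Rightarrow> 'e" where
  "cmap A p = snd (A p)"

definition cinv :: "('a, 'e) charts \<Rightarrow> 'a \<Rightarrow> 'e \<Rightarrow> 'a" where
  "cinv A p = inv_into (cdom A p) (cmap A p)"

locale smooth_manifold =
  fixes A :: "('a::{t2_space, second_countable_topology}, 'e::real_normed_vector) charts"
  assumes finite_dim: "\<exists>B :: 'e set. finite B \<and> span B = UNIV"
    and open_cdom: "open (cdom A p)"
    and mem_cdom: "p \<in> cdom A p"
    and open_cmap: "open (cmap A p ` cdom A p)"
    and homeo_cmap: "homeomorphism (cdom A p) (cmap A p ` cdom A p) (cmap A p) (cinv A p)"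
    and transition: "smooth_on (cmap A q ` (cdom A p \<inter> cdom A q)) (cmap A p \<circ> cinv A q)"

definition vspace :: "('e, 'e) charts" where
  "vspace = (\<lambda>p. (UNIV, \<lambda>x. x))"

definition prod_charts :: "('a, 'e) charts \<Rightarrow> ('b, 'f) charts \<Rightarrow> ('a \<times> 'b, 'e \<times> 'f) charts" where
  "prod_charts A B = (\<lambda>(p, q). (cdom A p \<times> cdom B q, map_prod (cmap A p) (cmap B q)))"

definition smooth_map_on ::
  "('a::topological_space, 'e::real_normed_vector) charts \<Rightarrow>
   ('b::topological_space, 'f::real_normed_vector) charts \<Rightarrow> 'a set \<Rightarrow> ('a \<Rightarrow> 'b) \<Rightarrow> bool" where
  "smooth_map_on A B S f \<longleftrightarrow> continuous_on S f \<and>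
     (\<forall>p q. smooth_on (cmap A p ` (cdom A p \<inter> S \<inter> f -` cdom B q)) (cmap B q \<circ> f \<circ> cinv A p))"

abbreviation "smooth_map A B f \<equiv> smooth_map_on A B UNIV f"

text \<open>The tangent map \<open>T\<^sub>p f\<close>, from the tangent space at \<open>p\<close> to the tangent space at \<open>f p\<close>.\<close>

definition tmap ::
  "('a, 'e::real_normed_vector) charts \<Rightarrow> ('b, 'f::real_normed_vector) charts \<Rightarrow>
   ('a \<Rightarrow> 'b) \<Rightarrow> 'a \<Rightarrow> 'e \<Rightarrow> 'f" where
  "tmap A B f p = frechet_derivative (cmap B (f p) \<circ> f \<circ> cinv A p) (at (cmap A p p))"

text \<open>The velocity of a curve at time \<open>0\<close>.\<close>

definition velocity :: "('a, 'e::real_normed_vector) charts \<Rightarrow> (real \<Rightarrow> 'a) \<Rightarrow> 'e" where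
  "velocity A c = tmap vspace A c 0 1"

subsection \<open>Differential forms\<close>

text \<open>A form assigns to each point an alternating form on the tangent space. Its coordinate
  expression in the chart with index \<open>q\<close> is the pullback by the inverse of that chart.\<close>

definition coord1 ::
  "('a, 'e::real_normed_vector) charts \<Rightarrow> 'a \<Rightarrow> ('a \<Rightarrow> 'e \<Rightarrow> 'b) \<Rightarrow> 'e \<Rightarrow> 'e \<Rightarrow> 'b" where
  "coord1 A q \<alpha> x v = \<alpha> (cinv A q x) (tmap vspace A (cinv A q) x v)"

definition coord2 ::
  "('a, 'e::real_normed_vector) charts \<Rightarrow> 'a \<Rightarrow> ('a \<Rightarrow> 'e \<Rightarrow> 'e \<Rightarrow> 'b) \<Rightarrow> 'e \<Rightarrow> 'e \<Rightarrow> 'e \<Rightarrow> 'b" where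
  "coord2 A q \<omega> x v w =
     \<omega> (cinv A q x) (tmap vspace A (cinv A q) x v) (tmap vspace A (cinv A q) x w)"

definition ext_deriv1 ::
  "('e \<Rightarrow> 'e \<Rightarrow> 'b) \<Rightarrow> 'e::real_normed_vector \<Rightarrow> 'e \<Rightarrow> 'e \<Rightarrow> 'b::real_normed_vector" where
  "ext_deriv1 \<alpha> x v w =
     frechet_derivative (\<lambda>y. \<alpha> y w) (at x) v - frechet_derivative (\<lambda>y. \<alpha> y v) (at x) w"

definition ext_deriv2 ::
  "('e \<Rightarrow> 'e \<Rightarrow> 'e \<Rightarrow> 'b) \<Rightarrow> 'e::real_normed_vector \<Rightarrow> 'e \<Rightarrow> 'e \<Rightarrow> 'e \<Rightarrow> 'b::real_normed_vector" where
  "ext_deriv2 \<omega> x u v w =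
     frechet_derivative (\<lambda>y. \<omega> y v w) (at x) u - frechet_derivative (\<lambda>y. \<omega> y u w) (at x) v
     + frechet_derivative (\<lambda>y. \<omega> y u v) (at x) w"

locale symplectic_manifold = smooth_manifold A
  for A :: "('m::{t2_space, second_countable_topology}, 'me::real_normed_vector) charts" +
  fixes \<omega> :: "'m \<Rightarrow> 'me \<Rightarrow> 'me \<Rightarrow> real"
  assumes bilin: "bilinear (\<omega> m)"
    and alternating: "\<omega> m v v = 0"
    and nondegenerate: "(\<And>w. \<omega> m v w = 0) \<Longrightarrow> v = 0"
    and smooth_form: "smooth_on (cmap A q ` cdom A q) (\<lambda>x. coord2 A q \<omega> x v w)"
    and closed_form: "x \<in> cmap A q ` cdom A q \<Longrightarrow> ext_deriv2 (coord2 A q \<omega>) x u v w = 0"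

subsection \<open>Complex structures\<close>

text \<open>An integrable almost complex structure: around each point there are smooth coordinates in which
  \<open>J\<close> is constant, that is, holomorphic coordinates.\<close>

locale complex_manifold = smooth_manifold A
  for A :: "('m::{t2_space, second_countable_topology}, 'me::real_normed_vector) charts" +
  fixes J :: "'m \<Rightarrow> 'me \<Rightarrow> 'me"
  assumes linear_J: "linear (J m)"
    and J_J: "J m (J m v) = - v"
    and integrable: "\<exists>D (\<psi> :: 'm \<Rightarrow> 'me) J\<^sub>0. open D \<and> m \<in> D \<and> inj_on \<psi> D \<and> open (\<psi> ` D)
          \<and> smooth_map_on A vspace D \<psi> \<and> smooth_map_on vspace A (\<psi> ` D) (inv_into D \<psi>)
          \<and> linear J\<^sub>0 \<and> (\<forall>p\<in>D. \<forall>v. tmap A vspace \<psi> p (J p v) = J\<^sub>0 (tmap A vspace \<psi> p v))"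

definition holomorphic_map_on ::
  "('a::topological_space, 'e::real_normed_vector) charts \<Rightarrow> ('a \<Rightarrow> 'e \<Rightarrow> 'e) \<Rightarrow>
   ('b::topological_space, 'f::real_normed_vector) charts \<Rightarrow> ('b \<Rightarrow> 'f \<Rightarrow> 'f) \<Rightarrow>
   'a set \<Rightarrow> ('a \<Rightarrow> 'b) \<Rightarrow> bool" where
  "holomorphic_map_on A J B J' S f \<longleftrightarrow> smooth_map_on A B S f \<and>
     (\<forall>p\<in>S. \<forall>v. tmap A B f p (J p v) = J' (f p) (tmap A B f p v))"

abbreviation "holomorphic_map A J B J' f \<equiv> holomorphic_map_on A J B J' UNIV f"

definition antiholomorphic_map ::
  "('a::topological_space, 'e::real_normed_vector) charts \<Rightarrow> ('a \<Rightarrow> 'e \<Rightarrow> 'e) \<Rightarrow>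
   ('b::topological_space, 'f::real_normed_vector) charts \<Rightarrow> ('b \<Rightarrow> 'f \<Rightarrow> 'f) \<Rightarrow>
   ('a \<Rightarrow> 'b) \<Rightarrow> bool" where
  "antiholomorphic_map A J B J' f \<longleftrightarrow> smooth_map A B f \<and>
     (\<forall>p v. tmap A B f p (J p v) = - J' (f p) (tmap A B f p v))"

definition prod_J :: "('a \<Rightarrow> 'e \<Rightarrow> 'e) \<Rightarrow> ('b \<Rightarrow> 'f \<Rightarrow> 'f) \<Rightarrow> 'a \<times> 'b \<Rightarrow> 'e \<times> 'f \<Rightarrow> 'e \<times> 'f" where
  "prod_J J J' = (\<lambda>(p, q). map_prod (J p) (J' q))"

definition complex_J :: "complex \<Rightarrow> complex \<Rightarrow> complex" where
  "complex_J z v = \<i> * v"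


section \<open>Lie groups\<close>

text \<open>The group is the whole type. Its Lie algebra, the tangent space at the identity, is therefore
  the model space as a vector space.\<close>

locale lie_group = group U + smooth_manifold A
  for U :: "'u::{t2_space, second_countable_topology} monoid" (structure)
    and A :: "('u, 'ue::real_normed_vector) charts" +
  assumes carrier_UNIV: "carrier U = UNIV"
    and smooth_mult: "smooth_map (prod_charts A A) A (\<lambda>(x, y). x \<otimes> y)"
    and smooth_inverse: "smooth_map A A (\<lambda>x. inv x)"

locale complex_lie_group = lie_group U A + complex_manifold A J
  for U :: "'u::{t2_space, second_countable_topology} monoid" (structure)
    and A :: "('u, 'ue::real_normed_vector) charts" and J :: "'u \<Rightarrow> 'ue \<Rightarrow> 'ue" +
  assumes holomorphic_mult:
      "holomorphic_map (prod_charts A A) (prod_J J J) A J (\<lambda>(x, y). x \<otimes> y)"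
    and holomorphic_inverse: "holomorphic_map A J A J (\<lambda>x. inv x)"

definition lie_exp ::
  "('u::topological_space) monoid \<Rightarrow> ('u, 'ue::real_normed_vector) charts \<Rightarrow> 'ue \<Rightarrow> 'u" where
  "lie_exp U A \<xi> = (THE g. \<exists>\<gamma>. smooth_map vspace A \<gamma> \<and> (\<forall>s t. \<gamma> (s + t) = \<gamma> s \<otimes>\<^bsub>U\<^esub> \<gamma> t)
     \<and> velocity A \<gamma> = \<xi> \<and> g = \<gamma> 1)"

definition Ad ::
  "('u::topological_space) monoid \<Rightarrow> ('u, 'ue::real_normed_vector) charts \<Rightarrow> 'u \<Rightarrow> 'ue \<Rightarrow> 'ue" where
  "Ad U A g = tmap A A (\<lambda>x. g \<otimes>\<^bsub>U\<^esub> x \<otimes>\<^bsub>U\<^esub> inv\<^bsub>U\<^esub> g) \<one>\<^bsub>U\<^esub>"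

definition bracket ::
  "('u::topological_space) monoid \<Rightarrow> ('u, 'ue::real_normed_vector) charts \<Rightarrow> 'ue \<Rightarrow> 'ue \<Rightarrow> 'ue" where
  "bracket U A \<xi> \<eta> = vector_derivative (\<lambda>t. Ad U A (lie_exp U A (t *\<^sub>R \<xi>)) \<eta>) (at 0)"

text \<open>The Lie algebra of a closed subgroup \<open>H\<close>.\<close>

definition subgroup_algebra ::
  "('u::topological_space) monoid \<Rightarrow> ('u, 'ue::real_normed_vector) charts \<Rightarrow> 'u set \<Rightarrow> 'ue set" where
  "subgroup_algebra U A H = {\<xi>. \<forall>t::real. lie_exp U A (t *\<^sub>R \<xi>) \<in> H}"

text \<open>The vector field on \<open>M\<close> induced by \<open>\<xi>\<close>.\<close>

definition induced_field ::
  "('u::topological_space) monoid \<Rightarrow> ('u, 'ue::real_normed_vector) charts \<Rightarrow>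
   ('m, 'me::real_normed_vector) charts \<Rightarrow> ('u \<Rightarrow> 'm \<Rightarrow> 'm) \<Rightarrow> 'ue \<Rightarrow> 'm \<Rightarrow> 'me" where
  "induced_field U A AM act \<xi> m = velocity AM (\<lambda>t. act (lie_exp U A (t *\<^sub>R \<xi>)) m)"

definition smooth_action ::
  "('u::topological_space) monoid \<Rightarrow> ('u, 'ue::real_normed_vector) charts \<Rightarrow>
   ('m::topological_space, 'me::real_normed_vector) charts \<Rightarrow> ('u \<Rightarrow> 'm \<Rightarrow> 'm) \<Rightarrow> bool" where
  "smooth_action U A AM act \<longleftrightarrow>
     group_action U UNIV act \<and> smooth_map (prod_charts A AM) AM (\<lambda>(u, m). act u m)"

text \<open>The complexification of a compact Lie group \<open>U\<close>: a complex Lie group \<open>H\<close> with a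
  homomorphism \<open>\<iota>\<close> from \<open>U\<close> to \<open>H\<close> for which the polar decomposition \<open>H = U exp(i \<uu>)\<close> holds,
  that is, \<open>(u, \<xi>) \<mapsto> \<iota>(u) exp(i \<iota>\<^sub>* \<xi>)\<close> is a diffeomorphism from \<open>U \<times> \<uu>\<close> to \<open>H\<close>. In particular
  the Lie algebra of \<open>H\<close> is \<open>\<iota>\<^sub>* \<uu> \<oplus> i \<iota>\<^sub>* \<uu>\<close>.\<close>

definition polar_map where
  "polar_map U A H AH JH \<iota> = (\<lambda>(u, \<xi>).
     \<iota> u \<otimes>\<^bsub>H\<^esub> lie_exp H AH (JH \<one>\<^bsub>H\<^esub> (tmap A AH \<iota> \<one>\<^bsub>U\<^esub> \<xi>)))"

locale complexification = U: lie_group U A + H: complex_lie_group H AH JH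
  for U :: "'u::{t2_space, second_countable_topology} monoid"
    and A :: "('u, 'ue::real_normed_vector) charts"
    and H :: "'h::{t2_space, second_countable_topology} monoid"
    and AH :: "('h, 'he::real_normed_vector) charts" and JH :: "'h \<Rightarrow> 'he \<Rightarrow> 'he" +
  fixes \<iota> :: "'u \<Rightarrow> 'h"
  assumes hom_\<iota>: "\<iota> \<in> hom U H"
    and smooth_\<iota>: "smooth_map A AH \<iota>"
    and bij_polar: "bij (polar_map U A H AH JH \<iota>)"
    and smooth_polar: "smooth_map (prod_charts A vspace) AH (polar_map U A H AH JH \<iota>)"
    and smooth_polar_inv: "smooth_map AH (prod_charts A vspace) (inv_into UNIV (polar_map U A H AH JH \<iota>))"


section \<open>Compact groups with involution\<close>

locale group_with_involution = lie_group U A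
  for U :: "'u::{t2_space, second_countable_topology} monoid" (structure)
    and A :: "('u, 'ue::real_normed_vector) charts" +
  fixes \<sigma> :: "'u \<Rightarrow> 'u"
  assumes compact_U: "compact (UNIV :: 'u set)"
    and connected_U: "connected (UNIV :: 'u set)"
    and hom_\<sigma>: "\<sigma> \<in> hom U U"
    and smooth_\<sigma>: "smooth_map A A \<sigma>"
    and \<sigma>_\<sigma>: "\<sigma> (\<sigma> u) = u"

definition lie_involution ::
  "('u::topological_space) monoid \<Rightarrow> ('u, 'ue::real_normed_vector) charts \<Rightarrow> ('u \<Rightarrow> 'u) \<Rightarrow> 'ue \<Rightarrow> 'ue" where
  "lie_involution U A \<sigma> = tmap A A \<sigma> \<one>\<^bsub>U\<^esub>"

definition K_group :: "('u::topological_space) monoid \<Rightarrow> ('u \<Rightarrow> 'u) \<Rightarrow> 'u set" where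
  "K_group U \<sigma> = connected_component_set {u. \<sigma> u = u} \<one>\<^bsub>U\<^esub>"

definition k_algebra where
  "k_algebra U A \<sigma> = subgroup_algebra U A (K_group U \<sigma>)"

definition q_space where
  "q_space U A \<sigma> = {\<xi>. lie_involution U A \<sigma> \<xi> = - \<xi>}"

definition abelian_subspace where
  "abelian_subspace U A \<bb> \<longleftrightarrow> subspace \<bb> \<and> (\<forall>\<xi>\<in>\<bb>. \<forall>\<eta>\<in>\<bb>. bracket U A \<xi> \<eta> = 0)"

definition maximal_abelian_in where
  "maximal_abelian_in U A V \<bb> \<longleftrightarrow> \<bb> \<subseteq> V \<and> abelian_subspace U A \<bb> \<and>
     (\<forall>\<cc>. \<cc> \<subseteq> V \<longrightarrow> abelian_subspace U A \<cc> \<longrightarrow> \<bb> \<subseteq> \<cc> \<longrightarrow> \<cc> = \<bb>)"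

subsection \<open>Roots and the Weyl chamber\<close>

text \<open>Roots are normalized to be real: \<open>\<alpha>\<close> is a root if there is \<open>e \<noteq> 0\<close> in the complexification of
  \<open>\<uu>\<close> with \<open>[\<xi>, e] = i \<alpha>(\<xi>) e\<close> for all \<open>\<xi>\<close> in \<open>\<tt>\<close>. Here \<open>e = x + i y\<close> is written as the pair \<open>x\<close>, \<open>y\<close>.
  A root is a function on \<open>\<tt>\<close>, extended by \<open>undefined\<close> outside of \<open>\<tt>\<close>.\<close>

definition root_vector where
  "root_vector U A \<tt> \<alpha> x y \<longleftrightarrow> (x \<noteq> 0 \<or> y \<noteq> 0) \<and>
     (\<forall>\<xi>\<in>\<tt>. bracket U A \<xi> x = - (\<alpha> \<xi> *\<^sub>R y) \<and> bracket U A \<xi> y = \<alpha> \<xi> *\<^sub>R x)"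

definition roots ::
  "('u::topological_space) monoid \<Rightarrow> ('u, 'ue::real_normed_vector) charts \<Rightarrow> 'ue set \<Rightarrow> ('ue \<Rightarrow> real) set" where
  "roots U A \<tt> = {\<alpha> \<in> extensional \<tt>. (\<exists>\<xi>\<in>\<tt>. \<alpha> \<xi> \<noteq> 0) \<and> (\<exists>x y. root_vector U A \<tt> \<alpha> x y)}"

definition roots' where
  "roots' U A \<tt> \<aa> = {\<alpha> \<in> roots U A \<tt>. \<forall>\<xi>\<in>\<aa>. \<alpha> \<xi> = 0}"

definition restricted_roots where
  "restricted_roots U A \<tt> \<aa> = (\<lambda>\<alpha>. restrict \<alpha> \<aa>) ` (roots U A \<tt> - roots' U A \<tt> \<aa>)"

definition positive_system :: "'e set \<Rightarrow> ('e \<Rightarrow> real) set \<Rightarrow> ('e \<Rightarrow> real) set \<Rightarrow> bool" where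
  "positive_system V R P \<longleftrightarrow> (\<exists>\<xi>\<in>V. (\<forall>\<alpha>\<in>R. \<alpha> \<xi> \<noteq> 0) \<and> P = {\<alpha>\<in>R. \<alpha> \<xi> > 0})"

definition positive_roots where
  "positive_roots U A \<tt> \<aa> P' Pa = P' \<union> {\<alpha> \<in> roots U A \<tt>. restrict \<alpha> \<aa> \<in> Pa}"

text \<open>The coroot of \<open>\<alpha>\<close> is the vector of \<open>[\<gg>\<^sub>\<alpha>, \<gg>\<^sub>-\<^sub>\<alpha>] \<inter> \<tt>\<close> on which \<open>\<alpha>\<close> takes the value \<open>2\<close>. The conjugate
  of \<open>e = x + i y\<close> spans \<open>\<gg>\<^sub>-\<^sub>\<alpha>\<close> and \<open>[x + i y, x - i y] = - 2 i [x, y]\<close>.\<close>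

definition is_coroot where
  "is_coroot U A \<tt> \<alpha> h \<longleftrightarrow> h \<in> \<tt> \<and> \<alpha> h = 2 \<and>
     (\<exists>x y. root_vector U A \<tt> \<alpha> x y \<and> h \<in> span {bracket U A x y})"

text \<open>\<open>\<tt>\<^sup>*\<close> is the subspace of \<open>\<uu>\<^sup>*\<close> fixed by the coadjoint action of \<open>T = exp \<tt>\<close>.\<close>

definition t_dual ::
  "('u::topological_space) monoid \<Rightarrow> ('u, 'ue::real_normed_vector) charts \<Rightarrow> 'ue set \<Rightarrow> ('ue \<Rightarrow>\<^sub>L real) set" where
  "t_dual U A \<tt> = {f. \<forall>u \<in> lie_exp U A ` \<tt>. \<forall>\<eta>. blinfun_apply f (Ad U A (inv\<^bsub>U\<^esub> u) \<eta>) = blinfun_apply f \<eta>}"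

definition a_dual where
  "a_dual U A \<sigma> \<tt> = {f \<in> t_dual U A \<tt>. \<forall>\<xi> \<in> \<tt> \<inter> k_algebra U A \<sigma>. blinfun_apply f \<xi> = 0}"

definition weyl_chamber where
  "weyl_chamber U A \<tt> P = {f \<in> t_dual U A \<tt>. \<forall>\<alpha>\<in>P. \<forall>h. is_coroot U A \<tt> \<alpha> h \<longrightarrow> blinfun_apply f h \<ge> 0}"

definition moment_Delta where
  "moment_Delta U A \<tt> P \<Phi> X = \<Phi> ` X \<inter> weyl_chamber U A \<tt> P"

subsection \<open>The real reductive group \<open>G\<close>\<close>

text \<open>\<open>\<gg> = \<kk> \<oplus> i \<qq>\<close>, and \<open>G\<close> is generated by \<open>exp \<gg>\<close> in \<open>H = U\<^sup>C\<close>.\<close>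

definition g_algebra where
  "g_algebra U A \<sigma> H AH JH \<iota> =
     {tmap A AH \<iota> \<one>\<^bsub>U\<^esub> \<xi> + JH \<one>\<^bsub>H\<^esub> (tmap A AH \<iota> \<one>\<^bsub>U\<^esub> \<eta>) | \<xi> \<eta>. \<xi> \<in> k_algebra U A \<sigma> \<and> \<eta> \<in> q_space U A \<sigma>}"

definition G_group where
  "G_group U A \<sigma> H AH JH \<iota> = generate H (lie_exp H AH ` g_algebra U A \<sigma> H AH JH \<iota>)"


section \<open>Hamiltonian manifolds with involution\<close>

locale hamiltonian_manifold =
  group_with_involution U A \<sigma> + M: symplectic_manifold AM \<omega>
  for U :: "'u::{t2_space, second_countable_topology} monoid" (structure)
    and A :: "('u, 'ue::real_normed_vector) charts" and \<sigma> :: "'u \<Rightarrow> 'u"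
    and AM :: "('m::{t2_space, second_countable_topology}, 'me::real_normed_vector) charts"
    and \<omega> :: "'m \<Rightarrow> 'me \<Rightarrow> 'me \<Rightarrow> real" +
  fixes act :: "'u \<Rightarrow> 'm \<Rightarrow> 'm" and \<tau> :: "'m \<Rightarrow> 'm" and \<Phi> :: "'m \<Rightarrow> ('ue \<Rightarrow>\<^sub>L real)"
  assumes action: "smooth_action U A AM act"
    and smooth_\<tau>: "smooth_map AM AM \<tau>"
    and \<tau>_\<tau>: "\<tau> (\<tau> m) = m"
    and \<tau>_\<omega>: "\<omega> (\<tau> m) (tmap AM AM \<tau> m v) (tmap AM AM \<tau> m w) = - \<omega> m v w"
    and smooth_\<Phi>: "smooth_map AM vspace \<Phi>"
    and equivariant_\<Phi>: "blinfun_apply (\<Phi> (act u m)) \<xi> = blinfun_apply (\<Phi> m) (Ad U A (inv u) \<xi>)"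
    and moment_\<Phi>: "tmap AM vspace (\<lambda>m. blinfun_apply (\<Phi> m) \<xi>) m v = \<omega> m (induced_field U A AM act \<xi> m) v"
    and \<tau>_\<Phi>: "blinfun_apply (\<Phi> (\<tau> m)) \<xi> = - blinfun_apply (\<Phi> m) (lie_involution U A \<sigma> \<xi>)"
    and \<tau>_act: "\<tau> (act u m) = act (\<sigma> u) (\<tau> m)"

locale kaehler_hamiltonian_manifold =
  hamiltonian_manifold U A \<sigma> AM \<omega> act \<tau> \<Phi> + M: complex_manifold AM J
  for U :: "'u::{t2_space, second_countable_topology} monoid" (structure)
    and A :: "('u, 'ue::real_normed_vector) charts" and \<sigma> :: "'u \<Rightarrow> 'u"
    and AM :: "('m::{t2_space, second_countable_topology}, 'me::real_normed_vector) charts"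
    and \<omega> :: "'m \<Rightarrow> 'me \<Rightarrow> 'me \<Rightarrow> real"
    and act :: "'u \<Rightarrow> 'm \<Rightarrow> 'm" and \<tau> :: "'m \<Rightarrow> 'm" and \<Phi> :: "'m \<Rightarrow> ('ue \<Rightarrow>\<^sub>L real)"
    and J :: "'m \<Rightarrow> 'me \<Rightarrow> 'me" +
  assumes invariant_J: "tmap AM AM (act u) m (J m v) = J (act u m) (tmap AM AM (act u) m v)"
    and J_\<omega>: "\<omega> m (J m v) (J m w) = \<omega> m v w"
    and J_positive: "v \<noteq> 0 \<Longrightarrow> \<omega> m v (J m v) > 0"
    and antiholomorphic_\<tau>: "antiholomorphic_map AM J AM J \<tau>"


section \<open>Prequantum line bundles\<close>

text \<open>A holomorphic line bundle is given by its total space, the projection and the scalar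
  multiplication in the fibres. As the fibres are one-dimensional, addition in the fibres is
  determined by \<open>a l + b l = (a + b) l\<close>, and a map between fibres is (conjugate-)linear as soon as it is
  (conjugate-)homogeneous.\<close>

locale holomorphic_line_bundle = M: complex_manifold AM J + L: complex_manifold AL JL
  for AM :: "('m::{t2_space, second_countable_topology}, 'me::real_normed_vector) charts"
    and J :: "'m \<Rightarrow> 'me \<Rightarrow> 'me"
    and AL :: "('l::{t2_space, second_countable_topology}, 'le::real_normed_vector) charts"
    and JL :: "'l \<Rightarrow> 'le \<Rightarrow> 'le" +
  fixes \<pi> :: "'l \<Rightarrow> 'm" and sc :: "complex \<Rightarrow> 'l \<Rightarrow> 'l"
  assumes holomorphic_\<pi>: "holomorphic_map AL JL AM J \<pi>"
    and local_triviality: "\<exists>V \<psi> \<theta>. open V \<and> m \<in> V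
      \<and> holomorphic_map_on AL JL (prod_charts AM vspace) (prod_J J complex_J) (\<pi> -` V) (\<lambda>l. (\<pi> l, \<psi> l))
      \<and> holomorphic_map_on (prod_charts AM vspace) (prod_J J complex_J) AL JL (V \<times> UNIV) \<theta>
      \<and> (\<forall>l \<in> \<pi> -` V. \<theta> (\<pi> l, \<psi> l) = l)
      \<and> (\<forall>p\<in>V. \<forall>z. \<pi> (\<theta> (p, z)) = p \<and> \<psi> (\<theta> (p, z)) = z)
      \<and> (\<forall>l \<in> \<pi> -` V. \<forall>z. \<pi> (sc z l) = \<pi> l \<and> \<psi> (sc z l) = z * \<psi> l)"

text \<open>The Hermitian form \<open>h\<close> is complex linear in the first argument and matters only for pairs of vectors in
  the same fibre.\<close>

definition hermitian_metric ::
  "('l::topological_space, 'le::real_normed_vector) charts \<Rightarrow> ('l \<Rightarrow> 'm) \<Rightarrow> (complex \<Rightarrow> 'l \<Rightarrow> 'l) \<Rightarrow>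
   ('l \<Rightarrow> 'l \<Rightarrow> complex) \<Rightarrow> bool" where
  "hermitian_metric AL \<pi> sc h \<longleftrightarrow>
     (\<forall>l l'. \<pi> l = \<pi> l' \<longrightarrow> h l' l = cnj (h l l') \<and> (\<forall>z. h (sc z l) l' = z * h l l')) \<and>
     (\<forall>l. l \<noteq> sc 0 l \<longrightarrow> Re (h l l) > 0) \<and>
     smooth_map AL vspace (\<lambda>l. h l l)"

text \<open>A linear connection is given by its horizontal lifts: \<open>hor l\<close> maps the tangent space of \<open>M\<close> at
  \<open>\<pi> l\<close> to the tangent space of \<open>L\<close> at \<open>l\<close>.\<close>

definition linear_connection ::
  "('m, 'me::real_normed_vector) charts \<Rightarrow> ('l, 'le::real_normed_vector) charts \<Rightarrow>
   ('l \<Rightarrow> 'm) \<Rightarrow> (complex \<Rightarrow> 'l \<Rightarrow> 'l) \<Rightarrow> ('l \<Rightarrow> 'me \<Rightarrow> 'le) \<Rightarrow> bool" where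
  "linear_connection AM AL \<pi> sc hor \<longleftrightarrow>
     (\<forall>l. linear (hor l)) \<and>
     (\<forall>l v. tmap AL AM \<pi> l (hor l v) = v) \<and>
     (\<forall>z l v. hor (sc z l) v = tmap AL AL (sc z) l (hor l v)) \<and>
     (\<forall>q p v. smooth_on (cmap AL q ` (cdom AL q \<inter> \<pi> -` cdom AM p))
        (\<lambda>x. let l = cinv AL q x in
           tmap AL vspace (cmap AL q) l (hor l (tmap vspace AM (cinv AM p) (cmap AM p (\<pi> l)) v))))"

text \<open>For a nonvanishing local section \<open>s\<close>, \<open>\<nabla>\<^sub>v s\<close> is the vertical part of \<open>T s (v)\<close>. It equals \<open>\<alpha>(v) s\<close> for
  a complex one-form \<open>\<alpha>\<close>, the connection form in the frame \<open>s\<close>, and the curvature is \<open>d\<alpha>\<close>.\<close>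

definition connection_form ::
  "('m, 'me::real_normed_vector) charts \<Rightarrow> ('l, 'le::real_normed_vector) charts \<Rightarrow>
   (complex \<Rightarrow> 'l \<Rightarrow> 'l) \<Rightarrow> ('l \<Rightarrow> 'me \<Rightarrow> 'le) \<Rightarrow> ('m \<Rightarrow> 'l) \<Rightarrow> 'm \<Rightarrow> 'me \<Rightarrow> complex" where
  "connection_form AM AL sc hor s m v =
     (THE a. tmap AM AL s m v - hor (s m) v = tmap vspace AL (\<lambda>z. sc z (s m)) 1 a)"

definition has_curvature ::
  "('m::topological_space, 'me::real_normed_vector) charts \<Rightarrow>
   ('l::topological_space, 'le::real_normed_vector) charts \<Rightarrow> ('l \<Rightarrow> 'm) \<Rightarrow>
   (complex \<Rightarrow> 'l \<Rightarrow> 'l) \<Rightarrow> ('l \<Rightarrow> 'me \<Rightarrow> 'le) \<Rightarrow> ('m \<Rightarrow> 'me \<Rightarrow> 'me \<Rightarrow> complex) \<Rightarrow> bool" where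
  "has_curvature AM AL \<pi> sc hor F \<longleftrightarrow>
     (\<forall>V s. open V \<longrightarrow> smooth_map_on AM AL V s \<longrightarrow> (\<forall>p\<in>V. \<pi> (s p) = p \<and> s p \<noteq> sc 0 (s p)) \<longrightarrow>
        (\<forall>q. \<forall>x \<in> cmap AM q ` (cdom AM q \<inter> V). \<forall>v w.
           ext_deriv1 (coord1 AM q (connection_form AM AL sc hor s)) x v w = coord2 AM q F x v w))"

text \<open>\<open>\<nu>\<^sub>L\<close>, the generator of the action of the circle by scalars.\<close>

definition scalar_field ::
  "('l, 'le::real_normed_vector) charts \<Rightarrow> (complex \<Rightarrow> 'l \<Rightarrow> 'l) \<Rightarrow> 'l \<Rightarrow> 'le" where
  "scalar_field AL sc l = velocity AL (\<lambda>t. sc (cis t) l)"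

locale equivariant_prequantum_bundle =
  kaehler_hamiltonian_manifold U A \<sigma> AM \<omega> act \<tau> \<Phi> J + holomorphic_line_bundle AM J AL JL \<pi> sc
  for U :: "'u::{t2_space, second_countable_topology} monoid" (structure)
    and A :: "('u, 'ue::real_normed_vector) charts" and \<sigma> :: "'u \<Rightarrow> 'u"
    and AM :: "('m::{t2_space, second_countable_topology}, 'me::real_normed_vector) charts"
    and \<omega> :: "'m \<Rightarrow> 'me \<Rightarrow> 'me \<Rightarrow> real"
    and act :: "'u \<Rightarrow> 'm \<Rightarrow> 'm" and \<tau> :: "'m \<Rightarrow> 'm" and \<Phi> :: "'m \<Rightarrow> ('ue \<Rightarrow>\<^sub>L real)"
    and J :: "'m \<Rightarrow> 'me \<Rightarrow> 'me"
    and AL :: "('l::{t2_space, second_countable_topology}, 'le::real_normed_vector) charts"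
    and JL :: "'l \<Rightarrow> 'le \<Rightarrow> 'le" and \<pi> :: "'l \<Rightarrow> 'm" and sc :: "complex \<Rightarrow> 'l \<Rightarrow> 'l" +
  fixes h :: "'l \<Rightarrow> 'l \<Rightarrow> complex" and hor :: "'l \<Rightarrow> 'me \<Rightarrow> 'le"
    and actL :: "'u \<Rightarrow> 'l \<Rightarrow> 'l" and \<tau>L :: "'l \<Rightarrow> 'l"
  assumes metric: "hermitian_metric AL \<pi> sc h"
    and connection: "linear_connection AM AL \<pi> sc hor"
    and hor_metric: "tmap AL vspace (\<lambda>l. h l l) l (hor l v) = 0"
    and hor_holomorphic: "hor l (J (\<pi> l) v) = JL l (hor l v)"
    and curvature: "has_curvature AM AL \<pi> sc hor (\<lambda>m v w. - 2 * pi * \<i> * \<omega> m v w)"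
    and actionL: "smooth_action U A AL actL"
    and actL_\<pi>: "\<pi> (actL u l) = act u (\<pi> l)"
    and actL_linear: "actL u (sc z l) = sc z (actL u l)"
    and actL_unitary: "\<pi> l = \<pi> l' \<Longrightarrow> h (actL u l) (actL u l') = h l l'"
    and generating_field: "induced_field U A AL actL \<xi> l =
      hor l (induced_field U A AM act \<xi> (\<pi> l)) + (2 * pi * blinfun_apply (\<Phi> (\<pi> l)) \<xi>) *\<^sub>R scalar_field AL sc l"
    and \<tau>L_\<tau>L: "\<tau>L (\<tau>L l) = l"
    and \<tau>L_\<pi>: "\<pi> (\<tau>L l) = \<tau> (\<pi> l)"
    and \<tau>L_conj_linear: "\<tau>L (sc z l) = sc (cnj z) (\<tau>L l)"
    and \<tau>L_antiholomorphic: "antiholomorphic_map AL JL AL JL \<tau>L"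
    and \<tau>L_hor: "tmap AL AL \<tau>L l (hor l v) = hor (\<tau>L l) (tmap AM AM \<tau> (\<pi> l) v)"


section \<open>Actions of the complexified group\<close>

definition extends_action ::
  "('h::topological_space) monoid \<Rightarrow> ('h, 'he::real_normed_vector) charts \<Rightarrow> ('h \<Rightarrow> 'he \<Rightarrow> 'he) \<Rightarrow> ('u \<Rightarrow> 'h) \<Rightarrow>
   ('m::topological_space, 'me::real_normed_vector) charts \<Rightarrow> ('m \<Rightarrow> 'me \<Rightarrow> 'me) \<Rightarrow>
   ('u \<Rightarrow> 'm \<Rightarrow> 'm) \<Rightarrow> ('h \<Rightarrow> 'm \<Rightarrow> 'm) \<Rightarrow> bool" where
  "extends_action H AH JH \<iota> AM J act actC \<longleftrightarrow>
     group_action H UNIV actC \<and>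
     holomorphic_map (prod_charts AH AM) (prod_J JH J) AM J (\<lambda>(g, m). actC g m) \<and>
     (\<forall>u m. actC (\<iota> u) m = act u m)"

end

theory Submission
  imports Defs
begin

text \<open>
  Let \<open>H = U\<^sup>C\<close> and let \<open>\<eta>\<close> be the vector corresponding to a point of \<open>\<Phi> (closure (H m)) \<inter> \<aa>\<^sup>*\<close> under an inner product on
  \<open>\<uu>\<close> that is invariant under \<open>U\<close> and \<open>\<sigma>\<close>; then \<open>\<sigma> \<eta> = - \<eta>\<close>. On the orbit of \<open>m\<close> the moment map is the gradient of a
  convex function \<open>\<psi>\<close> on the symmetric space of cosets \<open>U h\<close>. For \<open>t > 0\<close> let \<open>v\<^sub>t(\<gamma>)\<close> be the minimum over \<open>h\<close> of
  \<open>\<psi>(h) + d(h, exp(i t \<eta>) \<gamma>\<^sup>-\<^sup>1)\<^sup>2 / (2 t)\<close>, where \<open>d\<close> is the distance in this space, and put \<open>w\<^sub>t = v\<^sub>t - t |\<eta>|\<^sup>2 / 2\<close>.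

  As \<open>t\<close> grows, \<open>w\<^sub>t\<close> remains bounded above, locally uniformly in \<open>\<gamma>\<close>. Suppose that \<open>\<eta>\<close> has distance \<open>c > 0\<close> from
  \<open>\<Phi> (closure (G m))\<close>. For \<open>\<gamma>\<close> in \<open>G\<close> the minimum is attained on \<open>exp (i \<qq>)\<close>, and comparing the gradients of the two summands there
  gives \<open>w\<^sub>t(\<gamma>) \<le> - t c\<^sup>2 / 2 + O(1)\<close>. As \<open>\<psi>\<close> and the squared distance are plurisubharmonic, \<open>w\<^sub>t\<close> is
  subharmonic along \<open>z \<mapsto> A exp(Re z X) exp(Im z i X) B\<close>. Comparison with \<open>Re \<surd>(- i z)\<close> on large half discs extends the linear decay,
  at every rate below \<open>c\<^sup>2 / 2\<close>, from real to complex \<open>z\<close>, hence from \<open>G\<close> to the group generated by these curves with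
  \<open>X\<close> in \<open>\<gg>\<close>, which is \<open>H\<close>. But \<open>w\<^sub>t(g\<^sup>-\<^sup>1) \<ge> \<psi>(g) - t c\<^sup>2 / 8\<close> if \<open>\<Phi> (g m)\<close> has distance less than \<open>c / 2\<close> from \<open>\<eta>\<close>.\<close>


text \<open>\<open>v\<^sub>t\<close> is a Moreau envelope of the Kempf-Ness function, evaluated
  along a geodesic ray. The subtracted term t |\<eta>|^2 / 2 is the energy of the competitor 1 for
  \<gamma> = 1. If the gradient of \<psi> stays at distance c from \<eta>, the minimizer has to move
  by about t c, and strong convexity turns a displacement x into a gain of |x|^2 / (2 t): this is
  the rate c^2 / 2. The obstacle is to carry this rate from G to H, where minimizers no longer lie
  in exp(i \<qq>). Minimization usually destroys plurisubharmonicity. It survives here because the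
  energy is invariant under left multiplication of h by U, so the response of the minimizer is
  undetermined along U and can be chosen complex linear, as in Kiselev's minimum principle. An upper
  bound uniform in t on a disc and linear decay on its real diameter are then the data of a two
  constants theorem. At a fixed z the arc of radius R contributes only a fraction of order R^(-1/2),
  so the loss of rate is arbitrarily small, and a statement about all rates below a threshold
  survives products of any length.\<close>

section \<open>Finite-dimensional normed spaces in coordinates\<close>

locale findim =
  fixes B :: "'e::real_normed_vector set"
  assumes finite_B: "finite B" and indep_B: "independent B" and span_B: "span B = UNIV"
begin

lemma sum_representation: "(\<Sum>b\<in>B. representation B v b *\<^sub>R b) = v"
  using real_vector.sum_representation_eq[OF indep_B, of v B] finite_B span_B by auto

lemma linear_representation: "linear (\<lambda>v. representation B v b)"
  using real_vector.representation_add[OF indep_B] real_vector.representation_scale[OF indep_B]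
  by (intro linearI) (auto simp: span_B)

lemma representation_sum_eq:
  assumes "\<And>b. b \<notin> B \<Longrightarrow> c b = 0"
  shows "representation B (\<Sum>b\<in>B. c b *\<^sub>R b) = c"
proof (rule real_vector.representation_eqI[OF indep_B])
  have "{b. c b \<noteq> 0} \<subseteq> B" using assms by auto
  then show "finite {b. c b \<noteq> 0}" using finite_B finite_subset by blast
  show "(\<Sum>b | c b \<noteq> 0. c b *\<^sub>R b) = (\<Sum>b\<in>B. c b *\<^sub>R b)"
    by (rule sum.mono_neutral_left) (use assms finite_B in auto)
qed (use assms span_B in auto)

lemma linear_expand: "linear f \<Longrightarrow> f v = (\<Sum>b\<in>B. representation B v b *\<^sub>R f b)"
  by (subst sum_representation[symmetric, of v]) (simp add: linear_sum linear_cmul)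

text \<open>Coordinate vectors are functions on the whole space with the product topology. Off the
  basis the factor is the singleton of 0, so Tychonoff's theorem yields compactness although the
  index set is infinite.\<close>

definition box :: "real \<Rightarrow> ('e \<Rightarrow> real) set" where
  "box C = PiE UNIV (\<lambda>b. if b \<in> B then {-C..C} else {0})"

lemma compact_box: "compact (box C)"
proof -
  have "compactin (product_topology (\<lambda>_::'e. euclidean :: real topology) UNIV) (box C)"
    unfolding box_def compactin_PiE by auto
  then show ?thesis by (simp add: euclidean_product_topology)
qed

lemma continuous_combination: "continuous_on S (\<lambda>x::'e \<Rightarrow> real. \<Sum>b\<in>B. x b *\<^sub>R b)"
  by (intro continuous_intros continuous_on_subset[OF continuous_on_product_coordinates]) auto

text \<open>Equivalence of the given norm with the coordinate norms: on the unit sphere of the l1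
  norm in coordinates, which is compact, the norm attains its minimum, and this is positive because
  coordinates are unique. The general case follows by homogeneity.\<close>

lemma representation_bound: "\<exists>C>0. \<forall>v b. \<bar>representation B v b\<bar> \<le> C * norm v"
proof -
  define K where "K = box 1 \<inter> {x. (\<Sum>b\<in>B. \<bar>x b\<bar>) = 1}"
  have "closed {x::'e \<Rightarrow> real. (\<Sum>b\<in>B. \<bar>x b\<bar>) = 1}"
    by (intro closed_Collect_eq continuous_intros continuous_on_subset[OF continuous_on_product_coordinates]) auto
  then have cK: "compact K" unfolding K_def using compact_box by (rule compact_Int_closed[rotated])
  define n where "n = (\<lambda>x::'e \<Rightarrow> real. norm (\<Sum>b\<in>B. x b *\<^sub>R b))"
  have cn: "continuous_on K n" unfolding n_def by (intro continuous_on_norm continuous_combination)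
  have "\<exists>d>0. \<forall>x\<in>K. d \<le> n x"
  proof (cases "K = {}")
    case True then show ?thesis by (auto intro: exI[of _ 1])
  next
    case False
    obtain x where x: "x \<in> K" "\<And>y. y \<in> K \<Longrightarrow> n x \<le> n y"
      using continuous_attains_inf[OF cK False cn] by blast
    have "n x \<noteq> 0"
    proof
      assume "n x = 0"
      then have "(\<Sum>b\<in>B. x b *\<^sub>R b) = 0" by (simp add: n_def)
      moreover have "\<And>b. b \<notin> B \<Longrightarrow> x b = 0" using x(1) by (auto simp: K_def box_def PiE_iff split: if_splits dest: spec)
      ultimately have "x = representation B 0" using representation_sum_eq[of x] by simp
      then show False using x(1) by (simp add: K_def real_vector.representation_zero)
    qed
    then show ?thesis using x by (intro exI[of _ "n x"]) (auto simp: n_def)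
  qed
  then obtain d where d: "d > 0" "\<And>x. x \<in> K \<Longrightarrow> d \<le> n x" by blast
  have "\<bar>representation B v b\<bar> \<le> (1/d) * norm v" for v b
  proof -
    define r where "r = representation B v"
    define s where "s = (\<Sum>b\<in>B. \<bar>r b\<bar>)"
    have r0: "b \<notin> B \<Longrightarrow> r b = 0" for b unfolding r_def using real_vector.representation_ne_zero by fastforce
    show ?thesis
    proof (cases "s = 0")
      case True
      then have "\<And>b. b \<in> B \<Longrightarrow> r b = 0" unfolding s_def using finite_B by (simp add: sum_nonneg_eq_0_iff)
      then have "r b = 0" using r0 by blast
      then show ?thesis using d(1) by (simp add: r_def)
    next
      case False
      have s0: "s > 0" using False unfolding s_def by (metis abs_ge_zero less_le sum_nonneg)
      have rs: "\<bar>r b\<bar> \<le> s" for b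
        by (cases "b \<in> B") (use r0 s0 finite_B in \<open>auto simp: s_def intro: member_le_sum[of b B "\<lambda>b. \<bar>r b\<bar>"]\<close>)
      have "(\<lambda>b. r b / s) \<in> K"
      proof -
        have "\<bar>r b / s\<bar> \<le> 1" for b using rs[of b] s0 by simp
        then have "r b / s \<le> 1 \<and> -1 \<le> r b / s" for b by (simp only: abs_le_iff minus_le_iff)
        then have "(\<lambda>b. r b / s) \<in> box 1" unfolding box_def by (auto simp: PiE_iff r0)
        moreover have "(\<Sum>b\<in>B. \<bar>r b / s\<bar>) = 1"
          using s0 by (simp add: sum_divide_distrib[symmetric] s_def[symmetric])
        ultimately show ?thesis by (simp add: K_def)
      qed
      from d(2)[OF this] have "d \<le> norm (\<Sum>b\<in>B. (r b / s) *\<^sub>R b)" by (simp add: n_def)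
      also have "(\<Sum>b\<in>B. (r b / s) *\<^sub>R b) = (1/s) *\<^sub>R v"
        by (subst sum_representation[symmetric, of v]) (simp add: r_def scaleR_sum_right)
      finally have "d * s \<le> norm v" using s0 by (simp add: pos_le_divide_eq)
      then have "d * \<bar>r b\<bar> \<le> norm v" using mult_left_mono[OF rs[of b], of d] d(1) by linarith
      then show ?thesis using d(1) by (simp add: r_def pos_le_divide_eq mult.commute)
    qed
  qed
  then show ?thesis using d(1) by (intro exI[of _ "1/d"]) auto
qed

lemma linear_bounded:
  fixes f :: "'e \<Rightarrow> 'f::real_normed_vector"
  assumes "linear f"
  shows "bounded_linear f"
proof -
  obtain C where C: "C > 0" "\<And>v b. \<bar>representation B v b\<bar> \<le> C * norm v" using representation_bound by blast
  have "norm (f v) \<le> norm v * (\<Sum>b\<in>B. C * norm (f b))" for v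
  proof -
    have "norm (f v) \<le> (\<Sum>b\<in>B. norm (representation B v b *\<^sub>R f b))"
      by (subst linear_expand[OF assms]) (rule norm_sum)
    also have "\<dots> \<le> (\<Sum>b\<in>B. (C * norm v) * norm (f b))"
      by (intro sum_mono) (auto intro!: mult_right_mono C)
    also have "\<dots> = norm v * (\<Sum>b\<in>B. C * norm (f b))" by (simp add: sum_distrib_left algebra_simps)
    finally show ?thesis .
  qed
  then show ?thesis
    using assms by (intro bounded_linear_intro) (auto simp: linear_add linear_cmul)
qed

text \<open>Heine-Borel for an arbitrary norm: by \<open>representation_bound\<close> a bounded set
  lies in the continuous image of a compact box of coordinates.\<close>

lemma compact_closed_bounded:
  fixes S :: "'e set"
  assumes "closed S" "bounded S"
  shows "compact S"
proof -
  obtain C where C: "C > 0" "\<And>v b. \<bar>representation B v b\<bar> \<le> C * norm v" using representation_bound by blast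
  obtain r where r: "\<And>v. v \<in> S \<Longrightarrow> norm v \<le> r" using assms(2) by (auto simp: bounded_iff)
  have "S \<subseteq> (\<lambda>x. \<Sum>b\<in>B. x b *\<^sub>R b) ` box (C * r)"
  proof
    fix v assume v: "v \<in> S"
    have "\<bar>representation B v b\<bar> \<le> C * r" for b
      using order_trans[OF C(2)[of v b] mult_left_mono[OF r[OF v], of C]] C(1) by simp
    then have "representation B v b \<le> C * r \<and> - (C * r) \<le> representation B v b" for b
      by (simp only: abs_le_iff minus_le_iff)
    moreover have "b \<notin> B \<Longrightarrow> representation B v b = 0" for b
      using real_vector.representation_ne_zero by fastforce
    ultimately have "representation B v \<in> box (C * r)" by (auto simp: box_def PiE_iff)
    then show "v \<in> (\<lambda>x. \<Sum>b\<in>B. x b *\<^sub>R b) ` box (C * r)"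
      by (rule image_eqI[rotated]) (rule sum_representation[symmetric])
  qed
  moreover have "compact ((\<lambda>x. \<Sum>b\<in>B. x b *\<^sub>R b) ` box (C * r))"
    by (intro compact_continuous_image continuous_combination compact_box)
  ultimately show ?thesis
    using closed_Int_compact[OF assms(1), of "(\<lambda>x. \<Sum>b\<in>B. x b *\<^sub>R b) ` box (C * r)"] by (simp add: inf_absorb1)
qed

lemma compact_cball: "compact (cball (a::'e) r)"
  by (intro compact_closed_bounded) auto

lemma inj_imp_surj:
  assumes "linear f" "inj (f :: 'e \<Rightarrow> 'e)"
  shows "surj f"
proof -
  interpret fd: finite_dimensional_vector_space "(*\<^sub>R) :: real \<Rightarrow> 'e \<Rightarrow> 'e" B
    by unfold_locales (use finite_B indep_B span_B in \<open>auto simp: dependent_raw_def span_raw_def\<close>)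
  show ?thesis using fd.linear_inj_imp_surj assms
    by (metis linear_def)
qed

end

lemma findim_exists:
  fixes S :: "'e::real_normed_vector set"
  assumes "finite S" "span S = UNIV"
  obtains B where "B \<subseteq> S" "findim B"
proof -
  obtain B where B: "B \<subseteq> S" "independent B" "S \<subseteq> span B"
    using real_vector.maximal_independent_subset[of S] by blast
  have "span B = UNIV" using B(3) assms(2) by (metis span_minimal subspace_span top.extremum_unique)
  then have "findim B" using B assms(1) by (unfold_locales) (auto intro: finite_subset)
  then show ?thesis using that B by blast
qed

text \<open>The set \<open>S\<close> may be infinite here; that a basis chosen inside it is finite
  comes from the known basis \<open>B0\<close>.\<close>

lemma findim_exists_subset:
  fixes B0 S :: "'e::real_normed_vector set"
  assumes "findim B0" "span S = UNIV"
  obtains B where "B \<subseteq> S" "findim B"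
proof -
  interpret findim B0 by fact
  interpret fd: finite_dimensional_vector_space "(*\<^sub>R) :: real \<Rightarrow> 'e \<Rightarrow> 'e" B0
    by unfold_locales (use finite_B indep_B span_B in \<open>auto simp: dependent_raw_def span_raw_def\<close>)
  obtain B where B: "B \<subseteq> S" "independent B" "S \<subseteq> span B"
    using real_vector.maximal_independent_subset[of S] by blast
  have "span B = UNIV" using B(3) assms(2) by (metis span_minimal subspace_span top.extremum_unique)
  moreover have "finite B" using fd.finiteI_independent B(2) by (simp add: dependent_raw_def)
  ultimately show ?thesis using B that[of B] by (auto simp: findim_def)
qed

lemma findim_prod:
  fixes B :: "'e::real_normed_vector set" and B' :: "'f::real_normed_vector set"
  assumes "findim B" "findim B'"
  obtains C :: "('e \<times> 'f) set" where "findim C"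
proof -
  interpret B: findim B by fact
  interpret B': findim B' by fact
  let ?S = "(\<lambda>b. (b, 0)) ` B \<union> (\<lambda>b. (0, b)) ` B'"
  have "(v, w) \<in> span ?S" for v w
  proof -
    have "(v, 0::'f) \<in> span ?S"
    proof -
      have "(v, 0) = (\<Sum>b\<in>B. representation B v b *\<^sub>R (b, 0::'f))"
        by (rule prod_eqI) (simp_all add: fst_sum snd_sum B.sum_representation)
      also have "\<dots> \<in> span ?S" by (intro span_sum span_scale span_base) auto
      finally show ?thesis .
    qed
    moreover have "(0::'e, w) \<in> span ?S"
    proof -
      have "(0, w) = (\<Sum>b\<in>B'. representation B' w b *\<^sub>R (0::'e, b))"
        by (rule prod_eqI) (simp_all add: fst_sum snd_sum B'.sum_representation)
      also have "\<dots> \<in> span ?S" by (intro span_sum span_scale span_base) auto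
      finally show ?thesis .
    qed
    ultimately show ?thesis using span_add by fastforce
  qed
  then have "span ?S = UNIV" by (metis UNIV_eq_I surj_pair)
  then show ?thesis using findim_exists[of ?S] B.finite_B B'.finite_B that by blast
qed

lemma findim_real: "findim {1::real}"
proof
  have "x \<in> span {1::real}" for x
    using span_scale[OF span_base[of 1 "{1::real}"], of x] by simp
  then show "span {1::real} = UNIV" by blast
qed (auto simp: real_vector.dependent_single)

section \<open>Calculus of smooth maps\<close>

lemma has_frechet_derivative:
  "f differentiable (at x) \<Longrightarrow> (f has_derivative frechet_derivative f (at x)) (at x)"
  using frechet_derivative_works by blast

lemma frechet_derivative_cong_open:
  assumes "open S" "x \<in> S" "\<And>y. y \<in> S \<Longrightarrow> f y = g y"
  shows "frechet_derivative f (at x) = frechet_derivative g (at x)"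
proof -
  have "(f has_derivative D) (at x) \<longleftrightarrow> (g has_derivative D) (at x)" for D
    using has_derivative_transform_within_open[OF _ assms(1,2)] assms(3) by metis
  then show ?thesis by (simp add: frechet_derivative_def)
qed

lemma differentiable_cong_open:
  assumes "open S" "x \<in> S" "\<And>y. y \<in> S \<Longrightarrow> f y = g y"
  shows "f differentiable (at x) \<longleftrightarrow> g differentiable (at x)"
  unfolding differentiable_def
  using has_derivative_transform_within_open[OF _ assms(1,2)] assms(3) by metis

lemma Ck_on_cong:
  assumes "open S" "\<And>y. y \<in> S \<Longrightarrow> f y = g y"
  shows "Ck_on n f S \<longleftrightarrow> Ck_on n g S"
  using assms(2)
proof (induction n arbitrary: f g)
  case 0 then show ?case by (simp cong: continuous_on_cong)
next
  case (Suc n)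
  have "Ck_on n (\<lambda>x. frechet_derivative f (at x) v) S \<longleftrightarrow> Ck_on n (\<lambda>x. frechet_derivative g (at x) v) S" for v
    by (rule Suc.IH) (use frechet_derivative_cong_open[OF assms(1)] Suc.prems in metis)
  moreover have "f differentiable (at x) \<longleftrightarrow> g differentiable (at x)" if "x \<in> S" for x
    using differentiable_cong_open[OF assms(1) that] Suc.prems by blast
  ultimately show ?case by simp
qed

lemma Ck_on_mono: "Ck_on n f S \<Longrightarrow> T \<subseteq> S \<Longrightarrow> Ck_on n f T"
  by (induction n arbitrary: f) (auto intro: continuous_on_subset)

lemma Ck_on_local:
  assumes "\<And>x. x \<in> S \<Longrightarrow> \<exists>T. open T \<and> x \<in> T \<and> Ck_on n f T"
  shows "Ck_on n f S"
  using assms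
proof (induction n arbitrary: f)
  case 0
  have "continuous (at x) f" if x: "x \<in> S" for x
  proof -
    obtain T where "open T" "x \<in> T" "Ck_on 0 f T" using 0[OF x] by blast
    then show ?thesis by (simp add: continuous_on_eq_continuous_at)
  qed
  then show ?case by (simp add: continuous_at_imp_continuous_on)
next
  case (Suc n)
  have "f differentiable (at x)" if "x \<in> S" for x using Suc.prems[OF that] by auto
  moreover have "Ck_on n (\<lambda>x. frechet_derivative f (at x) v) S" for v
    by (rule Suc.IH) (use Suc.prems in fastforce)
  ultimately show ?case by simp
qed

lemma Ck_on_Suc: "Ck_on (Suc n) f S \<Longrightarrow> Ck_on n f S"
proof (induction n arbitrary: f)
  case 0
  then show ?case by (auto intro!: continuous_at_imp_continuous_on differentiable_imp_continuous_within)
next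
  case (Suc n)
  then show ?case by (metis Ck_on.simps(2))
qed

lemma smooth_on_Ck: "smooth_on S f \<Longrightarrow> Ck_on n f S"
  by (simp add: smooth_on_def)

lemma smooth_on_continuous: "smooth_on S f \<Longrightarrow> continuous_on S f"
  using smooth_on_Ck[of S f 0] by simp

lemma smooth_on_derivative:
  assumes "smooth_on S f"
  shows "smooth_on S (\<lambda>x. frechet_derivative f (at x) v)"
  using smooth_on_Ck[OF assms, of "Suc n" for n] by (simp add: smooth_on_def)

lemma smooth_on_differentiable: "smooth_on S f \<Longrightarrow> x \<in> S \<Longrightarrow> f differentiable (at x)"
  using smooth_on_Ck[of S f 1] by simp

lemma smooth_on_has_derivative:
  "smooth_on S f \<Longrightarrow> x \<in> S \<Longrightarrow> (f has_derivative frechet_derivative f (at x)) (at x)"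
  using smooth_on_differentiable has_frechet_derivative by blast

lemma Ck_on_const: "Ck_on n (\<lambda>x. c) S"
  by (induction n arbitrary: c) auto

lemma bounded_linear_Ck_on: 
  assumes "bounded_linear f"
  shows "Ck_on n f S"
proof (cases n)
  case 0 then show ?thesis using assms by (simp add: linear_continuous_on)
next
  case (Suc m)
  have "(f has_derivative f) (at x)" for x using assms by (rule bounded_linear_imp_has_derivative)
  then have "frechet_derivative f (at x) = f" "f differentiable (at x)" for x
    by (metis frechet_derivative_at) (use \<open>\<And>x. (f has_derivative f) (at x)\<close> differentiable_def in blast)
  then show ?thesis using Suc by (simp add: Ck_on_const)
qed

lemma Ck_on_bounded_linear:
  assumes "bounded_linear L" "open S" "Ck_on n f S"
  shows "Ck_on n (\<lambda>x. L (f x)) S"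
  using assms(3)
proof (induction n arbitrary: f)
  case 0
  then show ?case using assms(1) by (simp add: bounded_linear.continuous_on)
next
  case (Suc n)
  have d: "((\<lambda>x. L (f x)) has_derivative (\<lambda>v. L (frechet_derivative f (at x) v))) (at x)" if "x \<in> S" for x
    by (rule bounded_linear.has_derivative[OF assms(1)]) (use Suc.prems that has_frechet_derivative in auto)
  have "Ck_on n (\<lambda>x. L (frechet_derivative f (at x) v)) S" for v
    using Suc by simp
  moreover have "L (frechet_derivative f (at x) v) = frechet_derivative (\<lambda>x. L (f x)) (at x) v" if "x \<in> S" for x v
    using frechet_derivative_at[OF d[OF that]] by metis
  ultimately have "Ck_on n (\<lambda>x. frechet_derivative (\<lambda>x. L (f x)) (at x) v) S" for v
    using Ck_on_cong[OF assms(2)] by (metis (mono_tags, lifting))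
  then show ?case using d unfolding Ck_on.simps differentiable_def by blast
qed

lemma Ck_on_add:
  assumes "open S" "Ck_on n f S" "Ck_on n g S"
  shows "Ck_on n (\<lambda>x. f x + g x) S"
  using assms(2,3)
proof (induction n arbitrary: f g)
  case 0
  then show ?case by (simp add: continuous_on_add)
next
  case (Suc n)
  have d: "((\<lambda>x. f x + g x) has_derivative (\<lambda>v. frechet_derivative f (at x) v + frechet_derivative g (at x) v)) (at x)" if "x \<in> S" for x
    using Suc.prems that by (auto intro!: has_derivative_add has_frechet_derivative)
  have "Ck_on n (\<lambda>x. frechet_derivative f (at x) v + frechet_derivative g (at x) v) S" for v
    using Suc by simp
  moreover have "frechet_derivative f (at x) v + frechet_derivative g (at x) v = frechet_derivative (\<lambda>x. f x + g x) (at x) v" if "x \<in> S" for x v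
    using frechet_derivative_at[OF d[OF that]] by metis
  ultimately have "Ck_on n (\<lambda>x. frechet_derivative (\<lambda>x. f x + g x) (at x) v) S" for v
    using Ck_on_cong[OF assms(1)] by (metis (mono_tags, lifting))
  then show ?case using d unfolding Ck_on.simps differentiable_def by blast
qed

lemma Ck_on_sum:
  assumes "open S" "\<And>i. i \<in> I \<Longrightarrow> Ck_on n (f i) S"
  shows "Ck_on n (\<lambda>x. \<Sum>i\<in>I. f i x) S"
  using assms(2)
  by (induction I rule: infinite_finite_induct) (auto simp: Ck_on_const Ck_on_add[OF assms(1)])

lemma Ck_on_bounded_bilinear:
  assumes "bounded_bilinear pr" "open S" "Ck_on n f S" "Ck_on n g S"
  shows "Ck_on n (\<lambda>x. pr (f x) (g x)) S"
  using assms(3,4)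
proof (induction n arbitrary: f g)
  case 0
  then show ?case using bounded_bilinear.continuous_on[OF assms(1)] by simp
next
  case (Suc n)
  have d: "((\<lambda>x. pr (f x) (g x)) has_derivative (\<lambda>v. pr (f x) (frechet_derivative g (at x) v) + pr (frechet_derivative f (at x) v) (g x))) (at x)" if "x \<in> S" for x
    using Suc.prems that by (auto intro!: bounded_bilinear.FDERIV[OF assms(1)] has_frechet_derivative)
  have "Ck_on n (\<lambda>x. pr (f x) (frechet_derivative g (at x) v) + pr (frechet_derivative f (at x) v) (g x)) S" for v
    using Suc.prems Ck_on_Suc[OF Suc.prems(1)] Ck_on_Suc[OF Suc.prems(2)] by (intro Ck_on_add assms(2) Suc.IH) auto
  moreover have "pr (f x) (frechet_derivative g (at x) v) + pr (frechet_derivative f (at x) v) (g x) = frechet_derivative (\<lambda>x. pr (f x) (g x)) (at x) v" if "x \<in> S" for x v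
    using frechet_derivative_at[OF d[OF that]] by metis
  ultimately have "Ck_on n (\<lambda>x. frechet_derivative (\<lambda>x. pr (f x) (g x)) (at x) v) S" for v
    using Ck_on_cong[OF assms(2)] by (metis (mono_tags, lifting))
  then show ?case using d unfolding Ck_on.simps differentiable_def by blast
qed

text \<open>\<open>Ck_on\<close> speaks of derivatives in fixed directions only, whereas the chain
  rule differentiates g in the moving direction f'(x) v. Expanding this direction in the basis
  leaves finitely many products of coordinates of f' with derivatives of g in fixed directions, to
  which the induction hypothesis applies.\<close>

lemma (in findim) Ck_on_compose:
  fixes g :: "'e \<Rightarrow> 'f::real_normed_vector" and f :: "'d::real_normed_vector \<Rightarrow> 'e"
  assumes "open S" "open T" "f ` S \<subseteq> T" "Ck_on n f S" "Ck_on n g T"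
  shows "Ck_on n (\<lambda>x. g (f x)) S"
  using assms(3-)
proof (induction n arbitrary: g f)
  case 0
  then show ?case using continuous_on_compose2[of T g S f] by simp
next
  case (Suc n)
  let ?df = "\<lambda>x. frechet_derivative f (at x)" and ?dg = "\<lambda>x. frechet_derivative g (at x)"
  have hg: "(g has_derivative ?dg (f x)) (at (f x))" if "x \<in> S" for x
    using Suc.prems that has_frechet_derivative[of g "f x"] by auto
  have d: "((\<lambda>x. g (f x)) has_derivative (\<lambda>v. ?dg (f x) (?df x v))) (at x)" if "x \<in> S" for x
    by (rule has_derivative_compose[of f "?df x" x UNIV g "?dg (f x)", OF has_frechet_derivative hg[OF that]]) (use Suc.prems(2) that in auto)
  have Cf: "Ck_on n f S" "\<And>v. Ck_on n (\<lambda>x. ?df x v) S" and Cg: "Ck_on n g T" "\<And>v. Ck_on n (\<lambda>x. ?dg x v) T"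
    using Suc.prems(2,3) Ck_on_Suc[OF Suc.prems(2)] Ck_on_Suc[OF Suc.prems(3)] by auto
  have "Ck_on n (\<lambda>x. \<Sum>b\<in>B. representation B (?df x v) b *\<^sub>R ?dg (f x) b) S" for v
    by (intro Ck_on_sum assms(1) Ck_on_bounded_bilinear[OF bounded_bilinear_scaleR] Suc.IH Cf Cg Suc.prems(1)
        Ck_on_bounded_linear[OF linear_bounded[OF linear_representation]])
  moreover have "(\<Sum>b\<in>B. representation B (?df x v) b *\<^sub>R ?dg (f x) b) = frechet_derivative (\<lambda>x. g (f x)) (at x) v"
    if "x \<in> S" for x v
  proof -
    have "linear (?dg (f x))" using hg[OF that] has_derivative_linear by blast
    from linear_expand[OF this] show ?thesis using frechet_derivative_at[OF d[OF that]] by metis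
  qed
  ultimately have "Ck_on n (\<lambda>x. frechet_derivative (\<lambda>x. g (f x)) (at x) v) S" for v
    using Ck_on_cong[OF assms(1)] by (metis (mono_tags, lifting))
  then show ?case using d unfolding Ck_on.simps differentiable_def by blast
qed

lemma smooth_on_const: "smooth_on S (\<lambda>x. c)"
  by (simp add: smooth_on_def Ck_on_const)

lemma bounded_linear_smooth_on: "bounded_linear f \<Longrightarrow> smooth_on S f"
  by (simp add: smooth_on_def bounded_linear_Ck_on)

lemma smooth_on_id: "smooth_on S (\<lambda>x. x)"
  by (simp add: bounded_linear_smooth_on)

lemma smooth_on_bounded_linear: "bounded_linear L \<Longrightarrow> open S \<Longrightarrow> smooth_on S f \<Longrightarrow> smooth_on S (\<lambda>x. L (f x))"
  by (simp add: smooth_on_def Ck_on_bounded_linear)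

lemma smooth_on_add: "open S \<Longrightarrow> smooth_on S f \<Longrightarrow> smooth_on S g \<Longrightarrow> smooth_on S (\<lambda>x. f x + g x)"
  by (simp add: smooth_on_def Ck_on_add)

lemma smooth_on_bounded_bilinear:
  "bounded_bilinear pr \<Longrightarrow> open S \<Longrightarrow> smooth_on S f \<Longrightarrow> smooth_on S g \<Longrightarrow> smooth_on S (\<lambda>x. pr (f x) (g x))"
  by (simp add: smooth_on_def Ck_on_bounded_bilinear)

lemma smooth_on_Pair:
  assumes "open S" "smooth_on S f" "smooth_on S g"
  shows "smooth_on S (\<lambda>x. (f x, g x))"
proof -
  have "bounded_linear (\<lambda>v. (v, 0))" "bounded_linear (\<lambda>v. (0, v))"
    by (intro bounded_linear_Pair bounded_linear_ident bounded_linear_zero)+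
  from smooth_on_add[OF assms(1) smooth_on_bounded_linear[OF this(1) assms(1,2)] smooth_on_bounded_linear[OF this(2) assms(1,3)]]
  show ?thesis by simp
qed

lemma (in findim) smooth_on_compose:
  fixes g :: "'e \<Rightarrow> 'f::real_normed_vector" and f :: "'d::real_normed_vector \<Rightarrow> 'e"
  assumes "open S" "open T" "f ` S \<subseteq> T" "smooth_on S f" "smooth_on T g"
  shows "smooth_on S (\<lambda>x. g (f x))"
  using assms(4,5) unfolding smooth_on_def by (blast intro: Ck_on_compose[OF assms(1-3)])

lemma smooth_on_cong: "open S \<Longrightarrow> (\<And>y. y \<in> S \<Longrightarrow> f y = g y) \<Longrightarrow> smooth_on S f \<longleftrightarrow> smooth_on S g"
  using Ck_on_cong[of S f g] by (simp add: smooth_on_def)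

lemma smooth_on_mono: "smooth_on S f \<Longrightarrow> T \<subseteq> S \<Longrightarrow> smooth_on T f"
  unfolding smooth_on_def by (blast intro: Ck_on_mono)

lemma smooth_on_local:
  assumes "\<And>x. x \<in> S \<Longrightarrow> \<exists>T. open T \<and> x \<in> T \<and> smooth_on T f"
  shows "smooth_on S f"
  unfolding smooth_on_def
proof
  show "Ck_on n f S" for n
    by (rule Ck_on_local) (use assms in \<open>auto simp: smooth_on_def\<close>)
qed

text \<open>Strict differentiability: near x0 the finitely many derivatives along basis vectors are
  close to those at x0, so the derivatives are close in operator norm, and the mean value inequality
  concludes.\<close>

lemma (in findim) smooth_on_strict:
  fixes f :: "'e \<Rightarrow> 'f::real_normed_vector"
  assumes "smooth_on S f" "open S" "x0 \<in> S" "e > 0"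
  obtains d where "d > 0" "ball x0 d \<subseteq> S"
    "\<And>x y. x \<in> ball x0 d \<Longrightarrow> y \<in> ball x0 d \<Longrightarrow>
       norm (f x - f y - frechet_derivative f (at x0) (x - y)) \<le> e * norm (x - y)"
proof -
  let ?D = "\<lambda>x. frechet_derivative f (at x)"
  obtain C where C: "C > 0" "\<And>v b. \<bar>representation B v b\<bar> \<le> C * norm v" using representation_bound by blast
  \<comment> \<open>The sum over the basis multiplies the error by C times \<open>card B\<close>;
    the \<open>+ 1\<close> keeps the denominator positive in dimension zero.\<close>
  define e' where "e' = e / (C * (real (card B) + 1))"
  have e': "e' > 0" using assms(4) C by (simp add: e'_def)
  have "\<forall>\<^sub>F x in nhds x0. x \<in> S \<and> (\<forall>b\<in>B. norm (?D x b - ?D x0 b) < e')"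
  proof (intro eventually_conj eventually_ball_finite finite_B ballI)
    show "\<forall>\<^sub>F x in nhds x0. x \<in> S" using assms(2,3) by (rule eventually_nhds_in_open)
    fix b assume "b \<in> B"
    have "continuous (at x0) (\<lambda>x. ?D x b)"
      using smooth_on_continuous[OF smooth_on_derivative[OF assms(1)]] assms(2,3) continuous_on_eq_continuous_at by blast
    then have "((\<lambda>x. ?D x b) \<longlongrightarrow> ?D x0 b) (nhds x0)" 
      using tendsto_at_iff_tendsto_nhds[of "\<lambda>x. ?D x b" x0] by (simp add: isCont_def)
    then show "\<forall>\<^sub>F x in nhds x0. norm (?D x b - ?D x0 b) < e'"
      using e' by (auto simp: tendsto_iff dist_norm)
  qed
  then obtain d where d: "d > 0" "\<And>x. dist x x0 < d \<Longrightarrow> x \<in> S \<and> (\<forall>b\<in>B. norm (?D x b - ?D x0 b) < e')"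
    unfolding eventually_nhds_metric by blast
  have lin: "x \<in> S \<Longrightarrow> linear (?D x)" for x using smooth_on_has_derivative[OF assms(1)] has_derivative_linear by blast
  have on: "onorm (\<lambda>v. ?D x v - ?D x0 v) \<le> e" if x: "x \<in> ball x0 d" for x
  proof (rule onorm_bound)
    show "0 \<le> e" using assms(4) by simp
    fix v
    have l: "linear (\<lambda>v. ?D x v - ?D x0 v)"
      using lin[of x] lin[OF assms(3)] d(2)[of x] x by (auto simp: dist_commute intro: linear_compose_sub)
    have "norm (?D x v - ?D x0 v) \<le> (\<Sum>b\<in>B. norm (representation B v b *\<^sub>R (?D x b - ?D x0 b)))"
      by (subst linear_expand[OF l]) (rule norm_sum)
    also have "\<dots> \<le> (\<Sum>b\<in>B. (C * norm v) * e')"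
    proof (rule sum_mono)
      fix b assume "b \<in> B"
      then have "norm (?D x b - ?D x0 b) \<le> e'" using d(2)[of x] x by (auto simp: dist_commute less_imp_le)
      then show "norm (representation B v b *\<^sub>R (?D x b - ?D x0 b)) \<le> (C * norm v) * e'"
        using C(2)[of v b] by (auto intro!: mult_mono)
    qed
    also have "\<dots> = norm v * (real (card B) * (C * e'))" by (simp add: algebra_simps)
    also have "\<dots> \<le> norm v * e"
    proof (intro mult_left_mono)
      have "C * e' = e / (real (card B) + 1)" using C(1) by (simp add: e'_def)
      then have "C * e' + real (card B) * (C * e') = e" by (simp add: divide_simps algebra_simps)
      then show "real (card B) * (C * e') \<le> e" using mult_pos_pos[OF C(1) e'] by linarith
    qed simp
    finally show "norm (?D x v - ?D x0 v) \<le> e * norm v" by (simp add: mult.commute)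
  qed
  show ?thesis
  proof (rule that[OF d(1)])
    show "ball x0 d \<subseteq> S" using d(2) by (auto simp: dist_commute)
    fix x y assume xy: "x \<in> ball x0 d" "y \<in> ball x0 d"
    have "norm (f x - f y - ?D x0 (x - y)) \<le> norm (x - y) * e"
    proof (rule differentiable_bound_linearization[of y x "ball x0 d" f ?D x0])
      show "y + t *\<^sub>R (x - y) \<in> ball x0 d" if "t \<in> {0..1}" for t
        using convexD_alt[OF convex_ball xy(2,1), of t] that by (simp add: algebra_simps)
      show "(f has_derivative ?D z) (at z within ball x0 d)" if "z \<in> ball x0 d" for z
        using smooth_on_has_derivative[OF assms(1)] d(2)[of z] that by (auto simp: dist_commute intro: has_derivative_at_withinI)
    qed (use on d(1) in \<open>auto simp: fun_diff_def\<close>)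
    then show "norm (f x - f y - ?D x0 (x - y)) \<le> e * norm (x - y)" by (simp add: mult.commute)
  qed
qed

text \<open>The surjective half of the inverse function theorem. Since f - id is Lipschitz with
  constant 1/2 near x0, the map x -> y - f x + x is a contraction, and its fixed point solves f x =
  y. It preserves the ball of radius d/2 because d/4 + (1/2)(d/2) = d/2.\<close>

lemma (in findim) locally_onto:
  fixes f :: "'e \<Rightarrow> 'e"
  assumes "smooth_on S f" "open S" "x0 \<in> S" "\<And>v. frechet_derivative f (at x0) v = v"
  shows "\<exists>d>0. ball (f x0) d \<subseteq> f ` S"
proof -
  obtain d where d: "d > 0" "ball x0 d \<subseteq> S"
    "\<And>x y. x \<in> ball x0 d \<Longrightarrow> y \<in> ball x0 d \<Longrightarrow> norm (f x - f y - (x - y)) \<le> 1/2 * norm (x - y)"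
    using smooth_on_strict[OF assms(1-3), of "1/2"] assms(4) by auto
  have "y \<in> f ` S" if y: "dist (f x0) y < d / 4" for y
  proof -
    let ?T = "\<lambda>x. y - f x + x"
    have sub: "cball x0 (d/2) \<subseteq> ball x0 d" using d(1) by auto
    have "\<exists>!x\<in>cball x0 (d/2). ?T x = x"
    proof (rule Banach_fix)
      show "complete (cball x0 (d/2))" by (intro compact_imp_complete compact_cball)
      show "cball x0 (d/2) \<noteq> {}" using d(1) by auto
      show "0 \<le> (1/2::real)" "(1/2::real) < 1" by auto
      show "?T ` cball x0 (d/2) \<subseteq> cball x0 (d/2)"
      proof clarsimp
        fix x assume x: "dist x0 x * 2 \<le> d"
        have "x \<in> ball x0 d" "x0 \<in> ball x0 d" using x d(1) by auto
        from d(3)[OF this] have "norm (f x - f x0 - (x - x0)) \<le> 1/2 * norm (x - x0)" .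
        moreover have "norm ((y - f x + x) - x0) \<le> norm (y - f x0) + norm (f x - f x0 - (x - x0))"
          using norm_triangle_ineq4[of "y - f x0" "f x - f x0 - (x - x0)"] by (simp add: algebra_simps)
        ultimately show "dist x0 (y - f x + x) * 2 \<le> d"
          using x y by (simp add: dist_norm norm_minus_commute)
      qed
      show "dist (?T x) (?T z) \<le> 1/2 * dist x z" if "x \<in> cball x0 (d/2)" "z \<in> cball x0 (d/2)" for x z
      proof -
        have "norm (f x - f z - (x - z)) \<le> 1/2 * norm (x - z)" using d(3)[of x z] sub that by blast
        then show ?thesis using norm_minus_cancel[of "f x - f z - (x - z)"] by (simp add: dist_norm algebra_simps)
      qed
    qed
    then obtain x where "x \<in> cball x0 (d/2)" "?T x = x" by blast
    then show ?thesis using sub d(2) by (intro image_eqI[of _ _ x]) (auto simp: algebra_simps)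
  qed
  then show ?thesis using d(1) by (intro exI[of _ "d/4"]) auto
qed

subsection \<open>Local solutions of differential equations\<close>

text \<open>Picard iteration as a contraction on bounded continuous functions on the whole line; the
  solution is meaningful only on the open interval around 0.\<close>

lemma picard_local:
  fixes W :: "'d::banach \<Rightarrow> 'd"
  assumes r: "r > 0" and lip: "\<And>x y. x \<in> cball x0 r \<Longrightarrow> y \<in> cball x0 r \<Longrightarrow> norm (W x - W y) \<le> L * norm (x - y)"
    and L: "L > 0"
  shows "\<exists>a>0. \<exists>x. x 0 = x0 \<and> (\<forall>t\<in>{-a<..<a}. x t \<in> cball x0 r \<and> (x has_vector_derivative W (x t)) (at t))"
proof -
  define M where "M = norm (W x0) + L * r"
  have M: "M > 0" using r L by (simp add: M_def add_nonneg_pos)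
  have Wb: "norm (W x) \<le> M" if "x \<in> cball x0 r" for x
  proof -
    have "norm (W x) \<le> norm (W x0) + norm (W x - W x0)" by (metis add.commute diff_add_cancel norm_triangle_ineq)
    moreover have "norm (W x - W x0) \<le> L * r"
    proof -
      have "norm (W x - W x0) \<le> L * norm (x - x0)" using lip that r by auto
      also have "\<dots> \<le> L * r" using that L by (intro mult_left_mono) (auto simp: dist_norm norm_minus_commute)
      finally show ?thesis .
    qed
    ultimately show ?thesis by (simp add: M_def)
  qed
  have contW: "continuous_on (cball x0 r) W"
    by (rule lipschitz_on_continuous_on[of L], rule lipschitz_onI) (use lip L in \<open>auto simp: dist_norm\<close>)
  \<comment> \<open>The first bound keeps the iterates in the ball of radius r, the second makes the
    contraction constant 1/2.\<close>
  define a where "a = min (r / (2 * M)) (1 / (4 * L))"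
  have a: "a > 0" "2 * a * M \<le> r" "2 * a * L \<le> 1/2"
    using r M L by (auto simp: a_def min_def field_simps)
  \<comment> \<open>Clamping time to the interval makes the iterates functions on all of the line,
    as the space of bounded continuous functions requires.\<close>
  define cl where "cl = (\<lambda>t::real. max (-a) (min a t))"
  have cl: "cl t \<in> {-a..a}" "t \<in> {-a..a} \<Longrightarrow> cl t = t" for t using a(1) by (auto simp: cl_def)
  have contcl: "continuous_on UNIV cl" unfolding cl_def by (intro continuous_intros)
  \<comment> \<open>The difference of two integrals from -a is the oriented integral from 0 to
    \<open>cl t\<close>, for either sign of the time.\<close>
  define P where "P = (\<lambda>g::real \<Rightarrow> 'd. \<lambda>t. x0 + (integral {-a..cl t} g - integral {-a..0} g))"
  define s where "s = PiC UNIV (\<lambda>_::real. cball x0 r)"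
  have Pb: "norm (P g t - P g' t) \<le> 2 * a * K" if "continuous_on {-a..a} g" "continuous_on {-a..a} g'"
    "\<And>q. q \<in> {-a..a} \<Longrightarrow> norm (g q - g' q) \<le> K" for g g' K t
  proof -
    have K: "0 \<le> K" using order_trans[OF norm_ge_zero that(3)[of 0]] a(1) by simp
    have i: "g integrable_on {-a..u}" "g' integrable_on {-a..u}" if "u \<le> a" for u
      using that \<open>continuous_on {-a..a} g\<close> \<open>continuous_on {-a..a} g'\<close> 
      by (auto intro!: integrable_continuous_interval elim: continuous_on_subset)
    have b: "norm (integral {-a..u} g - integral {-a..u'} g - (integral {-a..u} g' - integral {-a..u'} g')) \<le> K * (u - u')"
      if u: "u' \<le> u" "-a \<le> u'" "u \<le> a" for u u'
    proof -
      have eq: "integral {-a..u} h - integral {-a..u'} h = integral {u'..u} h" if "h integrable_on {-a..u}" for h :: "real \<Rightarrow> 'd"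
        using Henstock_Kurzweil_Integration.integral_combine[of "-a" u' u h] u that by (simp add: algebra_simps)
      have i': "g integrable_on {u'..u}" "g' integrable_on {u'..u}"
        using i[of u] u by (auto elim!: integrable_on_subinterval)
      have "integral {u'..u} g - integral {u'..u} g' = integral {u'..u} (\<lambda>q. g q - g' q)"
        using i' by (simp add: integral_diff)
      moreover have "norm (integral {u'..u} (\<lambda>q. g q - g' q)) \<le> K * (u - u')"
        using integral_bound[of u' u "\<lambda>q. g q - g' q" K] that
        by (force intro!: continuous_intros continuous_on_subset[OF \<open>continuous_on {-a..a} g\<close>] continuous_on_subset[OF \<open>continuous_on {-a..a} g'\<close>] \<open>\<And>q. q \<in> {-a..a} \<Longrightarrow> norm (g q - g' q) \<le> K\<close>)
      ultimately show ?thesis using eq[OF i(1)] eq[OF i(2)] u by simp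
    qed
    have "norm (P g t - P g' t) \<le> K * \<bar>cl t\<bar>"
    proof (cases "0 \<le> cl t")
      case True
      then show ?thesis using b[of 0 "cl t"] cl(1)[of t] a(1) by (simp add: P_def algebra_simps)
    next
      case False
      then have "norm (integral {-a..0} g - integral {-a..cl t} g - (integral {-a..0} g' - integral {-a..cl t} g')) \<le> K * - cl t"
        using b[of "cl t" 0] cl(1)[of t] a(1) by simp
      then show ?thesis using False norm_minus_cancel[of "P g t - P g' t"] by (simp add: P_def algebra_simps)
    qed
    also have "\<dots> \<le> K * (2 * a)" using cl(1)[of t] a(1) K by (intro mult_left_mono) auto
    finally show ?thesis by (simp add: mult.commute)
  qed
  have contP: "continuous_on UNIV (P g)" if "continuous_on {-a..a} g" for g
    unfolding P_def
    by (intro continuous_intros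
          continuous_on_compose2[OF indefinite_integral_continuous_1[OF integrable_continuous_interval[OF that]] contcl])
      (use cl in auto)
  have cW: "continuous_on {-a..a} (\<lambda>t. W (apply_bcontfun f t))" if "f \<in> s" for f
  proof (rule continuous_on_compose2[OF contW])
    show "continuous_on {-a..a} (apply_bcontfun f)" by simp
    show "apply_bcontfun f ` {-a..a} \<subseteq> cball x0 r" using that by (force simp: s_def mem_PiC_iff Pi_iff)
  qed
  have Psub: "norm (P (\<lambda>t. W (apply_bcontfun f t)) t - x0) \<le> r" if "f \<in> s" for f t
  proof -
    have "norm (P (\<lambda>t. W (apply_bcontfun f t)) t - P (\<lambda>_. 0) t) \<le> 2 * a * M"
      by (rule Pb) (use that cW Wb in \<open>auto simp: s_def mem_PiC_iff Pi_iff\<close>)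
    then show ?thesis using a(2) by (simp add: P_def)
  qed
  define T where "T = (\<lambda>f. Bcontfun (P (\<lambda>t. W (apply_bcontfun f t))))"
  have Tap: "apply_bcontfun (T f) = P (\<lambda>t. W (apply_bcontfun f t))" if "f \<in> s" for f
  proof -
    have "P (\<lambda>t. W (apply_bcontfun f t)) \<in> bcontfun"
      unfolding bcontfun_def using contP[OF cW[OF that]] Psub[OF that] 
      by (auto simp: bounded_def dist_norm norm_minus_commute intro!: exI[of _ x0] exI[of _ r])
    then show ?thesis by (simp add: T_def Bcontfun_inverse)
  qed
  have "\<exists>!f\<in>s. T f = f"
  proof (rule Banach_fix)
    have "closed s" unfolding s_def by (rule closed_PiC) auto
    then show "complete s" by (simp add: complete_eq_closed)
    have "const_bcontfun x0 \<in> s" using r by (auto simp: s_def mem_PiC_iff Pi_iff)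
    then show "s \<noteq> {}" by blast
    show "0 \<le> (1/2::real)" "(1/2::real) < 1" by auto
    show "T ` s \<subseteq> s" using Psub Tap by (auto simp: s_def mem_PiC_iff Pi_iff dist_norm norm_minus_commute)
    show "dist (T f) (T g) \<le> 1/2 * dist f g" if fg: "f \<in> s" "g \<in> s" for f g
    proof (rule dist_bound)
      fix t
      have "norm (P (\<lambda>t. W (apply_bcontfun f t)) t - P (\<lambda>t. W (apply_bcontfun g t)) t) \<le> 2 * a * (L * dist f g)"
      proof (rule Pb)
        fix q
        have "norm (W (apply_bcontfun f q) - W (apply_bcontfun g q)) \<le> L * norm (apply_bcontfun f q - apply_bcontfun g q)"
          using lip fg by (auto simp: s_def mem_PiC_iff Pi_iff)
        also have "\<dots> \<le> L * dist f g" using dist_bounded[of f q g] L by (intro mult_left_mono) (auto simp: dist_norm)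
        finally show "norm (W (apply_bcontfun f q) - W (apply_bcontfun g q)) \<le> L * dist f g" .
      qed (use cW fg in auto)
      also have "\<dots> = (2 * a * L) * dist f g" by simp
      also have "\<dots> \<le> 1/2 * dist f g" using a(3) by (intro mult_right_mono) auto
      finally show "dist (apply_bcontfun (T f) t) (apply_bcontfun (T g) t) \<le> 1/2 * dist f g"
        using fg by (simp add: Tap dist_norm)
    qed
  qed
  then obtain f where f: "f \<in> s" "T f = f" by blast
  define x where "x = apply_bcontfun f"
  have xP: "x = P (\<lambda>t. W (x t))" using Tap[OF f(1)] f(2) by (simp add: x_def)
  have "x 0 = x0" by (subst xP) (use a(1) cl(2)[of 0] in \<open>simp add: P_def\<close>)
  moreover have "x t \<in> cball x0 r" for t using f(1) by (auto simp: x_def s_def mem_PiC_iff Pi_iff)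
  moreover have "(x has_vector_derivative W (x t)) (at t)" if t: "t \<in> {-a<..<a}" for t
  proof -
    have "((\<lambda>u. integral {-a..u} (\<lambda>t. W (x t))) has_vector_derivative W (x t)) (at t within {-a..a})"
      by (rule integral_has_vector_derivative) (use cW[OF f(1)] t in \<open>auto simp: x_def\<close>)
    then have "((\<lambda>u. integral {-a..u} (\<lambda>t. W (x t))) has_vector_derivative W (x t)) (at t)"
      using t by (simp add: at_within_Icc_at)
    then have "((\<lambda>u. x0 + (integral {-a..u} (\<lambda>t. W (x t)) - integral {-a..0} (\<lambda>t. W (x t)))) has_vector_derivative W (x t)) (at t)"
      by (auto intro!: derivative_eq_intros)
    moreover have "x u = x0 + (integral {-a..u} (\<lambda>t. W (x t)) - integral {-a..0} (\<lambda>t. W (x t)))" if "u \<in> {-a<..<a}" for u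
      by (subst xP) (use cl(2)[of u] that in \<open>simp add: P_def\<close>)
    ultimately show ?thesis
      using has_vector_derivative_transform_within_open[of _ _ t "{-a<..<a}" x] t by (metis (no_types, lifting) open_greaterThanLessThan)
  qed
  ultimately show ?thesis using a(1) by blast
qed

text \<open>\<open>picard_local\<close> works in a \<open>banach\<close> type, while the model space
  is merely a normed space. The equation is therefore transported to the dual space, which is
  complete: \<open>T\<close> embeds the model space by means of dual basis vectors,
  \<open>T'\<close> is a left inverse of it, and the vector field becomes T o V o T'.\<close>

lemma (in findim) local_solution:
  fixes V :: "'e \<Rightarrow> 'e"
  assumes "smooth_on S V" "open S" "x0 \<in> S"
  obtains a c where "a > 0" "c 0 = x0" "\<And>t. t \<in> {-a<..<a} \<Longrightarrow> c t \<in> S \<and> (c has_vector_derivative V (c t)) (at t)"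
proof -
  define T where "T = (\<lambda>v. \<Sum>b\<in>B. representation B v b *\<^sub>R Blinfun (\<lambda>w. representation B w b))"
  define T' where "T' = (\<lambda>\<phi>::'e \<Rightarrow>\<^sub>L real. \<Sum>b\<in>B. blinfun_apply \<phi> b *\<^sub>R b)"
  have bl: "bounded_linear (\<lambda>w. representation B w b)" for b by (intro linear_bounded linear_representation)
  have T: "bounded_linear T" unfolding T_def
    by (intro bounded_linear_sum bounded_linear_scaleR_const bl)
  have T': "bounded_linear T'" unfolding T'_def
    by (intro bounded_linear_sum bounded_linear_scaleR_const blinfun.bounded_linear_left)
  have rb: "representation B b b' = (if b' = b then 1 else 0)" if "b \<in> B" for b b'
    using real_vector.representation_basis[OF indep_B that] by auto
  have T'T: "T' (T v) = v" for v
  proof -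
    have "blinfun_apply (T v) b = representation B v b" if "b \<in> B" for b
      using that finite_B by (simp add: T_def blinfun.sum_left blinfun.scaleR_left bounded_linear_Blinfun_apply[OF bl] rb
          if_distrib[of "\<lambda>x. _ * x"] sum.delta' cong: if_cong)
    then show ?thesis using sum_representation[of v] by (simp add: T'_def)
  qed
  let ?D = "frechet_derivative V (at x0)"
  obtain d where d: "d > 0" "ball x0 d \<subseteq> S"
    "\<And>x y. x \<in> ball x0 d \<Longrightarrow> y \<in> ball x0 d \<Longrightarrow> norm (V x - V y - ?D (x - y)) \<le> 1 * norm (x - y)"
    using smooth_on_strict[OF assms, of 1] by auto
  have bD: "bounded_linear ?D" using smooth_on_has_derivative[OF assms(1,3)] has_derivative_bounded_linear by blast
  obtain K where K: "K > 0" "\<And>v. norm (?D v) \<le> norm v * K" using bounded_linear.pos_bounded[OF bD] by auto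
  obtain KT where KT: "KT > 0" "\<And>v. norm (T v) \<le> norm v * KT" using bounded_linear.pos_bounded[OF T] by auto
  obtain KT' where KT': "KT' > 0" "\<And>v. norm (T' v) \<le> norm v * KT'" using bounded_linear.pos_bounded[OF T'] by auto
  define r where "r = d / (2 * KT')"
  have r: "r > 0" using d KT' by (simp add: r_def)
  have inb: "T' \<phi> \<in> ball x0 d" if "\<phi> \<in> cball (T x0) r" for \<phi>
  proof -
    have "norm (T' \<phi> - x0) = norm (T' (\<phi> - T x0))" by (simp add: bounded_linear.linear[OF T'] linear_diff T'T)
    also have "\<dots> \<le> r * KT'" using KT'(2)[of "\<phi> - T x0"] that KT'(1) by (smt (verit) mem_cball dist_norm norm_minus_commute mult_right_mono)
    also have "\<dots> < d" using KT'(1) d(1) by (simp add: r_def)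
    finally show ?thesis by (simp add: dist_norm norm_minus_commute)
  qed
  define L where "L = KT * (1 + K) * KT'"
  have L: "L > 0" using KT K KT' by (simp add: L_def)
  have "norm (T (V (T' \<phi>)) - T (V (T' \<psi>))) \<le> L * norm (\<phi> - \<psi>)" if "\<phi> \<in> cball (T x0) r" "\<psi> \<in> cball (T x0) r" for \<phi> \<psi>
  proof -
    let ?x = "T' \<phi>" and ?y = "T' \<psi>"
    have "norm (V ?x - V ?y) \<le> norm (V ?x - V ?y - ?D (?x - ?y)) + norm (?D (?x - ?y))"
      by (metis diff_add_cancel norm_triangle_ineq)
    also have "\<dots> \<le> (1 + K) * norm (?x - ?y)" using d(3)[OF inb inb, OF that] K(2)[of "?x - ?y"] by (simp add: algebra_simps)
    also have "\<dots> \<le> (1 + K) * (norm (\<phi> - \<psi>) * KT')"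
      using KT'(2)[of "\<phi> - \<psi>"] K(1) by (intro mult_left_mono) (auto simp: bounded_linear.linear[OF T'] linear_diff)
    finally have 1: "norm (V ?x - V ?y) \<le> (1 + K) * (norm (\<phi> - \<psi>) * KT')" .
    have "norm (T (V ?x) - T (V ?y)) \<le> norm (V ?x - V ?y) * KT"
      using KT(2)[of "V ?x - V ?y"] by (simp add: bounded_linear.linear[OF T] linear_diff)
    also have "\<dots> \<le> ((1 + K) * (norm (\<phi> - \<psi>) * KT')) * KT" using 1 KT(1) by (intro mult_right_mono) auto
    finally show ?thesis by (simp add: L_def algebra_simps)
  qed
  from picard_local[OF r this L] obtain a x where ax: "a > 0" "x 0 = T x0"
    "\<And>t. t \<in> {-a<..<a} \<Longrightarrow> x t \<in> cball (T x0) r \<and> (x has_vector_derivative T (V (T' (x t)))) (at t)" by blast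
  show ?thesis
  proof (rule that[of a "\<lambda>t. T' (x t)"])
    fix t assume t: "t \<in> {-a<..<a}"
    show "T' (x t) \<in> S \<and> ((\<lambda>t. T' (x t)) has_vector_derivative V (T' (x t))) (at t)"
      using bounded_linear.has_vector_derivative[OF T', of x] ax(3)[OF t] inb d(2) by (fastforce simp: T'T)
  qed (use ax T'T in auto)
qed

section \<open>Calculus on manifolds\<close>

text \<open>The properties of single charts, without transition maps and without finite dimension.
  They suffice for derivatives and velocities, pass to products directly and hold for
  \<open>vspace\<close>.\<close>

locale charted =
  fixes A :: "('a::t2_space, 'e::real_normed_vector) charts"
  assumes open_dom: "open (cdom A p)"
    and mem_dom: "p \<in> cdom A p"
    and open_im: "open (cmap A p ` cdom A p)"
    and homeo: "homeomorphism (cdom A p) (cmap A p ` cdom A p) (cmap A p) (cinv A p)"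
begin

lemma cinv_cmap: "x \<in> cdom A p \<Longrightarrow> cinv A p (cmap A p x) = x"
  using homeo[of p] by (simp add: homeomorphism_def)

lemma cmap_cinv: "y \<in> cmap A p ` cdom A p \<Longrightarrow> cmap A p (cinv A p y) = y"
  using homeo[of p] by (auto simp: homeomorphism_def)

lemma cinv_mem: "y \<in> cmap A p ` cdom A p \<Longrightarrow> cinv A p y \<in> cdom A p"
  using homeo[of p] by (auto simp: homeomorphism_def)

lemma continuous_cmap: "continuous_on (cdom A p) (cmap A p)"
  using homeo[of p] by (simp add: homeomorphism_def)

lemma continuous_cinv: "continuous_on (cmap A p ` cdom A p) (cinv A p)"
  using homeo[of p] by (simp add: homeomorphism_def)

lemma isCont_cinv: "y \<in> cmap A p ` cdom A p \<Longrightarrow> isCont (cinv A p) y"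
  using continuous_cinv[of p] open_im[of p] continuous_on_eq_continuous_at by blast

lemma isCont_cmap: "x \<in> cdom A p \<Longrightarrow> isCont (cmap A p) x"
  using continuous_cmap[of p] open_dom[of p] continuous_on_eq_continuous_at by blast

lemma mem_im: "cmap A p p \<in> cmap A p ` cdom A p"
  using mem_dom by blast

lemma open_cmap_image:
  assumes "open V" "V \<subseteq> cdom A p"
  shows "open (cmap A p ` V)"
proof -
  have "cmap A p ` V = (cinv A p -` V) \<inter> (cmap A p ` cdom A p)"
    using assms(2) by (auto simp: cinv_cmap image_iff)
  then show ?thesis
    using continuous_open_preimage[OF continuous_cinv open_im assms(1), of p] by (simp add: Int_commute)
qed

end

lemma cdom_vspace [simp]: "cdom vspace p = UNIV" and cmap_vspace [simp]: "cmap vspace p = (\<lambda>x. x)"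
  and cinv_vspace [simp]: "cinv vspace p = (\<lambda>x. x)"
proof -
  show *: "cdom vspace p = UNIV" "cmap vspace p = (\<lambda>x. x)" by (simp_all add: cdom_def cmap_def vspace_def)
  show "cinv vspace p = (\<lambda>x. x)" unfolding cinv_def * by (simp add: fun_eq_iff inv_into_def)
qed

lemma charted_vspace: "charted (vspace :: ('e::real_normed_vector, 'e) charts)"
  by unfold_locales (auto simp: homeomorphism_def)

lemma cdom_prod [simp]: "cdom (prod_charts A B) (p, q) = cdom A p \<times> cdom B q"
  and cmap_prod [simp]: "cmap (prod_charts A B) (p, q) = map_prod (cmap A p) (cmap B q)"
  by (simp_all add: cdom_def cmap_def prod_charts_def)

lemma map_prod_image_times: "map_prod f g ` (S \<times> T) = f ` S \<times> g ` T"
  by force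

lemma cinv_prod:
  assumes "charted A" "charted B" "x \<in> cmap A p ` cdom A p" "y \<in> cmap B q ` cdom B q"
  shows "cinv (prod_charts A B) (p, q) (x, y) = (cinv A p x, cinv B q y)"
proof -
  interpret A: charted A by fact
  interpret B: charted B by fact
  have inj: "inj_on (map_prod (cmap A p) (cmap B q)) (cdom A p \<times> cdom B q)"
    by (intro map_prod_inj_on inj_on_inverseI[of _ "cinv A p"] inj_on_inverseI[of _ "cinv B q"] A.cinv_cmap B.cinv_cmap)
  have "map_prod (cmap A p) (cmap B q) (cinv A p x, cinv B q y) = (x, y)"
    using assms(3,4) by (simp add: A.cmap_cinv B.cmap_cinv)
  moreover have "(cinv A p x, cinv B q y) \<in> cdom A p \<times> cdom B q"
    using assms(3,4) by (simp add: A.cinv_mem B.cinv_mem)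
  ultimately show ?thesis
    using inv_into_f_f[OF inj, of "(cinv A p x, cinv B q y)"] by (simp add: cinv_def[of "prod_charts A B"])
qed

lemma charted_prod:
  assumes "charted A" "charted B"
  shows "charted (prod_charts A B)"
proof -
  interpret A: charted A by fact
  interpret B: charted B by fact
  show ?thesis
  proof
    fix p :: "'a \<times> 'c"
    obtain a b where p: "p = (a, b)" by fastforce
    show "open (cdom (prod_charts A B) p)" by (simp add: p open_Times A.open_dom B.open_dom)
    show "p \<in> cdom (prod_charts A B) p" by (simp add: p A.mem_dom B.mem_dom)
    show "open (cmap (prod_charts A B) p ` cdom (prod_charts A B) p)"
      by (simp add: p map_prod_image_times open_Times A.open_im B.open_im)
    have eq: "cinv (prod_charts A B) p z = (cinv A a (fst z), cinv B b (snd z))"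
      if "z \<in> cmap A a ` cdom A a \<times> cmap B b ` cdom B b" for z
      using that cinv_prod[OF assms] by (auto simp: p)
    have "continuous_on (cdom A a \<times> cdom B b) (\<lambda>z. (cmap A a (fst z), cmap B b (snd z)))"
      by (intro continuous_on_Pair continuous_on_compose2[OF A.continuous_cmap] continuous_on_compose2[OF B.continuous_cmap])
        (auto intro: continuous_intros)
    then have c1: "continuous_on (cdom A a \<times> cdom B b) (map_prod (cmap A a) (cmap B b))"
      by (simp add: map_prod_def split_beta)
    have "continuous_on (cmap A a ` cdom A a \<times> cmap B b ` cdom B b) (\<lambda>z. (cinv A a (fst z), cinv B b (snd z)))"
      by (intro continuous_on_Pair continuous_on_compose2[OF A.continuous_cinv] continuous_on_compose2[OF B.continuous_cinv])
        (auto intro: continuous_intros)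
    then have c2: "continuous_on (cmap A a ` cdom A a \<times> cmap B b ` cdom B b) (cinv (prod_charts A B) p)"
      by (subst continuous_on_cong[OF refl eq]) auto
    have "cinv (prod_charts A B) p ` (cmap A a ` cdom A a \<times> cmap B b ` cdom B b) = cdom A a \<times> cdom B b"
    proof (intro equalityI subsetI)
      fix z assume "z \<in> cdom A a \<times> cdom B b"
      then show "z \<in> cinv (prod_charts A B) p ` (cmap A a ` cdom A a \<times> cmap B b ` cdom B b)"
        by (intro image_eqI[of _ _ "(cmap A a (fst z), cmap B b (snd z))"])
          (auto simp: eq A.cinv_cmap B.cinv_cmap)
    qed (auto simp: eq A.cinv_cmap B.cinv_cmap)
    then show "homeomorphism (cdom (prod_charts A B) p) (cmap (prod_charts A B) p ` cdom (prod_charts A B) p)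
        (cmap (prod_charts A B) p) (cinv (prod_charts A B) p)"
      unfolding homeomorphism_def
      using c1 c2 by (auto simp: p map_prod_image_times eq[unfolded p] A.cinv_cmap B.cinv_cmap A.cmap_cinv B.cmap_cinv)
  qed
qed

lemma (in smooth_manifold) charted: "charted A"
  by (rule charted.intro) (rule open_cdom mem_cdom open_cmap homeo_cmap)+

lemma (in smooth_manifold) findim: obtains B :: "'e set" where "findim B"
  using finite_dim findim_exists by blast

subsection \<open>Derivatives of maps and velocities of curves\<close>

text \<open>A relation rather than a function, so that differentiability is carried along.
  Continuity at \<open>p\<close> is required separately, since the coordinate expression says
  nothing about f where its values leave the chart domain.\<close>

definition mder ::
  "('a::t2_space, 'e::real_normed_vector) charts \<Rightarrow> ('b::t2_space, 'f::real_normed_vector) charts \<Rightarrow>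
   ('a \<Rightarrow> 'b) \<Rightarrow> 'a \<Rightarrow> ('e \<Rightarrow> 'f) \<Rightarrow> bool" where
  "mder A B f p D \<longleftrightarrow> isCont f p \<and> ((\<lambda>x. cmap B (f p) (f (cinv A p x))) has_derivative D) (at (cmap A p p))"

definition vel :: "('a::t2_space, 'e::real_normed_vector) charts \<Rightarrow> (real \<Rightarrow> 'a) \<Rightarrow> real \<Rightarrow> 'e \<Rightarrow> bool" where
  "vel A c s w \<longleftrightarrow> isCont c s \<and> ((\<lambda>r. cmap A (c s) (c r)) has_vector_derivative w) (at s)"

lemma isCont_eventually_mem:
  assumes "isCont f x" "open V" "f x \<in> V"
  shows "\<forall>\<^sub>F y in nhds x. f y \<in> V"
proof -
  have "(f \<longlongrightarrow> f x) (nhds x)" using assms(1) tendsto_at_iff_tendsto_nhds[of f x] by (simp add: isCont_def)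
  then show ?thesis using assms(2,3) topological_tendstoD by blast
qed

lemma isCont_compose: "isCont f x \<Longrightarrow> isCont g (f x) \<Longrightarrow> isCont (\<lambda>y. g (f y)) x"
  using isCont_o2 by blast

lemma has_derivative_cong_nhds:
  assumes "(f has_derivative D) (at x)" "\<forall>\<^sub>F y in nhds x. f y = g y"
  shows "(g has_derivative D) (at x)"
  using has_derivative_transform_eventually[OF assms(1), of g] assms(2)
  by (simp add: eventually_nhds_conv_at)

lemma mder_compose:
  assumes "charted A" "charted B" "mder A B f p D" "mder B C g (f p) D'"
  shows "mder A C (\<lambda>x. g (f x)) p (\<lambda>v. D' (D v))"
proof -
  interpret A: charted A by fact
  interpret B: charted B by fact
  have cont: "isCont f p" "isCont g (f p)" using assms(3,4) by (auto simp: mder_def)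
  have c1: "isCont (\<lambda>x. f (cinv A p x)) (cmap A p p)"
    by (rule isCont_compose[OF A.isCont_cinv[OF A.mem_im]]) (use cont(1) A.cinv_cmap[OF A.mem_dom] in simp)
  have ev: "\<forall>\<^sub>F x in nhds (cmap A p p). f (cinv A p x) \<in> cdom B (f p)"
    by (rule isCont_eventually_mem[OF c1 B.open_dom]) (simp add: A.cinv_cmap[OF A.mem_dom] B.mem_dom)
  have D: "((\<lambda>x. cmap B (f p) (f (cinv A p x))) has_derivative D) (at (cmap A p p))"
    and D': "((\<lambda>y. cmap C (g (f p)) (g (cinv B (f p) y))) has_derivative D') (at (cmap B (f p) (f p)))"
    using assms(3,4) by (auto simp: mder_def)
  have D'': "((\<lambda>y. cmap C (g (f p)) (g (cinv B (f p) y))) has_derivative D') (at (cmap B (f p) (f (cinv A p (cmap A p p)))))"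
    using D' A.cinv_cmap[OF A.mem_dom] by simp
  have "((\<lambda>x. cmap C (g (f p)) (g (cinv B (f p) (cmap B (f p) (f (cinv A p x)))))) has_derivative (\<lambda>v. D' (D v))) (at (cmap A p p))"
    by (rule has_derivative_compose[OF D D''])
  then have "((\<lambda>x. cmap C (g (f p)) (g (f (cinv A p x)))) has_derivative (\<lambda>v. D' (D v))) (at (cmap A p p))"
    by (rule has_derivative_cong_nhds) (use ev in eventually_elim, simp add: B.cinv_cmap)
  then show ?thesis using isCont_compose[OF cont] by (simp add: mder_def)
qed

lemma vel_mder: "vel A c s w \<longleftrightarrow> mder vspace A c s (\<lambda>r. r *\<^sub>R w)"
  by (simp add: vel_def mder_def has_vector_derivative_def)

lemma mder_linear: "mder A B f p D \<Longrightarrow> linear D"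
  using has_derivative_linear by (auto simp: mder_def)

lemma vel_compose:
  assumes "charted A" "vel A c s w" "mder A B f (c s) D"
  shows "vel B (\<lambda>r. f (c r)) s (D w)"
  using mder_compose[OF charted_vspace assms(1) assms(2)[unfolded vel_mder] assms(3)] linear_cmul[OF mder_linear[OF assms(3)]]
  by (simp add: vel_mder)

lemma mder_unique: "mder A B f p D \<Longrightarrow> mder A B f p D' \<Longrightarrow> D = D'"
  unfolding mder_def using has_derivative_unique by blast

lemma mder_tmap: "mder A B f p D \<Longrightarrow> tmap A B f p = D"
  unfolding mder_def tmap_def using frechet_derivative_at by (force simp: o_def)

lemma vel_unique: "vel A c s w \<Longrightarrow> vel A c s w' \<Longrightarrow> w = w'"
  unfolding vel_def using vector_derivative_unique_at by blast

lemma vel_velocity: "vel A c 0 w \<Longrightarrow> velocity A c = w"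
  unfolding velocity_def using mder_tmap[of vspace A c 0] vel_mder by (metis scaleR_one)

lemma vel_cong:
  assumes "\<forall>\<^sub>F r in nhds s. c r = d r" "vel A c s w"
  shows "vel A d s w"
proof -
  have "c s = d s" using assms(1) by (rule eventually_nhds_x_imp_x)
  moreover have "isCont d s" using assms isCont_cong[OF assms(1)] by (simp add: vel_def)
  moreover have "((\<lambda>r. cmap A (c s) (d r)) has_vector_derivative w) (at s)"
    unfolding has_vector_derivative_def
    by (rule has_derivative_cong_nhds[of "\<lambda>r. cmap A (c s) (c r)"])
      (use assms in \<open>auto simp: vel_def has_vector_derivative_def elim: eventually_mono\<close>)
  ultimately show ?thesis by (simp add: vel_def)
qed

lemma vel_vspace: "vel vspace c s w \<longleftrightarrow> (c has_vector_derivative w) (at s)"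
  unfolding vel_def using has_vector_derivative_continuous by auto

lemma vel_const: "vel A (\<lambda>_. a) s 0"
  by (simp add: vel_def)

lemma vel_Pair:
  assumes "vel A c s w" "vel B d s w'"
  shows "vel (prod_charts A B) (\<lambda>r. (c r, d r)) s (w, w')"
  using assms by (auto simp: vel_def intro!: has_vector_derivative_Pair)

lemma vel_shift: "vel A c (s + a) w \<Longrightarrow> vel A (\<lambda>r. c (r + a)) s w"
proof -
  assume v: "vel A c (s + a) w"
  have "vel vspace (\<lambda>r. r + a) s 1" unfolding vel_vspace by (auto intro!: derivative_eq_intros)
  from vel_compose[OF charted_vspace this v[unfolded vel_mder]] show ?thesis by simp
qed

lemma vel_scale: "vel A c (k * s) w \<Longrightarrow> vel A (\<lambda>r. c (k * r)) s (k *\<^sub>R w)"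
proof -
  assume v: "vel A c (k * s) w"
  have "vel vspace (\<lambda>r. k * r) s k" unfolding vel_vspace has_real_derivative_iff_has_vector_derivative[symmetric]
    by (auto intro!: derivative_eq_intros)
  from vel_compose[OF charted_vspace this v[unfolded vel_mder]] show ?thesis by simp
qed

lemma smooth_map_on_mder:
  assumes "charted A" "charted B" "smooth_map_on A B S f" "open S" "p \<in> S"
  shows "mder A B f p (tmap A B f p)"
proof -
  interpret A: charted A by fact
  interpret B: charted B by fact
  have cont: "isCont f p" using assms(3-5) continuous_on_eq_continuous_at by (auto simp: smooth_map_on_def)
  have "smooth_on (cmap A p ` (cdom A p \<inter> S \<inter> f -` cdom B (f p))) (cmap B (f p) \<circ> f \<circ> cinv A p)"
    using assms(3) by (simp add: smooth_map_on_def)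
  moreover have "cmap A p p \<in> cmap A p ` (cdom A p \<inter> S \<inter> f -` cdom B (f p))"
    using assms(5) A.mem_dom B.mem_dom by blast
  ultimately have "(cmap B (f p) \<circ> f \<circ> cinv A p) differentiable (at (cmap A p p))"
    by (rule smooth_on_differentiable)
  then have "(cmap B (f p) \<circ> f \<circ> cinv A p has_derivative tmap A B f p) (at (cmap A p p))"
    unfolding tmap_def by (rule has_frechet_derivative)
  then show ?thesis using cont by (simp add: mder_def o_def)
qed

subsection \<open>Smooth maps\<close>

lemma smooth_map_on_compose:
  fixes f :: "'a::t2_space \<Rightarrow> 'b::t2_space" and g :: "'b \<Rightarrow> 'c::t2_space"
    and BB :: "'f::real_normed_vector set"
  assumes A: "charted A" and B: "charted B" and C: "charted C" and BB: "findim BB"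
    and f: "smooth_map_on A (B :: ('b, 'f) charts) S f" and g: "smooth_map_on B C T g"
    and S: "open S" and T: "open T" and sub: "f ` S \<subseteq> T"
  shows "smooth_map_on A C S (\<lambda>x. g (f x))"
  unfolding smooth_map_on_def
proof (intro conjI allI)
  interpret A: charted A by fact
  interpret B: charted B by fact
  interpret C: charted C by fact
  interpret BB: findim BB by fact
  have cf: "continuous_on S f" and cg: "continuous_on T g" using f g by (auto simp: smooth_map_on_def)
  show "continuous_on S (\<lambda>x. g (f x))" using continuous_on_compose2[OF cg cf sub] .
  fix p q
  show "smooth_on (cmap A p ` (cdom A p \<inter> S \<inter> (\<lambda>x. g (f x)) -` cdom C q)) (cmap C q \<circ> (\<lambda>x. g (f x)) \<circ> cinv A p)"
  proof (rule smooth_on_local)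
    fix x assume "x \<in> cmap A p ` (cdom A p \<inter> S \<inter> (\<lambda>x. g (f x)) -` cdom C q)"
    then obtain a where a: "x = cmap A p a" "a \<in> cdom A p" "a \<in> S" "g (f a) \<in> cdom C q" by auto
    define V where "V = cdom B (f a) \<inter> (T \<inter> g -` cdom C q)"
    have oV: "open V" unfolding V_def
      by (intro open_Int B.open_dom continuous_open_preimage[OF cg T C.open_dom])
    define W where "W = cdom A p \<inter> (S \<inter> f -` V)"
    have oW: "open W" unfolding W_def by (intro open_Int A.open_dom continuous_open_preimage[OF cf S oV])
    have oW': "open (cmap A p ` W)" by (rule A.open_cmap_image[OF oW]) (simp add: W_def)
    have oV': "open (cmap B (f a) ` V)" by (rule B.open_cmap_image[OF oV]) (simp add: V_def)
    have "smooth_on (cmap A p ` W) (\<lambda>x. (cmap C q \<circ> g \<circ> cinv B (f a)) ((cmap B (f a) \<circ> f \<circ> cinv A p) x))"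
    proof (rule BB.smooth_on_compose[OF oW' oV'])
      show "(cmap B (f a) \<circ> f \<circ> cinv A p) ` (cmap A p ` W) \<subseteq> cmap B (f a) ` V"
        by (auto simp: W_def A.cinv_cmap)
      show "smooth_on (cmap A p ` W) (cmap B (f a) \<circ> f \<circ> cinv A p)"
        by (rule smooth_on_mono[of "cmap A p ` (cdom A p \<inter> S \<inter> f -` cdom B (f a))"])
          (use f in \<open>auto simp: smooth_map_on_def W_def V_def\<close>)
      show "smooth_on (cmap B (f a) ` V) (cmap C q \<circ> g \<circ> cinv B (f a))"
        by (rule smooth_on_mono[of "cmap B (f a) ` (cdom B (f a) \<inter> T \<inter> g -` cdom C q)"])
          (use g in \<open>auto simp: smooth_map_on_def V_def\<close>)
    qed
    also have "?this \<longleftrightarrow> smooth_on (cmap A p ` W) (cmap C q \<circ> (\<lambda>x. g (f x)) \<circ> cinv A p)"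
      by (rule smooth_on_cong[OF oW']) (auto simp: W_def V_def A.cinv_cmap B.cinv_cmap)
    finally have "smooth_on (cmap A p ` W) (cmap C q \<circ> (\<lambda>x. g (f x)) \<circ> cinv A p)" .
    moreover have "x \<in> cmap A p ` W" using a sub by (auto simp: W_def V_def B.mem_dom)
    ultimately show "\<exists>T. open T \<and> x \<in> T \<and> smooth_on T (cmap C q \<circ> (\<lambda>x. g (f x)) \<circ> cinv A p)" using oW' by blast
  qed
qed

lemma smooth_map_on_mono:
  assumes "smooth_map_on A B S f" "T \<subseteq> S"
  shows "smooth_map_on A B T f"
  unfolding smooth_map_on_def
proof (intro conjI allI)
  show "continuous_on T f" using assms continuous_on_subset by (auto simp: smooth_map_on_def)
  show "smooth_on (cmap A p ` (cdom A p \<inter> T \<inter> f -` cdom B q)) (cmap B q \<circ> f \<circ> cinv A p)" for p q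
    by (rule smooth_on_mono[of "cmap A p ` (cdom A p \<inter> S \<inter> f -` cdom B q)"])
      (use assms in \<open>auto simp: smooth_map_on_def\<close>)
qed

lemma smooth_map_on_Pair:
  assumes A: "charted A" and B: "charted B" and C: "charted C"
    and f: "smooth_map_on A B S f" and g: "smooth_map_on A C S g" and S: "open S"
  shows "smooth_map_on A (prod_charts B C) S (\<lambda>x. (f x, g x))"
  unfolding smooth_map_on_def
proof (intro conjI allI)
  interpret A: charted A by fact
  interpret B: charted B by fact
  interpret C: charted C by fact
  have cf: "continuous_on S f" and cg: "continuous_on S g" using f g by (auto simp: smooth_map_on_def)
  then show "continuous_on S (\<lambda>x. (f x, g x))" by (rule continuous_on_Pair)
  fix p and q :: "'c \<times> 'e"
  obtain b c where q: "q = (b, c)" by fastforce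
  let ?W = "cdom A p \<inter> S \<inter> (\<lambda>x. (f x, g x)) -` cdom (prod_charts B C) q"
  have "?W = cdom A p \<inter> ((S \<inter> f -` cdom B b) \<inter> (S \<inter> g -` cdom C c))" by (auto simp: q)
  then have oW: "open (cmap A p ` ?W)"
    by (intro A.open_cmap_image) (auto intro!: open_Int A.open_dom continuous_open_preimage[OF cf S B.open_dom] continuous_open_preimage[OF cg S C.open_dom])
  have "smooth_on (cmap A p ` ?W) (cmap B b \<circ> f \<circ> cinv A p)" "smooth_on (cmap A p ` ?W) (cmap C c \<circ> g \<circ> cinv A p)"
    by (rule smooth_on_mono[of "cmap A p ` (cdom A p \<inter> S \<inter> f -` cdom B b)"], use f in \<open>auto simp: smooth_map_on_def q\<close>)
      (rule smooth_on_mono[of "cmap A p ` (cdom A p \<inter> S \<inter> g -` cdom C c)"], use g in \<open>auto simp: smooth_map_on_def q\<close>)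
  from smooth_on_Pair[OF oW this]
  show "smooth_on (cmap A p ` ?W) (cmap (prod_charts B C) q \<circ> (\<lambda>x. (f x, g x)) \<circ> cinv A p)"
    by (simp add: q o_def)
qed

lemma smooth_map_on_const:
  assumes "charted A"
  shows "smooth_map_on A B S (\<lambda>_. b)"
  unfolding smooth_map_on_def by (simp add: o_def smooth_on_const)

lemma smooth_map_on_vspace: "smooth_map_on vspace vspace S f \<longleftrightarrow> smooth_on S f"
  using smooth_on_continuous by (auto simp: smooth_map_on_def o_def)

context smooth_manifold
begin

lemma smooth_map_id: "smooth_map A A (\<lambda>x. x)"
  unfolding smooth_map_on_def
proof (intro conjI allI)
  show "smooth_on (cmap A p ` (cdom A p \<inter> UNIV \<inter> (\<lambda>x. x) -` cdom A q)) (cmap A q \<circ> (\<lambda>x. x) \<circ> cinv A p)" for p q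
    using transition[of p q] by (simp add: o_def Int_commute)
qed auto

lemma smooth_cmap: "smooth_map_on A vspace (cdom A q) (cmap A q)"
  unfolding smooth_map_on_def
proof (intro conjI allI)
  show "continuous_on (cdom A q) (cmap A q)" using charted.continuous_cmap[OF charted] .
  show "smooth_on (cmap A p ` (cdom A p \<inter> cdom A q \<inter> cmap A q -` cdom vspace r)) (cmap vspace r \<circ> cmap A q \<circ> cinv A p)" for p r
    using transition[of p q] by (simp add: o_def Int_commute)
qed

lemma smooth_cinv: "smooth_map_on vspace A (cmap A q ` cdom A q) (cinv A q)"
  unfolding smooth_map_on_def
proof (intro conjI allI)
  interpret charted A by (rule charted)
  show "continuous_on (cmap A q ` cdom A q) (cinv A q)" by (rule continuous_cinv)
  fix p :: 'e and r
  have "cmap A q ` cdom A q \<inter> cinv A q -` cdom A r = cmap A q ` (cdom A q \<inter> cdom A r)"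
    using cinv_cmap by auto
  then show "smooth_on (cmap vspace p ` (cdom vspace p \<inter> cmap A q ` cdom A q \<inter> cinv A q -` cdom A r)) (cmap A r \<circ> cinv A q \<circ> cinv vspace p)"
    using transition[of q r] by (simp add: o_def Int_commute)
qed

text \<open>The chart in which the velocity is computed varies with time, so transition maps enter here.\<close>

lemma vel_zero_constant:
  assumes I: "open I" "connected I" and v: "\<And>s. s \<in> I \<Longrightarrow> vel A c s 0" and "s \<in> I" "t \<in> I"
  shows "c s = c t"
proof -
  interpret charted A by (rule charted)
  have loc: "\<exists>e>0. \<forall>u. \<bar>u - r\<bar> < e \<longrightarrow> c u = c r" if r: "r \<in> I" for r
  proof -
    have cont: "isCont c u" if "u \<in> I" for u using v[OF that] by (simp add: vel_def)
    have "\<forall>\<^sub>F u in nhds r. u \<in> I \<and> c u \<in> cdom A (c r)"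
      using eventually_nhds_in_open[OF I(1) r] isCont_eventually_mem[OF cont[OF r] open_dom mem_dom]
      by (rule eventually_conj)
    then obtain e where e: "e > 0" "\<And>u. dist u r < e \<Longrightarrow> u \<in> I \<and> c u \<in> cdom A (c r)"
      unfolding eventually_nhds_metric by blast
    have "((\<lambda>u. cmap A (c r) (c u)) has_vector_derivative 0) (at u)" if u: "dist u r < e" for u
    proof -
      have uI: "u \<in> I" and ud: "c u \<in> cdom A (c r)" using e(2)[OF u] by auto
      have "mder A vspace (cmap A (c r)) (c u) (tmap A vspace (cmap A (c r)) (c u))"
        by (rule smooth_map_on_mder[OF charted charted_vspace smooth_cmap open_cdom ud])
      from vel_compose[OF charted v[OF uI] this] linear_0[OF mder_linear[OF this]]
      show ?thesis by (simp add: vel_vspace)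
    qed
    then have "((\<lambda>u. cmap A (c r) (c u)) has_vector_derivative 0) (at u within ball r e)" if "u \<in> ball r e" for u
      using that by (auto simp: dist_commute intro: has_vector_derivative_at_within)
    from has_vector_derivative_zero_constant[OF convex_ball this]
    obtain k where k: "\<And>u. u \<in> ball r e \<Longrightarrow> cmap A (c r) (c u) = k" by (metis (no_types, lifting))
    have "c u = c r" if "dist u r < e" for u
    proof -
      have "cmap A (c r) (c u) = cmap A (c r) (c r)" using k[of u] k[of r] that e(1) by (auto simp: dist_commute)
      then show ?thesis using cinv_cmap e(2)[OF that] mem_dom by metis
    qed
    then show ?thesis using e(1) unfolding dist_real_def by blast
  qed
  have "\<exists>T. openin (top_of_set I) T \<and> r \<in> T \<and> (\<forall>u\<in>T. c u = c r)" if r: "r \<in> I" for r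
  proof -
    obtain e where e: "e > 0" "\<forall>u. \<bar>u - r\<bar> < e \<longrightarrow> c u = c r" using loc[OF r] by auto
    have "\<forall>u\<in>I \<inter> ball r e. c u = c r"
      using e(2) by (metis IntD2 mem_ball dist_commute dist_real_def)
    then show ?thesis using e(1) r by (meson IntI centre_in_ball open_ball openin_open_Int)
  qed
  then have "c constant_on I" by (rule locally_constant_imp_constant[OF I(2)])
  then show ?thesis using assms(4,5) by (auto simp: constant_on_def)
qed

end

lemma smooth_map_fst:
  assumes "smooth_manifold A" "charted B"
  shows "smooth_map (prod_charts A B) A fst"
  unfolding smooth_map_on_def
proof (intro conjI allI)
  interpret A: smooth_manifold A by fact
  interpret cA: charted A by (rule A.charted)
  interpret B: charted B by fact
  obtain BB where BB: "findim (BB :: 'b set)" by (rule A.findim)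
  show "continuous_on UNIV fst" by (intro continuous_intros)
  fix p :: "'a \<times> 'c" and q
  obtain a b where p: "p = (a, b)" by fastforce
  have eq: "cmap (prod_charts A B) p ` (cdom (prod_charts A B) p \<inter> UNIV \<inter> fst -` cdom A q)
    = cmap A a ` (cdom A a \<inter> cdom A q) \<times> cmap B b ` cdom B b" (is "?L = ?R")
  proof -
    have "cdom A a \<times> cdom B b \<inter> fst -` cdom A q = (cdom A a \<inter> cdom A q) \<times> cdom B b" by auto
    then show ?thesis by (simp add: p map_prod_image_times)
  qed
  have o: "open (cmap A a ` (cdom A a \<inter> cdom A q))" by (intro cA.open_cmap_image open_Int A.open_cdom) auto
  have oR: "open ?R" by (intro open_Times o B.open_im)
  have "smooth_on ?R (\<lambda>z. (cmap A q \<circ> cinv A a) (fst z))"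
    by (rule findim.smooth_on_compose[OF BB oR o, of fst "cmap A q \<circ> cinv A a"])
      (use A.transition[of a q] in \<open>auto simp: Int_commute intro: bounded_linear_smooth_on bounded_linear_fst\<close>)
  also have "?this \<longleftrightarrow> smooth_on ?R (cmap A q \<circ> fst \<circ> cinv (prod_charts A B) p)"
  proof (rule smooth_on_cong[OF oR])
    fix z assume "z \<in> ?R"
    then have "cinv (prod_charts A B) (a, b) (fst z, snd z) = (cinv A a (fst z), cinv B b (snd z))"
      by (intro cinv_prod[OF A.charted assms(2)]) auto
    then show "(cmap A q \<circ> cinv A a) (fst z) = (cmap A q \<circ> fst \<circ> cinv (prod_charts A B) p) z" by (simp add: p)
  qed
  finally show "smooth_on (cmap (prod_charts A B) p ` (cdom (prod_charts A B) p \<inter> UNIV \<inter> fst -` cdom A q)) (cmap A q \<circ> fst \<circ> cinv (prod_charts A B) p)"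
    unfolding eq .
qed

lemma smooth_map_on_local:
  assumes "\<And>x. x \<in> S \<Longrightarrow> \<exists>T. open T \<and> x \<in> T \<and> smooth_map_on A B T f" and A: "charted A" and B: "charted B"
  shows "smooth_map_on A B S f"
  unfolding smooth_map_on_def
proof (intro conjI allI)
  interpret A: charted A by fact
  interpret B: charted B by fact
  have "continuous (at x) f" if x: "x \<in> S" for x
  proof -
    obtain T where "open T" "x \<in> T" "smooth_map_on A B T f" using assms(1)[OF x] by blast
    then show ?thesis using continuous_on_eq_continuous_at by (auto simp: smooth_map_on_def)
  qed
  then show "continuous_on S f" by (simp add: continuous_at_imp_continuous_on)
  fix p q
  show "smooth_on (cmap A p ` (cdom A p \<inter> S \<inter> f -` cdom B q)) (cmap B q \<circ> f \<circ> cinv A p)"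
  proof (rule smooth_on_local)
    fix x assume "x \<in> cmap A p ` (cdom A p \<inter> S \<inter> f -` cdom B q)"
    then obtain a where a: "x = cmap A p a" "a \<in> cdom A p" "a \<in> S" "f a \<in> cdom B q" by auto
    obtain T where T: "open T" "a \<in> T" "smooth_map_on A B T f" using assms(1)[OF a(3)] by blast
    have "open (cmap A p ` (cdom A p \<inter> (T \<inter> f -` cdom B q)))"
      by (intro A.open_cmap_image open_Int A.open_dom continuous_open_preimage[OF _ T(1) B.open_dom])
        (use T(3) in \<open>auto simp: smooth_map_on_def\<close>)
    then have "open (cmap A p ` (cdom A p \<inter> T \<inter> f -` cdom B q))" by (simp add: Int_assoc)
    moreover have "x \<in> cmap A p ` (cdom A p \<inter> T \<inter> f -` cdom B q)" using a T by blast
    moreover have "smooth_on (cmap A p ` (cdom A p \<inter> T \<inter> f -` cdom B q)) (cmap B q \<circ> f \<circ> cinv A p)"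
      using T(3) by (simp add: smooth_map_on_def)
    ultimately show "\<exists>T. open T \<and> x \<in> T \<and> smooth_on T (cmap B q \<circ> f \<circ> cinv A p)" by blast
  qed
qed

lemma smooth_map_on_cong:
  assumes "charted A" "charted B" "open S" "smooth_map_on A B S f" "\<And>x. x \<in> S \<Longrightarrow> f x = g x"
  shows "smooth_map_on A B S g"
  unfolding smooth_map_on_def
proof (intro conjI allI)
  interpret A: charted A by fact
  interpret B: charted B by fact
  have cf: "continuous_on S f" using assms(4) by (simp add: smooth_map_on_def)
  then show "continuous_on S g" using assms(5) by (simp cong: continuous_on_cong)
  fix p q
  let ?W = "cmap A p ` (cdom A p \<inter> S \<inter> f -` cdom B q)"
  have eq: "cdom A p \<inter> S \<inter> g -` cdom B q = cdom A p \<inter> S \<inter> f -` cdom B q" using assms(5) by auto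
  have o: "open ?W" unfolding Int_assoc
    by (intro A.open_cmap_image open_Int A.open_dom continuous_open_preimage[OF cf assms(3) B.open_dom]) auto
  have "smooth_on ?W (cmap B q \<circ> f \<circ> cinv A p)" using assms(4) by (simp add: smooth_map_on_def)
  also have "?this \<longleftrightarrow> smooth_on ?W (cmap B q \<circ> g \<circ> cinv A p)"
    by (rule smooth_on_cong[OF o]) (use assms(5) A.cinv_cmap in auto)
  finally show "smooth_on (cmap A p ` (cdom A p \<inter> S \<inter> g -` cdom B q)) (cmap B q \<circ> g \<circ> cinv A p)"
    unfolding eq .
qed

lemma mder_ident:
  assumes "charted A"
  shows "mder A A (\<lambda>x. x) p (\<lambda>v. v)"
proof -
  interpret charted A by fact
  have "\<forall>\<^sub>F y in nhds (cmap A p p). y = cmap A p (cinv A p y)"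
    using eventually_nhds_in_open[OF open_im mem_im] by (rule eventually_mono) (simp add: cmap_cinv)
  then have "((\<lambda>x. cmap A p (cinv A p x)) has_derivative (\<lambda>v. v)) (at (cmap A p p))"
    by (rule has_derivative_cong_nhds[OF has_derivative_ident])
  then show ?thesis by (simp add: mder_def)
qed

lemma mder_const: "charted A \<Longrightarrow> mder A B (\<lambda>_. b) p (\<lambda>_. 0)"
  by (simp add: mder_def)

lemma mder_Pair:
  assumes "mder A B f p D" "mder A C g p E"
  shows "mder A (prod_charts B C) (\<lambda>x. (f x, g x)) p (\<lambda>v. (D v, E v))"
  using assms by (auto simp: mder_def intro!: has_derivative_Pair continuous_Pair)

lemma mder_cong:
  assumes "charted A" "mder A B f p D" "\<forall>\<^sub>F x in nhds p. f x = g x"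
  shows "mder A B g p D"
proof -
  interpret charted A by fact
  have "isCont (cinv A p) (cmap A p p)" by (rule isCont_cinv[OF mem_im])
  then have "filterlim (cinv A p) (nhds p) (nhds (cmap A p p))"
    using tendsto_at_iff_tendsto_nhds[of "cinv A p" "cmap A p p"] cinv_cmap[OF mem_dom] by (simp add: isCont_def)
  then have ev: "\<forall>\<^sub>F x in nhds (cmap A p p). f (cinv A p x) = g (cinv A p x)"
    using assms(3) by (rule eventually_compose_filterlim[rotated])
  have fg: "f p = g p" using assms(3) by (rule eventually_nhds_x_imp_x)
  have "((\<lambda>x. cmap B (f p) (g (cinv A p x))) has_derivative D) (at (cmap A p p))"
    by (rule has_derivative_cong_nhds[of "\<lambda>x. cmap B (f p) (f (cinv A p x))"])
      (use assms(2) ev in \<open>auto simp: mder_def elim: eventually_mono\<close>)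
  moreover have "isCont g p" using assms isCont_cong[OF assms(3)] by (simp add: mder_def)
  ultimately show ?thesis by (simp add: mder_def fg)
qed

section \<open>Lie groups\<close>

text \<open>The right logarithmic derivative c'(s) c(s)^(-1), an element of the Lie algebra.\<close>

definition dlog ::
  "('u::t2_space) monoid \<Rightarrow> ('u, 'ue::real_normed_vector) charts \<Rightarrow> (real \<Rightarrow> 'u) \<Rightarrow> real \<Rightarrow> 'ue \<Rightarrow> bool" where
  "dlog U A c s X \<longleftrightarrow> vel A (\<lambda>r. c r \<otimes>\<^bsub>U\<^esub> inv\<^bsub>U\<^esub> c s) s X"

context lie_group
begin

lemma mem_carrier [simp]: "x \<in> carrier U"
  by (simp add: carrier_UNIV)

lemma inv_mult: "inv (x \<otimes> y) = inv y \<otimes> inv x"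
  by (rule inv_mult_group) auto

lemma mult_inv_cancel [simp]: "x \<otimes> (inv x \<otimes> y) = y" "inv x \<otimes> (x \<otimes> y) = y"
  by (simp_all add: m_assoc[symmetric])

lemma charted_AA: "charted (prod_charts A A)"
  by (intro charted_prod charted)

lemma smooth_mult_maps:
  fixes D :: "('d::t2_space, 'de::real_normed_vector) charts"
  assumes "charted D" "open S" "smooth_map_on D A S f" "smooth_map_on D A S g"
  shows "smooth_map_on D A S (\<lambda>x. f x \<otimes> g x)"
proof -
  obtain B :: "'ue set" where B: "findim B" by (rule findim)
  obtain B2 :: "('ue \<times> 'ue) set" where B2: "findim B2" using findim_prod[OF B B] .
  have "smooth_map_on D A S (\<lambda>x. (\<lambda>(x, y). x \<otimes> y) (f x, g x))"
    by (rule smooth_map_on_compose[OF assms(1) charted_AA charted B2 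
          smooth_map_on_Pair[OF assms(1) charted charted assms(3,4,2)] smooth_mult assms(2)]) auto
  then show ?thesis by simp
qed

lemma smooth_inverse_maps:
  fixes D :: "('d::t2_space, 'de::real_normed_vector) charts"
  assumes "charted D" "open S" "smooth_map_on D A S f"
  shows "smooth_map_on D A S (\<lambda>x. inv (f x))"
proof -
  obtain B :: "'ue set" where B: "findim B" by (rule findim)
  show ?thesis
    by (rule smooth_map_on_compose[OF assms(1) charted charted B assms(3) smooth_inverse assms(2)]) auto
qed

lemma smooth_left: "smooth_map A A (\<lambda>x. g \<otimes> x)" and smooth_right: "smooth_map A A (\<lambda>x. x \<otimes> g)"
  by (intro smooth_mult_maps charted smooth_map_on_const smooth_map_id open_UNIV)+

lemma smooth_conj: "smooth_map A A (\<lambda>x. g \<otimes> x \<otimes> inv g)"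
  by (intro smooth_mult_maps charted smooth_map_on_const smooth_map_id open_UNIV)

lemma mder_left: "mder A A (\<lambda>x. g \<otimes> x) p (tmap A A (\<lambda>x. g \<otimes> x) p)"
  and mder_right: "mder A A (\<lambda>x. x \<otimes> g) p (tmap A A (\<lambda>x. x \<otimes> g) p)"
  by (rule smooth_map_on_mder[OF charted charted smooth_left] smooth_map_on_mder[OF charted charted smooth_right]; simp)+

lemma mder_Ad: "mder A A (\<lambda>x. g \<otimes> x \<otimes> inv g) \<one> (Ad U A g)"
  unfolding Ad_def by (rule smooth_map_on_mder[OF charted charted smooth_conj]) auto

lemma linear_Ad: "linear (Ad U A g)"
  by (rule mder_linear[OF mder_Ad])

text \<open>The derivative of multiplication at (1, 1) is addition: it is linear and restricts to
  the identity on each factor.\<close>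

lemma vel_mult_one:
  assumes "vel A c s v" "vel A d s w" "c s = \<one>" "d s = \<one>"
  shows "vel A (\<lambda>r. c r \<otimes> d r) s (v + w)"
proof -
  let ?m = "\<lambda>(x, y). x \<otimes> y"
  define D where "D = tmap (prod_charts A A) A ?m (\<one>, \<one>)"
  have D: "mder (prod_charts A A) A ?m (\<one>, \<one>) D"
    unfolding D_def by (rule smooth_map_on_mder[OF charted_AA charted smooth_mult]) auto
  have "mder A A (\<lambda>x. ?m (x, \<one>)) \<one> (\<lambda>v. D (v, 0))"
    by (rule mder_compose[OF charted charted_AA mder_Pair[OF mder_ident[OF charted] mder_const[OF charted]] D])
  then have 1: "D (v, 0) = v" for v using mder_unique[OF _ mder_ident[OF charted]] by (simp add: fun_eq_iff) metis
  have "mder A A (\<lambda>x. ?m (\<one>, x)) \<one> (\<lambda>v. D (0, v))"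
    by (rule mder_compose[OF charted charted_AA mder_Pair[OF mder_const[OF charted] mder_ident[OF charted]] D])
  then have 2: "D (0, v) = v" for v using mder_unique[OF _ mder_ident[OF charted]] by (simp add: fun_eq_iff) metis
  have "D (v, w) = v + w"
    using linear_add[OF mder_linear[OF D], of "(v, 0)" "(0, w)"] 1 2 by simp
  moreover have "vel A (\<lambda>r. ?m (c r, d r)) s (D (v, w))"
    by (rule vel_compose[OF charted_AA vel_Pair[OF assms(1,2)]]) (use D assms(3,4) in simp)
  ultimately show ?thesis by simp
qed

lemma vel_inverse_one:
  assumes "vel A c s v" "c s = \<one>"
  shows "vel A (\<lambda>r. inv (c r)) s (- v)"
proof -
  have "mder A A (\<lambda>x. inv x) (c s) (tmap A A (\<lambda>x. inv x) (c s))"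
    by (rule smooth_map_on_mder[OF charted charted smooth_inverse]) auto
  from vel_compose[OF charted assms(1) this] obtain w where w: "vel A (\<lambda>r. inv (c r)) s w" by blast
  have "vel A (\<lambda>r. c r \<otimes> inv (c r)) s (v + w)" by (rule vel_mult_one[OF assms(1) w]) (simp_all add: assms(2))
  then have "vel A (\<lambda>r. \<one>) s (v + w)" by simp
  then have "v + w = 0" using vel_const vel_unique by blast
  then have "w = - v" by (simp add: eq_neg_iff_add_eq_0 add.commute)
  then show ?thesis using w by simp
qed

lemma vel_conj:
  assumes "vel A c s v" "c s = \<one>"
  shows "vel A (\<lambda>r. g \<otimes> c r \<otimes> inv g) s (Ad U A g v)"
  by (rule vel_compose[OF charted assms(1)]) (simp add: assms(2) mder_Ad)

lemma Ad_one [simp]: "Ad U A \<one> v = v"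
  using mder_unique[OF mder_Ad[of "\<one>"], of "\<lambda>v. v"] mder_ident[OF charted] by simp

lemma Ad_mult: "Ad U A (g \<otimes> h) v = Ad U A g (Ad U A h v)"
proof -
  have "mder A A (\<lambda>x. g \<otimes> (h \<otimes> x \<otimes> inv h) \<otimes> inv g) \<one> (\<lambda>v. Ad U A g (Ad U A h v))"
    by (rule mder_compose[OF charted charted mder_Ad]) (simp add: mder_Ad)
  moreover have "(\<lambda>x. g \<otimes> (h \<otimes> x \<otimes> inv h) \<otimes> inv g) = (\<lambda>x. (g \<otimes> h) \<otimes> x \<otimes> inv (g \<otimes> h))"
    by (simp add: inv_mult m_assoc)
  ultimately show ?thesis using mder_unique[OF mder_Ad[of "g \<otimes> h"]] by (metis (no_types, lifting))
qed

lemma Ad_inv_cancel [simp]: "Ad U A (inv g) (Ad U A g v) = v" "Ad U A g (Ad U A (inv g) v) = v"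
  by (simp_all add: Ad_mult[symmetric])

text \<open>Write c(r) d(r) d(s)^(-1) c(s)^(-1) as c(r) c(s)^(-1) times the conjugate of d(r)
  d(s)^(-1) by c(s); both factors are 1 at r = s.\<close>

lemma dlog_mult:
  assumes "dlog U A c s X" "dlog U A d s Y"
  shows "dlog U A (\<lambda>r. c r \<otimes> d r) s (X + Ad U A (c s) Y)"
proof -
  have "vel A (\<lambda>r. (c r \<otimes> inv (c s)) \<otimes> (c s \<otimes> (d r \<otimes> inv (d s)) \<otimes> inv (c s))) s (X + Ad U A (c s) Y)"
    by (rule vel_mult_one[OF assms(1)[unfolded dlog_def] vel_conj[OF assms(2)[unfolded dlog_def]]]) (simp_all add: m_assoc)
  then show ?thesis by (simp add: dlog_def inv_mult m_assoc)
qed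

lemma dlog_const: "dlog U A (\<lambda>_. g) s 0"
  by (simp add: dlog_def vel_const)

lemma dlog_inverse:
  assumes "dlog U A c s X"
  shows "dlog U A (\<lambda>r. inv (c r)) s (- Ad U A (inv (c s)) X)"
proof -
  have "vel A (\<lambda>r. inv (c s) \<otimes> inv (c r \<otimes> inv (c s)) \<otimes> inv (inv (c s))) s (Ad U A (inv (c s)) (- X))"
    by (rule vel_conj[OF vel_inverse_one[OF assms[unfolded dlog_def]]]) simp_all
  then show ?thesis by (simp add: dlog_def inv_mult m_assoc linear_neg[OF linear_Ad])
qed

lemma dlog_left: "dlog U A c s X \<Longrightarrow> dlog U A (\<lambda>r. g \<otimes> c r) s (Ad U A g X)"
  using dlog_mult[OF dlog_const, of c s X g] by simp

lemma dlog_right: "dlog U A c s X \<Longrightarrow> dlog U A (\<lambda>r. c r \<otimes> g) s X"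
  using dlog_mult[OF _ dlog_const, of c s X g] linear_0[OF linear_Ad] by simp

lemma dlog_unique: "dlog U A c s X \<Longrightarrow> dlog U A c s Y \<Longrightarrow> X = Y"
  unfolding dlog_def by (rule vel_unique)

lemma dlog_cong:
  assumes "\<forall>\<^sub>F r in nhds s. c r = d r" "dlog U A c s X"
  shows "dlog U A d s X"
  unfolding dlog_def
proof (rule vel_cong)
  have "c s = d s" using assms(1) by (rule eventually_nhds_x_imp_x)
  with assms(1) show "\<forall>\<^sub>F r in nhds s. c r \<otimes> inv (c s) = d r \<otimes> inv (d s)" by (auto elim: eventually_mono)
qed (use assms(2) in \<open>simp add: dlog_def\<close>)

lemma dlog_vel: 
  assumes "dlog U A c s X"
  shows "vel A c s (tmap A A (\<lambda>x. x \<otimes> c s) \<one> X)"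
proof -
  have "vel A (\<lambda>r. (c r \<otimes> inv (c s)) \<otimes> c s) s (tmap A A (\<lambda>x. x \<otimes> c s) \<one> X)"
    by (rule vel_compose[OF charted assms[unfolded dlog_def]]) (simp add: mder_right)
  then show ?thesis by (simp add: m_assoc)
qed

lemma vel_dlog: 
  assumes "vel A c s v"
  shows "dlog U A c s (tmap A A (\<lambda>x. x \<otimes> inv (c s)) (c s) v)"
  unfolding dlog_def by (rule vel_compose[OF charted assms mder_right])

lemma dlog_one_vel: "c s = \<one> \<Longrightarrow> dlog U A c s X \<longleftrightarrow> vel A c s X"
  by (simp add: dlog_def)

lemma dlog_zero_constant:
  assumes "open I" "connected I" "\<And>s. s \<in> I \<Longrightarrow> dlog U A c s 0" "s \<in> I" "t \<in> I"
  shows "c s = c t"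
proof (rule vel_zero_constant[OF assms(1,2) _ assms(4,5)])
  fix s assume "s \<in> I"
  from dlog_vel[OF assms(3)[OF this]] show "vel A c s 0"
    using linear_0[OF mder_linear[OF mder_right]] by simp
qed

lemma dlog_shift: "dlog U A c (s + a) X \<Longrightarrow> dlog U A (\<lambda>r. c (r + a)) s X"
  unfolding dlog_def by (rule vel_shift)

lemma dlog_scale: "dlog U A c (k * s) X \<Longrightarrow> dlog U A (\<lambda>r. c (k * r)) s (k *\<^sub>R X)"
  unfolding dlog_def by (rule vel_scale)

subsection \<open>One-parameter subgroups\<close>

text \<open>The product rule gives c^(-1) d the logarithmic derivative - Ad(c^(-1)) X + Ad(c^(-1)) X
  = 0.\<close>

lemma dlog_solution_unique:
  assumes "open I" "connected I" "0 \<in> I" "s \<in> I" "\<And>s. s \<in> I \<Longrightarrow> dlog U A c s X" "\<And>s. s \<in> I \<Longrightarrow> dlog U A d s X"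
  shows "inv (c s) \<otimes> d s = inv (c 0) \<otimes> d 0"
proof (rule dlog_zero_constant[OF assms(1,2) _ assms(4,3)])
  fix s assume s: "s \<in> I"
  from dlog_mult[OF dlog_inverse[OF assms(5)[OF s]] assms(6)[OF s]]
  show "dlog U A (\<lambda>s. inv (c s) \<otimes> d s) s 0" by simp
qed

text \<open>As functions of s, both c(s + t) and c(s) have logarithmic derivative X, so c(s)^(-1)
  c(s + t) keeps its value c(t) at s = 0. The interval is shortened by |t| to keep the shifted
  arguments in the domain.\<close>

lemma dlog_local_hom:
  assumes c0: "c 0 = \<one>" and c: "\<And>s. s \<in> {-b<..<b} \<Longrightarrow> dlog U A c s X" and st: "\<bar>s\<bar> + \<bar>t\<bar> < b"
  shows "c (s + t) = c s \<otimes> c t"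
proof -
  define I where "I = {-(b - \<bar>t\<bar>)<..<b - \<bar>t\<bar>}"
  have "inv (c s) \<otimes> c (s + t) = inv (c 0) \<otimes> c (0 + t)"
    by (rule dlog_solution_unique[of I s c X "\<lambda>s. c (s + t)"])
      (use st in \<open>auto simp: I_def abs_if split: if_splits intro!: c dlog_shift\<close>)
  then have "c s \<otimes> (inv (c s) \<otimes> c (s + t)) = c s \<otimes> c t" by (simp add: c0)
  then show ?thesis by simp
qed

text \<open>Extends a one-parameter group to twice its interval by c(s/2)^2. The two halves add up
  to X because c(s/2) commutes with c(r) for small r, whence Ad(c(s/2)) X = X.\<close>

lemma dlog_double:
  assumes c0: "c 0 = \<one>" and c: "\<And>s. s \<in> {-b<..<b} \<Longrightarrow> dlog U A c s X" and s: "s \<in> {-(2*b)<..<2*b}"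
  shows "dlog U A (\<lambda>s. c (1/2 * s) \<otimes> c (1/2 * s)) s X"
proof -
  let ?h = "1/2 * s"
  have h: "?h \<in> {-b<..<b}" using s by auto
  have Ad: "Ad U A (c ?h) X = X"
  proof -
    have b: "b > 0" using s by auto
    define e where "e = b - \<bar>?h\<bar>"
    have e: "e > 0" using s by (auto simp: e_def)
    have "c ?h \<otimes> c r \<otimes> inv (c ?h) = c r" if r: "\<bar>r\<bar> < e" for r
    proof -
      have "c ?h \<otimes> c r = c r \<otimes> c ?h"
        using dlog_local_hom[OF c0 c, of b ?h r] dlog_local_hom[OF c0 c, of b r ?h] r by (simp add: e_def add.commute)
      then show ?thesis by (simp add: m_assoc)
    qed
    then have "\<forall>\<^sub>F r in nhds 0. c ?h \<otimes> c r \<otimes> inv (c ?h) = c r"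
      unfolding eventually_nhds_metric using e by (auto simp: dist_real_def)
    moreover have "vel A c 0 X" using c[of 0] b dlog_one_vel[of c 0 X] c0 by simp
    ultimately show ?thesis using vel_conj[OF \<open>vel A c 0 X\<close> c0] vel_cong vel_unique by metis
  qed
  have "dlog U A (\<lambda>s. c (1/2 * s)) s ((1/2) *\<^sub>R X)" by (rule dlog_scale[OF c[OF h]])
  from dlog_mult[OF this this] show ?thesis
    using Ad linear_cmul[OF linear_Ad] by (simp add: scaleR_add_left[symmetric])
qed

end

lemma mder_vel:
  assumes "mder vspace A c s D"
  shows "vel A c s (D 1)"
proof -
  have "D r = r *\<^sub>R D 1" for r
    using linear_cmul[OF mder_linear[OF assms], of r 1] by simp
  then have "D = (\<lambda>r. r *\<^sub>R D 1)" by (rule ext)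
  then show ?thesis using assms unfolding vel_mder by metis
qed

context lie_group
begin

text \<open>The solution of \<open>c' = X c\<close> near the identity, where the right-invariant vector field \<open>V\<close> is written in
  the chart with index \<open>\<one>\<close>.\<close>

lemma local_one_parameter:
  "\<exists>a>0. \<exists>\<gamma>. \<gamma> 0 = \<one> \<and> (\<forall>s\<in>{-a<..<a}. dlog U A \<gamma> s X) \<and> smooth_map_on vspace A {-a<..<a} \<gamma>"
proof -
  interpret cA: charted A by (rule charted)
  obtain B :: "'ue set" where B: "findim B" by (rule findim)
  obtain B2 :: "('ue \<times> 'ue) set" where B2: "findim B2" using findim_prod[OF B B] .
  define Im where "Im = cmap A \<one> ` cdom A \<one>"
  define e0 where "e0 = cmap A \<one> \<one>"
  let ?i = "cinv A \<one>"
  define pr where "pr = (\<lambda>z. ?i (fst z) \<otimes> ?i (snd z))"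
  have oIm: "open Im" unfolding Im_def by (rule cA.open_im)
  have e0: "e0 \<in> Im" "?i e0 = \<one>" by (simp_all add: e0_def Im_def cA.mem_im cA.cinv_cmap cA.mem_dom)
  have oI2: "open (Im \<times> Im)" by (intro open_Times oIm)
  have s1: "smooth_map_on vspace A (Im \<times> Im) (\<lambda>z. ?i (fst z))"
    by (rule smooth_map_on_compose[OF charted_vspace charted_vspace charted B _ smooth_cinv oI2 oIm[unfolded Im_def]])
      (auto simp: smooth_map_on_vspace bounded_linear_smooth_on bounded_linear_fst Im_def)
  have s2: "smooth_map_on vspace A (Im \<times> Im) (\<lambda>z. ?i (snd z))"
    by (rule smooth_map_on_compose[OF charted_vspace charted_vspace charted B _ smooth_cinv oI2 oIm[unfolded Im_def]])
      (auto simp: smooth_map_on_vspace bounded_linear_smooth_on bounded_linear_snd Im_def)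
  have spr: "smooth_map_on vspace A (Im \<times> Im) pr"
    unfolding pr_def by (rule smooth_mult_maps[OF charted_vspace oI2 s1 s2])
  define Om where "Om = (Im \<times> Im) \<inter> pr -` cdom A \<one>"
  have oO: "open Om" unfolding Om_def
    by (rule continuous_open_preimage[OF _ oI2 open_cdom]) (use spr in \<open>simp add: smooth_map_on_def\<close>)
  have "smooth_map_on vspace vspace Om (\<lambda>z. cmap A \<one> (pr z))"
    by (rule smooth_map_on_compose[OF charted_vspace charted charted_vspace B smooth_map_on_mono[OF spr] smooth_cmap oO open_cdom])
      (auto simp: Om_def)
  then have sm: "smooth_on Om (\<lambda>z. cmap A \<one> (pr z))" by (simp add: smooth_map_on_vspace)
  define V where "V = (\<lambda>x. frechet_derivative (\<lambda>z. cmap A \<one> (pr z)) (at (e0, x)) (X, 0))"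
  have inO: "(e0, x) \<in> Om" if "x \<in> Im" for x
    using that e0 cA.cinv_mem[of x \<one>] by (simp add: Om_def pr_def Im_def)
  have "smooth_on Im (\<lambda>x. (e0, x))" by (intro smooth_on_Pair oIm smooth_on_const smooth_on_id)
  then have sV: "smooth_on Im V" unfolding V_def
    by (intro findim.smooth_on_compose[OF B2 oIm oO, of "\<lambda>x. (e0, x)" "\<lambda>z. frechet_derivative (\<lambda>z. cmap A \<one> (pr z)) (at z) (X, 0)"])
      (use inO smooth_on_derivative[OF sm] in auto)
  obtain a c where ac: "a > 0" "c 0 = e0" "\<And>t. t \<in> {-a<..<a} \<Longrightarrow> c t \<in> Im \<and> (c has_vector_derivative V (c t)) (at t)"
    using findim.local_solution[OF B sV oIm e0(1)] by blast
  let ?I = "{-a<..<a}"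
  \<comment> \<open>Bootstrap: the derivative of c is V o c, hence as regular as c itself.\<close>
  have ck: "Ck_on n c ?I" for n
  proof (induction n)
    case 0
    have "isCont c t" if "t \<in> ?I" for t using ac(3)[OF that] has_vector_derivative_continuous by blast
    then show ?case by (simp add: continuous_at_imp_continuous_on)
  next
    case (Suc n)
    have "Ck_on n (\<lambda>t. V (c t)) ?I"
      by (rule findim.Ck_on_compose[OF B _ oIm _ Suc smooth_on_Ck[OF sV]]) (use ac(3) in auto)
    then have 1: "Ck_on n (\<lambda>t. v *\<^sub>R V (c t)) ?I" for v
      by (intro Ck_on_bounded_linear[OF bounded_linear_scaleR_right]) auto
    have 2: "frechet_derivative c (at t) v = v *\<^sub>R V (c t)" if "t \<in> ?I" for t v
      using frechet_derivative_at[of c "\<lambda>v. v *\<^sub>R V (c t)" t] ac(3)[OF that] by (simp add: has_vector_derivative_def fun_eq_iff)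
    have "Ck_on n (\<lambda>t. frechet_derivative c (at t) v) ?I" for v
      using 1[of v] Ck_on_cong[of ?I "\<lambda>t. frechet_derivative c (at t) v" "\<lambda>t. v *\<^sub>R V (c t)"] 2 by auto
    moreover have "c differentiable (at t)" if "t \<in> ?I" for t
      using ac(3)[OF that] by (auto simp: has_vector_derivative_def differentiable_def)
    ultimately show ?case by simp
  qed
  define \<gamma> where "\<gamma> = (\<lambda>t. ?i (c t))"
  have s\<gamma>: "smooth_map_on vspace A ?I \<gamma>" unfolding \<gamma>_def
    by (rule smooth_map_on_compose[OF charted_vspace charted_vspace charted B _ smooth_cinv _ oIm[unfolded Im_def]])
      (use ck ac(3) in \<open>auto simp: smooth_map_on_vspace smooth_on_def Im_def\<close>)
  have "dlog U A \<gamma> s X" if s: "s \<in> ?I" for s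
  proof -
    define x where "x = c s"
    have x: "x \<in> Im" "(c has_vector_derivative V x) (at s)" using ac(3)[OF s] by (auto simp: x_def)
    define g where "g = \<gamma> s"
    have g: "g \<in> cdom A \<one>" "cmap A \<one> g = x"
      using x(1) cA.cinv_mem[of x \<one>] cA.cmap_cinv[of x \<one>] by (auto simp: g_def \<gamma>_def x_def Im_def)
    have "mder vspace A \<gamma> s (tmap vspace A \<gamma> s)"
      by (rule smooth_map_on_mder[OF charted_vspace charted s\<gamma> _ s]) auto
    then have "vel A \<gamma> s (tmap vspace A \<gamma> s 1)" by (rule mder_vel)
    from vel_dlog[OF this] obtain Y where Y: "dlog U A \<gamma> s Y" by blast
    text \<open>Both \<open>X\<close> and \<open>Y\<close> are mapped to \<open>c'(s)\<close> by the injective derivative \<open>D\<close> of right translation.\<close>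
    let ?R = "\<lambda>h. cmap A \<one> (h \<otimes> g)"
    define D where "D = (\<lambda>v. frechet_derivative (\<lambda>z. cmap A \<one> (pr z)) (at (e0, x)) (v, 0))"
    have ig: "?i x = g" using cA.cinv_cmap[OF g(1)] g(2) by simp
    have D: "mder A vspace ?R \<one> D"
      unfolding mder_def
    proof
      have "isCont (\<lambda>h. h \<otimes> g) \<one>" using mder_right by (auto simp: mder_def)
      moreover have "isCont (cmap A \<one>) (\<one> \<otimes> g)" using cA.isCont_cmap[OF g(1)] by simp
      ultimately show "isCont ?R \<one>" by (rule isCont_compose)
      have "((\<lambda>y. (y, x)) has_derivative (\<lambda>v. (v, 0))) (at e0)" by (auto intro!: derivative_eq_intros)
      from has_derivative_compose[OF this smooth_on_has_derivative[OF sm inO[OF x(1)]]]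
      have "((\<lambda>y. cmap A \<one> (?i y \<otimes> g)) has_derivative D) (at e0)" by (simp add: pr_def D_def ig)
      then show "((\<lambda>y. cmap vspace (?R \<one>) (?R (?i y))) has_derivative D) (at (cmap A \<one> \<one>))"
        by (simp add: e0_def)
    qed
    \<comment> \<open>\<open>?Q\<close> recovers h from the coordinates of h g; its derivative
      \<open>E\<close> is a left inverse of \<open>D\<close>.\<close>
    let ?Q = "\<lambda>w. ?i w \<otimes> inv g"
    have "smooth_map_on vspace A Im ?Q"
      by (intro smooth_mult_maps charted_vspace oIm smooth_map_on_const) (use smooth_cinv in \<open>simp add: Im_def\<close>)
    from smooth_map_on_mder[OF charted_vspace charted this oIm x(1)]
    obtain E where E: "mder vspace A ?Q x E" by blast
    have "mder A A (\<lambda>h. ?Q (?R h)) \<one> (\<lambda>v. E (D v))"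
      by (rule mder_compose[OF charted charted_vspace D]) (use E g(2) in simp)
    moreover have "\<forall>\<^sub>F h in nhds \<one>. ?Q (?R h) = h"
    proof -
      have "\<forall>\<^sub>F h in nhds \<one>. h \<otimes> g \<in> cdom A \<one>"
        by (rule isCont_eventually_mem[OF _ open_cdom]) (use mder_right g(1) in \<open>auto simp: mder_def\<close>)
      then show ?thesis by (rule eventually_mono) (simp add: cA.cinv_cmap m_assoc)
    qed
    ultimately have "mder A A (\<lambda>h. h) \<one> (\<lambda>v. E (D v))" by (rule mder_cong[OF charted])
    from mder_unique[OF this mder_ident[OF charted]] have ED: "E (D v) = v" for v by meson
    have "vel vspace (\<lambda>r. ?R (\<gamma> r \<otimes> inv (\<gamma> s))) s (D Y)"
      by (rule vel_compose[OF charted Y[unfolded dlog_def]]) (use D in simp)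
    moreover have "\<forall>\<^sub>F r in nhds s. ?R (\<gamma> r \<otimes> inv (\<gamma> s)) = c r"
    proof -
      have "\<forall>\<^sub>F r in nhds s. r \<in> ?I" using s by (intro eventually_nhds_in_open) auto
      then show ?thesis
        by (rule eventually_mono) (use ac(3) in \<open>auto simp: g_def m_assoc \<gamma>_def cA.cmap_cinv Im_def\<close>)
    qed
    ultimately have "vel vspace c s (D Y)" by (rule vel_cong[rotated])
    then have "D Y = V x" using x(2) vector_derivative_unique_at by (auto simp: vel_vspace)
    then have "D Y = D X" by (simp add: V_def D_def)
    then have "Y = X" using ED by metis
    then show ?thesis using Y by simp
  qed
  moreover have "\<gamma> 0 = \<one>" by (simp add: \<gamma>_def ac(2) e0)
  ultimately show ?thesis using ac(1) s\<gamma> by blast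
qed

text \<open>The local solution is doubled repeatedly, to the intervals of radius 2^n a, and the
  solutions agree on overlaps by uniqueness.\<close>

lemma one_parameter_exists:
  "\<exists>\<gamma>. \<gamma> 0 = \<one> \<and> (\<forall>s. dlog U A \<gamma> s X) \<and> smooth_map vspace A \<gamma>"
proof -
  obtain a \<gamma> where a: "a > 0" "\<gamma> 0 = \<one>" "\<And>s. s \<in> {-a<..<a} \<Longrightarrow> dlog U A \<gamma> s X" "smooth_map_on vspace A {-a<..<a} \<gamma>"
    using local_one_parameter[of X] by blast
  define b where "b = (\<lambda>n. 2 ^ n * a)"
  have b: "b n > 0" "b (Suc n) = 2 * b n" for n using a(1) by (simp_all add: b_def)
  have "\<exists>g. g 0 = \<one> \<and> (\<forall>s\<in>{-b n<..<b n}. dlog U A g s X)" for n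
  proof (induction n)
    case 0 then show ?case using a by (auto simp: b_def)
  next
    case (Suc n)
    then obtain g where g: "g 0 = \<one>" "\<And>s. s \<in> {-b n<..<b n} \<Longrightarrow> dlog U A g s X" by blast
    show ?case using dlog_double[OF g] g(1) by (intro exI[of _ "\<lambda>s. g (1/2 * s) \<otimes> g (1/2 * s)"]) (auto simp: b)
  qed
  then obtain g where g: "\<And>n. g n 0 = \<one>" "\<And>n s. s \<in> {-b n<..<b n} \<Longrightarrow> dlog U A (g n) s X" by metis
  have agree: "d s = e s" if "d 0 = \<one>" "e 0 = \<one>" "s \<in> {-r<..<r}" "\<And>s. s \<in> {-r<..<r} \<Longrightarrow> dlog U A d s X" "\<And>s. s \<in> {-r<..<r} \<Longrightarrow> dlog U A e s X" for d e s r
  proof -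
    have "inv (d s) \<otimes> e s = inv (d 0) \<otimes> e 0"
      by (rule dlog_solution_unique[of "{-r<..<r}" s d X e]) (use that in auto)
    then have "d s \<otimes> (inv (d s) \<otimes> e s) = d s \<otimes> \<one>" by (simp add: that)
    then show ?thesis by simp
  qed
  have exn: "\<exists>n. \<bar>s\<bar> < b n" for s
  proof -
    obtain n :: nat where "\<bar>s\<bar> / a < n" using reals_Archimedean2 by blast
    also have "real n < 2 ^ n" by (rule of_nat_less_two_power)
    finally show ?thesis using a(1) by (auto simp: b_def pos_divide_less_eq)
  qed
  define \<Gamma> where "\<Gamma> = (\<lambda>s. g (SOME n. \<bar>s\<bar> < b n) s)"
  have \<Gamma>: "\<Gamma> s = g n s" if "\<bar>s\<bar> < b n" for s n
  proof -
    define k where "k = (SOME n. \<bar>s\<bar> < b n)"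
    have k: "\<bar>s\<bar> < b k" unfolding k_def using exn by (rule someI_ex)
    have "g k s = g n s"
      by (rule agree[of _ _ _ "min (b k) (b n)"]) (use g k that in \<open>auto simp: abs_less_iff\<close>)
    then show ?thesis by (simp add: \<Gamma>_def k_def)
  qed
  have \<Gamma>d: "dlog U A \<Gamma> s X" for s
  proof -
    obtain n where n: "\<bar>s\<bar> < b n" using exn by blast
    have "\<forall>\<^sub>F r in nhds s. r \<in> {-b n<..<b n}" using n by (intro eventually_nhds_in_open) auto
    then have "\<forall>\<^sub>F r in nhds s. g n r = \<Gamma> r" by (rule eventually_mono) (simp add: \<Gamma>[symmetric] abs_less_iff)
    then show ?thesis by (rule dlog_cong) (use g(2) n in \<open>auto simp: abs_less_iff\<close>)
  qed
  have \<Gamma>0: "\<Gamma> 0 = \<one>" using \<Gamma>[of 0 0] b g by simp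
  have add: "\<Gamma> (s + t) = \<Gamma> s \<otimes> \<Gamma> t" for s t
    by (rule dlog_local_hom[where b = "\<bar>s\<bar> + \<bar>t\<bar> + 1" and X = X]) (use \<Gamma>0 \<Gamma>d in auto)
  have loc: "smooth_map_on vspace A {-a<..<a} \<Gamma>"
    by (rule smooth_map_on_cong[OF charted_vspace charted _ a(4)]) (use agree[of \<gamma> \<Gamma>] a \<Gamma>0 \<Gamma>d in auto)
  \<comment> \<open>By the homomorphism property \<Gamma>(r) = \<Gamma>(s) \<Gamma>(r - s), which
    reduces smoothness near s to smoothness near 0.\<close>
  have "smooth_map vspace A \<Gamma>"
  proof (rule smooth_map_on_local[OF _ charted_vspace charted])
    fix s :: real
    let ?T = "{s - a<..<s + a}"
    have "smooth_on ?T (\<lambda>r. r + (- s))" by (intro smooth_on_add smooth_on_id smooth_on_const) auto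
    then have "smooth_map_on vspace A ?T (\<lambda>r. \<Gamma> (r + (- s)))"
      by (intro smooth_map_on_compose[OF charted_vspace charted_vspace charted findim_real _ loc])
        (auto simp: smooth_map_on_vspace)
    then have "smooth_map_on vspace A ?T (\<lambda>r. \<Gamma> s \<otimes> \<Gamma> (r + (- s)))"
      by (intro smooth_mult_maps charted_vspace smooth_map_on_const) auto
    then have "smooth_map_on vspace A ?T \<Gamma>"
      using add[of s "r - s" for r] by (simp add: add[symmetric])
    then show "\<exists>T. open T \<and> s \<in> T \<and> smooth_map_on vspace A T \<Gamma>" using a(1) by (intro exI[of _ ?T]) auto
  qed
  then show ?thesis using \<Gamma>0 \<Gamma>d by blast
qed

lemma one_parameter_unique:
  assumes "\<gamma> 0 = \<one>" "\<And>s. dlog U A \<gamma> s X" "\<And>s. dlog U A c s X"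
  shows "c s = \<gamma> s \<otimes> c 0"
proof -
  have "inv (\<gamma> s) \<otimes> c s = inv (\<gamma> 0) \<otimes> c 0"
    by (rule dlog_solution_unique[of UNIV s \<gamma> X c]) (use assms in auto)
  then have "\<gamma> s \<otimes> (inv (\<gamma> s) \<otimes> c s) = \<gamma> s \<otimes> c 0" by (simp add: assms(1))
  then show ?thesis by simp
qed

lemma hom_dlog:
  assumes "\<And>s t. \<gamma> (s + t) = \<gamma> s \<otimes> \<gamma> t" "vel A \<gamma> 0 X"
  shows "\<gamma> 0 = \<one>" "dlog U A \<gamma> s X"
proof -
  show g0: "\<gamma> 0 = \<one>" using assms(1)[of 0 0] by (metis add_0 mult_inv_cancel(2) mem_carrier r_inv l_inv)
  have "vel A (\<lambda>r. \<gamma> (r + (- s))) s X" by (rule vel_shift) (simp add: assms(2))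
  moreover have "\<gamma> (r + (- s)) = \<gamma> r \<otimes> inv (\<gamma> s)" for r
  proof -
    have "\<gamma> (r + (- s)) \<otimes> \<gamma> s = \<gamma> r" by (simp add: assms(1)[symmetric])
    then show ?thesis by (metis m_assoc mem_carrier r_inv r_one)
  qed
  ultimately show "dlog U A \<gamma> s X" by (simp add: dlog_def)
qed

text \<open>Discharges the definite description in \<open>lie_exp\<close>: a smooth homomorphism
  with velocity X satisfies the logarithmic differential equation, whose solution is unique.\<close>

lemma lie_exp_eq:
  assumes "\<gamma> 0 = \<one>" "\<And>s. dlog U A \<gamma> s X"
  shows "lie_exp U A X = \<gamma> 1"
proof -
  obtain \<delta> where \<delta>: "\<delta> 0 = \<one>" "\<And>s. dlog U A \<delta> s X" "smooth_map vspace A \<delta>" using one_parameter_exists[of X] by blast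
  have \<delta>add: "\<delta> (s + t) = \<delta> s \<otimes> \<delta> t" for s t
    by (rule dlog_local_hom[where b = "\<bar>s\<bar> + \<bar>t\<bar> + 1" and X = X]) (use \<delta> in auto)
  have eq: "\<gamma>' s = \<delta> s" if "\<gamma>' 0 = \<one>" "\<And>s. dlog U A \<gamma>' s X" for \<gamma>' s
    using one_parameter_unique[of \<delta> X \<gamma>' s] \<delta> that by simp
  have \<delta>v: "velocity A \<delta> = X" by (rule vel_velocity) (use \<delta> dlog_one_vel[of \<delta> 0 X] in auto)
  show ?thesis unfolding lie_exp_def
  proof (rule the_equality)
    show "\<exists>\<gamma>'. smooth_map vspace A \<gamma>' \<and> (\<forall>s t. \<gamma>' (s + t) = \<gamma>' s \<otimes> \<gamma>' t) \<and> velocity A \<gamma>' = X \<and> \<gamma> 1 = \<gamma>' 1"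
      using \<delta> \<delta>add \<delta>v eq[OF assms] by blast
    fix g assume "\<exists>\<gamma>'. smooth_map vspace A \<gamma>' \<and> (\<forall>s t. \<gamma>' (s + t) = \<gamma>' s \<otimes> \<gamma>' t) \<and> velocity A \<gamma>' = X \<and> g = \<gamma>' 1"
    then obtain \<gamma>' where g': "smooth_map vspace A \<gamma>'" "\<And>s t. \<gamma>' (s + t) = \<gamma>' s \<otimes> \<gamma>' t" "velocity A \<gamma>' = X" "g = \<gamma>' 1" by blast
    have "mder vspace A \<gamma>' 0 (tmap vspace A \<gamma>' 0)"
      by (rule smooth_map_on_mder[OF charted_vspace charted g'(1)]) auto
    then have "vel A \<gamma>' 0 (tmap vspace A \<gamma>' 0 1)" by (rule mder_vel)
    then have "vel A \<gamma>' 0 X" using g'(3) by (simp add: velocity_def)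
    from hom_dlog[OF g'(2) this] show "g = \<gamma> 1" using eq[of \<gamma>'] eq[OF assms] g'(4) by metis
  qed
qed

definition ex :: "'ue \<Rightarrow> real \<Rightarrow> 'u" where
  "ex X t = lie_exp U A (t *\<^sub>R X)"

lemma ex_unique_at:
  assumes "\<gamma> 0 = \<one>" "\<And>s. dlog U A \<gamma> s X"
  shows "ex X t = \<gamma> t"
proof -
  have "lie_exp U A (t *\<^sub>R X) = \<gamma> (t * 1)"
    by (rule lie_exp_eq[of "\<lambda>s. \<gamma> (t * s)"]) (use assms in \<open>auto intro!: dlog_scale\<close>)
  then show ?thesis by (simp add: ex_def)
qed

lemma ex_zero [simp]: "ex X 0 = \<one>"
  and dlog_ex: "dlog U A (ex X) s X"
  and smooth_ex: "smooth_map vspace A (ex X)"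
proof -
  obtain \<delta> where \<delta>: "\<delta> 0 = \<one>" "\<And>s. dlog U A \<delta> s X" "smooth_map vspace A \<delta>" using one_parameter_exists[of X] by blast
  then have "ex X = \<delta>" using ex_unique_at by blast
  then show "ex X 0 = \<one>" "dlog U A (ex X) s X" "smooth_map vspace A (ex X)" using \<delta> by simp_all
qed

lemma ex_add: "ex X (s + t) = ex X s \<otimes> ex X t"
  by (rule dlog_local_hom[where b = "\<bar>s\<bar> + \<bar>t\<bar> + 1" and X = X]) (auto simp: dlog_ex)

lemma ex_minus: "ex X (- s) = inv (ex X s)"
proof -
  have "ex X s \<otimes> ex X (- s) = \<one>" by (simp add: ex_add[symmetric])
  then show ?thesis by (metis mult_inv_cancel(2) mem_carrier r_one)
qed

lemma ex_scale: "ex (k *\<^sub>R X) t = ex X (t * k)"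
  by (simp add: ex_def)

lemma lie_exp_ex: "lie_exp U A X = ex X 1"
  by (simp add: ex_def)

lemma flow_unique: "(\<And>s. dlog U A c s X) \<Longrightarrow> c s = ex X s \<otimes> c 0"
  by (rule one_parameter_unique[OF ex_zero dlog_ex])

lemma vel_ex: "vel A (ex X) 0 X"
  using dlog_ex[of X 0] dlog_one_vel[of "ex X" 0 X] by simp

lemma dlog_ex_left: "dlog U A (\<lambda>s. ex X s \<otimes> g) s X"
  by (rule dlog_right[OF dlog_ex])

lemma Ad_ex_self: "Ad U A (ex X s) X = X"
proof -
  have "vel A (\<lambda>r. ex X s \<otimes> ex X r \<otimes> inv (ex X s)) 0 (Ad U A (ex X s) X)"
    by (rule vel_conj[OF vel_ex ex_zero])
  moreover have "ex X s \<otimes> ex X r \<otimes> inv (ex X s) = ex X r" for r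
    by (simp add: ex_minus[symmetric] ex_add[symmetric])
  ultimately show ?thesis using vel_unique[OF vel_ex, of X "Ad U A (ex X s) X"] by simp
qed

end

context lie_group
begin

subsection \<open>The adjoint representation and the bracket\<close>

text \<open>In charts, Ad g v is the partial derivative at x = 1 of the jointly smooth map (g, x) ->
  g x g^(-1), hence smooth in the remaining variable g.\<close>

lemma smooth_Ad: "smooth_map A vspace (\<lambda>g. Ad U A g v)"
proof (rule smooth_map_on_local[OF _ charted charted_vspace])
  interpret cA: charted A by (rule charted)
  fix g0 :: 'u
  obtain B :: "'ue set" where B: "findim B" by (rule findim)
  obtain B2 :: "('ue \<times> 'ue) set" where B2: "findim B2" using findim_prod[OF B B] .
  define Im where "Im = cmap A \<one> ` cdom A \<one>"
  define I0 where "I0 = cmap A g0 ` cdom A g0"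
  define e0 where "e0 = cmap A \<one> \<one>"
  define pr where "pr = (\<lambda>z. cinv A g0 (fst z) \<otimes> cinv A \<one> (snd z) \<otimes> inv (cinv A g0 (fst z)))"
  have o: "open Im" "open I0" unfolding Im_def I0_def by (rule cA.open_im)+
  have e0: "e0 \<in> Im" "cinv A \<one> e0 = \<one>" by (simp_all add: e0_def Im_def cA.mem_im cA.cinv_cmap cA.mem_dom)
  have oI2: "open (I0 \<times> Im)" by (intro open_Times o)
  have s1: "smooth_map_on vspace A (I0 \<times> Im) (\<lambda>z. cinv A g0 (fst z))"
    by (rule smooth_map_on_compose[OF charted_vspace charted_vspace charted B _ smooth_cinv oI2 o(2)[unfolded I0_def]])
      (auto simp: smooth_map_on_vspace bounded_linear_smooth_on bounded_linear_fst I0_def)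
  have s2: "smooth_map_on vspace A (I0 \<times> Im) (\<lambda>z. cinv A \<one> (snd z))"
    by (rule smooth_map_on_compose[OF charted_vspace charted_vspace charted B _ smooth_cinv oI2 o(1)[unfolded Im_def]])
      (auto simp: smooth_map_on_vspace bounded_linear_smooth_on bounded_linear_snd Im_def)
  have spr: "smooth_map_on vspace A (I0 \<times> Im) pr"
    unfolding pr_def by (intro smooth_mult_maps smooth_inverse_maps charted_vspace oI2 s1 s2)
  define Om where "Om = (I0 \<times> Im) \<inter> pr -` cdom A \<one>"
  have oO: "open Om" unfolding Om_def
    by (rule continuous_open_preimage[OF _ oI2 open_cdom]) (use spr in \<open>simp add: smooth_map_on_def\<close>)
  have "smooth_map_on vspace vspace Om (\<lambda>z. cmap A \<one> (pr z))"
    by (rule smooth_map_on_compose[OF charted_vspace charted charted_vspace B smooth_map_on_mono[OF spr] smooth_cmap oO open_cdom])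
      (auto simp: Om_def)
  then have sm: "smooth_on Om (\<lambda>z. cmap A \<one> (pr z))" by (simp add: smooth_map_on_vspace)
  have inO: "(x, e0) \<in> Om" if "x \<in> I0" for x
    using that e0 mem_cdom by (simp add: Om_def pr_def)
  have "smooth_on I0 (\<lambda>x. (x, e0))" by (intro smooth_on_Pair o smooth_on_const smooth_on_id)
  then have "smooth_on I0 (\<lambda>x. frechet_derivative (\<lambda>z. cmap A \<one> (pr z)) (at (x, e0)) (0, v))"
    by (intro findim.smooth_on_compose[OF B2 o(2) oO, of "\<lambda>x. (x, e0)" "\<lambda>z. frechet_derivative (\<lambda>z. cmap A \<one> (pr z)) (at z) (0, v)"])
      (use inO smooth_on_derivative[OF sm] in auto)
  moreover have "frechet_derivative (\<lambda>z. cmap A \<one> (pr z)) (at (x, e0)) (0, v) = Ad U A (cinv A g0 x) v" if x: "x \<in> I0" for x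
  proof -
    have "((\<lambda>y. (x, y)) has_derivative (\<lambda>v. (0, v))) (at e0)" by (auto intro!: derivative_eq_intros)
    from has_derivative_compose[OF this smooth_on_has_derivative[OF sm inO[OF x]]]
    have "((\<lambda>y. cmap A \<one> (pr (x, y))) has_derivative (\<lambda>v. frechet_derivative (\<lambda>z. cmap A \<one> (pr z)) (at (x, e0)) (0, v))) (at e0)" .
    moreover have "((\<lambda>y. cmap A \<one> (pr (x, y))) has_derivative Ad U A (cinv A g0 x)) (at e0)"
      using mder_Ad[of "cinv A g0 x"] by (simp add: mder_def pr_def e0_def)
    ultimately have "(\<lambda>v. frechet_derivative (\<lambda>z. cmap A \<one> (pr z)) (at (x, e0)) (0, v)) = Ad U A (cinv A g0 x)"
      by (rule has_derivative_unique)
    from fun_cong[OF this, of v] show ?thesis .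
  qed
  ultimately have "smooth_on I0 (\<lambda>x. Ad U A (cinv A g0 x) v)" using smooth_on_cong[OF o(2)] by (metis (no_types, lifting))
  then have "smooth_map_on A vspace (cdom A g0) (\<lambda>g. Ad U A (cinv A g0 (cmap A g0 g)) v)"
    by (intro smooth_map_on_compose[OF charted charted_vspace charted_vspace B smooth_cmap _ open_cdom o(2)])
      (auto simp: smooth_map_on_vspace I0_def)
  then have "smooth_map_on A vspace (cdom A g0) (\<lambda>g. Ad U A g v)"
    by (rule smooth_map_on_cong[OF charted charted_vspace open_cdom]) (simp add: cA.cinv_cmap)
  then show "\<exists>T. open T \<and> g0 \<in> T \<and> smooth_map_on A vspace T (\<lambda>g. Ad U A g v)"
    using open_cdom mem_cdom by blast
qed

lemma continuous_Ad: "continuous_on S (\<lambda>g. Ad U A g v)"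
  using smooth_Ad[of v] continuous_on_subset by (auto simp: smooth_map_on_def)

text \<open>The bracket is defined by a derivative along a single curve; smoothness of Ad identifies
  it with the total derivative at 1, which gives linearity in the first argument.\<close>

lemma mder_Ad_bracket: "mder A vspace (\<lambda>g. Ad U A g Y) \<one> (\<lambda>X. bracket U A X Y)"
proof -
  have D: "mder A vspace (\<lambda>g. Ad U A g Y) \<one> (tmap A vspace (\<lambda>g. Ad U A g Y) \<one>)"
    by (rule smooth_map_on_mder[OF charted charted_vspace smooth_Ad]) auto
  have "bracket U A X Y = tmap A vspace (\<lambda>g. Ad U A g Y) \<one> X" for X
  proof -
    have "vel vspace (\<lambda>t. Ad U A (ex X t) Y) 0 (tmap A vspace (\<lambda>g. Ad U A g Y) \<one> X)"
      by (rule vel_compose[OF charted vel_ex]) (use D in simp)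
    then show ?thesis by (simp add: bracket_def ex_def[symmetric] vel_vspace vector_derivative_at)
  qed
  then show ?thesis using D by (simp add: fun_eq_iff)
qed

lemma Ad_derivative:
  assumes "dlog U A c s X"
  shows "((\<lambda>r. Ad U A (c r) Y) has_vector_derivative bracket U A X (Ad U A (c s) Y)) (at s)"
proof -
  have "vel vspace (\<lambda>r. Ad U A (c r \<otimes> inv (c s)) (Ad U A (c s) Y)) s (bracket U A X (Ad U A (c s) Y))"
    by (rule vel_compose[OF charted assms[unfolded dlog_def]]) (simp add: mder_Ad_bracket)
  then show ?thesis by (simp add: vel_vspace Ad_mult)
qed

lemma linear_bracket_left: "linear (\<lambda>X. bracket U A X Y)"
  by (rule mder_linear[OF mder_Ad_bracket])

lemma bracket_derivative: "((\<lambda>t. Ad U A (ex X t) Y) has_vector_derivative bracket U A X Y) (at 0)"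
  using Ad_derivative[OF dlog_ex[of X 0], of Y] by simp

lemma linear_bracket_right: "linear (bracket U A X)"
proof (rule linearI)
  fix Y Z and k :: real
  have "((\<lambda>t. Ad U A (ex X t) Y + Ad U A (ex X t) Z) has_vector_derivative bracket U A X Y + bracket U A X Z) (at 0)"
    by (intro has_vector_derivative_add bracket_derivative)
  then show "bracket U A X (Y + Z) = bracket U A X Y + bracket U A X Z"
    using bracket_derivative[of X "Y + Z"] vector_derivative_unique_at by (fastforce simp: linear_add[OF linear_Ad])
  have "((\<lambda>t. k *\<^sub>R Ad U A (ex X t) Y) has_vector_derivative k *\<^sub>R bracket U A X Y) (at 0)"
    by (intro bounded_linear.has_vector_derivative[OF bounded_linear_scaleR_right] bracket_derivative)
  then show "bracket U A X (k *\<^sub>R Y) = k *\<^sub>R bracket U A X Y"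
    using bracket_derivative[of X "k *\<^sub>R Y"] vector_derivative_unique_at by (fastforce simp: linear_cmul[OF linear_Ad])
qed

lemmas bracket_simps =
  linear_add[OF linear_bracket_left] linear_diff[OF linear_bracket_left] linear_cmul[OF linear_bracket_left]
  linear_neg[OF linear_bracket_left] linear_0[OF linear_bracket_left]
  linear_add[OF linear_bracket_right] linear_diff[OF linear_bracket_right] linear_cmul[OF linear_bracket_right]
  linear_neg[OF linear_bracket_right] linear_0[OF linear_bracket_right]

lemma bracket_self: "bracket U A X X = 0"
  using bracket_derivative[of X X] vector_derivative_unique_at[of "\<lambda>t. X" 0 0]
  by (simp add: Ad_ex_self)

text \<open>The derivative of Ad is available for fixed vectors only, so the moving vector is
  expanded in a basis and the product rule is applied to its coordinates.\<close>

lemma Ad_vector_derivative: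
  assumes "dlog U A u s \<nu>" "(x has_vector_derivative v) (at s)"
  shows "((\<lambda>r. Ad U A (u r) (x r)) has_vector_derivative bracket U A \<nu> (Ad U A (u s) (x s)) + Ad U A (u s) v) (at s)"
proof -
  obtain B1 :: "'ue set" where B1: "findim B1" by (rule findim)
  interpret findim B1 by fact
  have eq: "Ad U A g y = (\<Sum>b\<in>B1. representation B1 y b *\<^sub>R Ad U A g b)" for g y
    by (rule linear_expand[OF linear_Ad])
  have r: "((\<lambda>r. representation B1 (x r) b) has_vector_derivative representation B1 v b) (at s)" for b
    using bounded_linear.has_vector_derivative[OF linear_bounded[OF linear_representation] assms(2)] .
  have "((\<lambda>r. \<Sum>b\<in>B1. representation B1 (x r) b *\<^sub>R Ad U A (u r) b) has_vector_derivative
    (\<Sum>b\<in>B1. representation B1 (x s) b *\<^sub>R bracket U A \<nu> (Ad U A (u s) b) + representation B1 v b *\<^sub>R Ad U A (u s) b)) (at s)"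
    by (intro has_vector_derivative_sum bounded_bilinear.has_vector_derivative[OF bounded_bilinear_scaleR] r Ad_derivative assms(1))
  moreover have "(\<Sum>b\<in>B1. representation B1 (x s) b *\<^sub>R bracket U A \<nu> (Ad U A (u s) b)) = bracket U A \<nu> (Ad U A (u s) (x s))"
    unfolding eq[of "u s" "x s"] by (simp add: linear_sum[OF linear_bracket_right] bracket_simps)
  ultimately show ?thesis unfolding eq[of _ "x _"] eq[of _ v] by (simp add: sum.distrib)
qed

lemma bracket_antisym: "bracket U A X Y = - bracket U A Y X"
proof -
  have "bracket U A X Y + bracket U A Y X = 0"
  proof -
    have "bracket U A (X + Y) (X + Y) = bracket U A X Y + bracket U A Y X"
      by (simp add: bracket_simps bracket_self[of X] bracket_self[of Y])
    then show ?thesis using bracket_self[of "X + Y"] by simp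
  qed
  then show ?thesis by (rule eq_neg_iff_add_eq_0[THEN iffD2])
qed

end

subsection \<open>Homomorphisms\<close>

locale lie_hom = G: lie_group G AG + H: lie_group H AH
  for G :: "'g::{t2_space, second_countable_topology} monoid" and AG :: "('g, 'ge::real_normed_vector) charts"
    and H :: "'h::{t2_space, second_countable_topology} monoid" and AH :: "('h, 'he::real_normed_vector) charts" +
  fixes \<phi> :: "'g \<Rightarrow> 'h"
  assumes hom: "\<phi> \<in> hom G H" and smooth: "smooth_map AG AH \<phi>"
begin

abbreviation d\<phi> :: "'ge \<Rightarrow> 'he" where
  "d\<phi> \<equiv> tmap AG AH \<phi> \<one>\<^bsub>G\<^esub>"

lemma mult: "\<phi> (x \<otimes>\<^bsub>G\<^esub> y) = \<phi> x \<otimes>\<^bsub>H\<^esub> \<phi> y"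
  by (rule hom_mult[OF hom]) auto

lemma one: "\<phi> \<one>\<^bsub>G\<^esub> = \<one>\<^bsub>H\<^esub>"
  by (rule hom_one[OF hom G.is_group H.is_group])

lemma inverse: "\<phi> (inv\<^bsub>G\<^esub> x) = inv\<^bsub>H\<^esub> \<phi> x"
proof -
  have "\<phi> (inv\<^bsub>G\<^esub> x) \<otimes>\<^bsub>H\<^esub> \<phi> x = \<one>\<^bsub>H\<^esub>" by (simp add: mult[symmetric] one)
  then show ?thesis by (simp add: H.inv_equality)
qed

lemma mder: "mder AG AH \<phi> p (tmap AG AH \<phi> p)"
  by (rule smooth_map_on_mder[OF G.charted H.charted smooth]) auto

lemma linear: "linear d\<phi>"
  by (rule mder_linear[OF mder])

lemma bounded_linear: "bounded_linear d\<phi>"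
  using G.findim findim.linear_bounded linear by metis

lemma dlog:
  assumes "dlog G AG c s X"
  shows "dlog H AH (\<lambda>r. \<phi> (c r)) s (d\<phi> X)"
proof -
  have "vel AH (\<lambda>r. \<phi> (c r \<otimes>\<^bsub>G\<^esub> inv\<^bsub>G\<^esub> c s)) s (d\<phi> X)"
    by (rule vel_compose[OF G.charted assms[unfolded dlog_def]]) (simp add: mder)
  then show ?thesis by (simp add: dlog_def mult inverse)
qed

lemma ex: "\<phi> (G.ex X t) = H.ex (d\<phi> X) t"
proof -
  have "\<And>s. dlog H AH (\<lambda>r. \<phi> (G.ex X r)) s (d\<phi> X)" by (rule dlog[OF G.dlog_ex])
  from H.flow_unique[OF this, of t] show ?thesis by (simp add: one)
qed

lemma Ad: "d\<phi> (Ad G AG g v) = Ad H AH (\<phi> g) (d\<phi> v)"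
proof -
  have "mder AG AH (\<lambda>x. \<phi> (g \<otimes>\<^bsub>G\<^esub> x \<otimes>\<^bsub>G\<^esub> inv\<^bsub>G\<^esub> g)) \<one>\<^bsub>G\<^esub> (\<lambda>v. d\<phi> (Ad G AG g v))"
    by (rule mder_compose[OF G.charted G.charted G.mder_Ad]) (simp add: mder)
  moreover have "mder AG AH (\<lambda>x. \<phi> g \<otimes>\<^bsub>H\<^esub> \<phi> x \<otimes>\<^bsub>H\<^esub> inv\<^bsub>H\<^esub> \<phi> g) \<one>\<^bsub>G\<^esub> (\<lambda>v. Ad H AH (\<phi> g) (d\<phi> v))"
    by (rule mder_compose[OF G.charted H.charted mder]) (simp add: one H.mder_Ad)
  ultimately have "(\<lambda>v. d\<phi> (Ad G AG g v)) = (\<lambda>v. Ad H AH (\<phi> g) (d\<phi> v))"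
    by (intro mder_unique) (simp_all add: mult inverse)
  then show ?thesis by meson
qed

lemma bracket: "d\<phi> (bracket G AG X Y) = bracket H AH (d\<phi> X) (d\<phi> Y)"
proof -
  have "((\<lambda>t. d\<phi> (Ad G AG (G.ex X t) Y)) has_vector_derivative d\<phi> (bracket G AG X Y)) (at 0)"
    by (intro bounded_linear.has_vector_derivative[OF bounded_linear] G.bracket_derivative)
  then have "((\<lambda>t. Ad H AH (H.ex (d\<phi> X) t) (d\<phi> Y)) has_vector_derivative d\<phi> (bracket G AG X Y)) (at 0)"
    by (simp add: Ad ex)
  then show ?thesis using H.bracket_derivative vector_derivative_unique_at by blast
qed

end

context lie_group
begin

lemma conj_lie_hom: "lie_hom U A U A (\<lambda>x. g \<otimes> x \<otimes> inv g)"
proof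
  show "(\<lambda>x. g \<otimes> x \<otimes> inv g) \<in> hom U U" by (rule homI) (simp_all add: m_assoc)
qed (rule smooth_conj)

lemma Ad_bracket: "Ad U A g (bracket U A X Y) = bracket U A (Ad U A g X) (Ad U A g Y)"
  using lie_hom.bracket[OF conj_lie_hom, of g X Y] unfolding Ad_def .

lemma Ad_ex: "g \<otimes> ex X t \<otimes> inv g = ex (Ad U A g X) t"
  using lie_hom.ex[OF conj_lie_hom, of g X t] unfolding Ad_def .

end

context complex_lie_group
begin

text \<open>Translations are slices of the holomorphic multiplication. Along (v, 0) and (0, v) the
  product structure acts as J, because J maps 0 to 0. The purpose is complex linearity of
  Ad.\<close>

lemma mult_J: "tmap A A (\<lambda>x. g \<otimes> x \<otimes> g') p (J p v) = J (g \<otimes> p \<otimes> g') (tmap A A (\<lambda>x. g \<otimes> x \<otimes> g') p v)"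
proof -
  let ?m = "\<lambda>(x, y). x \<otimes> y"
  have m: "mder (prod_charts A A) A ?m z (tmap (prod_charts A A) A ?m z)" for z
    by (rule smooth_map_on_mder[OF charted_AA charted smooth_mult]) auto
  have h: "tmap (prod_charts A A) A ?m (x, y) (J x v, J y w) = J (x \<otimes> y) (tmap (prod_charts A A) A ?m (x, y) (v, w))" for x y v w
    using holomorphic_mult by (auto simp: holomorphic_map_on_def prod_J_def dest!: spec[of _ "(v, w)"])
  have L: "mder A A (\<lambda>x. g \<otimes> x) p (\<lambda>v. tmap (prod_charts A A) A ?m (g, p) (0, v))" for g p
    using mder_compose[OF charted charted_AA mder_Pair[OF mder_const[OF charted] mder_ident[OF charted]] m, of g p] by simp
  have R: "mder A A (\<lambda>x. x \<otimes> g) p (\<lambda>v. tmap (prod_charts A A) A ?m (p, g) (v, 0))" for g p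
    using mder_compose[OF charted charted_AA mder_Pair[OF mder_ident[OF charted] mder_const[OF charted]] m, of g p] by simp
  have "mder A A (\<lambda>x. g \<otimes> x \<otimes> g') p (\<lambda>v. tmap (prod_charts A A) A ?m (g \<otimes> p, g') (tmap (prod_charts A A) A ?m (g, p) (0, v), 0))"
    by (rule mder_compose[OF charted charted L R])
  then have eq: "tmap A A (\<lambda>x. g \<otimes> x \<otimes> g') p = (\<lambda>v. tmap (prod_charts A A) A ?m (g \<otimes> p, g') (tmap (prod_charts A A) A ?m (g, p) (0, v), 0))"
    by (rule mder_tmap)
  show ?thesis unfolding eq
    using h[of g p 0 v] h[of "g \<otimes> p" g' _ 0] linear_0[OF linear_J, of g] linear_0[OF linear_J, of g'] by simp
qed

lemma Ad_J: "Ad U A g (J \<one> v) = J \<one> (Ad U A g v)"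
  using mult_J[of g "inv g" \<one> v] by (simp add: Ad_def)

lemma bounded_linear_J: "bounded_linear (J p)"
  using findim findim.linear_bounded linear_J by metis

lemma bracket_J_right: "bracket U A X (J \<one> Y) = J \<one> (bracket U A X Y)"
proof -
  have "((\<lambda>t. J \<one> (Ad U A (ex X t) Y)) has_vector_derivative J \<one> (bracket U A X Y)) (at 0)"
    by (intro bounded_linear.has_vector_derivative[OF bounded_linear_J] bracket_derivative)
  then show ?thesis using bracket_derivative[of X "J \<one> Y"] vector_derivative_unique_at by (fastforce simp: Ad_J)
qed

lemma bracket_J_left: "bracket U A (J \<one> X) Y = J \<one> (bracket U A X Y)"
  by (metis bracket_antisym bracket_J_right linear_neg linear_J)

end

section \<open>The complexified group\<close>

lemma smooth_map_snd_vspace: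
  assumes "charted A"
  shows "smooth_map (prod_charts A vspace) (vspace :: ('e::real_normed_vector, 'e) charts) snd"
  unfolding smooth_map_on_def
proof (intro conjI allI)
  interpret charted A by fact
  show "continuous_on UNIV snd" by (intro continuous_intros)
  fix p :: "'a \<times> 'e" and q :: 'e
  obtain a b where p: "p = (a, b)" by fastforce
  let ?R = "cmap A a ` cdom A a \<times> (UNIV :: 'e set)"
  have eq: "cmap (prod_charts A vspace) p ` (cdom (prod_charts A vspace) p \<inter> UNIV \<inter> snd -` cdom vspace q) = ?R"
    by (simp add: p map_prod_image_times)
  have "smooth_on ?R snd" by (intro bounded_linear_smooth_on bounded_linear_snd)
  also have "?this \<longleftrightarrow> smooth_on ?R (cmap vspace q \<circ> snd \<circ> cinv (prod_charts A vspace) p)"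
  proof (rule smooth_on_cong)
    show "open ?R" by (intro open_Times open_im open_UNIV)
    fix z assume "z \<in> ?R"
    then have "cinv (prod_charts A vspace) (a, b) (fst z, snd z) = (cinv A a (fst z), cinv vspace b (snd z))"
      by (intro cinv_prod[OF assms charted_vspace]) auto
    then show "snd z = (cmap vspace q \<circ> snd \<circ> cinv (prod_charts A vspace) p) z" by (simp add: p)
  qed
  finally show "smooth_on (cmap (prod_charts A vspace) p ` (cdom (prod_charts A vspace) p \<inter> UNIV \<inter> snd -` cdom vspace q))
     (cmap vspace q \<circ> snd \<circ> cinv (prod_charts A vspace) p)" unfolding eq .
qed

text \<open>The difference quotient at 0 is g itself, so continuity of g is all that enters. It
  serves for B(q x)(q v) = q B(q x) v.\<close>

lemma has_vector_derivative_scaleR_at_0: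
  fixes g :: "real \<Rightarrow> 'e::real_normed_vector"
  assumes "isCont g 0"
  shows "((\<lambda>r. r *\<^sub>R g r) has_vector_derivative g 0) (at 0)"
proof -
  have "((\<lambda>h. (1/h) *\<^sub>R ((0 + h) *\<^sub>R g (0 + h) - 0 *\<^sub>R g 0)) \<longlongrightarrow> g 0) (at 0)"
  proof (rule Lim_transform_eventually)
    show "(g \<longlongrightarrow> g 0) (at 0)" using assms by (simp add: isCont_def)
    show "\<forall>\<^sub>F h in at 0. g h = (1/h) *\<^sub>R ((0 + h) *\<^sub>R g (0 + h) - 0 *\<^sub>R g 0)"
      using eventually_neq_at_within[of 0] by (rule eventually_mono) simp
  qed
  then have "((\<lambda>h. norm ((0 + h) *\<^sub>R g (0 + h) - 0 *\<^sub>R g 0 - h *\<^sub>R g 0) / norm h) \<longlongrightarrow> 0) (at 0)"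
  proof -
    have "((\<lambda>h. norm (g h - g 0)) \<longlongrightarrow> 0) (at 0)" using assms by (simp add: isCont_def LIM_zero_iff tendsto_norm_zero_iff)
    then show ?thesis
    proof (rule Lim_transform_eventually)
      show "\<forall>\<^sub>F h in at 0. norm (g h - g 0) = norm ((0 + h) *\<^sub>R g (0 + h) - 0 *\<^sub>R g 0 - h *\<^sub>R g 0) / norm h"
        using eventually_neq_at_within[of 0]
        by (rule eventually_mono) (simp add: scaleR_diff_right[symmetric] del: scaleR_diff_right)
    qed
  qed
  then show ?thesis by (simp add: has_vector_derivative_def has_derivative_at bounded_linear_scaleR_left)
qed

context complexification
begin

sublocale iota: lie_hom U A H AH \<iota>
  by unfold_locales (rule hom_\<iota> smooth_\<iota>)+

abbreviation i :: "'ue \<Rightarrow> 'he" where "i \<equiv> tmap A AH \<iota> \<one>\<^bsub>U\<^esub>"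
abbreviation j :: "'he \<Rightarrow> 'he" where "j \<equiv> JH \<one>\<^bsub>H\<^esub>"

text \<open>exp(i x). Up to left multiplication by U these points form the symmetric space, and
  \<open>pu\<close>, \<open>px\<close> are the polar coordinates in h = \<iota>(u) exp(i x).\<close>

definition E :: "'ue \<Rightarrow> 'h" where "E x = lie_exp H AH (j (i x))"
definition pu :: "'h \<Rightarrow> 'u" where "pu h = fst (inv_into UNIV (polar_map U A H AH JH \<iota>) h)"
definition px :: "'h \<Rightarrow> 'ue" where "px h = snd (inv_into UNIV (polar_map U A H AH JH \<iota>) h)"

lemma polar_eq: "polar_map U A H AH JH \<iota> (u, x) = \<iota> u \<otimes>\<^bsub>H\<^esub> E x"
  by (simp add: polar_map_def E_def)

lemma polar [simp]: "\<iota> (pu h) \<otimes>\<^bsub>H\<^esub> E (px h) = h"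
  using surj_f_inv_f[OF bij_is_surj[OF bij_polar], of h]
  by (simp add: pu_def px_def polar_eq[symmetric])

lemma pu_polar [simp]: "pu (\<iota> u \<otimes>\<^bsub>H\<^esub> E x) = u" and px_polar [simp]: "px (\<iota> u \<otimes>\<^bsub>H\<^esub> E x) = x"
  using inv_f_f[OF bij_is_inj[OF bij_polar], of "(u, x)"] by (simp_all add: pu_def px_def polar_eq)

lemma linear_i: "linear i" by (rule iota.linear)
lemma linear_j: "linear j" by (rule H.linear_J)
lemma linear_ji: "linear (\<lambda>x. j (i x))"
  using linear_compose[OF linear_i linear_j] by (simp add: o_def)
lemma j_j [simp]: "j (j X) = - X" by (rule H.J_J)

lemma E_scale: "E (s *\<^sub>R x) = H.ex (j (i x)) s"
  by (simp add: E_def H.ex_def linear_cmul[OF linear_ji])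

lemma E_ex: "E x = H.ex (j (i x)) 1"
  using E_scale[of 1 x] by simp

lemma E_zero [simp]: "E 0 = \<one>\<^bsub>H\<^esub>"
  using E_scale[of 0 0] by simp

lemma E_add: "E ((r + s) *\<^sub>R x) = E (r *\<^sub>R x) \<otimes>\<^bsub>H\<^esub> E (s *\<^sub>R x)"
  by (simp add: E_scale H.ex_add)

lemma E_minus: "E (- x) = inv\<^bsub>H\<^esub> E x"
  using E_scale[of "-1" x] by (simp add: H.ex_minus E_ex)

lemma px_E [simp]: "px (E x) = x" and pu_E [simp]: "pu (E x) = \<one>\<^bsub>U\<^esub>"
  using px_polar[of "\<one>\<^bsub>U\<^esub>" x] pu_polar[of "\<one>\<^bsub>U\<^esub>" x] by (simp_all add: iota.one)

lemma px_one [simp]: "px \<one>\<^bsub>H\<^esub> = 0" and pu_one [simp]: "pu \<one>\<^bsub>H\<^esub> = \<one>\<^bsub>U\<^esub>"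
  using px_E[of 0] pu_E[of 0] by simp_all

lemma pu_left: "pu (\<iota> u \<otimes>\<^bsub>H\<^esub> h) = u \<otimes>\<^bsub>U\<^esub> pu h" and px_left: "px (\<iota> u \<otimes>\<^bsub>H\<^esub> h) = px h"
proof -
  have "\<iota> u \<otimes>\<^bsub>H\<^esub> h = \<iota> (u \<otimes>\<^bsub>U\<^esub> pu h) \<otimes>\<^bsub>H\<^esub> E (px h)"
    by (simp add: iota.mult H.m_assoc)
  then show "pu (\<iota> u \<otimes>\<^bsub>H\<^esub> h) = u \<otimes>\<^bsub>U\<^esub> pu h" "px (\<iota> u \<otimes>\<^bsub>H\<^esub> h) = px h" by simp_all
qed

lemma Ad_E: "\<iota> u \<otimes>\<^bsub>H\<^esub> E x \<otimes>\<^bsub>H\<^esub> inv\<^bsub>H\<^esub> \<iota> u = E (Ad U A u x)"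
  by (simp add: E_ex H.Ad_ex H.Ad_J iota.Ad)

lemma smooth_polar_maps: "smooth_map AH A pu" "smooth_map AH vspace px" "smooth_map vspace AH E"
proof -
  obtain B :: "'ue set" where B: "findim B" by (rule U.findim)
  obtain B2 :: "('ue \<times> 'ue) set" where B2: "findim B2" using findim_prod[OF B B] .
  have cp: "charted (prod_charts A vspace)" by (intro charted_prod U.charted charted_vspace)
  show "smooth_map AH A pu" unfolding pu_def
    by (rule smooth_map_on_compose[OF H.charted cp U.charted B2 smooth_polar_inv smooth_map_fst[OF U.smooth_manifold_axioms charted_vspace]]) auto
  show "smooth_map AH vspace px" unfolding px_def
    by (rule smooth_map_on_compose[OF H.charted cp charted_vspace B2 smooth_polar_inv smooth_map_snd_vspace[OF U.charted]]) auto
  have "smooth_map vspace (prod_charts A vspace) (\<lambda>x. (\<one>\<^bsub>U\<^esub>, x))"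
    by (intro smooth_map_on_Pair charted_vspace U.charted smooth_map_on_const open_UNIV) (simp add: smooth_map_on_vspace smooth_on_id)
  from smooth_map_on_compose[OF charted_vspace cp H.charted B2 this smooth_polar]
  have "smooth_map vspace AH (\<lambda>x. polar_map U A H AH JH \<iota> (\<one>\<^bsub>U\<^esub>, x))" by simp
  then show "smooth_map vspace AH E" by (simp add: polar_eq iota.one)
qed

lemma mder_px: "mder AH vspace px p (tmap AH vspace px p)"
  by (rule smooth_map_on_mder[OF H.charted charted_vspace smooth_polar_maps(2)]) auto

lemma mder_pu: "mder AH A pu p (tmap AH A pu p)"
  by (rule smooth_map_on_mder[OF H.charted U.charted smooth_polar_maps(1)]) auto

text \<open>The derivative of y -> exp(i y) at x, right translated to the identity. The usual
  formula for it is a power series in ad; a differential equation in the scaling parameter takes its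
  place below.\<close>

definition B :: "'ue \<Rightarrow> 'ue \<Rightarrow> 'he" where
  "B x = tmap vspace AH (\<lambda>y. E y \<otimes>\<^bsub>H\<^esub> inv\<^bsub>H\<^esub> E x) x"

lemma mder_B: "mder vspace AH (\<lambda>y. E y \<otimes>\<^bsub>H\<^esub> inv\<^bsub>H\<^esub> E x) x (B x)"
  unfolding B_def
  by (rule smooth_map_on_mder[OF charted_vspace H.charted, of UNIV])
    (intro H.smooth_mult_maps charted_vspace smooth_map_on_const open_UNIV smooth_polar_maps UNIV_I)+

lemma linear_B: "linear (B x)"
  by (rule mder_linear[OF mder_B])

lemma dlog_E:
  assumes "(\<xi> has_vector_derivative v) (at s)"
  shows "dlog H AH (\<lambda>s. E (\<xi> s)) s (B (\<xi> s) v)"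
  unfolding dlog_def by (rule vel_compose[OF charted_vspace _ mder_B]) (simp add: vel_vspace assms)

lemma smooth_B: "smooth_on UNIV (\<lambda>x. B x v)"
proof -
  obtain B1 :: "'ue set" where B1: "findim B1" by (rule U.findim)
  obtain BH :: "'he set" where BH: "findim BH" by (rule H.findim)
  obtain B2 :: "('ue \<times> 'ue) set" where B2: "findim B2" using findim_prod[OF B1 B1] .
  interpret cH: charted AH by (rule H.charted)
  define pr where "pr = (\<lambda>z::'ue \<times> 'ue. E (fst z) \<otimes>\<^bsub>H\<^esub> inv\<^bsub>H\<^esub> E (snd z))"
  have s1: "smooth_map vspace AH (\<lambda>z::'ue \<times> 'ue. E (fst z))" and s2: "smooth_map vspace AH (\<lambda>z::'ue \<times> 'ue. E (snd z))"
    by (rule smooth_map_on_compose[OF charted_vspace charted_vspace H.charted B1 _ smooth_polar_maps(3)];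
        simp add: smooth_map_on_vspace bounded_linear_smooth_on bounded_linear_fst bounded_linear_snd)+
  have spr: "smooth_map vspace AH pr" unfolding pr_def
    by (intro H.smooth_mult_maps H.smooth_inverse_maps charted_vspace open_UNIV s1 s2)
  define Om where "Om = pr -` cdom AH \<one>\<^bsub>H\<^esub>"
  have oO: "open Om" unfolding Om_def
    by (rule open_vimage[OF H.open_cdom]) (use spr in \<open>simp add: smooth_map_on_def\<close>)
  have "smooth_map_on vspace vspace Om (\<lambda>z. cmap AH \<one>\<^bsub>H\<^esub> (pr z))"
    by (rule smooth_map_on_compose[OF charted_vspace H.charted charted_vspace BH smooth_map_on_mono[OF spr] H.smooth_cmap oO H.open_cdom])
      (auto simp: Om_def)
  then have sm: "smooth_on Om (\<lambda>z. cmap AH \<one>\<^bsub>H\<^esub> (pr z))" by (simp add: smooth_map_on_vspace)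
  have inO: "(x, x) \<in> Om" for x by (simp add: Om_def pr_def H.mem_cdom)
  have "smooth_on UNIV (\<lambda>x::'ue. (x, x))" by (intro smooth_on_Pair open_UNIV smooth_on_id)
  then have "smooth_on UNIV (\<lambda>x. frechet_derivative (\<lambda>z. cmap AH \<one>\<^bsub>H\<^esub> (pr z)) (at (x, x)) (v, 0))"
    by (intro findim.smooth_on_compose[OF B2 open_UNIV oO, of "\<lambda>x. (x, x)" "\<lambda>z. frechet_derivative (\<lambda>z. cmap AH \<one>\<^bsub>H\<^esub> (pr z)) (at z) (v, 0)"])
      (use inO smooth_on_derivative[OF sm] in auto)
  moreover have "frechet_derivative (\<lambda>z. cmap AH \<one>\<^bsub>H\<^esub> (pr z)) (at (x, x)) (v, 0) = B x v" for x
  proof -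
    have "((\<lambda>y. (y, x)) has_derivative (\<lambda>v. (v, 0))) (at x)" by (auto intro!: derivative_eq_intros)
    from has_derivative_compose[OF this smooth_on_has_derivative[OF sm inO]]
    have "((\<lambda>y. cmap AH \<one>\<^bsub>H\<^esub> (pr (y, x))) has_derivative (\<lambda>v. frechet_derivative (\<lambda>z. cmap AH \<one>\<^bsub>H\<^esub> (pr z)) (at (x, x)) (v, 0))) (at x)" .
    moreover have "((\<lambda>y. cmap AH \<one>\<^bsub>H\<^esub> (pr (y, x))) has_derivative B x) (at x)"
      using mder_B[of x] by (simp add: mder_def pr_def)
    ultimately have "(\<lambda>v. frechet_derivative (\<lambda>z. cmap AH \<one>\<^bsub>H\<^esub> (pr z)) (at (x, x)) (v, 0)) = B x"
      by (rule has_derivative_unique)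
    from fun_cong[OF this, of v] show ?thesis .
  qed
  ultimately show ?thesis by simp
qed

lemma B_at_zero: "B 0 v = j (i v)"
proof -
  have "dlog H AH (\<lambda>s. E (s *\<^sub>R v)) 0 (B (0 *\<^sub>R v) v)"
    by (rule dlog_E) (auto intro!: derivative_eq_intros)
  then have "dlog H AH (H.ex (j (i v))) 0 (B 0 v)" by (simp add: E_scale)
  then show ?thesis using H.dlog_unique H.dlog_ex by blast
qed

text \<open>Differentiates exp(i (r + q) y) = exp(i r y) exp(i q y) in y, a cocycle identity that
  holds because both factors have the same direction.\<close>

lemma B_add: "B ((r + q) *\<^sub>R x) ((r + q) *\<^sub>R v) = B (r *\<^sub>R x) (r *\<^sub>R v) + Ad H AH (E (r *\<^sub>R x)) (B (q *\<^sub>R x) (q *\<^sub>R v))"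
proof -
  have d: "dlog H AH (\<lambda>s. E (k *\<^sub>R (x + s *\<^sub>R v))) 0 (B (k *\<^sub>R x) (k *\<^sub>R v))" for k
  proof -
    have "((\<lambda>s. k *\<^sub>R (x + s *\<^sub>R v)) has_vector_derivative k *\<^sub>R v) (at 0)" by (auto intro!: derivative_eq_intros)
    from dlog_E[OF this] show ?thesis by simp
  qed
  have "dlog H AH (\<lambda>s. E ((r + q) *\<^sub>R (x + s *\<^sub>R v))) 0
      (B (r *\<^sub>R x) (r *\<^sub>R v) + Ad H AH (E (r *\<^sub>R x)) (B (q *\<^sub>R x) (q *\<^sub>R v)))"
    using H.dlog_mult[OF d[of r] d[of q]] by (simp only: E_add scaleR_zero_left add_0_right)
  then show ?thesis by (rule H.dlog_unique[OF d])
qed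

text \<open>The cocycle identity, differentiated at parameter 0, is a linear differential equation
  for r -> B(r x)(r v). All later facts on the exponential map are read off from it.\<close>

lemma B_derivative:
  "((\<lambda>r. B (r *\<^sub>R x) (r *\<^sub>R v)) has_vector_derivative j (i v) + bracket H AH (j (i x)) (B (r *\<^sub>R x) (r *\<^sub>R v))) (at r)"
proof -
  have "isCont (\<lambda>r. B (r *\<^sub>R x) v) 0"
  proof -
    have "isCont (\<lambda>y. B y v) (0 *\<^sub>R x)" using smooth_on_continuous[OF smooth_B[of v]] by (simp add: continuous_on_eq_continuous_at)
    moreover have "isCont (\<lambda>r. r *\<^sub>R x) 0" by (rule bounded_linear.isCont[OF bounded_linear_scaleR_left continuous_ident])
    ultimately show ?thesis using isCont_compose[of 0 "\<lambda>r. r *\<^sub>R x" "\<lambda>y. B y v"] by blast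
  qed
  from has_vector_derivative_scaleR_at_0[OF this]
  have 1: "((\<lambda>q. B (q *\<^sub>R x) (q *\<^sub>R v)) has_vector_derivative j (i v)) (at 0)"
    by (simp add: linear_cmul[OF linear_B] B_at_zero)
  have 2: "((\<lambda>q. Ad H AH (E (q *\<^sub>R x)) (B (r *\<^sub>R x) (r *\<^sub>R v))) has_vector_derivative bracket H AH (j (i x)) (B (r *\<^sub>R x) (r *\<^sub>R v))) (at 0)"
    using H.bracket_derivative[of "j (i x)"] by (simp add: E_scale)
  have "vel vspace (\<lambda>q. B ((q + r) *\<^sub>R x) ((q + r) *\<^sub>R v)) 0 (j (i v) + bracket H AH (j (i x)) (B (r *\<^sub>R x) (r *\<^sub>R v)))"
    using has_vector_derivative_add[OF 1 2] by (simp add: vel_vspace B_add)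
  then have "vel vspace (\<lambda>q. B ((q - r + r) *\<^sub>R x) ((q - r + r) *\<^sub>R v)) r (j (i v) + bracket H AH (j (i x)) (B (r *\<^sub>R x) (r *\<^sub>R v)))"
    using vel_shift[of vspace "\<lambda>q. B ((q + r) *\<^sub>R x) ((q + r) *\<^sub>R v)" r "-r"] by simp
  then show ?thesis by (simp add: vel_vspace)
qed

subsection \<open>Real and imaginary parts\<close>

text \<open>Differentiate the polar decomposition of exp(s X) at s = 0, where the derivative of
  \<open>E\<close> is \<open>j\<close> after \<open>i\<close>.\<close>

lemma decomposition_exists: "\<exists>a b. X = i a + j (i b)"
proof -
  let ?c = "H.ex X"
  have v: "vel AH ?c 0 X" by (rule H.vel_ex)
  have x: "((\<lambda>s. px (?c s)) has_vector_derivative tmap AH vspace px \<one>\<^bsub>H\<^esub> X) (at 0)"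
    using vel_compose[OF H.charted v, of vspace px] mder_px by (simp add: vel_vspace)
  have "vel A (\<lambda>s. pu (?c s)) 0 (tmap AH A pu \<one>\<^bsub>H\<^esub> X)"
    using vel_compose[OF H.charted v, of A pu] mder_pu by simp
  then have "dlog U A (\<lambda>s. pu (?c s)) 0 (tmap AH A pu \<one>\<^bsub>H\<^esub> X)" by (simp add: U.dlog_one_vel)
  from H.dlog_mult[OF iota.dlog[OF this] dlog_E[OF x]]
  have "dlog H AH ?c 0 (i (tmap AH A pu \<one>\<^bsub>H\<^esub> X) + j (i (tmap AH vspace px \<one>\<^bsub>H\<^esub> X)))"
    by (simp add: iota.one B_at_zero)
  then show ?thesis using H.dlog_unique H.dlog_ex by blast
qed

text \<open>The curve \<iota>(exp(s a)) exp(i s b) has velocity \<open>i a + j (i b)\<close> at the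
  identity. If this vanishes, so do the velocities of its smooth polar coordinates exp(s a) and s
  b.\<close>

lemma decomposition_unique:
  assumes "i a + j (i b) = 0"
  shows "a = 0" "b = 0"
proof -
  let ?c = "\<lambda>s. \<iota> (U.ex a s) \<otimes>\<^bsub>H\<^esub> E (s *\<^sub>R b)"
  have d: "((\<lambda>s. s *\<^sub>R b) has_vector_derivative b) (at 0)" by (auto intro!: derivative_eq_intros)
  have "dlog H AH ?c 0 (i a + j (i b))"
    using H.dlog_mult[OF iota.dlog[OF U.dlog_ex[of a 0]] dlog_E[OF d]] by (simp add: iota.one B_at_zero)
  then have v: "vel AH ?c 0 0" using H.dlog_one_vel[of ?c 0] by (simp add: iota.one assms)
  have "((\<lambda>s. px (?c s)) has_vector_derivative tmap AH vspace px (?c 0) 0) (at 0)"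
    using vel_compose[OF H.charted v mder_px] by (simp add: vel_vspace)
  then have "((\<lambda>s. s *\<^sub>R b) has_vector_derivative 0) (at 0)"
    using linear_0[OF mder_linear[OF mder_px]] by simp
  then show "b = 0" using d vector_derivative_unique_at by blast
  have "vel A (\<lambda>s. pu (?c s)) 0 (tmap AH A pu (?c 0) 0)"
    by (rule vel_compose[OF H.charted v mder_pu])
  then have "vel A (U.ex a) 0 0" using linear_0[OF mder_linear[OF mder_pu]] by simp
  then show "a = 0" using U.vel_ex vel_unique by blast
qed

lemma decomposition_eq:
  assumes "i a + j (i b) = i a' + j (i b')"
  shows "a = a'" "b = b'"
proof -
  have "i (a - a') + j (i (b - b')) = (i a + j (i b)) - (i a' + j (i b'))"
    by (simp add: linear_diff[OF linear_i] linear_diff[OF linear_j])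
  also have "\<dots> = 0" using assms by simp
  finally show "a = a'" "b = b'" using decomposition_unique[of "a - a'" "b - b'"] by simp_all
qed

definition re :: "'he \<Rightarrow> 'ue" where "re X = (THE a. \<exists>b. X = i a + j (i b))"
definition im :: "'he \<Rightarrow> 'ue" where "im X = (THE b. \<exists>a. X = i a + j (i b))"

lemma re_eq [simp]: "re (i a + j (i b)) = a" and im_eq [simp]: "im (i a + j (i b)) = b"
  unfolding re_def im_def using decomposition_eq by (intro the_equality; blast)+

lemma re_im: "i (re X) + j (i (im X)) = X"
proof -
  obtain a b where "X = i a + j (i b)" using decomposition_exists by blast
  then show ?thesis by simp
qed

lemma linear_re: "linear re" and linear_im: "linear im"
proof -
  have add: "X + Y = i (re X + re Y) + j (i (im X + im Y))" for X Y
    using re_im[of X] re_im[of Y] by (simp add: linear_add[OF linear_i] linear_add[OF linear_j] algebra_simps)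
  have scale: "k *\<^sub>R X = i (k *\<^sub>R re X) + j (i (k *\<^sub>R im X))" for k X
  proof -
    have "k *\<^sub>R (i (re X) + j (i (im X))) = i (k *\<^sub>R re X) + j (i (k *\<^sub>R im X))"
      by (simp add: linear_cmul[OF linear_i] linear_cmul[OF linear_j] scaleR_add_right)
    then show ?thesis by (simp only: re_im)
  qed
  have "re (X + Y) = re X + re Y" "im (X + Y) = im X + im Y" for X Y
    by (subst add, rule re_eq) (subst add, rule im_eq)
  moreover have "re (k *\<^sub>R X) = k *\<^sub>R re X" "im (k *\<^sub>R X) = k *\<^sub>R im X" for k X
    by (subst scale, rule re_eq) (subst scale, rule im_eq)
  ultimately show "linear re" "linear im" by (auto intro: linearI)
qed

end

lemma (in findim) bilinear_bounded_bilinear: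
  fixes f :: "'e \<Rightarrow> 'e \<Rightarrow> 'f::real_normed_vector"
  assumes "bilinear f"
  shows "bounded_bilinear f"
proof -
  obtain C where C: "C > 0" "\<And>v b. \<bar>representation B v b\<bar> \<le> C * norm v" using representation_bound by blast
  have l: "linear (f x)" "linear (\<lambda>x. f x y)" for x y using assms by (auto simp: bilinear_def)
  have "norm (f x y) \<le> norm x * norm y * (\<Sum>b\<in>B. \<Sum>b'\<in>B. C * C * norm (f b b'))" for x y
  proof -
    have "f x y = (\<Sum>b\<in>B. \<Sum>b'\<in>B. (representation B x b * representation B y b') *\<^sub>R f b b')"
      by (subst linear_expand[OF l(2)], subst linear_expand[OF l(1)]) (simp add: scaleR_sum_right)
    also have "norm \<dots> \<le> (\<Sum>b\<in>B. \<Sum>b'\<in>B. (C * norm x) * (C * norm y) * norm (f b b'))"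
    proof (intro order_trans[OF norm_sum] sum_mono)
      fix b b'
      have "\<bar>representation B x b * representation B y b'\<bar> \<le> (C * norm x) * (C * norm y)"
        unfolding abs_mult by (intro mult_mono C) (use C(1) in auto)
      then show "norm ((representation B x b * representation B y b') *\<^sub>R f b b') \<le> (C * norm x) * (C * norm y) * norm (f b b')"
        by (auto intro!: mult_right_mono)
    qed
    finally show ?thesis by (simp add: sum_distrib_left algebra_simps)
  qed
  then show ?thesis
    by (intro bounded_bilinear.intro)
      (use linear_add[OF l(1)] linear_add[OF l(2)] linear_cmul[OF l(1)] linear_cmul[OF l(2)] in \<open>auto intro!: exI[of _ "\<Sum>b\<in>B. \<Sum>b'\<in>B. C * C * norm (f b b')"]\<close>)
qed

context complexification
begin

lemma i_re_im [simp]: "re (i a) = a" "im (i a) = 0" "re (j (i b)) = 0" "im (j (i b)) = b"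
  using re_eq[of a 0] im_eq[of a 0] re_eq[of 0 b] im_eq[of 0 b]
  by (simp_all add: linear_0[OF linear_i] linear_0[OF linear_j])

lemma re_j: "re (j X) = - im X" and im_j: "im (j X) = re X"
proof -
  have "j X = i (- im X) + j (i (re X))"
    by (subst re_im[of X, symmetric]) (simp add: linear_add[OF linear_j] linear_neg[OF linear_i])
  then show "re (j X) = - im X" "im (j X) = re X" using re_eq im_eq by metis+
qed

lemma re_Ad: "re (Ad H AH (\<iota> u) X) = Ad U A u (re X)" and im_Ad: "im (Ad H AH (\<iota> u) X) = Ad U A u (im X)"
proof -
  have "Ad H AH (\<iota> u) X = i (Ad U A u (re X)) + j (i (Ad U A u (im X)))"
    by (subst re_im[of X, symmetric]) (simp add: linear_add[OF H.linear_Ad] H.Ad_J iota.Ad)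
  then show "re (Ad H AH (\<iota> u) X) = Ad U A u (re X)" "im (Ad H AH (\<iota> u) X) = Ad U A u (im X)"
    using re_eq im_eq by metis+
qed

lemma re_bracket_i: "re (bracket H AH (i a) X) = bracket U A a (re X)"
  and im_bracket_i: "im (bracket H AH (i a) X) = bracket U A a (im X)"
proof -
  have "bracket H AH (i a) X = i (bracket U A a (re X)) + j (i (bracket U A a (im X)))"
    by (subst re_im[of X, symmetric]) (simp add: linear_add[OF H.linear_bracket_right] H.bracket_J_right iota.bracket)
  then show "re (bracket H AH (i a) X) = bracket U A a (re X)" "im (bracket H AH (i a) X) = bracket U A a (im X)"
    using re_eq im_eq by metis+
qed

lemma re_bracket_ji: "re (bracket H AH (j (i a)) X) = - bracket U A a (im X)"
  and im_bracket_ji: "im (bracket H AH (j (i a)) X) = bracket U A a (re X)"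
  by (simp_all add: H.bracket_J_left re_j im_j re_bracket_i im_bracket_i)

lemma bounded_linear_re: "bounded_linear re" and bounded_linear_im: "bounded_linear im"
  using H.findim findim.linear_bounded linear_re linear_im by metis+

lemma B_re_derivative:
  "((\<lambda>r. re (B (r *\<^sub>R x) (r *\<^sub>R v))) has_vector_derivative - bracket U A x (im (B (r *\<^sub>R x) (r *\<^sub>R v)))) (at r)"
  using bounded_linear.has_vector_derivative[OF bounded_linear_re B_derivative[of x v r]]
  by (simp add: linear_add[OF linear_re] re_bracket_ji)

lemma B_im_derivative:
  "((\<lambda>r. im (B (r *\<^sub>R x) (r *\<^sub>R v))) has_vector_derivative v + bracket U A x (re (B (r *\<^sub>R x) (r *\<^sub>R v)))) (at r)"
  using bounded_linear.has_vector_derivative[OF bounded_linear_im B_derivative[of x v r]]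
  by (simp add: linear_add[OF linear_im] im_bracket_ji)

text \<open>The derivative of \<open>px\<close> at \<open>h\<close> along any curve with logarithmic
  derivative \<open>X\<close>; \<open>dpu\<close> below is the logarithmic derivative of
  \<open>pu\<close> along it.\<close>

definition dpx :: "'h \<Rightarrow> 'he \<Rightarrow> 'ue" where
  "dpx h X = tmap AH vspace px h (tmap AH AH (\<lambda>x. x \<otimes>\<^bsub>H\<^esub> h) \<one>\<^bsub>H\<^esub> X)"

definition dpu :: "'h \<Rightarrow> 'he \<Rightarrow> 'ue" where
  "dpu h X = tmap A A (\<lambda>x. x \<otimes>\<^bsub>U\<^esub> inv\<^bsub>U\<^esub> pu h) (pu h) (tmap AH A pu h (tmap AH AH (\<lambda>x. x \<otimes>\<^bsub>H\<^esub> h) \<one>\<^bsub>H\<^esub> X))"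

lemma linear_dpx: "linear (dpx h)" and linear_dpu: "linear (dpu h)"
proof -
  have l: "linear (tmap AH AH (\<lambda>x. x \<otimes>\<^bsub>H\<^esub> h) \<one>\<^bsub>H\<^esub>)" by (rule mder_linear[OF H.mder_right])
  show "linear (dpx h)" using linear_compose[OF l mder_linear[OF mder_px]] by (simp add: dpx_def[abs_def] o_def)
  show "linear (dpu h)"
    using linear_compose[OF linear_compose[OF l mder_linear[OF mder_pu]] mder_linear[OF U.mder_right]]
    by (simp add: dpu_def[abs_def] o_def)
qed

lemma px_derivative:
  assumes "dlog H AH c s X"
  shows "((\<lambda>r. px (c r)) has_vector_derivative dpx (c s) X) (at s)"
  using vel_compose[OF H.charted H.dlog_vel[OF assms] mder_px] by (simp add: vel_vspace dpx_def)

lemma pu_derivative: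
  assumes "dlog H AH c s X"
  shows "dlog U A (\<lambda>r. pu (c r)) s (dpu (c s) X)"
  using U.vel_dlog[OF vel_compose[OF H.charted H.dlog_vel[OF assms] mder_pu]] by (simp add: dpu_def)

text \<open>The product rule for the logarithmic derivative of \<iota>(u) exp(i x), along the curve
  exp(s X) h.\<close>

lemma polar_derivative:
  "X = i (dpu h X) + Ad H AH (\<iota> (pu h)) (B (px h) (dpx h X))"
proof -
  let ?c = "\<lambda>s. H.ex X s \<otimes>\<^bsub>H\<^esub> h"
  have c: "dlog H AH ?c 0 X" by (rule H.dlog_ex_left)
  have "dlog H AH ?c 0 (i (dpu h X) + Ad H AH (\<iota> (pu h)) (B (px h) (dpx h X)))"
    using H.dlog_mult[OF iota.dlog[OF pu_derivative[OF c]] dlog_E[OF px_derivative[OF c]]] by simp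
  then show ?thesis using c H.dlog_unique by blast
qed

lemma im_polar_derivative: "im X = Ad U A (pu h) (im (B (px h) (dpx h X)))"
  and re_polar_derivative: "re X = dpu h X + Ad U A (pu h) (re (B (px h) (dpx h X)))"
  using arg_cong[OF polar_derivative[of X h], of im] arg_cong[OF polar_derivative[of X h], of re]
  by (simp_all add: linear_add[OF linear_im] linear_add[OF linear_re] im_Ad re_Ad)

text \<open>The polar decomposition from the other side: \<open>h = exp(i \<Xi>) u\<close>.\<close>

definition Xi :: "'h \<Rightarrow> 'ue" where "Xi h = Ad U A (pu h) (px h)"

lemma Xi_left: "Xi (\<iota> u \<otimes>\<^bsub>H\<^esub> h) = Ad U A u (Xi h)"
  by (simp add: Xi_def pu_left px_left U.Ad_mult)

lemma Xi_E [simp]: "Xi (E x) = x"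
  by (simp add: Xi_def)

definition dXi :: "'h \<Rightarrow> 'he \<Rightarrow> 'ue" where
  "dXi h X = bracket U A (dpu h X) (Xi h) + Ad U A (pu h) (dpx h X)"

lemma linear_dXi: "linear (dXi h)"
  unfolding dXi_def[abs_def]
  by (intro linear_compose_add linear_compose[OF linear_dpu U.linear_bracket_left, unfolded o_def]
      linear_compose[OF linear_dpx U.linear_Ad, unfolded o_def])

lemma Xi_derivative:
  assumes "dlog H AH c s X"
  shows "((\<lambda>r. Xi (c r)) has_vector_derivative dXi (c s) X) (at s)"
  using U.Ad_vector_derivative[OF pu_derivative[OF assms] px_derivative[OF assms]] by (simp add: Xi_def dXi_def)

lemma dXi_i: "dXi h (i a) = bracket U A a (Xi h)"
proof -
  have "((\<lambda>s. Xi (H.ex (i a) s \<otimes>\<^bsub>H\<^esub> h)) has_vector_derivative dXi h (i a)) (at 0)"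
    using Xi_derivative[OF H.dlog_ex_left[of "i a" h 0]] by simp
  moreover have "Xi (H.ex (i a) s \<otimes>\<^bsub>H\<^esub> h) = Ad U A (U.ex a s) (Xi h)" for s
    by (simp add: Xi_left iota.ex[symmetric])
  ultimately show ?thesis using U.bracket_derivative[of a "Xi h"] vector_derivative_unique_at by auto
qed

text \<open>The Hessian operator of half the squared distance |Xi|^2 / 2 on the symmetric space:
  \<open>Xi\<close> is the gradient of this function, and \<open>Dx h b\<close> is its derivative in
  the direction i b, which involves no rotation by U.\<close>

definition Dx :: "'h \<Rightarrow> 'ue \<Rightarrow> 'ue" where "Dx h b = dXi h (j (i b))"

lemma linear_Dx: "linear (Dx h)"
  using linear_compose[OF linear_ji linear_dXi, of h] by (simp add: Dx_def[abs_def] o_def)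

lemma dXi_eq: "dXi h X = bracket U A (re X) (Xi h) + Dx h (im X)"
  using linear_add[OF linear_dXi, of h "i (re X)" "j (i (im X))"] by (simp add: re_im dXi_i Dx_def)

text \<open>For X = i b the real part of \<open>polar_derivative\<close> determines the rotation
  \<open>dpu\<close> in terms of v, and the imaginary part determines v in terms of b. What remains
  are the end values of a Jacobi field and of its derivative.\<close>

lemma Dx_eq:
  fixes h b defines "x \<equiv> px h" and "v \<equiv> dpx h (j (i b))"
  shows "Dx h b = Ad U A (pu h) (v + bracket U A x (re (B x v)))" "im (B x v) = Ad U A (inv\<^bsub>U\<^esub> pu h) b"
proof -
  show "im (B x v) = Ad U A (inv\<^bsub>U\<^esub> pu h) b"
    using arg_cong[OF im_polar_derivative[of "j (i b)" h], of "Ad U A (inv\<^bsub>U\<^esub> pu h)"] by (simp add: x_def v_def)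
  have "dpu h (j (i b)) = - Ad U A (pu h) (re (B x v))"
    using re_polar_derivative[of "j (i b)" h] by (simp add: x_def v_def eq_neg_iff_add_eq_0)
  then have "Dx h b = bracket U A (- Ad U A (pu h) (re (B x v))) (Ad U A (pu h) x) + Ad U A (pu h) v"
    by (simp add: Dx_def dXi_def Xi_def x_def v_def)
  also have "\<dots> = Ad U A (pu h) (v + bracket U A x (re (B x v)))"
    using U.bracket_antisym[of x "re (B x v)"]
    by (simp add: linear_add[OF U.linear_Ad] linear_diff[OF U.linear_Ad] linear_neg[OF U.linear_Ad] U.bracket_simps U.Ad_bracket[symmetric] add.commute)
  finally show "Dx h b = Ad U A (pu h) (v + bracket U A x (re (B x v)))" .
qed

end

section \<open>Jacobi fields and the Hessian of the squared distance\<close>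

locale inner_complexification = complexification U A H AH JH \<iota>
  for U :: "'u::{t2_space, second_countable_topology} monoid"
    and A :: "('u, 'ue::real_normed_vector) charts"
    and H :: "'h::{t2_space, second_countable_topology} monoid"
    and AH :: "('h, 'he::real_normed_vector) charts" and JH :: "'h \<Rightarrow> 'he \<Rightarrow> 'he"
    and \<iota> :: "'u \<Rightarrow> 'h" +
  fixes ip :: "'ue \<Rightarrow> 'ue \<Rightarrow> real"
  assumes bilinear_ip: "bilinear ip"
    and ip_sym: "ip x y = ip y x"
    and ip_pos: "x \<noteq> 0 \<Longrightarrow> ip x x > 0"
    and ip_Ad: "ip (Ad U A u x) (Ad U A u y) = ip x y"
begin

lemma bounded_bilinear_ip: "bounded_bilinear ip"
  using U.findim findim.bilinear_bounded_bilinear bilinear_ip by metis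

lemmas ip_simps =
  bounded_bilinear.add_left[OF bounded_bilinear_ip] bounded_bilinear.add_right[OF bounded_bilinear_ip]
  bounded_bilinear.diff_left[OF bounded_bilinear_ip] bounded_bilinear.diff_right[OF bounded_bilinear_ip]
  bounded_bilinear.minus_left[OF bounded_bilinear_ip] bounded_bilinear.minus_right[OF bounded_bilinear_ip]
  bounded_bilinear.scaleR_left[OF bounded_bilinear_ip] bounded_bilinear.scaleR_right[OF bounded_bilinear_ip]
  bounded_bilinear.zero_left[OF bounded_bilinear_ip] bounded_bilinear.zero_right[OF bounded_bilinear_ip]

lemma ip_nonneg: "ip x x \<ge> 0"
  using ip_pos[of x] by (cases "x = 0") (auto simp: ip_simps)

lemma ip_derivative:
  assumes "(f has_vector_derivative f') (at s)" "(g has_vector_derivative g') (at s)"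
  shows "((\<lambda>r. ip (f r) (g r)) has_real_derivative ip (f s) g' + ip f' (g s)) (at s)"
  using bounded_bilinear.has_vector_derivative[OF bounded_bilinear_ip assms]
  by (simp add: has_real_derivative_iff_has_vector_derivative)

lemma ip_skew: "ip (bracket U A a x) y = - ip x (bracket U A a y)"
proof -
  have "((\<lambda>s. ip (Ad U A (U.ex a s) x) (Ad U A (U.ex a s) y)) has_real_derivative ip x (bracket U A a y) + ip (bracket U A a x) y) (at 0)"
    using ip_derivative[OF U.bracket_derivative[of a x] U.bracket_derivative[of a y]] by simp
  then have "((\<lambda>s. ip x y) has_real_derivative ip x (bracket U A a y) + ip (bracket U A a x) y) (at 0)"
    by (simp add: ip_Ad)
  then have "ip x (bracket U A a y) + ip (bracket U A a x) y = 0" using DERIV_const DERIV_unique by blast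
  then show ?thesis by simp
qed

definition nrm :: "'ue \<Rightarrow> real" where "nrm x = sqrt (ip x x)"

lemma nrm_nonneg [simp]: "nrm x \<ge> 0" and nrm_sq: "(nrm x)\<^sup>2 = ip x x"
  by (simp_all add: nrm_def ip_nonneg)

lemma ip_cauchy_schwarz: "\<bar>ip x y\<bar> \<le> nrm x * nrm y"
proof -
  have "(ip x y)\<^sup>2 \<le> ip x x * ip y y"
  proof (cases "y = 0")
    case False
    then have p: "ip y y > 0" by (rule ip_pos)
    have "0 \<le> ip (ip y y *\<^sub>R x - ip x y *\<^sub>R y) (ip y y *\<^sub>R x - ip x y *\<^sub>R y)" by (rule ip_nonneg)
    also have "\<dots> = ip y y * (ip x x * ip y y - (ip x y)\<^sup>2)"
      by (simp add: ip_simps ip_sym[of y x] power2_eq_square algebra_simps)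
    finally show ?thesis using p by (simp add: zero_le_mult_iff)
  qed (simp add: ip_simps)
  then have "sqrt ((ip x y)\<^sup>2) \<le> sqrt (ip x x * ip y y)" by (rule real_sqrt_le_mono)
  then show ?thesis by (simp add: nrm_def real_sqrt_mult)
qed

lemma nrm_triangle: "nrm (x + y) \<le> nrm x + nrm y"
proof (rule power2_le_imp_le)
  have "ip x y \<le> nrm x * nrm y" using ip_cauchy_schwarz[of x y] by simp
  then show "(nrm (x + y))\<^sup>2 \<le> (nrm x + nrm y)\<^sup>2"
    by (simp add: power2_sum nrm_sq ip_simps ip_sym[of y x])
qed simp

lemma nrm_scaleR: "nrm (k *\<^sub>R x) = \<bar>k\<bar> * nrm x"
  by (simp add: nrm_def ip_simps real_sqrt_mult[symmetric] power2_eq_square[symmetric])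
    (simp add: real_sqrt_mult power2_eq_square)

lemma nrm_minus [simp]: "nrm (- x) = nrm x"
  by (simp add: nrm_def ip_simps)

lemma nrm_zero [simp]: "nrm 0 = 0"
  by (simp add: nrm_def ip_simps)

lemma nrm_Ad [simp]: "nrm (Ad U A u x) = nrm x"
  by (simp add: nrm_def ip_Ad)

lemma nrm_pos: "x \<noteq> 0 \<Longrightarrow> nrm x > 0"
  by (simp add: nrm_def ip_pos)

lemma continuous_nrm: "continuous_on S nrm"
  unfolding nrm_def by (intro continuous_intros bounded_bilinear.continuous_on[OF bounded_bilinear_ip])

lemma nrm_equiv: obtains c C where "c > 0" "C > 0" "\<And>x. c * norm x \<le> nrm x" "\<And>x. nrm x \<le> C * norm x"
proof -
  obtain B1 :: "'ue set" where B1: "findim B1" by (rule U.findim)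
  have cs: "compact (sphere (0::'ue) 1)"
  proof (rule findim.compact_closed_bounded[OF B1])
    show "closed (sphere (0::'ue) 1)" unfolding sphere_def by (intro closed_Collect_eq continuous_intros)
    show "bounded (sphere (0::'ue) 1)" by (rule bounded_subset[OF bounded_cball[of 0 1]]) auto
  qed
  have "\<exists>c>0. \<forall>x\<in>sphere 0 1. c \<le> nrm x"
  proof (cases "sphere (0::'ue) 1 = {}")
    case True then show ?thesis by (auto intro: exI[of _ 1])
  next
    case False
    obtain x where "x \<in> sphere 0 1" "\<And>y. y \<in> sphere 0 1 \<Longrightarrow> nrm x \<le> nrm y"
      using continuous_attains_inf[OF cs False continuous_nrm] by blast
    moreover then have "nrm x > 0" by (intro nrm_pos) auto
    ultimately show ?thesis by blast
  qed
  then obtain c where c: "c > 0" "\<And>x. x \<in> sphere 0 1 \<Longrightarrow> c \<le> nrm x" by blast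
  obtain K where K: "K > 0" "\<And>x y. norm (ip x y) \<le> norm x * norm y * K"
    using bounded_bilinear.pos_bounded[OF bounded_bilinear_ip] by blast
  show ?thesis
  proof (rule that[OF c(1), of "sqrt K"])
    show "sqrt K > 0" using K by simp
    fix x
    show "c * norm x \<le> nrm x"
    proof (cases "x = 0")
      case False
      have "c \<le> nrm ((1 / norm x) *\<^sub>R x)" by (rule c(2)) (use False in simp)
      then show ?thesis using False by (simp add: nrm_scaleR pos_le_divide_eq mult.commute)
    qed simp
    have "ip x x \<le> (norm x)\<^sup>2 * K" using K(2)[of x x] by (simp add: power2_eq_square)
    then have "nrm x \<le> sqrt ((norm x)\<^sup>2 * K)" unfolding nrm_def by (rule real_sqrt_le_mono)
    then show "nrm x \<le> sqrt K * norm x" by (simp add: real_sqrt_mult mult.commute)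
  qed
qed

lemma nrm_Xi: "nrm (Xi h) = nrm (px h)"
  by (simp add: Xi_def)

text \<open>The three properties of \<open>Dx\<close> come from the Jacobi field \<open>p\<close>, which solves \<open>p'' = - (ad x)\<^sup>2 p\<close>.\<close>

definition jac :: "'ue \<Rightarrow> 'ue \<Rightarrow> real \<Rightarrow> 'ue" where "jac x v r = im (B (r *\<^sub>R x) (r *\<^sub>R v))"
definition jac' :: "'ue \<Rightarrow> 'ue \<Rightarrow> real \<Rightarrow> 'ue" where "jac' x v r = v + bracket U A x (re (B (r *\<^sub>R x) (r *\<^sub>R v)))"

lemma jac_zero [simp]: "jac x v 0 = 0" and jac'_zero: "jac' x v 0 = v"
  by (simp_all add: jac_def jac'_def linear_0[OF linear_B] linear_0[OF linear_im] linear_0[OF linear_re] U.bracket_simps)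

lemma jac_derivative: "(jac x v has_vector_derivative jac' x v r) (at r)"
  unfolding jac_def[abs_def] jac'_def by (rule B_im_derivative)

lemma bounded_linear_bracket: "bounded_linear (bracket U A x)"
  using U.findim findim.linear_bounded U.linear_bracket_right by metis

lemma jac'_derivative: "(jac' x v has_vector_derivative - bracket U A x (bracket U A x (jac x v r))) (at r)"
proof -
  have "((\<lambda>r. v + bracket U A x (re (B (r *\<^sub>R x) (r *\<^sub>R v)))) has_vector_derivative
     0 + bracket U A x (- bracket U A x (im (B (r *\<^sub>R x) (r *\<^sub>R v))))) (at r)"
    by (intro has_vector_derivative_add has_vector_derivative_const
        bounded_linear.has_vector_derivative[OF bounded_linear_bracket B_re_derivative])
  then show ?thesis by (simp add: jac'_def[abs_def] jac_def U.bracket_simps)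
qed

lemma Dx_jac:
  fixes h b defines "x \<equiv> px h" and "v \<equiv> dpx h (j (i b))"
  shows "Dx h b = Ad U A (pu h) (jac' x v 1)" "b = Ad U A (pu h) (jac x v 1)"
  using Dx_eq[where h = h and b = b] by (simp_all add: jac_def jac'_def x_def v_def)

lemma derivative_nonneg_le:
  assumes "\<And>r. ((f :: real \<Rightarrow> real) has_real_derivative f' r) (at r)" "\<And>r. f' r \<ge> 0"
  shows "f 0 \<le> f 1"
  by (rule DERIV_nonneg_imp_nondecreasing[of 0 1]) (use assms in auto)

text \<open>In a direction n' commuting with x the Jacobi field p has constant derivative <v, n'>.
  As p(0) = 0, the components of p(1) and p'(1) along n' coincide.\<close>

lemma Dx_centralizer:
  assumes "bracket U A (Xi h) n = 0"
  shows "ip (Dx h b) n = ip b n"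
proof -
  define x where "x = px h"
  define v where "v = dpx h (j (i b))"
  define n' where "n' = Ad U A (inv\<^bsub>U\<^esub> pu h) n"
  have n: "n = Ad U A (pu h) n'" by (simp add: n'_def)
  have "Ad U A (pu h) (bracket U A x n') = 0" using assms by (simp add: n Xi_def x_def U.Ad_bracket)
  then have "Ad U A (inv\<^bsub>U\<^esub> pu h) (Ad U A (pu h) (bracket U A x n')) = 0" by (simp only: linear_0[OF U.linear_Ad])
  then have xn: "bracket U A x n' = 0" by simp
  have "ip (jac' x v r) n' = ip v n'" for r by (simp add: jac'_def ip_simps ip_skew xn)
  moreover have "((\<lambda>r. ip (jac x v r) n') has_real_derivative ip (jac' x v r) n') (at r)" for r
    using ip_derivative[OF jac_derivative[of x v r] has_vector_derivative_const[of n']] by (simp add: ip_simps)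
  ultimately have d: "((\<lambda>r. ip (jac x v r) n' - r * ip v n') has_real_derivative 0) (at r)" for r
    by (auto intro!: derivative_eq_intros)
  have "ip (jac x v 1) n' = ip v n'"
    using DERIV_const_ratio_const[of 0 1 "\<lambda>r. ip (jac x v r) n' - r * ip v n'" 0] d by (simp add: ip_simps)
  then show ?thesis
    using Dx_jac[where h = h and b = b] \<open>\<And>r. ip (jac' x v r) n' = ip v n'\<close>[of 1] n
    by (metis ip_Ad x_def v_def)
qed

text \<open>Nonpositive curvature. For w = p(1) the function <p', p> - 2 <w, p> + r |w|^2 vanishes
  at 0, has derivative |[x, p]|^2 + |p' - w|^2, and takes the value <p'(1), w> - |w|^2 at 1.\<close>

lemma Dx_positive: "ip (Dx h b) b \<ge> ip b b"
proof -
  define x where "x = px h"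
  define v where "v = dpx h (j (i b))"
  let ?p = "jac x v" and ?p' = "jac' x v"
  define w where "w = ?p 1"
  have "0 \<le> ip (?p' 1) (?p 1) - 2 * ip w (?p 1) + 1 * ip w w"
  proof -
    have d: "((\<lambda>r. ip (?p' r) (?p r) - 2 * ip w (?p r) + r * ip w w) has_real_derivative
       (ip (?p' r) (?p' r) + ip (- bracket U A x (bracket U A x (?p r))) (?p r)) - 2 * (ip w (?p' r) + ip 0 (?p r)) + ip w w) (at r)" for r
      by (intro DERIV_add DERIV_diff ip_derivative jac'_derivative jac_derivative DERIV_cmult has_vector_derivative_const)
        (auto intro!: derivative_eq_intros)
    have e: "(ip (?p' r) (?p' r) + ip (- bracket U A x (bracket U A x (?p r))) (?p r)) - 2 * (ip w (?p' r) + ip 0 (?p r)) + ip w w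
      = ip (bracket U A x (?p r)) (bracket U A x (?p r)) + ip (?p' r - w) (?p' r - w)" for r
      by (simp add: ip_simps ip_skew ip_sym[of "?p' r" w])
    show ?thesis
      using derivative_nonneg_le[OF DERIV_cong[OF d e]] ip_nonneg by (simp add: ip_simps(9,10))
  qed
  then have "ip w w \<le> ip (?p' 1) w" by (simp add: w_def)
  then show ?thesis using Dx_jac[where h = h and b = b] by (metis ip_Ad x_def v_def w_def)
qed

text \<open>Plurisubharmonicity of the squared distance. For the Jacobi fields p, q with end values
  a, b up to Ad, the function <p', p> + <q', q> - 2 <[x, p], q> vanishes at 0, and its derivative is
  |p' + [x, q]|^2 + |q' - [x, p]|^2.\<close>

lemma Dx_psh: "ip (Dx h a) a + ip (Dx h b) b \<ge> 2 * ip (Xi h) (bracket U A a b)"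
proof -
  define x where "x = px h"
  define v where "v = dpx h (j (i a))"
  define w where "w = dpx h (j (i b))"
  let ?p = "jac x v" and ?p' = "jac' x v" and ?q = "jac x w" and ?q' = "jac' x w"
  let ?f = "\<lambda>r. ip (?p' r) (?p r) + ip (?q' r) (?q r) - 2 * ip (bracket U A x (?p r)) (?q r)"
  have d: "(?f has_real_derivative
     (ip (?p' r) (?p' r) + ip (- bracket U A x (bracket U A x (?p r))) (?p r)) +
     (ip (?q' r) (?q' r) + ip (- bracket U A x (bracket U A x (?q r))) (?q r)) -
     2 * (ip (bracket U A x (?p r)) (?q' r) + ip (bracket U A x (?p' r)) (?q r))) (at r)" for r
    by (intro DERIV_add DERIV_diff ip_derivative jac'_derivative jac_derivative DERIV_cmult
        bounded_linear.has_vector_derivative[OF bounded_linear_bracket])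
  have e: "(ip (?p' r) (?p' r) + ip (- bracket U A x (bracket U A x (?p r))) (?p r)) +
     (ip (?q' r) (?q' r) + ip (- bracket U A x (bracket U A x (?q r))) (?q r)) -
     2 * (ip (bracket U A x (?p r)) (?q' r) + ip (bracket U A x (?p' r)) (?q r))
     = ip (?p' r + bracket U A x (?q r)) (?p' r + bracket U A x (?q r)) +
       ip (?q' r - bracket U A x (?p r)) (?q' r - bracket U A x (?p r))" for r
    using ip_skew[of x "?p' r" "?q r"]
    by (simp add: ip_simps ip_skew[of x "bracket U A x _"] ip_sym[of "bracket U A x (?p r)" "?q' r"] ip_sym[of "bracket U A x (?q r)" "?p' r"])
  have "0 \<le> ?f 1"
    using derivative_nonneg_le[OF DERIV_cong[OF d e]] ip_nonneg by (simp add: ip_simps(9,10) U.bracket_simps)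
  then have "2 * ip (bracket U A x (?p 1)) (?q 1) \<le> ip (?p' 1) (?p 1) + ip (?q' 1) (?q 1)" by simp
  moreover have "ip (bracket U A x (?p 1)) (?q 1) = ip x (bracket U A (?p 1) (?q 1))"
    using ip_skew[of "?p 1" x "?q 1"] U.bracket_antisym[of x "?p 1"] by (simp add: ip_simps)
  moreover have "ip x (bracket U A (?p 1) (?q 1)) = ip (Xi h) (bracket U A a b)"
    using Dx_jac(2)[where h = h and b = a] Dx_jac(2)[where h = h and b = b]
    by (metis Xi_def U.Ad_bracket ip_Ad x_def v_def w_def)
  moreover have "ip (?p' 1) (?p 1) = ip (Dx h a) a" "ip (?q' 1) (?q 1) = ip (Dx h b) b"
    using Dx_jac[where h = h and b = a] Dx_jac[where h = h and b = b] by (metis ip_Ad x_def v_def w_def)+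
  ultimately show ?thesis by simp
qed

end

section \<open>Invariant inner products\<close>

context lie_group
begin

lemma compact_orbit_bounds:
  assumes "compact (UNIV :: 'u set)" "continuous_on UNIV (f :: 'u \<Rightarrow> real)"
  obtains u v where "\<And>w. f u \<le> f w" "\<And>w. f w \<le> f v"
proof -
  have ne: "(UNIV :: 'u set) \<noteq> {}" by simp
  show ?thesis
    using continuous_attains_inf[OF assms(1) ne assms(2)] continuous_attains_sup[OF assms(1) ne assms(2)] that by blast
qed

text \<open>A symmetric form is represented by a function of pairs. The invariant form is the minimizer of the strictly convex
  invariant function \<open>q \<mapsto> sup\<^sub>u S (q \<circ> Ad u)\<close> on a compact convex invariant set of forms, which is unique.\<close>

lemma invariant_form_exists:
  assumes cU: "compact (UNIV :: 'u set)"
  shows "\<exists>ip :: 'ue \<Rightarrow> 'ue \<Rightarrow> real. bilinear ip \<and> (\<forall>x y. ip x y = ip y x) \<and> (\<forall>x. x \<noteq> 0 \<longrightarrow> ip x x > 0) \<and>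
    (\<forall>u x y. ip (Ad U A u x) (Ad U A u y) = ip x y)"
proof -
  obtain B :: "'ue set" where B: "findim B" by (rule findim)
  interpret findim B by fact
  let ?r = "representation B"
  define ip0 where "ip0 = (\<lambda>x y. \<Sum>b\<in>B. ?r x b * ?r y b)"
  have bil0: "bilinear ip0"
    unfolding bilinear_def ip0_def
    by (intro conjI allI linearI)
      (simp_all add: linear_add[OF linear_representation] linear_cmul[OF linear_representation] algebra_simps sum.distrib sum_distrib_left)
  have sym0: "ip0 x y = ip0 y x" for x y by (simp add: ip0_def mult.commute)
  have pos0: "ip0 x x > 0" if "x \<noteq> 0" for x
  proof -
    have "ip0 x x \<ge> 0" unfolding ip0_def by (intro sum_nonneg) auto
    moreover have "ip0 x x \<noteq> 0"
    proof
      assume "ip0 x x = 0"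
      then have "\<And>b. b \<in> B \<Longrightarrow> ?r x b = 0" unfolding ip0_def using finite_B by (subst (asm) sum_nonneg_eq_0_iff) auto
      then show False using sum_representation[of x] that by simp
    qed
    ultimately show ?thesis by simp
  qed
  have contq: "continuous_on UNIV (\<lambda>u. q (Ad U A u x) (Ad U A u y))" if "bilinear q" for q :: "'ue \<Rightarrow> 'ue \<Rightarrow> real" and x y
    by (rule bounded_bilinear.continuous_on[OF bilinear_bounded_bilinear[OF that]]) (rule continuous_Ad)+
  define N where "N = (\<lambda>x u. ip0 (Ad U A u x) (Ad U A u x))"
  have cN: "continuous_on UNIV (N x)" for x unfolding N_def by (rule contq[OF bil0])
  have "\<exists>u v. \<forall>w. N x u \<le> N x w \<and> N x w \<le> N x v" for x
    using compact_orbit_bounds[OF cU cN[of x]] by metis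
  then obtain lu hu where lh: "\<And>x w. N x (lu x) \<le> N x w" "\<And>x w. N x w \<le> N x (hu x)" by metis
  \<comment> \<open>The extremes of \<open>ip0\<close> along the orbit of x. The conditions lo <= q
    <= hi are invariant and convex, bound q, and force positive definiteness because
    \<open>lo\<close> is positive away from 0.\<close>
  define lo where "lo = (\<lambda>x. N x (lu x))"
  define hi where "hi = (\<lambda>x. N x (hu x))"
  have N_Ad: "N (Ad U A v x) w = N x (w \<otimes> v)" for v x w by (simp add: N_def Ad_mult)
  have inv_lo: "lo (Ad U A v x) = lo x" for v x
  proof (rule antisym)
    show "lo (Ad U A v x) \<le> lo x"
      using lh(1)[of "Ad U A v x" "lu x \<otimes> inv v"] by (simp add: lo_def N_Ad m_assoc)
    show "lo x \<le> lo (Ad U A v x)" using lh(1)[of x "lu (Ad U A v x) \<otimes> v"] by (simp add: lo_def N_Ad)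
  qed
  have inv_hi: "hi (Ad U A v x) = hi x" for v x
  proof (rule antisym)
    show "hi x \<le> hi (Ad U A v x)"
      using lh(2)[where x = "Ad U A v x" and w = "hu x \<otimes> inv v"] by (simp add: hi_def N_Ad m_assoc)
    show "hi (Ad U A v x) \<le> hi x" using lh(2)[where x = x and w = "hu (Ad U A v x) \<otimes> v"] by (simp add: hi_def N_Ad)
  qed
  have lo_pos: "lo x > 0" if "x \<noteq> 0" for x
  proof -
    have "Ad U A u x \<noteq> 0" for u using that Ad_inv_cancel(1)[of u x] linear_0[OF linear_Ad] by metis
    then show ?thesis unfolding lo_def N_def by (intro pos0)
  qed
  \<comment> \<open>By polarization the bound on the diagonal bounds all values of q, which puts
    \<open>C\<close> inside a compact product of intervals.\<close>
  define K where "K = (\<lambda>x y. (hi (x + y) + hi (x - y)) / 4)"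
  define C where "C = {q. bilinear (\<lambda>x y. q (x, y)) \<and> (\<forall>x y. q (x, y) = q (y, x)) \<and> (\<forall>x. lo x \<le> q (x, x) \<and> q (x, x) \<le> hi x)}"
  define act where "act = (\<lambda>(q :: 'ue \<times> 'ue \<Rightarrow> real) u (x, y). q (Ad U A u x, Ad U A u y))"
  define S where "S = (\<lambda>q :: 'ue \<times> 'ue \<Rightarrow> real. \<Sum>a\<in>B. \<Sum>b\<in>B. (q (a, b))\<^sup>2)"
  have Cb: "bilinear (\<lambda>x y. q (x, y))" "q (x, y) = q (y, x)" "lo x \<le> q (x, x)" "q (x, x) \<le> hi x" if "q \<in> C" for q x y
    using that by (auto simp: C_def)
  have lin: "linear (\<lambda>x. q (x, y))" "linear (\<lambda>y. q (x, y))" if "bilinear (\<lambda>x y. q (x, y))" for q :: "'ue \<times> 'ue \<Rightarrow> real" and x y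
    using that by (auto simp: bilinear_def)
  have lo_nonneg: "lo x \<ge> 0" for x
  proof (cases "x = 0")
    case True then show ?thesis using linear_0[OF linear_Ad] linear_representation by (simp add: lo_def N_def ip0_def sum_nonneg)
  qed (use lo_pos in \<open>auto intro: less_imp_le\<close>)
  have bound: "\<bar>q (x, y)\<bar> \<le> K x y" if q: "q \<in> C" for q x y
  proof -
    note l = lin[OF Cb(1)[OF q]]
    have "q (x + y, x + y) - q (x - y, x - y) = 4 * q (x, y)"
      using Cb(2)[OF q, of y x] by (simp add: linear_add[OF l(1)] linear_add[OF l(2)] linear_diff[OF l(1)] linear_diff[OF l(2)])
    moreover have "0 \<le> q (x + y, x + y)" "0 \<le> q (x - y, x - y)"
      using order_trans[OF lo_nonneg Cb(3)[OF q]] by auto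
    moreover have "q (x + y, x + y) \<le> hi (x + y)" "q (x - y, x - y) \<le> hi (x - y)" using Cb(4)[OF q] by auto
    ultimately show ?thesis by (simp add: K_def abs_le_iff)
  qed
  have actC: "act q u \<in> C" if q: "q \<in> C" for q u
  proof -
    have "bilinear (\<lambda>x y. act q u (x, y))"
      using lin[OF Cb(1)[OF q]] linear_Ad[of u] by (auto simp: bilinear_def act_def intro: linear_compose[unfolded o_def])
    then show ?thesis using Cb(2-4)[OF q] inv_lo inv_hi by (simp add: C_def act_def) metis
  qed
  have act_act: "act (act q u) v = act q (u \<otimes> v)" for q u v by (auto simp: act_def Ad_mult)
  have evc: "continuous_on T (\<lambda>q. q z)" for z :: "'ue \<times> 'ue" and T :: "('ue \<times> 'ue \<Rightarrow> real) set"
    by (rule continuous_on_subset[OF continuous_on_product_coordinates]) auto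
  have compC: "compact C"
  proof -
    have "C \<subseteq> PiE UNIV (\<lambda>z. {-K (fst z) (snd z)..K (fst z) (snd z)})"
    proof
      fix q assume q: "q \<in> C"
      have "q z \<in> {-K (fst z) (snd z)..K (fst z) (snd z)}" for z
        using bound[OF q, of "fst z" "snd z"] by (simp add: abs_le_iff)
      then show "q \<in> PiE UNIV (\<lambda>z. {-K (fst z) (snd z)..K (fst z) (snd z)})" by (auto simp: PiE_iff)
    qed
    moreover have "compact (PiE UNIV (\<lambda>z::'ue \<times> 'ue. {-K (fst z) (snd z)..K (fst z) (snd z)}))"
      using compactin_PiE[of "\<lambda>_. euclidean" UNIV "\<lambda>z::'ue \<times> 'ue. {-K (fst z) (snd z)..K (fst z) (snd z)}"]
      by (simp add: euclidean_product_topology)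
    moreover have "closed C"
    proof -
      have "C = {q. (\<forall>x x' y. q (x + x', y) = q (x, y) + q (x', y)) \<and> (\<forall>k x y. q (k *\<^sub>R x, y) = k * q (x, y)) \<and>
         (\<forall>x y y'. q (x, y + y') = q (x, y) + q (x, y')) \<and> (\<forall>k x y. q (x, k *\<^sub>R y) = k * q (x, y)) \<and>
         (\<forall>x y. q (x, y) = q (y, x)) \<and> (\<forall>x. lo x \<le> q (x, x)) \<and> (\<forall>x. q (x, x) \<le> hi x)}"
        by (auto simp: C_def bilinear_def linear_iff)
      also have "closed \<dots>"
        by (intro closed_Collect_conj closed_Collect_all closed_Collect_eq closed_Collect_le continuous_intros evc)
      finally show ?thesis .
    qed
    ultimately show ?thesis using closed_Int_compact by (metis inf.absorb1)
  qed
  have q0C: "(\<lambda>(x, y). ip0 x y) \<in> C"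
    using bil0 sym0 lh(1)[of _ \<one>] lh(2)[where w = \<one>] by (auto simp: C_def lo_def hi_def N_def)
  define KS where "KS = (\<Sum>a\<in>B. \<Sum>b\<in>B. (K a b)\<^sup>2)"
  have Sb: "0 \<le> S q" "q \<in> C \<Longrightarrow> S q \<le> KS" for q
  proof -
    show "0 \<le> S q" by (simp add: S_def sum_nonneg)
    assume q: "q \<in> C"
    show "S q \<le> KS" unfolding S_def KS_def
      by (intro sum_mono) (use bound[OF q] in \<open>auto simp: abs_le_square_iff[symmetric] intro: order_trans[OF _ abs_ge_self]\<close>)
  qed
  define R where "R = {r. \<exists>q\<in>C. \<forall>u. S (act q u) \<le> r}"
  have Rne: "KS \<in> R" using q0C Sb(2) actC by (auto simp: R_def)
  have Rbd: "bdd_below R" by (rule bdd_belowI[of _ 0]) (use order_trans[OF Sb(1)] in \<open>auto simp: R_def\<close>)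
  define m where "m = Inf R"
  define F where "F = (\<lambda>n::nat. C \<inter> {q. \<forall>u. S (act q u) \<le> m + 1 / real (Suc n)})"
  have cS: "continuous_on T (\<lambda>q. S (act q u))" for T u
    unfolding S_def act_def by (simp, intro continuous_intros evc)
  have Fne: "F n \<noteq> {}" for n
  proof -
    have "Inf R < m + 1 / real (Suc n)" by (simp add: m_def)
    then obtain r where "r \<in> R" "r < m + 1 / real (Suc n)" using cInf_less_iff[of R] Rne Rbd by blast
    moreover obtain q where "q \<in> C" "\<And>u. S (act q u) \<le> r" using \<open>r \<in> R\<close> by (auto simp: R_def)
    ultimately have "q \<in> F n" unfolding F_def using order_trans less_imp_le by blast
    then show ?thesis by blast
  qed
  have Fmono: "F k \<subseteq> F n" if "n \<le> k" for n k
  proof -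
    have "1 / real (Suc k) \<le> 1 / real (Suc n)" using that by (simp add: frac_le)
    then show ?thesis by (auto simp: F_def intro: order_trans[OF _ add_left_mono])
  qed
  define G where "G = (\<lambda>n::nat. {q. \<forall>u. S (act q u) \<le> m + 1 / real (Suc n)})"
  have "C \<inter> (\<Inter>n\<in>UNIV. G n) \<noteq> {}"
  proof (rule compact_imp_fip_image[OF compC])
    show "closed (G n)" for n unfolding G_def
      by (intro closed_Collect_all closed_Collect_le continuous_intros cS)
    fix I :: "nat set" assume I: "finite I" "I \<subseteq> UNIV"
    have "F (Max (insert 0 I)) \<subseteq> C \<inter> (\<Inter>n\<in>I. G n)"
    proof
      fix q assume q: "q \<in> F (Max (insert 0 I))"
      have "q \<in> F n" if "n \<in> I" for n
        using Fmono[of n "Max (insert 0 I)"] that I(1) q by (auto intro: Max_ge)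
      then show "q \<in> C \<inter> (\<Inter>n\<in>I. G n)" using q by (auto simp: F_def G_def)
    qed
    then show "C \<inter> (\<Inter>n\<in>I. G n) \<noteq> {}" using Fne by blast
  qed
  then have "\<exists>q. \<forall>n. q \<in> F n" by (auto simp: F_def G_def)
  then obtain q where "\<And>n. q \<in> F n" by blast
  then have q: "q \<in> C" "\<And>u n. S (act q u) \<le> m + 1 / real (Suc n)" by (auto simp: F_def)
  have qm: "S (act q u) \<le> m" for u
  proof (rule field_le_epsilon)
    fix e :: real assume "e > 0"
    then obtain n where "1 / real (Suc n) < e" using nat_approx_posE by blast
    then show "S (act q u) \<le> m + e" using q(2)[of u n] by linarith
  qed
  have uniq: "q1 = q2" if q1: "q1 \<in> C" "\<And>u. S (act q1 u) \<le> m" and q2: "q2 \<in> C" "\<And>u. S (act q2 u) \<le> m" for q1 q2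
  proof (rule ccontr)
    assume ne: "q1 \<noteq> q2"
    define d where "d = (\<lambda>z. q1 z - q2 z)"
    have bd: "bilinear (\<lambda>x y. d (x, y))"
      using lin[OF Cb(1)[OF q1(1)]] lin[OF Cb(1)[OF q2(1)]] by (auto simp: bilinear_def d_def intro: linear_compose_sub)
    have cont: "continuous_on UNIV (\<lambda>u. S (act d u))"
      unfolding S_def act_def by (simp, intro continuous_intros contq[OF bd])
    obtain u0 where u0: "\<And>w. S (act d u0) \<le> S (act d w)" using compact_orbit_bounds[OF cU cont] by metis
    have "S (act d u0) \<noteq> 0"
    proof
      assume "S (act d u0) = 0"
      then have z: "d (Ad U A u0 a, Ad U A u0 b) = 0" if "a \<in> B" "b \<in> B" for a b
        using that finite_B by (simp add: S_def act_def sum_nonneg_eq_0_iff sum_nonneg)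
      have lA: "linear (\<lambda>x. d (Ad U A u0 x, y))" "linear (\<lambda>y. d (x, Ad U A u0 y))" for x y
        using bd linear_Ad[of u0] by (auto simp: bilinear_def intro: linear_compose[unfolded o_def])
      have z2: "d (Ad U A u0 x, Ad U A u0 y) = 0" for x y
        by (subst linear_expand[OF lA(1)], subst linear_expand[OF lA(2)]) (simp add: z)
      have "d (x, y) = 0" for x y using z2[of "Ad U A (inv u0) x" "Ad U A (inv u0) y"] by simp
      then show False using ne by (auto simp: d_def fun_eq_iff)
    qed
    then have dpos: "S (act d u0) > 0" using Sb(1)[of "act d u0"] by simp
    \<comment> \<open>By the parallelogram identity the midpoint of two minimizers lowers
      \<open>S\<close> by a quarter of its value on their difference, and that value has a positive
      minimum over the compact group. The supremum for the midpoint would lie below m.\<close>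
    define mid where "mid = (\<lambda>z. (1/2) * (q1 z + q2 z))"
    have "mid \<in> C"
    proof -
      note l1 = lin[OF Cb(1)[OF q1(1)]] and l2 = lin[OF Cb(1)[OF q2(1)]]
      have "bilinear (\<lambda>x y. mid (x, y))"
        unfolding bilinear_def mid_def
        by (intro conjI allI linearI)
          (simp_all add: linear_add[OF l1(1)] linear_add[OF l1(2)] linear_add[OF l2(1)] linear_add[OF l2(2)]
            linear_cmul[OF l1(1)] linear_cmul[OF l1(2)] linear_cmul[OF l2(1)] linear_cmul[OF l2(2)] distrib_left add_divide_distrib)
      moreover have "lo x \<le> mid (x, x)" "mid (x, x) \<le> hi x" "mid (x, y) = mid (y, x)" for x y
        using Cb(2)[OF q1(1), of x y] Cb(2)[OF q2(1), of x y] Cb(3)[OF q1(1), of x] Cb(3)[OF q2(1), of x]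
          Cb(4)[OF q1(1), of x] Cb(4)[OF q2(1), of x] by (simp_all add: mid_def)
      ultimately show ?thesis by (simp add: C_def)
    qed
    moreover have "S (act mid u) \<le> m - S (act d u0) / 4" for u
    proof -
      have "S (act mid u) = S (act q1 u) / 2 + S (act q2 u) / 2 - S (act d u) / 4"
        unfolding S_def sum_divide_distrib sum.distrib[symmetric] sum_subtractf[symmetric]
        by (intro sum.cong refl) (simp add: act_def mid_def d_def power2_eq_square field_simps)
      then show ?thesis using q1(2)[of u] q2(2)[of u] u0[of u] by simp
    qed
    ultimately have "m - S (act d u0) / 4 \<in> R" by (auto simp: R_def)
    then have "m \<le> m - S (act d u0) / 4" unfolding m_def by (rule cInf_lower[OF _ Rbd])
    then show False using dpos by simp
  qed
  have inv: "act q v = q" for v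
    by (rule uniq) (use q(1) qm actC act_act in auto)
  show ?thesis
  proof (intro exI[of _ "\<lambda>x y. q (x, y)"] conjI allI impI)
    show "bilinear (\<lambda>x y. q (x, y))" by (rule Cb(1)[OF q(1)])
    show "q (x, y) = q (y, x)" for x y by (rule Cb(2)[OF q(1)])
    show "q (x, x) > 0" if "x \<noteq> 0" for x using lo_pos[OF that] Cb(3)[OF q(1), of x] by linarith
    show "q (Ad U A u x, Ad U A u y) = q (x, y)" for u x y using fun_cong[OF inv[of u], of "(x, y)"] by (simp add: act_def)
  qed
qed

end

context group_with_involution
begin

sublocale sig: lie_hom U A U A \<sigma>
  by unfold_locales (rule hom_\<sigma> smooth_\<sigma>)+

abbreviation s' :: "'ue \<Rightarrow> 'ue" where "s' \<equiv> lie_involution U A \<sigma>"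

lemma s'_d: "s' = tmap A A \<sigma> \<one>"
  by (simp add: lie_involution_def)

lemma linear_s': "linear s'" and s'_Ad: "s' (Ad U A g x) = Ad U A (\<sigma> g) (s' x)" and s'_ex: "\<sigma> (ex x t) = ex (s' x) t"
  and s'_bracket: "s' (bracket U A x y) = bracket U A (s' x) (s' y)"
  unfolding s'_d by (rule sig.linear sig.Ad sig.ex sig.bracket)+

lemma s'_s' [simp]: "s' (s' x) = x"
proof -
  have "mder A A (\<lambda>x. \<sigma> (\<sigma> x)) \<one> (\<lambda>v. s' (s' v))"
    unfolding s'_d by (rule mder_compose[OF charted charted sig.mder]) (use sig.mder[of \<one>] in \<open>simp add: sig.one\<close>)
  then have "mder A A (\<lambda>x. x) \<one> (\<lambda>v. s' (s' v))" by (simp add: \<sigma>_\<sigma>)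
  from mder_unique[OF this mder_ident[OF charted]] show ?thesis by meson
qed

text \<open>Average over the group of order two generated by the involution; invariance under Ad
  persists because the involution of the Lie algebra intertwines Ad u with Ad (\<sigma> u).\<close>

lemma invariant_form:
  obtains ip :: "'ue \<Rightarrow> 'ue \<Rightarrow> real" where "bilinear ip" "\<And>x y. ip x y = ip y x" "\<And>x. x \<noteq> 0 \<Longrightarrow> ip x x > 0"
    "\<And>u x y. ip (Ad U A u x) (Ad U A u y) = ip x y" "\<And>x y. ip (s' x) (s' y) = ip x y"
proof -
  obtain ip :: "'ue \<Rightarrow> 'ue \<Rightarrow> real" where *: "bilinear ip \<and> (\<forall>x y. ip x y = ip y x) \<and> (\<forall>x. x \<noteq> 0 \<longrightarrow> ip x x > 0) \<and>
    (\<forall>u x y. ip (Ad U A u x) (Ad U A u y) = ip x y)"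
    using invariant_form_exists[OF compact_U] by (rule exE)
  then have ip: "bilinear ip" "ip x y = ip y x" "x \<noteq> 0 \<Longrightarrow> ip x x > 0" "ip (Ad U A u x) (Ad U A u y) = ip x y" for u x y
    by auto
  show ?thesis
  proof (rule that[of "\<lambda>x y. ip x y + ip (s' x) (s' y)"])
    show "bilinear (\<lambda>x y. ip x y + ip (s' x) (s' y))"
    proof -
      have l: "linear (\<lambda>x. ip x y)" "linear (ip x)" for x y using ip(1) by (auto simp: bilinear_def)
      show ?thesis unfolding bilinear_def
        by (intro conjI allI linear_compose_add l linear_compose[OF linear_s' l(1), unfolded o_def]
            linear_compose[OF linear_s' l(2), unfolded o_def])
    qed
    show "ip x y + ip (s' x) (s' y) = ip y x + ip (s' y) (s' x)" for x y by (intro arg_cong2[of _ _ _ _ "(+)"] ip(2))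
    show "ip x x + ip (s' x) (s' x) > 0" if "x \<noteq> 0" for x
    proof -
      have "s' x \<noteq> 0" using that linear_0[OF linear_s'] s'_s' by metis
      then show ?thesis using ip(3)[OF that] ip(3)[of "s' x"] by simp
    qed
  qed (simp_all add: ip(4) s'_Ad add.commute)
qed

end

context inner_complexification
begin

lemma riesz:
  assumes "linear (f :: 'ue \<Rightarrow> real)"
  obtains y where "\<And>x. f x = ip y x"
proof -
  obtain B1 :: "'ue set" where B1: "findim B1" by (rule U.findim)
  interpret findim B1 by fact
  have lip: "linear (\<lambda>y. ip y x)" "linear (ip y)" for x y using bilinear_ip by (auto simp: bilinear_def)
  define T where "T = (\<lambda>y. \<Sum>b\<in>B1. ip y b *\<^sub>R b)"
  have lT: "linear T" unfolding T_def
    by (intro linear_compose_sum ballI linearI) (simp_all add: ip_simps algebra_simps)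
  have co: "ip y b = c b" if "T y = (\<Sum>b\<in>B1. c b *\<^sub>R b)" "b \<in> B1" for y b c
  proof -
    have r: "representation B1 (\<Sum>b\<in>B1. k b *\<^sub>R b) b = k b" for k
    proof -
      have "(\<Sum>b\<in>B1. k b *\<^sub>R b) = (\<Sum>b\<in>B1. (if b \<in> B1 then k b else 0) *\<^sub>R b)" by (intro sum.cong) auto
      then show ?thesis using representation_sum_eq[of "\<lambda>b. if b \<in> B1 then k b else 0"] that(2) by simp
    qed
    show ?thesis using that r[of "ip y"] r[of c] by (simp add: T_def)
  qed
  have "inj T"
  proof (rule linear_injective_0[OF lT, THEN iffD2], intro allI impI)
    fix y assume "T y = 0"
    then have b0: "ip y b = 0" if "b \<in> B1" for b using co[of y "\<lambda>_. 0" b] that by simp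
    have "ip y y = 0" by (subst linear_expand[OF lip(2)]) (simp add: b0)
    then show "y = 0" using ip_pos[of y] by auto
  qed
  then have "surj T" by (rule inj_imp_surj[OF lT])
  then obtain y where y: "T y = (\<Sum>b\<in>B1. f b *\<^sub>R b)" by (metis surjD)
  have "f x = ip y x" for x
    unfolding linear_expand[OF assms, of x] linear_expand[OF lip(2), of y x] by (simp add: co[OF y])
  then show ?thesis by (rule that)
qed

end

section \<open>The moment map along orbits of the complexified group\<close>

locale complex_hamiltonian =
  inner_complexification U A H AH JH \<iota> ip + ham: kaehler_hamiltonian_manifold U A \<sigma> AM \<omega> act \<tau> \<Phi> J
  for U :: "'u::{t2_space, second_countable_topology} monoid"
    and A :: "('u, 'ue::real_normed_vector) charts"
    and H :: "'h::{t2_space, second_countable_topology} monoid"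
    and AH :: "('h, 'he::real_normed_vector) charts" and JH :: "'h \<Rightarrow> 'he \<Rightarrow> 'he"
    and \<iota> :: "'u \<Rightarrow> 'h" and ip :: "'ue \<Rightarrow> 'ue \<Rightarrow> real" and \<sigma> :: "'u \<Rightarrow> 'u"
    and AM :: "('m::{t2_space, second_countable_topology}, 'me::real_normed_vector) charts"
    and \<omega> :: "'m \<Rightarrow> 'me \<Rightarrow> 'me \<Rightarrow> real"
    and act :: "'u \<Rightarrow> 'm \<Rightarrow> 'm" and \<tau> :: "'m \<Rightarrow> 'm" and \<Phi> :: "'m \<Rightarrow> ('ue \<Rightarrow>\<^sub>L real)"
    and J :: "'m \<Rightarrow> 'me \<Rightarrow> 'me" +
  fixes actC :: "'h \<Rightarrow> 'm \<Rightarrow> 'm"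
  assumes extends: "extends_action H AH JH \<iota> AM J act actC"
    and ip_involution: "ip (lie_involution U A \<sigma> x) (lie_involution U A \<sigma> y) = ip x y"
begin

abbreviation s' :: "'ue \<Rightarrow> 'ue" where "s' \<equiv> lie_involution U A \<sigma>"

lemma actC_mult: "actC (g \<otimes>\<^bsub>H\<^esub> h) y = actC g (actC h y)"
  using extends group_action.composition_rule[of H UNIV actC y g h] by (simp add: extends_action_def)

lemma actC_one [simp]: "actC \<one>\<^bsub>H\<^esub> y = y"
  using extends group_action.id_eq_one[of H UNIV actC] by (auto simp: extends_action_def fun_eq_iff dest: spec[of _ y])

lemma actC_\<iota>: "actC (\<iota> u) y = act u y"
  using extends by (simp add: extends_action_def)

lemma actC_holomorphic: "holomorphic_map (prod_charts AH AM) (prod_J JH J) AM J (\<lambda>(g, m). actC g m)"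
  using extends by (simp add: extends_action_def)

lemma charted_HM: "charted (prod_charts AH AM)"
  by (intro charted_prod H.charted ham.M.charted)

lemma mder_actC: "mder (prod_charts AH AM) AM (\<lambda>(g, m). actC g m) z (tmap (prod_charts AH AM) AM (\<lambda>(g, m). actC g m) z)"
  by (rule smooth_map_on_mder[OF charted_HM ham.M.charted])
    (use actC_holomorphic in \<open>auto simp: holomorphic_map_on_def\<close>)

lemma smooth_actC_maps:
  fixes D :: "('d::t2_space, 'de::real_normed_vector) charts"
  assumes "charted D" "open S" "smooth_map_on D AH S f" "smooth_map_on D AM S g"
  shows "smooth_map_on D AM S (\<lambda>x. actC (f x) (g x))"
proof -
  obtain B1 :: "'he set" where B1: "findim B1" by (rule H.findim)
  obtain B2 :: "'me set" where B2: "findim B2" by (rule ham.M.findim)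
  obtain B3 :: "('he \<times> 'me) set" where B3: "findim B3" using findim_prod[OF B1 B2] .
  have "smooth_map_on D AM S (\<lambda>x. (\<lambda>(g, m). actC g m) (f x, g x))"
    by (rule smooth_map_on_compose[OF assms(1) charted_HM ham.M.charted B3 
          smooth_map_on_Pair[OF assms(1) H.charted ham.M.charted assms(3,4,2)] _ assms(2) open_UNIV])
      (use actC_holomorphic in \<open>auto simp: holomorphic_map_on_def\<close>)
  then show ?thesis by simp
qed

definition XM :: "'he \<Rightarrow> 'm \<Rightarrow> 'me" where
  "XM X y = tmap AH AM (\<lambda>g. actC g y) \<one>\<^bsub>H\<^esub> X"

lemma mder_orbit: "mder AH AM (\<lambda>g. actC g y) g (\<lambda>v. tmap (prod_charts AH AM) AM (\<lambda>(g, m). actC g m) (g, y) (v, 0))"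
  using mder_compose[OF H.charted charted_HM mder_Pair[OF mder_ident[OF H.charted] mder_const[OF H.charted]] mder_actC, of y g] by simp

lemma XM_eq: "XM X y = tmap (prod_charts AH AM) AM (\<lambda>(g, m). actC g m) (\<one>\<^bsub>H\<^esub>, y) (X, 0)"
  unfolding XM_def mder_tmap[OF mder_orbit] by simp

lemma mder_XM: "mder AH AM (\<lambda>g. actC g y) \<one>\<^bsub>H\<^esub> (\<lambda>X. XM X y)"
  unfolding XM_eq by (rule mder_orbit)

lemma linear_XM: "linear (\<lambda>X. XM X y)"
  by (rule mder_linear[OF mder_XM])

lemma XM_j: "XM (j X) y = J y (XM X y)"
proof -
  have "tmap (prod_charts AH AM) AM (\<lambda>(g, m). actC g m) (\<one>\<^bsub>H\<^esub>, y) (prod_J JH J (\<one>\<^bsub>H\<^esub>, y) (X, 0))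
    = J (actC \<one>\<^bsub>H\<^esub> y) (tmap (prod_charts AH AM) AM (\<lambda>(g, m). actC g m) (\<one>\<^bsub>H\<^esub>, y) (X, 0))"
    using actC_holomorphic[unfolded holomorphic_map_on_def, THEN conjunct2, rule_format, of "(\<one>\<^bsub>H\<^esub>, y)" "(X, 0)"] by simp
  then show ?thesis by (simp add: XM_eq prod_J_def linear_0[OF ham.M.linear_J])
qed

lemma vel_orbit:
  assumes "dlog H AH c s X"
  shows "vel AM (\<lambda>r. actC (c r) y) s (XM X (actC (c s) y))"
proof -
  have "vel AM (\<lambda>r. actC (c r \<otimes>\<^bsub>H\<^esub> inv\<^bsub>H\<^esub> c s) (actC (c s) y)) s (XM X (actC (c s) y))"
    by (rule vel_compose[OF H.charted assms[unfolded dlog_def]]) (simp add: mder_XM)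
  then show ?thesis by (simp add: actC_mult[symmetric] H.m_assoc)
qed

lemma induced_field_XM: "induced_field U A AM act a y = XM (i a) y"
proof -
  have "vel AM (\<lambda>r. actC (\<iota> (U.ex a r)) y) 0 (XM (i a) (actC (\<iota> (U.ex a 0)) y))"
    by (rule vel_orbit[OF iota.dlog[OF U.dlog_ex]])
  then have "vel AM (\<lambda>r. act (lie_exp U A (r *\<^sub>R a)) y) 0 (XM (i a) y)"
    by (simp add: actC_\<iota> U.ex_def[symmetric]) (simp add: actC_\<iota>[symmetric] iota.one)
  then show ?thesis unfolding induced_field_def by (rule vel_velocity)
qed

lemma mder_Phi: "mder AM vspace (\<lambda>m. blinfun_apply (\<Phi> m) x) y (\<lambda>v. \<omega> y (XM (i x) y) v)"
proof -
  have D: "mder AM vspace \<Phi> y (tmap AM vspace \<Phi> y)"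
    by (rule smooth_map_on_mder[OF ham.M.charted charted_vspace ham.smooth_\<Phi>]) auto
  have "mder vspace vspace (\<lambda>f. blinfun_apply f x) f (\<lambda>f. blinfun_apply f x)" for f :: "'ue \<Rightarrow>\<^sub>L real"
    using bounded_linear_imp_has_derivative[OF blinfun.bounded_linear_left[of x]]
      bounded_linear.isCont[OF blinfun.bounded_linear_left continuous_ident, of f x] by (simp add: mder_def)
  from mder_compose[OF ham.M.charted charted_vspace D this]
  have m: "mder AM vspace (\<lambda>m. blinfun_apply (\<Phi> m) x) y (\<lambda>v. blinfun_apply (tmap AM vspace \<Phi> y v) x)" .
  from mder_tmap[OF this] ham.moment_\<Phi>[of x y]
  have "(\<lambda>v. blinfun_apply (tmap AM vspace \<Phi> y v) x) = (\<lambda>v. \<omega> y (XM (i x) y) v)"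
    by (simp add: fun_eq_iff induced_field_XM)
  then show ?thesis using m by simp
qed

lemma Phi_derivative:
  assumes "dlog H AH c s X"
  shows "((\<lambda>r. blinfun_apply (\<Phi> (actC (c r) y)) x) has_real_derivative
     \<omega> (actC (c s) y) (XM (i x) (actC (c s) y)) (XM X (actC (c s) y))) (at s)"
  using vel_compose[OF ham.M.charted vel_orbit[OF assms, of y] mder_Phi[of x]]
  by (simp add: vel_vspace has_real_derivative_iff_has_vector_derivative)

definition sharp :: "('ue \<Rightarrow> real) \<Rightarrow> 'ue" where
  "sharp f = (SOME y. \<forall>x. f x = ip y x)"

lemma ip_sharp: "linear f \<Longrightarrow> ip (sharp f) x = f x"
  unfolding sharp_def using riesz[of f] someI_ex[of "\<lambda>y. \<forall>x. f x = ip y x"] by metis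

lemma ip_cancel: "(\<And>x. ip y x = ip z x) \<Longrightarrow> y = z"
  using ip_pos[of "y - z"] by (force simp: ip_simps)

lemma ip_coordinates: obtains Bs :: "'ue set" and d where "\<And>v. v = (\<Sum>b\<in>Bs. ip v (d b) *\<^sub>R b)"
proof -
  obtain B1 :: "'ue set" where B1: "findim B1" by (rule U.findim)
  interpret findim B1 by fact
  define d where "d = (\<lambda>b. sharp (\<lambda>v. representation B1 v b))"
  have d: "ip (d b) v = representation B1 v b" for b v unfolding d_def by (rule ip_sharp[OF linear_representation])
  have "v = (\<Sum>b\<in>B1. ip v (d b) *\<^sub>R b)" for v using sum_representation[of v] by (simp add: ip_sym[of v] d)
  then show ?thesis by (rule that)
qed

lemma has_vector_derivative_ip:
  assumes "\<And>x. ((\<lambda>r. ip (f r) x) has_real_derivative ip f' x) (at s)"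
  shows "(f has_vector_derivative f') (at s)"
proof -
  obtain Bs :: "'ue set" and d where eq: "\<And>v. v = (\<Sum>b\<in>Bs. ip v (d b) *\<^sub>R b)" by (rule ip_coordinates) blast
  have "((\<lambda>r. \<Sum>b\<in>Bs. ip (f r) (d b) *\<^sub>R b) has_vector_derivative (\<Sum>b\<in>Bs. ip f' (d b) *\<^sub>R b)) (at s)"
    by (intro has_vector_derivative_sum bounded_linear.has_vector_derivative[OF bounded_linear_scaleR_left]
        assms[unfolded has_real_derivative_iff_has_vector_derivative])
  then show ?thesis unfolding eq[symmetric] .
qed

definition Phis :: "'m \<Rightarrow> 'ue" where "Phis y = sharp (blinfun_apply (\<Phi> y))"

lemma ip_Phis: "ip (Phis y) x = blinfun_apply (\<Phi> y) x"
  unfolding Phis_def by (rule ip_sharp) (simp add: bounded_linear.linear blinfun.bounded_linear_right)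

lemma Phis_\<iota>: "Phis (actC (\<iota> u) y) = Ad U A u (Phis y)"
proof (rule ip_cancel)
  fix x
  have "ip (Ad U A u (Phis y)) x = ip (Phis y) (Ad U A (inv\<^bsub>U\<^esub> u) x)"
    using ip_Ad[of u "Phis y" "Ad U A (inv\<^bsub>U\<^esub> u) x"] by simp
  then show "ip (Phis (actC (\<iota> u) y)) x = ip (Ad U A u (Phis y)) x"
    by (simp add: ip_Phis actC_\<iota> ham.equivariant_\<Phi>)
qed

lemma bilinear_omega: "bilinear (\<omega> y)"
  by (rule ham.M.bilin)

lemma omega_linear: "linear (\<omega> y v)" "linear (\<lambda>v. \<omega> y v w)"
  using bilinear_omega by (auto simp: bilinear_def)

lemmas omega_simps =
  linear_add[OF omega_linear(1)] linear_add[OF omega_linear(2)] linear_neg[OF omega_linear(1)] linear_neg[OF omega_linear(2)]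
  linear_cmul[OF omega_linear(1)] linear_cmul[OF omega_linear(2)] linear_diff[OF omega_linear(1)] linear_diff[OF omega_linear(2)]

lemma omega_antisym: "\<omega> y v w = - \<omega> y w v"
proof -
  have "\<omega> y (v + w) (v + w) = \<omega> y v w + \<omega> y w v"
    by (simp add: omega_simps ham.M.alternating[of y v] ham.M.alternating[of y w])
  then show ?thesis by (simp add: ham.M.alternating)
qed

lemma omega_J_sym: "\<omega> y v (J y w) = \<omega> y w (J y v)"
  using ham.J_\<omega>[of y v "J y w"] omega_antisym[of y "J y v" w] by (simp add: ham.M.J_J omega_simps)

lemma omega_J_nonneg: "\<omega> y v (J y v) \<ge> 0"
  using ham.J_positive[of v y] linear_0[OF omega_linear(2)] by (cases "v = 0") (auto intro: less_imp_le)

definition dPhi :: "'m \<Rightarrow> 'he \<Rightarrow> 'ue" where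
  "dPhi y X = sharp (\<lambda>x. \<omega> y (XM (i x) y) (XM X y))"

lemma ip_dPhi: "ip (dPhi y X) x = \<omega> y (XM (i x) y) (XM X y)"
  unfolding dPhi_def
  by (rule ip_sharp) (intro linear_compose[OF linear_compose[OF linear_i linear_XM] omega_linear(2), unfolded o_def])

lemma linear_dPhi: "linear (dPhi y)"
  by (rule linearI; rule ip_cancel)
    (simp_all add: ip_dPhi ip_simps linear_add[OF linear_XM] linear_cmul[OF linear_XM] omega_simps)

lemma Phis_derivative:
  assumes "dlog H AH c s X"
  shows "((\<lambda>r. Phis (actC (c r) y)) has_vector_derivative dPhi (actC (c s) y) X) (at s)"
  by (rule has_vector_derivative_ip) (use Phi_derivative[OF assms] in \<open>simp add: ip_Phis ip_dPhi\<close>)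

lemma dPhi_i: "dPhi y (i a) = bracket U A a (Phis y)"
proof -
  have "((\<lambda>r. Phis (actC (\<iota> (U.ex a r)) y)) has_vector_derivative dPhi y (i a)) (at 0)"
    using Phis_derivative[OF iota.dlog[OF U.dlog_ex[of a 0]], of y] by (simp add: iota.one)
  then show ?thesis using U.bracket_derivative[of a "Phis y"] vector_derivative_unique_at by (auto simp: Phis_\<iota>)
qed

text \<open>The Hessian operator of the Kempf-Ness function: <\<open>Tphi y b\<close>, b> is the
  squared Kaehler length of the vector field induced by b at y.\<close>

definition Tphi :: "'m \<Rightarrow> 'ue \<Rightarrow> 'ue" where "Tphi y b = dPhi y (j (i b))"

lemma linear_Tphi: "linear (Tphi y)"
  using linear_compose[OF linear_ji linear_dPhi, of y] by (simp add: Tphi_def[abs_def] o_def)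

lemma dPhi_eq: "dPhi y X = bracket U A (re X) (Phis y) + Tphi y (im X)"
  using linear_add[OF linear_dPhi, of y "i (re X)" "j (i (im X))"] by (simp add: re_im dPhi_i Tphi_def)

lemma Tphi_nonneg: "ip (Tphi y b) b \<ge> 0"
  by (simp add: Tphi_def ip_dPhi XM_j omega_J_nonneg)

lemma omega_bracket: "\<omega> y (XM (i b) y) (XM (i a) y) = - ip (Phis y) (bracket U A a b)"
  using ip_dPhi[of y "i a" b] by (simp add: dPhi_i ip_skew)

text \<open>Expand the squared Kaehler length of a_M + J b_M. Its mixed term is \<omega>(b_M, a_M),
  which by equivariance of the moment map equals - <\<Phi>, [a, b]>.\<close>

lemma Tphi_psh: "ip (Tphi y a) a + ip (Tphi y b) b \<ge> 2 * ip (Phis y) (bracket U A a b)"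
proof -
  let ?a = "XM (i a) y" and ?b = "XM (i b) y"
  have "0 \<le> \<omega> y (?a + J y ?b) (J y (?a + J y ?b))" by (rule omega_J_nonneg)
  also have "\<dots> = \<omega> y ?a (J y ?a) + \<omega> y ?b (J y ?b) + 2 * \<omega> y ?b ?a"
    using omega_antisym[of y "J y ?b" ?b] omega_antisym[of y ?a ?b]
    by (simp add: linear_add[OF ham.M.linear_J] ham.M.J_J omega_simps ham.J_\<omega>)
  finally show ?thesis by (simp add: Tphi_def ip_dPhi XM_j omega_bracket)
qed

subsection \<open>The potential\<close>

text \<open>The Kempf-Ness function, normalized to 0 at the identity, as the integral of its
  gradient along the geodesic to the coset of \<open>h\<close>.\<close>

definition psi :: "'m \<Rightarrow> 'h \<Rightarrow> real" where
  "psi y h = integral {0..1} (\<lambda>r. blinfun_apply (\<Phi> (actC (E (r *\<^sub>R px h)) y)) (px h))"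

lemma psi_left: "psi y (\<iota> u \<otimes>\<^bsub>H\<^esub> h) = psi y h"
  by (simp add: psi_def px_left)

lemma smooth_Phi_E: "smooth_on UNIV (\<lambda>x. \<Phi> (actC (E x) y))"
proof -
  obtain B2 :: "'me set" where B2: "findim B2" by (rule ham.M.findim)
  have "smooth_map vspace AM (\<lambda>x. actC (E x) y)"
    by (intro smooth_actC_maps charted_vspace smooth_polar_maps smooth_map_on_const open_UNIV)
  from smooth_map_on_compose[OF charted_vspace ham.M.charted charted_vspace B2 this ham.smooth_\<Phi>]
  show ?thesis by (simp add: smooth_map_on_vspace)
qed

text \<open>The gradient of \<open>psi\<close> is the moment map. Since \<open>psi\<close> is an
  integral along one chosen path, this amounts to closedness of the one-form X -> <\<Phi>, im X>:
  the s-derivative of the integrand is an exact r-derivative, and only the end point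
  contributes.\<close>

lemma psi_derivative:
  "((\<lambda>s. psi y (H.ex X s \<otimes>\<^bsub>H\<^esub> h)) has_real_derivative ip (Phis (actC (H.ex X s \<otimes>\<^bsub>H\<^esub> h) y)) (im X)) (at s)"
proof -
  obtain B1 :: "'ue set" where B1: "findim B1" by (rule U.findim)
  obtain BH :: "'he set" where BH: "findim BH" by (rule H.findim)
  obtain BR :: "(real \<times> real) set" where BR: "findim BR" using findim_prod[OF findim_real findim_real] .
  let ?c = "\<lambda>s. H.ex X s \<otimes>\<^bsub>H\<^esub> h"
  define \<xi> where "\<xi> = (\<lambda>s. px (?c s))"
  define \<xi>' where "\<xi>' = (\<lambda>s. dpx (?c s) X)"
  have c: "dlog H AH ?c s X" for s by (rule H.dlog_ex_left)
  have d\<xi>: "(\<xi> has_vector_derivative \<xi>' s) (at s)" for s unfolding \<xi>_def \<xi>'_def by (rule px_derivative[OF c])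
  have "smooth_map vspace AH ?c" by (intro H.smooth_mult_maps charted_vspace H.smooth_ex smooth_map_on_const open_UNIV)
  from smooth_map_on_compose[OF charted_vspace H.charted charted_vspace BH this smooth_polar_maps(2)]
  have s\<xi>: "smooth_on UNIV \<xi>" by (simp add: smooth_map_on_vspace \<xi>_def)
  define N where "N = (\<lambda>x. \<Phi> (actC (E x) y))"
  define Q where "Q = (\<lambda>z. blinfun_apply (N (snd z *\<^sub>R \<xi> (fst z))) (\<xi> (fst z)))"
  have s1: "smooth_on UNIV (\<lambda>z::real \<times> real. \<xi> (fst z))"
    by (rule findim.smooth_on_compose[OF findim_real open_UNIV open_UNIV _ _ s\<xi>]) (auto intro: bounded_linear_smooth_on bounded_linear_fst)
  have s2: "smooth_on UNIV (\<lambda>z::real \<times> real. snd z *\<^sub>R \<xi> (fst z))"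
    by (intro smooth_on_bounded_bilinear[OF bounded_bilinear_scaleR] open_UNIV s1 bounded_linear_smooth_on bounded_linear_snd)
  have s3: "smooth_on UNIV (\<lambda>z::real \<times> real. N (snd z *\<^sub>R \<xi> (fst z)))"
    by (rule findim.smooth_on_compose[OF B1 open_UNIV open_UNIV _ s2]) (auto simp: N_def smooth_Phi_E)
  have sQ: "smooth_on UNIV Q" unfolding Q_def
    by (intro smooth_on_bounded_bilinear[OF bounded_bilinear_blinfun_apply] open_UNIV s1 s3)
  define Qs where "Qs = (\<lambda>s r. frechet_derivative Q (at (s, r)) (1, 0))"
  have Qs: "((\<lambda>s. Q (s, r)) has_vector_derivative Qs s r) (at s)" for s r
  proof -
    have "((\<lambda>s. (s, r)) has_derivative (\<lambda>v. (v, 0))) (at s)" by (auto intro!: derivative_eq_intros)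
    from has_derivative_compose[OF this smooth_on_has_derivative[OF sQ UNIV_I]]
    have d: "((\<lambda>s. Q (s, r)) has_derivative (\<lambda>v. frechet_derivative Q (at (s, r)) (v, 0))) (at s)" .
    have "frechet_derivative Q (at (s, r)) (v, 0) = v *\<^sub>R Qs s r" for v
      using linear_cmul[OF has_derivative_linear[OF d], of v 1] by (simp add: Qs_def)
    then show ?thesis using d by (simp add: has_vector_derivative_def)
  qed
  have contQs: "continuous_on UNIV (\<lambda>(s, r). Qs s r)"
    using smooth_on_continuous[OF smooth_on_derivative[OF sQ, of "(1, 0)"]] by (simp add: Qs_def case_prod_unfold)
  have contQ: "continuous_on UNIV (\<lambda>r. Q (s, r))" for s
    by (rule continuous_on_compose2[OF smooth_on_continuous[OF sQ]]) (auto intro: continuous_intros)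
  define b where "b = (\<lambda>s r. B (r *\<^sub>R \<xi> s) (r *\<^sub>R \<xi>' s))"
  \<comment> \<open>The one-form evaluated on the variation field \<open>b s r\<close> of the family
    of geodesics.\<close>
  define W where "W = (\<lambda>s r. blinfun_apply (N (r *\<^sub>R \<xi> s)) (im (b s r)))"
  have W: "((\<lambda>r. W s r) has_real_derivative Qs s r) (at r)" for s r
  proof -
    let ?z = "actC (E (r *\<^sub>R \<xi> s)) y"
    have e1: "dlog H AH (\<lambda>q. E (q *\<^sub>R \<xi> s)) r (j (i (\<xi> s)))" unfolding E_scale by (rule H.dlog_ex)
    have e2: "dlog H AH (\<lambda>q. E (r *\<^sub>R \<xi> q)) s (b s r)" unfolding b_def
      by (rule dlog_E) (auto intro!: derivative_eq_intros d\<xi>)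
    have 1: "((\<lambda>q. ip (Phis (actC (E (q *\<^sub>R \<xi> s)) y)) (im (b s q))) has_real_derivative
      ip (Phis ?z) (\<xi>' s + bracket U A (\<xi> s) (re (b s r))) + ip (dPhi ?z (j (i (\<xi> s)))) (im (b s r))) (at r)"
      unfolding b_def by (rule ip_derivative[OF Phis_derivative[OF e1] B_im_derivative])
    have 2: "((\<lambda>q. ip (Phis (actC (E (r *\<^sub>R \<xi> q)) y)) (\<xi> q)) has_real_derivative
      ip (Phis ?z) (\<xi>' s) + ip (dPhi ?z (b s r)) (\<xi> s)) (at s)"
      by (rule ip_derivative[OF Phis_derivative[OF e2] d\<xi>])
    have "Qs s r = ip (Phis ?z) (\<xi>' s) + ip (dPhi ?z (b s r)) (\<xi> s)"
      using Qs[of r s] 2 DERIV_unique by (auto simp: Q_def N_def ip_Phis has_real_derivative_iff_has_vector_derivative vector_derivative_unique_at)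
    \<comment> \<open>Closedness: the Hessian \<open>Tphi\<close> is symmetric, and equivariance of
      the moment map turns its derivative along U into the bracket term.\<close>
    also have "ip (dPhi ?z (b s r)) (\<xi> s) = ip (Phis ?z) (bracket U A (\<xi> s) (re (b s r))) + ip (dPhi ?z (j (i (\<xi> s)))) (im (b s r))"
    proof -
      have "ip (Tphi ?z (im (b s r))) (\<xi> s) = ip (Tphi ?z (\<xi> s)) (im (b s r))"
        by (simp add: Tphi_def ip_dPhi XM_j omega_J_sym[of ?z "XM (i (\<xi> s)) ?z"])
      then show ?thesis
        using U.bracket_antisym[of "re (b s r)" "\<xi> s"] by (simp add: dPhi_eq ip_simps ip_skew U.bracket_simps)
    qed
    finally have "Qs s r = ip (Phis ?z) (\<xi>' s + bracket U A (\<xi> s) (re (b s r))) + ip (dPhi ?z (j (i (\<xi> s)))) (im (b s r))"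
      by (simp add: ip_simps)
    then show ?thesis using 1 by (simp add: W_def N_def ip_Phis)
  qed
  have "((\<lambda>s. integral (cbox 0 1) (\<lambda>r. Q (s, r))) has_vector_derivative integral (cbox 0 1) (Qs s)) (at s within UNIV)"
    by (rule leibniz_rule_vector_derivative)
      (use Qs in \<open>auto intro!: integrable_continuous_interval continuous_on_subset[OF contQ] continuous_on_subset[OF contQs]\<close>)
  moreover have "integral (cbox 0 1) (Qs s) = W s 1 - W s 0"
  proof -
    have "(Qs s has_integral (W s 1 - W s 0)) {0..1}"
      by (rule fundamental_theorem_of_calculus)
        (simp_all add: W[unfolded has_real_derivative_iff_has_vector_derivative] has_vector_derivative_at_within)
    then show ?thesis by (simp add: integral_unique)
  qed
  moreover have "W s 0 = 0" by (simp add: W_def b_def linear_0[OF linear_B] linear_0[OF linear_im] blinfun.zero_right)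
  moreover have "W s 1 = ip (Phis (actC (?c s) y)) (im X)"
  proof -
    have p: "\<iota> (pu (?c s)) \<otimes>\<^bsub>H\<^esub> E (\<xi> s) = ?c s" unfolding \<xi>_def by (rule polar)
    have "actC (?c s) y = actC (\<iota> (pu (?c s))) (actC (E (\<xi> s)) y)"
      unfolding actC_mult[symmetric] p ..
    then have e1: "Phis (actC (?c s) y) = Ad U A (pu (?c s)) (Phis (actC (E (\<xi> s)) y))" by (simp only: Phis_\<iota>)
    have e2: "im X = Ad U A (pu (?c s)) (im (b s 1))"
      unfolding b_def \<xi>_def \<xi>'_def scaleR_one by (rule im_polar_derivative)
    have "ip (Phis (actC (?c s) y)) (im X) = ip (Phis (actC (E (\<xi> s)) y)) (im (b s 1))"
      unfolding e1 by (subst e2) (rule ip_Ad)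
    then show ?thesis by (simp only: W_def N_def ip_Phis scaleR_one)
  qed
  moreover have "(\<lambda>s. integral (cbox 0 1) (\<lambda>r. Q (s, r))) = (\<lambda>s. psi y (?c s))"
    by (simp add: psi_def Q_def N_def \<xi>_def)
  ultimately show ?thesis by (simp add: has_real_derivative_iff_has_vector_derivative)
qed

end

context lie_group
begin

text \<open>Conjugation by exp(-r Z) turns every solution of d' = [Z, d] into a constant.\<close>

lemma linear_ode_zero:
  assumes d: "\<And>r. (d has_vector_derivative bracket U A Z (d r)) (at r)" and d0: "d 0 = 0"
  shows "d r = 0"
proof -
  let ?w = "\<lambda>r. Ad U A (inv (ex Z r)) (d r)"
  have inv: "dlog U A (\<lambda>r. inv (ex Z r)) s (- Z)" for s
    using dlog_inverse[OF dlog_ex[of Z s]] Ad_ex_self[of Z "- s"] by (simp add: ex_minus)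
  have "(?w has_vector_derivative 0) (at s)" for s
  proof -
    have "(?w has_vector_derivative bracket U A (- Z) (Ad U A (inv (ex Z s)) (d s)) + Ad U A (inv (ex Z s)) (bracket U A Z (d s))) (at s)"
      by (rule Ad_vector_derivative[OF inv d])
    moreover have "Ad U A (inv (ex Z s)) (bracket U A Z (d s)) = bracket U A Z (Ad U A (inv (ex Z s)) (d s))"
      using Ad_ex_self[of Z "- s"] by (simp add: Ad_bracket ex_minus)
    ultimately show ?thesis by (simp add: bracket_simps)
  qed
  then obtain k where k: "\<And>s. s \<in> UNIV \<Longrightarrow> ?w s = k"
    using has_vector_derivative_zero_constant[OF convex_UNIV, of ?w] by (metis (no_types, lifting))
  have "?w r = ?w 0" by (rule trans[OF k k[symmetric]]) auto
  then have "Ad U A (ex Z r) (?w r) = 0" using d0 by (simp add: linear_0[OF linear_Ad])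
  then show ?thesis by simp
qed

end

section \<open>The real form\<close>

context complex_hamiltonian
begin

text \<open>\<open>sH\<close> and \<open>sC\<close> are the antilinear extension of the involution to the complexified Lie algebra and the
  corresponding antiholomorphic involution of the complexified group.\<close>

definition sH :: "'he \<Rightarrow> 'he" where "sH X = i (s' (re X)) + j (i (- s' (im X)))"
definition sC :: "'h \<Rightarrow> 'h" where "sC h = \<iota> (\<sigma> (pu h)) \<otimes>\<^bsub>H\<^esub> E (- s' (px h))"

lemma re_sH [simp]: "re (sH X) = s' (re X)" and im_sH [simp]: "im (sH X) = - s' (im X)"
  unfolding sH_def by simp_all

lemma re_im_eqI: "re X = re Y \<Longrightarrow> im X = im Y \<Longrightarrow> X = Y"
  by (metis re_im)

lemma linear_sH: "linear sH"
  by (rule linearI; rule re_im_eqI)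
    (simp_all add: linear_add[OF linear_re] linear_add[OF linear_im] linear_cmul[OF linear_re] linear_cmul[OF linear_im]
      linear_add[OF ham.linear_s'] linear_cmul[OF ham.linear_s'])

lemma bounded_linear_sH: "bounded_linear sH" and bounded_linear_s': "bounded_linear s'"
  by (metis H.findim findim.linear_bounded linear_sH) (metis U.findim findim.linear_bounded ham.linear_s')

lemma sH_bracket: "sH (bracket H AH (j (i x)) Y) = bracket H AH (j (i (- s' x))) (sH Y)"
  by (rule re_im_eqI)
    (simp_all add: re_bracket_ji im_bracket_ji linear_neg[OF ham.linear_s'] ham.s'_bracket U.bracket_simps)

lemma sH_Ad: "sH (Ad H AH (\<iota> u) X) = Ad H AH (\<iota> (\<sigma> u)) (sH X)"
  by (rule re_im_eqI) (simp_all add: re_Ad im_Ad ham.s'_Ad linear_neg[OF U.linear_Ad])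

text \<open>Both sides, scaled by r, solve the linear equation of \<open>B_derivative\<close> with
  the same inhomogeneity and vanish at r = 0. This makes the involution \<open>sC\<close>, defined
  by polar coordinates, accessible to differentiation.\<close>

lemma B_sH: "B (- s' x) (- s' v) = sH (B x v)"
proof -
  let ?y1 = "\<lambda>r. B (r *\<^sub>R (- s' x)) (r *\<^sub>R (- s' v))" and ?y2 = "\<lambda>r. sH (B (r *\<^sub>R x) (r *\<^sub>R v))"
  let ?Z = "j (i (- s' x))"
  have "(\<lambda>r. ?y1 r - ?y2 r) 1 = 0"
  proof (rule H.linear_ode_zero[of "\<lambda>r. ?y1 r - ?y2 r" ?Z])
    fix r
    have 1: "(?y1 has_vector_derivative j (i (- s' v)) + bracket H AH ?Z (?y1 r)) (at r)" by (rule B_derivative)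
    have "(?y2 has_vector_derivative sH (j (i v) + bracket H AH (j (i x)) (B (r *\<^sub>R x) (r *\<^sub>R v)))) (at r)"
      by (rule bounded_linear.has_vector_derivative[OF bounded_linear_sH B_derivative])
    moreover have "sH (j (i v)) = j (i (- s' v))" by (rule re_im_eqI) (simp_all add: linear_0[OF ham.linear_s'])
    ultimately have 2: "(?y2 has_vector_derivative j (i (- s' v)) + bracket H AH ?Z (?y2 r)) (at r)"
      by (simp add: linear_add[OF linear_sH] sH_bracket)
    show "((\<lambda>r. ?y1 r - ?y2 r) has_vector_derivative bracket H AH ?Z (?y1 r - ?y2 r)) (at r)"
      using has_vector_derivative_diff[OF 1 2] by (simp add: H.bracket_simps)
  qed (simp add: linear_0[OF linear_B] linear_0[OF linear_sH])
  then show ?thesis by simp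
qed

lemma sC_dlog:
  assumes "dlog H AH c s X"
  shows "dlog H AH (\<lambda>r. sC (c r)) s (sH X)"
proof -
  let ?h = "c s"
  have 1: "dlog H AH (\<lambda>r. \<iota> (\<sigma> (pu (c r)))) s (i (s' (dpu ?h X)))"
    using iota.dlog[OF ham.sig.dlog[OF pu_derivative[OF assms]]] by (simp add: ham.s'_d)
  have "((\<lambda>r. - s' (px (c r))) has_vector_derivative - s' (dpx ?h X)) (at s)"
    by (intro has_vector_derivative_minus bounded_linear.has_vector_derivative[OF bounded_linear_s'] px_derivative[OF assms])
  from H.dlog_mult[OF 1 dlog_E[OF this]]
  have "dlog H AH (\<lambda>r. sC (c r)) s (i (s' (dpu ?h X)) + Ad H AH (\<iota> (\<sigma> (pu ?h))) (sH (B (px ?h) (dpx ?h X))))"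
    unfolding sC_def by (simp only: B_sH)
  moreover have "i (s' (dpu ?h X)) + Ad H AH (\<iota> (\<sigma> (pu ?h))) (sH (B (px ?h) (dpx ?h X))) = sH X"
  proof -
    have "sH (i (dpu ?h X)) = i (s' (dpu ?h X))" by (rule re_im_eqI) (simp_all add: linear_0[OF ham.linear_s'])
    then show ?thesis
      by (subst (3) polar_derivative[of X ?h]) (simp add: linear_add[OF linear_sH] sH_Ad)
  qed
  ultimately show ?thesis by simp
qed

text \<open>Compatibility with left multiplication by one-parameter groups takes the place of a
  proof that \<open>sC\<close> is a homomorphism; it suffices for a group generated by
  exponentials.\<close>

lemma sC_ex: "sC (H.ex X t \<otimes>\<^bsub>H\<^esub> h) = H.ex (sH X) t \<otimes>\<^bsub>H\<^esub> sC h"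
proof -
  have "\<And>s. dlog H AH (\<lambda>r. sC (H.ex X r \<otimes>\<^bsub>H\<^esub> h)) s (sH X)" by (rule sC_dlog[OF H.dlog_ex_left])
  from H.flow_unique[OF this, of t] show ?thesis by simp
qed

lemma sC_one: "sC \<one>\<^bsub>H\<^esub> = \<one>\<^bsub>H\<^esub>"
  by (simp add: sC_def ham.sig.one iota.one linear_0[OF ham.linear_s'])

definition GG :: "'h set" where "GG = G_group U A \<sigma> H AH JH \<iota>"

text \<open>A one-parameter group fixed by \<sigma> is connected and contains 1, so it stays in the
  identity component.\<close>

lemma k_algebra_eq: "k_algebra U A \<sigma> = {x. s' x = x}"
proof (intro equalityI subsetI)
  fix x assume "x \<in> k_algebra U A \<sigma>"
  then have "U.ex x t \<in> K_group U \<sigma>" for t by (simp add: k_algebra_def subgroup_algebra_def U.ex_def)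
  then have "\<sigma> (U.ex x t) = U.ex x t" for t
    using connected_component_subset[of "{u. \<sigma> u = u}" "\<one>\<^bsub>U\<^esub>"] by (auto simp: K_group_def)
  then have "U.ex (s' x) = U.ex x" by (simp add: ham.s'_ex fun_eq_iff)
  then have "vel A (U.ex (s' x)) 0 x" using U.vel_ex[of x] by simp
  from vel_unique[OF U.vel_ex this] show "x \<in> {x. s' x = x}" by simp
next
  fix x assume "x \<in> {x. s' x = x}"
  then have fx: "\<sigma> (U.ex x t) = U.ex x t" for t by (simp add: ham.s'_ex)
  have "connected (range (U.ex x))"
    using U.smooth_ex[of x] connected_continuous_image[of UNIV "U.ex x"] by (simp add: smooth_map_on_def)
  moreover have "\<one>\<^bsub>U\<^esub> \<in> range (U.ex x)" by (rule range_eqI[of _ _ 0]) simp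
  moreover have "range (U.ex x) \<subseteq> {u. \<sigma> u = u}" using fx by auto
  ultimately have "range (U.ex x) \<subseteq> K_group U \<sigma>" unfolding K_group_def by (intro connected_component_maximal)
  then show "x \<in> k_algebra U A \<sigma>" by (auto simp: k_algebra_def subgroup_algebra_def U.ex_def)
qed

lemma g_algebra_iff: "X \<in> g_algebra U A \<sigma> H AH JH \<iota> \<longleftrightarrow> sH X = X"
proof
  assume "X \<in> g_algebra U A \<sigma> H AH JH \<iota>"
  then show "sH X = X" by (auto simp: g_algebra_def k_algebra_eq q_space_def intro!: re_im_eqI)
next
  assume "sH X = X"
  then have "s' (re X) = re X" "- s' (im X) = im X" using re_sH[of X] im_sH[of X] by auto
  then have "s' (re X) = re X" "s' (im X) = - im X" by (auto simp: minus_equation_iff)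
  then show "X \<in> g_algebra U A \<sigma> H AH JH \<iota>"
    unfolding g_algebra_def k_algebra_eq q_space_def using re_im[of X] by force
qed

lemma GG_eq: "GG = generate H ((\<lambda>X. H.ex X 1) ` {X. sH X = X})"
proof -
  have "g_algebra U A \<sigma> H AH JH \<iota> = {X. sH X = X}" using g_algebra_iff by blast
  then show ?thesis by (simp add: GG_def G_group_def H.lie_exp_ex[abs_def])
qed

lemma GG_mult: "g \<in> GG \<Longrightarrow> h \<in> GG \<Longrightarrow> g \<otimes>\<^bsub>H\<^esub> h \<in> GG"
  unfolding GG_eq by (rule generate.eng)

lemma GG_one: "\<one>\<^bsub>H\<^esub> \<in> GG"
  unfolding GG_eq by (rule generate.one)

lemma GG_inv: "g \<in> GG \<Longrightarrow> inv\<^bsub>H\<^esub> g \<in> GG"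
  unfolding GG_eq by (rule H.generate_m_inv_closed) auto

lemma GG_ex: "sH X = X \<Longrightarrow> H.ex X t \<in> GG"
proof -
  assume "sH X = X"
  then have "sH (t *\<^sub>R X) = t *\<^sub>R X" by (simp add: linear_cmul[OF linear_sH])
  then have "H.ex (t *\<^sub>R X) 1 \<in> GG" unfolding GG_eq by (intro generate.incl) blast
  then show ?thesis by (simp add: H.ex_scale)
qed

lemma GG_E: "s' x = - x \<Longrightarrow> E x \<in> GG"
  unfolding E_ex by (intro GG_ex re_im_eqI) (simp_all add: linear_0[OF ham.linear_s'])

lemma GG_\<iota>_ex: "s' x = x \<Longrightarrow> \<iota> (U.ex x t) \<in> GG"
  unfolding iota.ex by (intro GG_ex re_im_eqI) (simp_all add: linear_0[OF ham.linear_s'])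

text \<open>Inverses of generators need no case of their own, because exp(X)^(-1) = exp(-X) is again
  a generator.\<close>

lemma GG_induct [consumes 1, case_names one ex]:
  assumes g: "g \<in> GG" and one: "P \<one>\<^bsub>H\<^esub>" and ex: "\<And>X g. sH X = X \<Longrightarrow> g \<in> GG \<Longrightarrow> P g \<Longrightarrow> P (H.ex X 1 \<otimes>\<^bsub>H\<^esub> g)"
  shows "P g"
proof -
  have "h \<in> GG \<Longrightarrow> P h \<Longrightarrow> P (g \<otimes>\<^bsub>H\<^esub> h)" for h
    using g unfolding GG_eq
  proof (induction g arbitrary: h rule: generate.induct)
    case one then show ?case by simp
  next
    case (incl x) then show ?case using ex by (auto simp: GG_eq)
  next
    case (inv x)
    then obtain X where X: "sH X = X" "x = H.ex X 1" by auto
    have "sH (- X) = - X" using X by (simp add: linear_neg[OF linear_sH])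
    moreover have "inv\<^bsub>H\<^esub> x = H.ex (- X) 1" using H.ex_scale[of "-1" X 1] by (simp add: X H.ex_minus)
    ultimately show ?case using ex inv by (auto simp: GG_eq)
  next
    case (eng a b)
    have "P (a \<otimes>\<^bsub>H\<^esub> (b \<otimes>\<^bsub>H\<^esub> h))"
      using eng by (intro eng.IH(1)) (auto intro: generate.eng)
    then show ?case by (simp add: H.m_assoc)
  qed
  from this[OF GG_one one] show ?thesis by simp
qed

lemma sC_GG: "g \<in> GG \<Longrightarrow> sC g = g"
  by (induction rule: GG_induct) (simp_all add: sC_one sC_ex)

text \<open>Uniqueness of the polar decomposition, applied to a fixed point of
  \<open>sC\<close>.\<close>

lemma GG_polar:
  assumes "g \<in> GG"
  shows "\<sigma> (pu g) = pu g" "s' (px g) = - px g"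
proof -
  have "pu (sC g) = \<sigma> (pu g)" "px (sC g) = - s' (px g)" by (simp_all add: sC_def)
  then show "\<sigma> (pu g) = pu g" "s' (px g) = - px g" using sC_GG[OF assms] by (simp, metis minus_minus)
qed

lemma GG_Xi: "g \<in> GG \<Longrightarrow> s' (Xi g) = - Xi g"
  using GG_polar[of g] by (simp add: Xi_def ham.s'_Ad linear_neg[OF U.linear_Ad])

text \<open>The curve t -> exp(-t X) z(t) has velocity zero: at the identity the derivative of the
  action sends (- X, w) to w minus the induced field, and w is that field.\<close>

lemma integral_curve_unique:
  assumes z: "\<And>t. vel AM z t (XM X (z t))"
  shows "z t = actC (H.ex X t) (z 0)"
proof -
  define d where "d = (\<lambda>t. actC (H.ex X (- t)) (z t))"
  let ?a = "\<lambda>(g, m). actC g m"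
  have "vel AM d s 0" for s
  proof -
    let ?D = "tmap (prod_charts AH AM) AM ?a (\<one>\<^bsub>H\<^esub>, z s)"
    have D: "mder (prod_charts AH AM) AM ?a (\<one>\<^bsub>H\<^esub>, z s) ?D" by (rule mder_actC)
    have "vel AH (H.ex X) (-1 * s + s) X" using H.vel_ex by simp
    have "vel AH (\<lambda>r. H.ex X (-1 * r + s)) s (-1 *\<^sub>R X)"
    proof (rule vel_scale)
      show "vel AH (\<lambda>r. H.ex X (r + s)) (-1 * s) X"
        by (rule vel_shift) (use H.vel_ex in simp)
    qed
    from vel_compose[OF charted_HM vel_Pair[OF this z[of s]], of AM ?a ?D] D
    have "vel AM (\<lambda>r. actC (H.ex X (s - r)) (z r)) s (?D (- X, XM X (z s)))" by simp
    moreover have "?D (- X, XM X (z s)) = 0"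
    proof -
      have "mder AM AM (\<lambda>y. ?a (\<one>\<^bsub>H\<^esub>, y)) (z s) (\<lambda>v. ?D (0, v))"
        by (rule mder_compose[OF ham.M.charted charted_HM mder_Pair[OF mder_const[OF ham.M.charted] mder_ident[OF ham.M.charted]] D])
      then have "mder AM AM (\<lambda>y. y) (z s) (\<lambda>v. ?D (0, v))" by simp
      from mder_unique[OF this mder_ident[OF ham.M.charted]] have "?D (0, v) = v" for v by meson
      moreover have "?D (- X, 0) = - XM X (z s)"
        using linear_neg[OF linear_XM, of X "z s"] by (simp add: XM_eq)
      ultimately show ?thesis
        using linear_add[OF mder_linear[OF D], of "(- X, 0)" "(0, XM X (z s))"] by simp
    qed
    ultimately have 1: "vel AM (\<lambda>r. actC (H.ex X (s - r)) (z r)) s 0" by simp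
    have "smooth_map AM AM (\<lambda>y. actC (H.ex X (- s)) y)"
      by (intro smooth_actC_maps ham.M.charted smooth_map_on_const ham.M.smooth_map_id open_UNIV)
    from smooth_map_on_mder[OF ham.M.charted ham.M.charted this open_UNIV UNIV_I]
    obtain E where E: "mder AM AM (\<lambda>y. actC (H.ex X (- s)) y) (actC (H.ex X (s - s)) (z s)) E" by blast
    have "vel AM (\<lambda>r. actC (H.ex X (- s)) (actC (H.ex X (s - r)) (z r))) s (E 0)"
      by (rule vel_compose[OF ham.M.charted 1 E])
    then show ?thesis
      using linear_0[OF mder_linear[OF E]] by (simp add: d_def actC_mult[symmetric] H.ex_add[symmetric])
  qed
  then have "d t = d 0" by (intro ham.M.vel_zero_constant[of UNIV]) auto
  then have "actC (H.ex X t) (d t) = actC (H.ex X t) (z 0)" by (simp add: d_def)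
  then show ?thesis by (simp add: d_def actC_mult[symmetric] H.ex_minus)
qed

text \<open>Only the action of U is assumed to be intertwined by \<tau>. Antiholomorphy extends this
  infinitesimally to i \<uu>, and uniqueness of integral curves then gives
  \<open>tau_ex\<close>.\<close>

lemma tau_XM: "tmap AM AM \<tau> y (XM X y) = XM (sH X) (\<tau> y)"
proof -
  have mt: "mder AM AM \<tau> y (tmap AM AM \<tau> y)" for y
    by (rule smooth_map_on_mder[OF ham.M.charted ham.M.charted ham.smooth_\<tau>]) auto
  have 1: "tmap AM AM \<tau> y (XM (i a) y) = XM (i (s' a)) (\<tau> y)" for a
  proof -
    have "vel AM (\<lambda>r. \<tau> (actC (\<iota> (U.ex a r)) y)) 0 (tmap AM AM \<tau> y (XM (i a) y))"
      by (rule vel_compose[OF ham.M.charted]) (use vel_orbit[OF iota.dlog[OF U.dlog_ex[of a 0]], of y] mt in \<open>simp_all add: iota.one\<close>)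
    moreover have "vel AM (\<lambda>r. actC (\<iota> (U.ex (s' a) r)) (\<tau> y)) 0 (XM (i (s' a)) (\<tau> y))"
      using vel_orbit[OF iota.dlog[OF U.dlog_ex[of "s' a" 0]], of "\<tau> y"] by (simp add: iota.one)
    moreover have "\<tau> (actC (\<iota> (U.ex a r)) y) = actC (\<iota> (U.ex (s' a) r)) (\<tau> y)" for r
      by (simp add: actC_\<iota> ham.\<tau>_act ham.s'_ex)
    ultimately show ?thesis using vel_unique by auto
  qed
  have 2: "tmap AM AM \<tau> y (XM (j (i b)) y) = XM (j (i (- s' b))) (\<tau> y)" for b
    using ham.antiholomorphic_\<tau> 1[of b]
    by (simp add: XM_j antiholomorphic_map_def linear_neg[OF linear_i] linear_neg[OF linear_XM] linear_neg[OF ham.M.linear_J])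
  have "tmap AM AM \<tau> y (XM X y) = tmap AM AM \<tau> y (XM (i (re X)) y + XM (j (i (im X))) y)"
    using linear_add[OF linear_XM, of "i (re X)" "j (i (im X))" y] by (simp add: re_im)
  also have "\<dots> = XM (i (s' (re X))) (\<tau> y) + XM (j (i (- s' (im X)))) (\<tau> y)"
    by (simp only: linear_add[OF mder_linear[OF mt]] 1 2)
  finally show ?thesis by (simp add: sH_def linear_add[OF linear_XM])
qed

lemma tau_ex: "\<tau> (actC (H.ex X t) y) = actC (H.ex (sH X) t) (\<tau> y)"
proof -
  have mt: "mder AM AM \<tau> y (tmap AM AM \<tau> y)" for y
    by (rule smooth_map_on_mder[OF ham.M.charted ham.M.charted ham.smooth_\<tau>]) auto
  have "vel AM (\<lambda>t. \<tau> (actC (H.ex X t) y)) s (XM (sH X) (\<tau> (actC (H.ex X s) y)))" for s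
    using vel_compose[OF ham.M.charted vel_orbit[OF H.dlog_ex] mt] by (simp add: tau_XM)
  from integral_curve_unique[of "\<lambda>t. \<tau> (actC (H.ex X t) y)", OF this, of t] show ?thesis by simp
qed

lemma tau_GG: "g \<in> GG \<Longrightarrow> \<tau> (actC g y) = actC g (\<tau> y)"
  by (induction rule: GG_induct) (simp_all add: actC_mult tau_ex)

lemma tau_closure:
  assumes "\<tau> y = y" "z \<in> closure {actC g y | g. g \<in> GG}"
  shows "\<tau> z = z"
proof -
  have c: "continuous_on UNIV \<tau>" using ham.smooth_\<tau> by (simp add: smooth_map_on_def)
  have "closed {z. \<tau> z = z}" by (intro closed_Collect_eq c continuous_intros)
  moreover have "{actC g y | g. g \<in> GG} \<subseteq> {z. \<tau> z = z}" using tau_GG assms(1) by auto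
  ultimately show ?thesis using assms(2) closure_minimal by blast
qed

lemma Phis_tau: "\<tau> y = y \<Longrightarrow> s' (Phis y) = - Phis y"
proof (rule ip_cancel)
  fix x assume y: "\<tau> y = y"
  have "blinfun_apply (\<Phi> y) (s' x) = - blinfun_apply (\<Phi> y) x" using ham.\<tau>_\<Phi>[of y x] unfolding y by linarith
  moreover have "ip (s' (Phis y)) x = ip (Phis y) (s' x)" using ip_involution[of "Phis y" "s' x"] by simp
  ultimately show "ip (s' (Phis y)) x = ip (- Phis y) x" by (simp add: ip_Phis ip_simps)
qed

text \<open>At a fixed point of \<tau> the moment map equals its own negative on \<sigma>-fixed
  vectors.\<close>

lemma moment_in_a_dual:
  assumes "\<tau> y = y" "\<Phi> y \<in> t_dual U A \<tt>"
  shows "\<Phi> y \<in> a_dual U A \<sigma> \<tt>"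
proof -
  have "blinfun_apply (\<Phi> y) \<xi> = 0" if "s' \<xi> = \<xi>" for \<xi>
    using ham.\<tau>_\<Phi>[of y \<xi>] unfolding assms(1) that by linarith
  then show ?thesis using assms(2) by (simp add: a_dual_def k_algebra_eq)
qed

text \<open>Adjoining to \<bb> the line through an element that commutes with \<bb> gives an abelian
  subspace, equal to \<bb> by maximality.\<close>

lemma maximal_abelian_memI:
  assumes max: "maximal_abelian_in U A V \<bb>" and V: "subspace V" "x \<in> V" and comm: "\<And>y. y \<in> \<bb> \<Longrightarrow> bracket U A y x = 0"
  shows "x \<in> \<bb>"
proof -
  have b: "\<bb> \<subseteq> V" "subspace \<bb>" "\<And>y z. y \<in> \<bb> \<Longrightarrow> z \<in> \<bb> \<Longrightarrow> bracket U A y z = 0"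
    using max by (auto simp: maximal_abelian_in_def abelian_subspace_def)
  define \<cc> where "\<cc> = {y + k *\<^sub>R x | y k. y \<in> \<bb>}"
  have "subspace \<cc>"
  proof (rule subspaceI)
    show "0 \<in> \<cc>" unfolding \<cc>_def using subspace_0[OF b(2)] by force
    fix p q assume "p \<in> \<cc>" "q \<in> \<cc>"
    then obtain y k z l where "p = y + k *\<^sub>R x" "q = z + l *\<^sub>R x" "y \<in> \<bb>" "z \<in> \<bb>" by (auto simp: \<cc>_def)
    then have "p + q = (y + z) + (k + l) *\<^sub>R x" "y + z \<in> \<bb>" using b(2) by (auto simp: algebra_simps subspace_add)
    then show "p + q \<in> \<cc>" unfolding \<cc>_def by blast
  next
    fix c p assume "p \<in> \<cc>"
    then obtain y k where "p = y + k *\<^sub>R x" "y \<in> \<bb>" by (auto simp: \<cc>_def)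
    then have "c *\<^sub>R p = c *\<^sub>R y + (c * k) *\<^sub>R x" "c *\<^sub>R y \<in> \<bb>" using b(2) by (auto simp: algebra_simps subspace_scale)
    then show "c *\<^sub>R p \<in> \<cc>" unfolding \<cc>_def by blast
  qed
  moreover have "bracket U A p q = 0" if pq: "p \<in> \<cc>" "q \<in> \<cc>" for p q
  proof -
    obtain y k z l where "p = y + k *\<^sub>R x" "q = z + l *\<^sub>R x" "y \<in> \<bb>" "z \<in> \<bb>" using pq by (auto simp: \<cc>_def)
    then show ?thesis using comm[of y] comm[of z] b(3)[of y z] U.bracket_antisym[of x z]
      by (simp add: U.bracket_simps U.bracket_self)
  qed
  moreover have "\<bb> \<subseteq> \<cc>" unfolding \<cc>_def using scaleR_zero_left[of x] by (force intro: exI[of _ 0])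
  moreover have "\<cc> \<subseteq> V" using b(1) V by (auto simp: \<cc>_def intro: subspace_add subspace_scale)
  ultimately have "\<cc> = \<bb>" using max by (auto simp: maximal_abelian_in_def abelian_subspace_def)
  moreover have "x \<in> \<cc>" unfolding \<cc>_def using subspace_0[OF b(2)] by (force intro: exI[of _ 1])
  ultimately show ?thesis by simp
qed

text \<open>A vector fixed by T commutes with \<tt>, so \<eta> lies in \<tt>. Its part \<theta> in
  \<qq> commutes with \<aa>, hence lies in \<aa>, so that the remaining part \<kappa> lies in \<tt>
  and is fixed by the involution. There f vanishes, which gives |\<kappa>|^2 = <\<eta>, \<kappa>> =
  0.\<close>

lemma a_dual_in_q:
  assumes a: "maximal_abelian_in U A (q_space U A \<sigma>) \<aa>" and t: "maximal_abelian_in U A UNIV \<tt>" "\<aa> \<subseteq> \<tt>"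
    and f: "f \<in> a_dual U A \<sigma> \<tt>" and \<eta>: "\<And>x. ip \<eta> x = blinfun_apply f x"
  shows "s' \<eta> = - \<eta>"
proof -
  have subt: "subspace \<tt>" using t(1) by (simp add: maximal_abelian_in_def abelian_subspace_def)
  have comm: "bracket U A \<xi> \<eta> = 0" if \<xi>: "\<xi> \<in> \<tt>" for \<xi>
  proof -
    have "Ad U A (U.ex \<xi> r) \<eta> = \<eta>" for r
    proof (rule ip_cancel)
      fix x
      have "r *\<^sub>R \<xi> \<in> \<tt>" using subt \<xi> by (rule subspace_scale)
      then have "blinfun_apply f (Ad U A (inv\<^bsub>U\<^esub> (U.ex \<xi> r)) x) = blinfun_apply f x"
        using f by (auto simp: a_dual_def t_dual_def U.ex_def)
      then show "ip (Ad U A (U.ex \<xi> r) \<eta>) x = ip \<eta> x"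
        using ip_Ad[of "U.ex \<xi> r" \<eta> "Ad U A (inv\<^bsub>U\<^esub> (U.ex \<xi> r)) x"] by (simp add: \<eta>)
    qed
    then show ?thesis using U.bracket_derivative[of \<xi> \<eta>] vector_derivative_unique_at[of "\<lambda>r. \<eta>" _ 0 0] by simp
  qed
  have \<eta>t: "\<eta> \<in> \<tt>" by (rule maximal_abelian_memI[OF t(1)]) (use comm in auto)
  define \<kappa> where "\<kappa> = (1/2) *\<^sub>R (\<eta> + s' \<eta>)"
  define \<theta> where "\<theta> = (1/2) *\<^sub>R (\<eta> - s' \<eta>)"
  have sum: "\<eta> = \<kappa> + \<theta>" by (simp add: \<kappa>_def \<theta>_def algebra_simps flip: scaleR_add_left)
  have s\<kappa>: "s' \<kappa> = \<kappa>" and s\<theta>: "s' \<theta> = - \<theta>"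
    by (simp_all add: \<kappa>_def \<theta>_def linear_cmul[OF ham.linear_s'] linear_add[OF ham.linear_s'] linear_diff[OF ham.linear_s'] algebra_simps)
  have "\<theta> \<in> \<aa>"
  proof (rule maximal_abelian_memI[OF a])
    show "subspace (q_space U A \<sigma>)"
      by (rule subspaceI) (simp_all add: q_space_def linear_0[OF ham.linear_s'] linear_add[OF ham.linear_s'] linear_cmul[OF ham.linear_s'])
    show "\<theta> \<in> q_space U A \<sigma>" using s\<theta> by (simp add: q_space_def)
    fix \<xi> assume \<xi>: "\<xi> \<in> \<aa>"
    then have s\<xi>: "s' \<xi> = - \<xi>" using a by (auto simp: maximal_abelian_in_def q_space_def)
    have "bracket U A \<xi> \<eta> = 0" using comm t(2) \<xi> by auto
    moreover from this have "bracket U A \<xi> (s' \<eta>) = 0"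
      using ham.s'_bracket[of \<xi> \<eta>] s\<xi> linear_0[OF ham.linear_s'] by (simp add: U.bracket_simps)
    ultimately show "bracket U A \<xi> \<theta> = 0" by (simp add: \<theta>_def U.bracket_simps)
  qed
  then have "\<kappa> \<in> \<tt>" using sum \<eta>t t(2) subspace_diff[OF subt, of \<eta> \<theta>] by auto
  then have "ip \<eta> \<kappa> = 0" using f s\<kappa> by (simp add: a_dual_def k_algebra_eq \<eta>)
  moreover have "ip \<theta> \<kappa> = 0" using ip_involution[of \<theta> \<kappa>] by (simp add: s\<kappa> s\<theta> ip_simps)
  ultimately have "ip \<kappa> \<kappa> = 0" by (simp add: sum ip_simps)
  then have "\<kappa> = 0" using ip_pos[of \<kappa>] by auto
  then show ?thesis using sum s\<theta> by simp
qed

end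

section \<open>Subharmonic functions\<close>

text \<open>f' has to exist near 0, but f'' only at the point 0 itself; this is the regularity that
  the energies below provide. The difference of the two sides is nondecreasing in s.\<close>

lemma second_difference_ge:
  fixes f f' :: "real \<Rightarrow> real"
  assumes f: "\<And>s. \<bar>s\<bar> < d \<Longrightarrow> (f has_real_derivative f' s) (at s)" and d: "d > 0"
    and f': "(f' has_real_derivative f2) (at 0)" and e: "e > 0"
  shows "\<exists>\<delta>>0. \<forall>s. 0 < s \<and> s < \<delta> \<longrightarrow> f s + f (- s) - 2 * f 0 \<ge> (f2 - e) * s\<^sup>2"
proof -
  have "((\<lambda>h. (f' (0 + h) - f' 0) / h) \<longlongrightarrow> f2) (at 0)" using f' by (rule DERIV_D)
  then have "\<forall>\<^sub>F h in at 0. dist ((f' (0 + h) - f' 0) / h) f2 < e" using e by (rule tendstoD)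
  then obtain \<delta>0 where \<delta>0: "\<delta>0 > 0" "\<And>h. h \<noteq> 0 \<Longrightarrow> \<bar>h\<bar> < \<delta>0 \<Longrightarrow> \<bar>(f' h - f' 0) / h - f2\<bar> < e"
    unfolding eventually_at by (auto simp: dist_real_def)
  define \<delta> where "\<delta> = min d \<delta>0"
  have "f s + f (- s) - 2 * f 0 \<ge> (f2 - e) * s\<^sup>2" if s: "0 < s" "s < \<delta>" for s
  proof -
    let ?\<phi> = "\<lambda>s. f s + f (- s) - 2 * f 0 - (f2 - e) * s\<^sup>2"
    have der: "(?\<phi> has_real_derivative f' r - f' (- r) - (f2 - e) * (2 * r)) (at r)" if r: "0 \<le> r" "r \<le> s" for r
    proof -
      have r1: "\<bar>r\<bar> < d" "\<bar>- r\<bar> < d" using r s by (auto simp: \<delta>_def)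
      have "((\<lambda>s. f (- s)) has_real_derivative - f' (- r)) (at r)"
        using DERIV_chain2[where f = f and g = uminus and x = r, OF f[OF r1(2)] DERIV_minus[OF DERIV_ident]] by simp
      then show ?thesis using f[OF r1(1)] by (auto intro!: derivative_eq_intros)
    qed
    have nonneg: "f' r - f' (- r) - (f2 - e) * (2 * r) \<ge> 0" if r: "0 \<le> r" "r \<le> s" for r
    proof (cases "r = 0")
      case False
      then have rp: "r > 0" using r by simp
      have "f2 - e < (f' r - f' 0) / r" "f2 - e < (f' (- r) - f' 0) / (- r)"
        using \<delta>0(2)[of r] \<delta>0(2)[of "- r"] rp r s by (auto simp: \<delta>_def abs_less_iff)
      then have "(f2 - e) * r < f' r - f' 0" "(f2 - e) * r < f' 0 - f' (- r)"
        using rp by (simp_all add: pos_less_divide_eq minus_divide_left)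
      then show ?thesis by linarith
    qed simp
    have "?\<phi> 0 \<le> ?\<phi> s"
    proof (rule DERIV_nonneg_imp_nondecreasing[of 0 s ?\<phi>])
      show "\<exists>y. (?\<phi> has_real_derivative y) (at r) \<and> 0 \<le> y" if r: "0 \<le> r" "r \<le> s" for r
        using der[OF r] nonneg[OF r] by (intro exI conjI)
    qed (use s in simp)
    then show ?thesis by simp
  qed
  then show ?thesis using d \<delta>0(1) by (intro exI[of _ \<delta>]) (auto simp: \<delta>_def)
qed

text \<open>Four-point Laplacian bounds replace the sub-mean value property: they are what the infimum of a
  family of smooth plurisubharmonic functions inherits at a minimizer.\<close>

definition subharmonic4 :: "(complex \<Rightarrow> real) \<Rightarrow> bool" where
  "subharmonic4 V \<longleftrightarrow> (\<forall>z e. e > 0 \<longrightarrow> (\<exists>\<delta>>0. \<forall>s. 0 < s \<and> s < \<delta> \<longrightarrow>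
     V (z + of_real s) + V (z - of_real s) + V (z + \<i> * of_real s) + V (z - \<i> * of_real s) - 4 * V z \<ge> - (e * s\<^sup>2)))"

text \<open>Harmonicity of the real part of a holomorphic function: the second derivatives along 1
  and along i are Re g2 and - Re g2 and cancel.\<close>

lemma root_harmonic:
  assumes z: "Im z > 0" and e: "e > 0"
  shows "\<exists>\<delta>>0. \<forall>s. 0 < s \<and> s < \<delta> \<longrightarrow>
     Re (csqrt (- \<i> * (z + of_real s))) + Re (csqrt (- \<i> * (z - of_real s))) + Re (csqrt (- \<i> * (z + \<i> * of_real s)))
       + Re (csqrt (- \<i> * (z - \<i> * of_real s))) - 4 * Re (csqrt (- \<i> * z)) \<le> e * s\<^sup>2"
proof -
  let ?g = "\<lambda>z. csqrt (- \<i> * z)"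
  let ?g' = "\<lambda>z. - \<i> / (2 * csqrt (- \<i> * z))"
  have nz: "csqrt (- \<i> * w) \<noteq> 0" if "Im w > 0" for w using that by auto
  have dom: "- \<i> * w \<notin> \<real>\<^sub>\<le>\<^sub>0" if "Im w > 0" for w using that by (auto simp: complex_nonpos_Reals_iff)
  have D1: "(?g has_field_derivative ?g' w) (at w)" if w: "Im w > 0" for w
  proof -
    have "((\<lambda>w. - \<i> * w) has_field_derivative - \<i>) (at w)" by (auto intro!: derivative_eq_intros)
    then have "(?g has_field_derivative inverse (2 * csqrt (- \<i> * w)) * - \<i>) (at w)"
      by (rule DERIV_chain2[where f = csqrt and g = "\<lambda>w. - \<i> * w" and x = w, OF has_field_derivative_csqrt[OF dom[OF w]]])
    moreover have "inverse (2 * csqrt (- \<i> * w)) * - \<i> = ?g' w" by (simp only: divide_inverse mult.commute)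
    ultimately show ?thesis by (simp only:)
  qed
  obtain g2 where D2: "(?g' has_field_derivative g2) (at z)"
  proof -
    have "((\<lambda>w. 2 * csqrt (- \<i> * w)) has_field_derivative 2 * ?g' z) (at z)"
      by (intro DERIV_cmult D1 z)
    moreover have "2 * csqrt (- \<i> * z) \<noteq> 0" using nz[OF z] by (simp only: mult_eq_0_iff) simp
    ultimately show ?thesis by (rule that[OF DERIV_divide[OF DERIV_const]])
  qed
  define d where "d = Im z"
  \<comment> \<open>The function is negated because an upper bound is wanted and
    \<open>second_difference_ge\<close> bounds from below.\<close>
  have along: "\<exists>\<delta>>0. \<forall>s. 0 < s \<and> s < \<delta> \<longrightarrow>
      - Re (?g (z + c * of_real s)) + - Re (?g (z + c * of_real (- s))) - 2 * - Re (?g (z + c * of_real 0)) \<ge> (- Re (c * c * g2) - e / 2) * s\<^sup>2"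
    if c: "norm c \<le> 1" for c
  proof (rule second_difference_ge[where d = d])
    have line: "((\<lambda>s. z + c * of_real s) has_vector_derivative c) (at s)" for s
      by (auto intro!: derivative_eq_intros)
    have im: "Im (z + c * of_real s) > 0" if "\<bar>s\<bar> < d" for s :: real
    proof -
      have "\<bar>Im (c * of_real s)\<bar> \<le> norm c * \<bar>s\<bar>" using abs_Im_le_cmod[of "c * of_real s"] by (simp add: norm_mult)
      also have "\<dots> \<le> \<bar>s\<bar>" using c by (simp add: mult_left_le_one_le)
      finally have "\<bar>Im (c * of_real s)\<bar> < Im z" using that by (simp add: d_def)
      then show ?thesis by (simp add: abs_less_iff)
    qed
    show "((\<lambda>s. - Re (?g (z + c * of_real s))) has_real_derivative - Re (c * ?g' (z + c * of_real s))) (at s)"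
      if "\<bar>s\<bar> < d" for s
    proof -
      have "((\<lambda>s. ?g (z + c * of_real s)) has_vector_derivative c * ?g' (z + c * of_real s)) (at s)"
        using field_vector_diff_chain_at[OF line D1[OF im[OF that]]] by (simp add: o_def)
      from bounded_linear.has_vector_derivative[OF bounded_linear_Re this]
      show ?thesis using has_vector_derivative_minus
        by (fastforce simp: has_real_derivative_iff_has_vector_derivative)
    qed
    have "((\<lambda>s. ?g' (z + c * of_real s)) has_vector_derivative c * g2) (at 0)"
      using field_vector_diff_chain_at[OF line[of 0], of ?g' g2] D2 by (simp add: o_def)
    then have "((\<lambda>s. c * ?g' (z + c * of_real s)) has_vector_derivative c * (c * g2)) (at 0)"
      by (rule bounded_linear.has_vector_derivative[OF bounded_linear_mult_right])
    from bounded_linear.has_vector_derivative[OF bounded_linear_Re this]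
    show "((\<lambda>s. - Re (c * ?g' (z + c * of_real s))) has_real_derivative - Re (c * c * g2)) (at 0)"
      using has_vector_derivative_minus by (fastforce simp: has_real_derivative_iff_has_vector_derivative mult.assoc)
    show "e / 2 > 0" "d > 0" using e z by (simp_all add: d_def)
  qed
  obtain \<delta>1 where \<delta>1: "\<delta>1 > 0" "\<And>s. 0 < s \<and> s < \<delta>1 \<Longrightarrow>
      - Re (?g (z + of_real s)) - Re (?g (z - of_real s)) + 2 * Re (?g z) \<ge> (- Re g2 - e / 2) * s\<^sup>2"
    using along[of 1] by auto
  obtain \<delta>2 where \<delta>2: "\<delta>2 > 0" "\<And>s. 0 < s \<and> s < \<delta>2 \<Longrightarrow>
      - Re (?g (z + \<i> * of_real s)) - Re (?g (z - \<i> * of_real s)) + 2 * Re (?g z) \<ge> (Re g2 - e / 2) * s\<^sup>2"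
    using along[of \<i>] by auto
  show ?thesis
  proof (intro exI[of _ "min \<delta>1 \<delta>2"] conjI allI impI)
    show "min \<delta>1 \<delta>2 > 0" using \<delta>1 \<delta>2 by simp
    fix s assume s: "0 < s \<and> s < min \<delta>1 \<delta>2"
    show "Re (?g (z + of_real s)) + Re (?g (z - of_real s)) + Re (?g (z + \<i> * of_real s)) + Re (?g (z - \<i> * of_real s)) - 4 * Re (?g z) \<le> e * s\<^sup>2"
      using \<delta>1(2)[of s] \<delta>2(2)[of s] s by (auto simp: algebra_simps)
  qed
qed

lemma Re_csqrt_rotate: "Re (csqrt (- \<i> * z)) = sqrt ((norm z + Im z) / 2)"
  by (simp add: csqrt.simps norm_mult)

lemma Re_csqrt_ge:
  assumes "Im z \<ge> 0"
  shows "Re (csqrt (- \<i> * z)) \<ge> sqrt (norm z / 2)" "Re (csqrt (- \<i> * z)) \<le> sqrt (norm z)"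
proof -
  have "Im z \<le> norm z" using abs_Im_le_cmod[of z] by simp
  then show "Re (csqrt (- \<i> * z)) \<ge> sqrt (norm z / 2)" "Re (csqrt (- \<i> * z)) \<le> sqrt (norm z)"
    using assms unfolding Re_csqrt_rotate by (auto intro!: real_sqrt_le_mono)
qed

text \<open>Maximum principle for V minus the barrier q, which is at least m on the diameter and at
  least M on the arc. At an interior maximum the four-point Laplacians of V and of a perturbed
  barrier contradict each other.\<close>

lemma two_constants_upper:
  assumes sub: "subharmonic4 V" and cont: "continuous_on UNIV V" and R: "R > 0" and mM: "m \<le> M"
    and V_le_M: "\<And>z. norm z \<le> R \<Longrightarrow> V z \<le> M" and V_le_m: "\<And>x. \<bar>x\<bar> \<le> R \<Longrightarrow> V (of_real x) \<le> m"
    and z1: "Im z1 \<ge> 0" "norm z1 \<le> R"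
  shows "V z1 \<le> m + (M - m) * sqrt (2 * norm z1 / R)"
proof -
  \<comment> \<open>Chosen so that c sqrt(R / 2) = M - m, by which the barrier reaches M on the
    arc.\<close>
  define c where "c = (M - m) * sqrt (2 / R)"
  have c: "c \<ge> 0" using mM R by (simp add: c_def)
  define q where "q = (\<lambda>z. m + c * Re (csqrt (- \<i> * z)))"
  define S where "S = cball 0 R \<inter> {z. Im z \<ge> 0}"
  have cS: "compact S" unfolding S_def by (intro compact_Int_closed compact_cball closed_halfspace_Im_ge)
  have z1S: "z1 \<in> S" using z1 by (simp add: S_def)
  have q_ge: "q z \<ge> m" if "z \<in> S" for z
    using c Re_csqrt_ge(1)[of z] that order_trans[of 0 "sqrt (norm z / 2)"] by (simp add: q_def S_def)
  have q_arc: "q z \<ge> M" if "norm z = R" "Im z \<ge> 0" for z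
  proof -
    have "M - m = c * sqrt (norm z / 2)" using R by (simp add: c_def that real_sqrt_mult[symmetric])
    also have "\<dots> \<le> c * Re (csqrt (- \<i> * z))" using c Re_csqrt_ge(1)[OF that(2)] by (intro mult_left_mono) auto
    finally show ?thesis by (simp add: q_def)
  qed
  have contq: "continuous_on S q" unfolding q_def Re_csqrt_rotate by (intro continuous_intros) auto
  have "V z1 \<le> q z1"
  proof (rule ccontr)
    assume "\<not> V z1 \<le> q z1"
    \<comment> \<open>The term \<delta> (R^2 - |z|^2) makes the barrier strictly superharmonic, with
      four-point Laplacian at most - 4 \<delta> s^2 from this term. Its size leaves half of the
      assumed excess at z1.\<close>
    define \<delta> where "\<delta> = (V z1 - q z1) / (2 * (R\<^sup>2 + 1))"
    have \<delta>: "\<delta> > 0" using \<open>\<not> V z1 \<le> q z1\<close> by (simp add: \<delta>_def add_nonneg_pos)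
    define q' where "q' = (\<lambda>z. q z + \<delta> * (R\<^sup>2 - (norm z)\<^sup>2))"
    have cq': "continuous_on S q'" unfolding q'_def by (intro continuous_intros contq)
    obtain z where z: "z \<in> S" "\<And>w. w \<in> S \<Longrightarrow> V w - q' w \<le> V z - q' z"
      using continuous_attains_sup[OF cS _ continuous_on_diff[OF continuous_on_subset[OF cont subset_UNIV] cq']] z1S by blast
    have "V z1 - q' z1 > 0"
    proof -
      have "\<delta> * (R\<^sup>2 - (norm z1)\<^sup>2) \<le> \<delta> * (R\<^sup>2 + 1)"
        using \<delta> zero_le_power2[of "norm z1"] by (intro mult_left_mono) linarith+
      also have "\<dots> = (V z1 - q z1) / 2"
      proof -
        have "R\<^sup>2 + 1 > 0" by (simp add: add_nonneg_pos)
        then show ?thesis by (simp add: \<delta>_def divide_simps)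
      qed
      finally show ?thesis using \<open>\<not> V z1 \<le> q z1\<close> by (simp add: q'_def field_simps)
    qed
    then have pos: "V z > q' z" using z(2)[OF z1S] by linarith
    have q'q: "q' w \<ge> q w" if "w \<in> S" for w
      using \<delta> that by (simp add: q'_def S_def power_mono)
    have "norm z \<noteq> R"
      using pos q'q[OF z(1)] q_arc[of z] V_le_M[of z] z(1) by (auto simp: S_def)
    moreover have "Im z \<noteq> 0"
    proof
      assume "Im z = 0"
      then have "z = of_real (Re z)" by (simp add: complex_eq_iff)
      moreover have "\<bar>Re z\<bar> \<le> R" using z(1) abs_Re_le_cmod[of z] by (auto simp: S_def)
      ultimately have "V z \<le> m" using V_le_m by metis
      then show False using pos q'q[OF z(1)] q_ge[OF z(1)] by linarith
    qed
    ultimately have zin: "norm z < R" "Im z > 0" using z(1) by (auto simp: S_def)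
    obtain \<delta>1 where \<delta>1: "\<delta>1 > 0" "\<And>s. 0 < s \<and> s < \<delta>1 \<Longrightarrow>
       V (z + of_real s) + V (z - of_real s) + V (z + \<i> * of_real s) + V (z - \<i> * of_real s) - 4 * V z \<ge> - (\<delta> * s\<^sup>2)"
      using sub \<delta> unfolding subharmonic4_def by blast
    \<comment> \<open>After multiplication by c the error of the root stays below \<delta>; the
      \<open>+ 1\<close> covers c = 0. The budget is then - \<delta> <= \<delta> - 4 \<delta>, which
      is absurd.\<close>
    have e0: "\<delta> / (c + 1) > 0" using \<delta> c by simp
    obtain \<delta>2 where \<delta>2: "\<delta>2 > 0" "\<And>s. 0 < s \<and> s < \<delta>2 \<Longrightarrow>
       Re (csqrt (- \<i> * (z + of_real s))) + Re (csqrt (- \<i> * (z - of_real s))) + Re (csqrt (- \<i> * (z + \<i> * of_real s)))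
       + Re (csqrt (- \<i> * (z - \<i> * of_real s))) - 4 * Re (csqrt (- \<i> * z)) \<le> \<delta> / (c + 1) * s\<^sup>2"
      using root_harmonic[OF zin(2) e0] by blast
    define \<delta>3 where "\<delta>3 = min (R - norm z) (Im z)"
    define s where "s = min (min \<delta>1 \<delta>2) \<delta>3 / 2"
    have s: "0 < s" "s < \<delta>1" "s < \<delta>2" "s < \<delta>3" using \<delta>1(1) \<delta>2(1) zin by (auto simp: s_def \<delta>3_def min_def)
    have inS: "z + w \<in> S" if "norm w = s" for w
      using that s(4) norm_triangle_ineq[of z w] abs_Im_le_cmod[of w] by (auto simp: S_def \<delta>3_def)
    have ptS: "z + of_real s \<in> S" "z - of_real s \<in> S" "z + \<i> * of_real s \<in> S" "z - \<i> * of_real s \<in> S"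
      using inS[of "of_real s"] inS[of "- of_real s"] inS[of "\<i> * of_real s"] inS[of "- (\<i> * of_real s)"] s(1) by (simp_all add: norm_mult)
    have nsq: "(norm (z + of_real s))\<^sup>2 + (norm (z - of_real s))\<^sup>2 + (norm (z + \<i> * of_real s))\<^sup>2 + (norm (z - \<i> * of_real s))\<^sup>2
       = 4 * (norm z)\<^sup>2 + 4 * s\<^sup>2"
      unfolding cmod_power2 by (simp add: power2_eq_square algebra_simps)
    have "- (\<delta> * s\<^sup>2) \<le> V (z + of_real s) + V (z - of_real s) + V (z + \<i> * of_real s) + V (z - \<i> * of_real s) - 4 * V z"
      using \<delta>1(2) s by blast
    also have "\<dots> \<le> q' (z + of_real s) + q' (z - of_real s) + q' (z + \<i> * of_real s) + q' (z - \<i> * of_real s) - 4 * q' z"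
      using z(2)[OF ptS(1)] z(2)[OF ptS(2)] z(2)[OF ptS(3)] z(2)[OF ptS(4)] by linarith
    also have "\<dots> = c * (Re (csqrt (- \<i> * (z + of_real s))) + Re (csqrt (- \<i> * (z - of_real s))) + Re (csqrt (- \<i> * (z + \<i> * of_real s)))
       + Re (csqrt (- \<i> * (z - \<i> * of_real s))) - 4 * Re (csqrt (- \<i> * z)))
       - \<delta> * ((norm (z + of_real s))\<^sup>2 + (norm (z - of_real s))\<^sup>2 + (norm (z + \<i> * of_real s))\<^sup>2 + (norm (z - \<i> * of_real s))\<^sup>2 - 4 * (norm z)\<^sup>2)"
      unfolding q'_def q_def by (simp add: algebra_simps)
    also have "\<dots> \<le> c * (\<delta> / (c + 1) * s\<^sup>2) - \<delta> * (4 * s\<^sup>2)"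
      unfolding nsq by (intro diff_mono mult_left_mono \<delta>2(2)) (use s c \<delta> in auto)
    also have "c * (\<delta> / (c + 1) * s\<^sup>2) \<le> \<delta> * s\<^sup>2"
    proof -
      have "c * (\<delta> / (c + 1)) \<le> \<delta>" using c \<delta> by (simp add: field_simps)
      then show ?thesis using mult_right_mono[of "c * (\<delta> / (c + 1))" \<delta> "s\<^sup>2"] by (simp add: mult.assoc)
    qed
    finally have "2 * (\<delta> * s\<^sup>2) \<le> 0" by (simp add: algebra_simps)
    then show False using \<delta> s(1) by (simp add: mult_le_0_iff power2_eq_square)
  qed
  also have "q z1 \<le> m + (M - m) * sqrt (2 * norm z1 / R)"
  proof -
    have "c * Re (csqrt (- \<i> * z1)) \<le> c * sqrt (norm z1)" using c Re_csqrt_ge(2)[OF z1(1)] by (intro mult_left_mono) auto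
    also have "\<dots> = (M - m) * sqrt (2 * norm z1 / R)" by (simp add: c_def real_sqrt_mult[symmetric])
    finally show ?thesis by (simp add: q_def)
  qed
  finally show ?thesis .
qed

text \<open>The lower half disc follows by complex conjugation, which exchanges two of the four
  points and preserves the real diameter.\<close>

lemma two_constants:
  assumes sub: "subharmonic4 V" and cont: "continuous_on UNIV V" and R: "R > 0" and mM: "m \<le> M"
    and V_le_M: "\<And>z. norm z \<le> R \<Longrightarrow> V z \<le> M" and V_le_m: "\<And>x. \<bar>x\<bar> \<le> R \<Longrightarrow> V (of_real x) \<le> m"
    and z1: "norm z1 \<le> R"
  shows "V z1 \<le> m + (M - m) * sqrt (2 * norm z1 / R)"
proof (cases "Im z1 \<ge> 0")
  case True
  show ?thesis by (rule two_constants_upper[OF sub cont R mM V_le_M V_le_m True z1])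
next
  case False
  have sub': "subharmonic4 (\<lambda>z. V (cnj z))"
    unfolding subharmonic4_def
  proof (intro allI impI)
    fix z and e :: real assume "e > 0"
    then obtain \<delta> where "\<delta> > 0" "\<And>s. 0 < s \<and> s < \<delta> \<Longrightarrow>
      V (cnj z + of_real s) + V (cnj z - of_real s) + V (cnj z + \<i> * of_real s) + V (cnj z - \<i> * of_real s) - 4 * V (cnj z) \<ge> - (e * s\<^sup>2)"
      using sub unfolding subharmonic4_def by blast
    then show "\<exists>\<delta>>0. \<forall>s. 0 < s \<and> s < \<delta> \<longrightarrow> - (e * s\<^sup>2) \<le> V (cnj (z + of_real s)) + V (cnj (z - of_real s)) + V (cnj (z + \<i> * of_real s)) + V (cnj (z - \<i> * of_real s)) - 4 * V (cnj z)"
      by (intro exI[of _ \<delta>]) (auto simp: algebra_simps)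
  qed
  have cont': "continuous_on UNIV (\<lambda>z. V (cnj z))"
    by (rule continuous_on_compose2[OF cont]) (auto intro: continuous_intros)
  have "V (cnj (cnj z1)) \<le> m + (M - m) * sqrt (2 * norm (cnj z1) / R)"
    by (rule two_constants_upper[OF sub' cont' R mM]) (use V_le_M V_le_m z1 False in auto)
  then show ?thesis by simp
qed

text \<open>Growth from one-sided derivative bounds, meant for the distance to a set, which need not
  be differentiable. Points with f s = 0 are exempt from the hypothesis; there continuity and the
  slack in \<open>b\<close> carry the bound a little further.\<close>

lemma dini_bound:
  fixes f :: "real \<Rightarrow> real"
  assumes cont: "continuous_on {0..1} f" and nonneg: "\<And>s. f s \<ge> 0" and L: "L \<ge> 0"
    and dini: "\<And>s e. s \<in> {0..<1} \<Longrightarrow> f s > 0 \<Longrightarrow> e > 0 \<Longrightarrow> \<exists>d>0. \<forall>r. s < r \<and> r < s + d \<and> r \<le> 1 \<longrightarrow> f r \<le> f s + (L + e) * (r - s)"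
  shows "f 1 \<le> f 0 + L"
proof (rule field_le_epsilon)
  fix e' :: real assume "e' > 0"
  define e where "e = e' / 2"
  have e: "e > 0" using \<open>e' > 0\<close> by (simp add: e_def)
  \<comment> \<open>The e in the slope absorbs the error of the Dini bound, the additive e gives
    room where f vanishes.\<close>
  define b where "b = (\<lambda>s. f 0 + (L + e) * s + e)"
  define T where "T = {s \<in> {0..1}. \<forall>r\<in>{0..s}. f r \<le> b r}"
  have T0: "0 \<in> T" using e by (simp add: T_def b_def)
  define s where "s = Sup T"
  have bd: "bdd_above T" by (rule bdd_aboveI[of _ 1]) (auto simp: T_def)
  have "0 \<le> s" unfolding s_def by (rule cSup_upper[OF T0 bd])
  moreover have "s \<le> 1" unfolding s_def
  proof (rule cSup_least)
    show "T \<noteq> {}" using T0 by blast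
  qed (simp add: T_def)
  ultimately have s01: "s \<in> {0..1}" by simp
  have below: "f r \<le> b r" if r: "0 \<le> r" "r < s" for r
  proof -
    have "r < Sup T" using r(2) by (simp only: s_def)
    then obtain t where "t \<in> T" "r < t" using T0 by (blast elim: less_cSupE)
    then show ?thesis using r(1) by (auto simp: T_def)
  qed
  have fs: "f s \<le> b s"
  proof (cases "s = 0")
    case True then show ?thesis using T0 by (simp add: T_def)
  next
    case False
    then have sp: "s > 0" using s01 by auto
    have "continuous_on {0..1} (\<lambda>r. b r - f r)" unfolding b_def by (intro continuous_intros cont)
    then have "((\<lambda>r. b r - f r) \<longlongrightarrow> b s - f s) (at s within {0..1})" using s01 by (simp add: continuous_on_def)
    then have "((\<lambda>r. b r - f r) \<longlongrightarrow> b s - f s) (at s within {0..<s})" by (rule tendsto_within_subset) (use s01 in auto)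
    moreover have "at s within {0..<s} \<noteq> bot" using sp by (simp add: at_within_eq_bot_iff)
    moreover have "\<forall>\<^sub>F r in at s within {0..<s}. 0 \<le> b r - f r"
      unfolding eventually_at_filter using below by (auto intro: always_eventually)
    ultimately show ?thesis using tendsto_lowerbound by fastforce
  qed
  have "s = 1"
  proof (rule ccontr)
    assume "s \<noteq> 1"
    then have s1: "s \<in> {0..<1}" using s01 by auto
    have "\<exists>d>0. \<forall>r. s < r \<and> r < s + d \<and> r \<le> 1 \<longrightarrow> f r \<le> b r"
    proof (cases "f s > 0")
      case True
      then obtain d where "d > 0" "\<And>r. s < r \<and> r < s + d \<and> r \<le> 1 \<Longrightarrow> f r \<le> f s + (L + e) * (r - s)"
        using dini[OF s1 _ e] by blast
      then show ?thesis using fs by (intro exI[of _ d]) (fastforce simp: b_def algebra_simps)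
    next
      case False
      have "f s < e" using False e by simp
      then have "\<forall>\<^sub>F r in at s within {0..1}. f r < e"
        using cont s01 order_tendstoD(2)[of f "f s" "at s within {0..1}" e] by (simp add: continuous_on_def)
      then obtain d where d: "d > 0" "\<And>r. r \<in> {0..1} \<Longrightarrow> r \<noteq> s \<Longrightarrow> dist r s < d \<Longrightarrow> f r < e"
        unfolding eventually_at by blast
      have "f r \<le> b r" if r: "s < r \<and> r < s + d \<and> r \<le> 1" for r
      proof -
        have "f r < e" using d(2)[of r] r s01 by (auto simp: dist_real_def)
        moreover have "(L + e) * r \<ge> 0" using L e r s01 by auto
        ultimately show ?thesis using nonneg[of 0] by (simp add: b_def)
      qed
      then show ?thesis using d(1) by blast
    qed
    then obtain d where d: "d > 0" "\<And>r. s < r \<and> r < s + d \<and> r \<le> 1 \<Longrightarrow> f r \<le> b r" by blast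
    define t where "t = min (s + d / 2) 1"
    have t: "s < t" "t < s + d" "t \<le> 1" using d(1) s1 by (auto simp: t_def min_def)
    have "t \<in> T" unfolding T_def
    proof (intro CollectI conjI ballI)
      show "t \<in> {0..1}" using t s01 by auto
      fix r assume "r \<in> {0..t}"
      then show "f r \<le> b r" using below[of r] fs d(2)[of r] t by (cases r s rule: linorder_cases) auto
    qed
    then have "t \<le> s" using cSup_upper[OF _ bd] by (simp add: s_def)
    then show False using t by simp
  qed
  then show "f 1 \<le> f 0 + L + e'" using fs by (simp add: b_def e_def)
qed

lemma (in lie_group) continuous_mult:
  assumes "continuous_on S f" "continuous_on S g"
  shows "continuous_on S (\<lambda>x. f x \<otimes> g x)"
proof -
  have "continuous_on UNIV (\<lambda>(x, y). x \<otimes> y)" using smooth_mult by (simp add: smooth_map_on_def)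
  from continuous_on_compose2[OF this continuous_on_Pair[OF assms]] show ?thesis by simp
qed

lemma (in lie_group) continuous_ex: "continuous_on S (ex X)"
  using smooth_ex[of X] continuous_on_subset by (auto simp: smooth_map_on_def)

lemma (in lie_group) continuous_inverse:
  assumes "continuous_on S f"
  shows "continuous_on S (\<lambda>x. inv (f x))"
proof -
  have "continuous_on UNIV (\<lambda>x. inv x)" using smooth_inverse by (simp add: smooth_map_on_def)
  from continuous_on_compose2[OF this assms] show ?thesis by simp
qed

context complexification
begin

lemma continuous_polar_maps:
  "continuous_on S f \<Longrightarrow> continuous_on S (\<lambda>x. px (f x))" "continuous_on S f \<Longrightarrow> continuous_on S (\<lambda>x. pu (f x))"
  "continuous_on S g \<Longrightarrow> continuous_on S (\<lambda>x. E (g x))"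
  using smooth_polar_maps by (auto simp: smooth_map_on_def intro: continuous_on_compose2)

lemma continuous_\<iota>: "continuous_on S f \<Longrightarrow> continuous_on S (\<lambda>x. \<iota> (f x))"
  using smooth_\<iota> by (auto simp: smooth_map_on_def intro: continuous_on_compose2)

lemma Xi_px: "Xi h = px (h \<otimes>\<^bsub>H\<^esub> inv\<^bsub>H\<^esub> \<iota> (pu h))"
proof -
  have "h \<otimes>\<^bsub>H\<^esub> inv\<^bsub>H\<^esub> \<iota> (pu h) = \<iota> (pu h) \<otimes>\<^bsub>H\<^esub> E (px h) \<otimes>\<^bsub>H\<^esub> inv\<^bsub>H\<^esub> \<iota> (pu h)" by simp
  also have "\<dots> = E (Xi h)" unfolding Ad_E Xi_def ..
  finally show ?thesis by simp
qed

lemma continuous_Xi: "continuous_on S f \<Longrightarrow> continuous_on S (\<lambda>x. Xi (f x))"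
  unfolding Xi_px by (intro continuous_polar_maps H.continuous_mult H.continuous_inverse continuous_\<iota>)

end

section \<open>The energy function\<close>

context complex_hamiltonian
begin

lemma continuous_action:
  assumes "continuous_on S f" "continuous_on S g"
  shows "continuous_on S (\<lambda>x. actC (f x) (g x))"
proof -
  have "continuous_on UNIV (\<lambda>(g, m). actC g m)" using actC_holomorphic by (simp add: holomorphic_map_on_def smooth_map_on_def)
  from continuous_on_compose2[OF this continuous_on_Pair[OF assms]] show ?thesis by simp
qed

lemma continuous_Phis: "continuous_on S f \<Longrightarrow> continuous_on S (\<lambda>x. Phis (f x))"
proof -
  assume f: "continuous_on S f"
  obtain Bs :: "'ue set" and d where eq: "\<And>v. v = (\<Sum>b\<in>Bs. ip v (d b) *\<^sub>R b)" by (rule ip_coordinates) blast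
  have "continuous_on UNIV \<Phi>" using ham.smooth_\<Phi> by (simp add: smooth_map_on_def)
  from continuous_on_compose2[OF this f] have c: "continuous_on S (\<lambda>x. \<Phi> (f x))" by simp
  have "continuous_on S (\<lambda>x. \<Sum>b\<in>Bs. ip (Phis (f x)) (d b) *\<^sub>R b)"
    unfolding ip_Phis by (intro continuous_intros c)
  then show ?thesis unfolding eq[symmetric] .
qed

lemma continuous_psi: "continuous_on UNIV (\<lambda>h. psi y h)"
proof -
  have "continuous_on (UNIV \<times> cbox 0 1) (\<lambda>(h, r). blinfun_apply (\<Phi> (actC (E (r *\<^sub>R px h)) y)) (px h))"
    unfolding case_prod_unfold
  proof (intro continuous_intros continuous_polar_maps continuous_action)
    have "continuous_on UNIV \<Phi>" using ham.smooth_\<Phi> by (simp add: smooth_map_on_def)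
    then show "continuous_on (UNIV \<times> cbox 0 1) (\<lambda>x::'h \<times> real. \<Phi> (actC (E (snd x *\<^sub>R px (fst x))) y))"
      by (rule continuous_on_compose2) (auto intro!: continuous_intros continuous_polar_maps continuous_action)
  qed
  from integral_continuous_on_param[OF this] show ?thesis by (simp add: psi_def)
qed

text \<open>Up to the factor \<open>1 / (2 t)\<close> the second summand is the squared distance between \<open>h\<close> and \<open>inv k\<close> in the symmetric
  space of cosets of \<open>\<iota> U\<close>.\<close>

definition Fn :: "'m \<Rightarrow> real \<Rightarrow> 'h \<Rightarrow> 'h \<Rightarrow> real" where
  "Fn y t k h = psi y h + ip (Xi (h \<otimes>\<^bsub>H\<^esub> k)) (Xi (h \<otimes>\<^bsub>H\<^esub> k)) / (2 * t)"

text \<open>The gradient of \<open>Fn y t k\<close> at \<open>h\<close>, and \<open>TT\<close> is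
  its Hessian operator; directions are of the form exp(i b) h.\<close>

definition gF :: "'m \<Rightarrow> real \<Rightarrow> 'h \<Rightarrow> 'h \<Rightarrow> 'ue" where
  "gF y t k h = Phis (actC h y) + (1 / t) *\<^sub>R Xi (h \<otimes>\<^bsub>H\<^esub> k)"

definition TT :: "'m \<Rightarrow> real \<Rightarrow> 'h \<Rightarrow> 'h \<Rightarrow> 'ue \<Rightarrow> 'ue" where
  "TT y t k h b = Tphi (actC h y) b + (1 / t) *\<^sub>R Dx (h \<otimes>\<^bsub>H\<^esub> k) b"

lemma Fn_left: "Fn y t k (\<iota> u \<otimes>\<^bsub>H\<^esub> h) = Fn y t k h"
  by (simp add: Fn_def psi_left H.m_assoc Xi_left ip_Ad)

lemma linear_TT: "linear (TT y t k h)"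
  unfolding TT_def[abs_def]
  by (intro linear_compose_add linear_Tphi linear_compose_scale_right linear_Dx)

lemma TT_pos: "t > 0 \<Longrightarrow> ip (TT y t k h b) b \<ge> ip b b / t"
  using Tphi_nonneg[of "actC h y" b] Dx_positive[where h = "h \<otimes>\<^bsub>H\<^esub> k" and b = b]
  by (simp add: TT_def ip_simps divide_right_mono add_increasing)

text \<open>The Gauss lemma: \<open>Xi h\<close> commutes with itself, so \<open>Dx\<close> does not
  change the radial component, and rotations are orthogonal to it.\<close>

lemma ip_Xi_dXi: "ip (Xi h) (dXi h X) = ip (Xi h) (im X)"
  using Dx_centralizer[of h "Xi h" "im X"] ip_skew[of "re X" "Xi h" "Xi h"]
  by (simp add: dXi_eq ip_simps U.bracket_self ip_sym[of _ "Xi h"])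

lemma ip_Xi_derivative:
  assumes "dlog H AH c s X"
  shows "((\<lambda>r. ip (Xi (c r)) (Xi (c r)) / (2 * t)) has_real_derivative ip (Xi (c s)) (im X) / t) (at s)"
proof -
  have "((\<lambda>r. ip (Xi (c r)) (Xi (c r)) / (2 * t)) has_real_derivative
     (ip (Xi (c s)) (dXi (c s) X) + ip (dXi (c s) X) (Xi (c s))) / (2 * t)) (at s)"
    by (intro DERIV_cdivide ip_derivative Xi_derivative assms)
  then show ?thesis by (simp add: ip_sym[of "dXi _ _"] ip_Xi_dXi)
qed

lemma gF_derivative:
  assumes "dlog H AH c s X"
  shows "((\<lambda>r. gF y t k (c r)) has_vector_derivative bracket U A (re X) (gF y t k (c s)) + TT y t k (c s) (im X)) (at s)"
proof -
  have "((\<lambda>r. gF y t k (c r)) has_vector_derivative dPhi (actC (c s) y) X + (1 / t) *\<^sub>R dXi (c s \<otimes>\<^bsub>H\<^esub> k) X) (at s)"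
    unfolding gF_def
    by (intro has_vector_derivative_add Phis_derivative assms bounded_linear.has_vector_derivative[OF bounded_linear_scaleR_right]
        Xi_derivative[OF H.dlog_right[OF assms]])
  then show ?thesis
    by (simp add: gF_def TT_def dPhi_eq dXi_eq scaleR_add_right U.bracket_simps algebra_simps)
qed

lemma Fn_derivative:
  "((\<lambda>s. Fn y t k (H.ex X s \<otimes>\<^bsub>H\<^esub> h)) has_real_derivative ip (gF y t k (H.ex X s \<otimes>\<^bsub>H\<^esub> h)) (im X)) (at s)"
proof -
  have "((\<lambda>s. Fn y t k (H.ex X s \<otimes>\<^bsub>H\<^esub> h)) has_real_derivative ip (Phis (actC (H.ex X s \<otimes>\<^bsub>H\<^esub> h) y)) (im X)
    + ip (Xi (H.ex X s \<otimes>\<^bsub>H\<^esub> h \<otimes>\<^bsub>H\<^esub> k)) (im X) / t) (at s)"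
    unfolding Fn_def by (intro DERIV_add psi_derivative ip_Xi_derivative H.dlog_right H.dlog_ex_left)
  then show ?thesis by (simp add: gF_def ip_simps)
qed

text \<open>Along the geodesic exp(i s \<xi>) h the potential is convex, and the squared distance
  has Hessian at least 1/t by nonpositive curvature; integrate twice.\<close>

lemma Fn_strongly_convex:
  assumes t: "t > 0"
  shows "Fn y t k (E \<xi> \<otimes>\<^bsub>H\<^esub> h) \<ge> Fn y t k h + ip (gF y t k h) \<xi> + ip \<xi> \<xi> / (2 * t)"
proof -
  let ?c = "\<lambda>s. H.ex (j (i \<xi>)) s \<otimes>\<^bsub>H\<^esub> h"
  let ?g = "gF y t k h"
  have dF: "((\<lambda>s. Fn y t k (?c s)) has_real_derivative ip (gF y t k (?c s)) \<xi>) (at s)" for s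
    using Fn_derivative[of y t k "j (i \<xi>)" h s] by simp
  have dg: "((\<lambda>s. ip (gF y t k (?c s)) \<xi>) has_real_derivative ip (TT y t k (?c s) \<xi>) \<xi>) (at s)" for s
    using ip_derivative[OF gF_derivative[where y = y and t = t and k = k, OF H.dlog_ex_left[of "j (i \<xi>)" h s]] has_vector_derivative_const[of \<xi>]]
    by (simp add: ip_simps U.bracket_simps)
  have 1: "ip (gF y t k (?c s)) \<xi> \<ge> ip ?g \<xi> + s * (ip \<xi> \<xi> / t)" if "s \<ge> 0" for s
  proof -
    let ?f = "\<lambda>s. ip (gF y t k (?c s)) \<xi> - s * (ip \<xi> \<xi> / t)"
    have "?f 0 \<le> ?f s"
    proof (rule DERIV_nonneg_imp_nondecreasing[of 0 s ?f])
      fix r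
      have "(?f has_real_derivative ip (TT y t k (?c r) \<xi>) \<xi> - 1 * (ip \<xi> \<xi> / t)) (at r)"
        by (intro DERIV_diff dg DERIV_cmult_right DERIV_ident)
      then show "\<exists>z. (?f has_real_derivative z) (at r) \<and> 0 \<le> z" using TT_pos[OF t, of \<xi> y k "?c r"] by (intro exI conjI) auto
    qed (use that in simp)
    then show ?thesis by simp
  qed
  let ?f = "\<lambda>s. Fn y t k (?c s) - s * ip ?g \<xi> - s\<^sup>2 * (ip \<xi> \<xi> / (2 * t))"
  have "?f 0 \<le> ?f 1"
  proof (rule DERIV_nonneg_imp_nondecreasing[of 0 1 ?f])
    fix r :: real assume r: "0 \<le> r"
    have "((\<lambda>s. s\<^sup>2 * (ip \<xi> \<xi> / (2 * t))) has_real_derivative r * (ip \<xi> \<xi> / t)) (at r)"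
      using t by (auto intro!: derivative_eq_intros simp: field_simps)
    then have "(?f has_real_derivative ip (gF y t k (?c r)) \<xi> - 1 * ip ?g \<xi> - r * (ip \<xi> \<xi> / t)) (at r)"
      by (intro DERIV_diff dF DERIV_cmult_right DERIV_ident)
    then show "\<exists>z. (?f has_real_derivative z) (at r) \<and> 0 \<le> z" using 1[OF r] by (intro exI conjI) auto
  qed simp
  then show ?thesis by (simp add: E_ex)
qed

lemma H_decompose: obtains u \<xi> where "h' = \<iota> u \<otimes>\<^bsub>H\<^esub> (E \<xi> \<otimes>\<^bsub>H\<^esub> h)"
proof -
  let ?g = "h' \<otimes>\<^bsub>H\<^esub> inv\<^bsub>H\<^esub> h"
  have "\<iota> (pu ?g) \<otimes>\<^bsub>H\<^esub> (E (px ?g) \<otimes>\<^bsub>H\<^esub> h) = (\<iota> (pu ?g) \<otimes>\<^bsub>H\<^esub> E (px ?g)) \<otimes>\<^bsub>H\<^esub> h" by (simp only: H.m_assoc H.carrier_UNIV UNIV_I)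
  also have "\<dots> = h'" by (simp only: polar) (simp add: H.m_assoc)
  finally show ?thesis using that by metis
qed

text \<open>Every coset is reached from h by one geodesic, so strong convexity is a global bound.
  Completing the square in \<xi> gives - t/2 times the squared gradient, and thereby an estimate of
  the minimum from any trial point.\<close>

lemma Fn_lower:
  assumes t: "t > 0"
  shows "Fn y t k h' \<ge> Fn y t k h - t / 2 * ip (gF y t k h) (gF y t k h)"
proof -
  obtain u \<xi> where h': "h' = \<iota> u \<otimes>\<^bsub>H\<^esub> (E \<xi> \<otimes>\<^bsub>H\<^esub> h)" by (rule H_decompose)
  let ?g = "gF y t k h"
  have "0 \<le> ip (\<xi> + t *\<^sub>R ?g) (\<xi> + t *\<^sub>R ?g) / (2 * t)" using t by (simp add: ip_nonneg)
  also have "\<dots> = ip ?g \<xi> + ip \<xi> \<xi> / (2 * t) + t / 2 * ip ?g ?g"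
    using t by (simp add: ip_simps ip_sym[of \<xi> ?g] field_simps)
  finally show ?thesis using Fn_strongly_convex[OF t, of y k h \<xi>] by (simp add: h' Fn_left)
qed

lemma Fn_alt: "Fn y t k h = psi y h + ip (px (h \<otimes>\<^bsub>H\<^esub> k)) (px (h \<otimes>\<^bsub>H\<^esub> k)) / (2 * t)"
  by (simp add: Fn_def nrm_sq[symmetric] nrm_Xi)

lemma continuous_Fn:
  assumes "continuous_on S f" "continuous_on S g" "t \<noteq> 0"
  shows "continuous_on S (\<lambda>x. Fn y t (f x) (g x))"
  unfolding Fn_alt
  by (intro continuous_intros continuous_polar_maps H.continuous_mult bounded_bilinear.continuous_on[OF bounded_bilinear_ip]
      continuous_on_compose2[OF continuous_psi] assms) (use assms in auto)

text \<open>\<open>Q\<close> is a parameter because two minima are compared: over all of \<uu>, and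
  over the -1 eigenspace \<qq> for the real group.\<close>

lemma Fn_minimizer:
  assumes t: "t > 0" and Q: "closed Q" "0 \<in> Q"
  obtains x where "x \<in> Q" "\<And>x'. x' \<in> Q \<Longrightarrow> Fn y t k (E x) \<le> Fn y t k (E x')"
proof -
  let ?g = "gF y t k \<one>\<^bsub>H\<^esub>"
  \<comment> \<open>Beyond this radius the quadratic term |x|^2 / (2 t) outweighs the linear term
    <?g, x>.\<close>
  define R where "R = 2 * t * nrm ?g"
  have out: "Fn y t k (E x) \<ge> Fn y t k \<one>\<^bsub>H\<^esub>" if "nrm x > R" for x
  proof -
    have "Fn y t k (E x) \<ge> Fn y t k \<one>\<^bsub>H\<^esub> + ip ?g x + ip x x / (2 * t)"
      using Fn_strongly_convex[OF t, of y k "\<one>\<^bsub>H\<^esub>" x] by simp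
    moreover have "ip ?g x \<ge> - (nrm ?g * nrm x)" using ip_cauchy_schwarz[of ?g x] by linarith
    moreover have "nrm ?g * nrm x \<le> ip x x / (2 * t)"
    proof -
      have "R * nrm x \<le> nrm x * nrm x" using that by (intro mult_right_mono) auto
      then show ?thesis using t by (simp add: R_def nrm_sq[symmetric] power2_eq_square field_simps)
    qed
    ultimately show ?thesis by linarith
  qed
  obtain c C where c: "c > 0" "\<And>x. c * norm x \<le> nrm x" using nrm_equiv by metis
  obtain B1 :: "'ue set" where B1: "findim B1" by (rule U.findim)
  let ?K = "Q \<inter> {x. nrm x \<le> R}"
  have "closed {x. nrm x \<le> R}" by (intro closed_Collect_le continuous_nrm continuous_intros)
  moreover have "bounded ?K"
  proof (rule boundedI)
    fix x assume "x \<in> ?K"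
    then show "norm x \<le> R / c" using c(1) c(2)[of x] by (simp add: pos_le_divide_eq mult.commute)
  qed
  ultimately have "compact ?K" using Q(1) by (intro findim.compact_closed_bounded[OF B1] closed_Int) auto
  moreover have "R \<ge> 0" using t by (simp add: R_def)
  then have K0: "0 \<in> ?K" using Q(2) by simp
  moreover have "continuous_on ?K (\<lambda>x. Fn y t k (E x))"
    using t by (intro continuous_Fn continuous_polar_maps continuous_intros) auto
  ultimately obtain x where x: "x \<in> ?K" "\<And>x'. x' \<in> ?K \<Longrightarrow> Fn y t k (E x) \<le> Fn y t k (E x')"
    using continuous_attains_inf[of ?K "\<lambda>x. Fn y t k (E x)"] by blast
  show ?thesis
  proof (rule that[of x])
    fix x' assume "x' \<in> Q"
    then show "Fn y t k (E x) \<le> Fn y t k (E x')"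
      using x(2)[of x'] x(2)[OF K0] out[of x'] by (cases "nrm x' \<le> R") auto
  qed (use x in auto)
qed

lemma gF_minimizer:
  assumes "\<And>s. Fn y t k h \<le> Fn y t k (H.ex X s \<otimes>\<^bsub>H\<^esub> h)"
  shows "ip (gF y t k h) (im X) = 0"
proof -
  have "((\<lambda>s. Fn y t k (H.ex X s \<otimes>\<^bsub>H\<^esub> h)) has_real_derivative ip (gF y t k h) (im X)) (at 0)"
    using Fn_derivative[of y t k X h 0] by simp
  from DERIV_local_min[OF this, of 1] assms show ?thesis by simp
qed

definition vv :: "'m \<Rightarrow> real \<Rightarrow> 'h \<Rightarrow> real" where "vv y t k = Inf (range (Fn y t k))"

lemma vv_attained:
  assumes t: "t > 0"
  obtains h where "vv y t k = Fn y t k h" "\<And>h'. vv y t k \<le> Fn y t k h'" "gF y t k h = 0"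
proof -
  obtain x where x: "\<And>x'. Fn y t k (E x) \<le> Fn y t k (E x')" using Fn_minimizer[OF t closed_UNIV UNIV_I, of y k] by auto
  have min: "Fn y t k (E x) \<le> Fn y t k h'" for h'
    using x[of "px h'"] Fn_left[of y t k "pu h'" "E (px h')"] by simp
  then have v: "vv y t k = Fn y t k (E x)" unfolding vv_def by (intro cInf_eq_minimum) auto
  have "ip (gF y t k (E x)) b = 0" for b using gF_minimizer[OF min, of "j (i b)"] by simp
  then have "gF y t k (E x) = 0" by (intro ip_cancel) (simp add: ip_simps)
  then show ?thesis using that[OF v] v min by auto
qed

lemma vv_le: "t > 0 \<Longrightarrow> vv y t k \<le> Fn y t k h"
  using vv_attained by metis

lemma vv_ge: "t > 0 \<Longrightarrow> vv y t k \<ge> Fn y t k h - t / 2 * ip (gF y t k h) (gF y t k h)"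
  using vv_attained Fn_lower by metis

lemma continuous_gF:
  assumes "continuous_on S f" "continuous_on S g"
  shows "continuous_on S (\<lambda>x. gF y t (f x) (g x))"
  unfolding gF_def by (intro continuous_intros continuous_Phis continuous_action continuous_Xi H.continuous_mult assms)

text \<open>No continuity of the minimizer is involved: with h minimal at z, the infimum nearby lies
  between the energy at this fixed h and that energy minus t/2 times the squared gradient, and the
  gradient vanishes at z.\<close>

lemma continuous_vv:
  assumes t: "t > 0" and f: "continuous_on UNIV (f :: 'z::topological_space \<Rightarrow> 'h)"
  shows "continuous_on UNIV (\<lambda>z. vv y t (f z))"
  unfolding continuous_on_def
proof
  fix z
  obtain h where h: "vv y t (f z) = Fn y t (f z) h" "gF y t (f z) h = 0" using vv_attained[OF t, of y "f z"] by metis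
  have u: "((\<lambda>z. Fn y t (f z) h) \<longlongrightarrow> Fn y t (f z) h) (at z)"
    using continuous_Fn[OF f continuous_on_const[of UNIV h], of t y] t by (simp add: continuous_on_def)
  have "continuous_on UNIV (\<lambda>z. Fn y t (f z) h - t / 2 * ip (gF y t (f z) h) (gF y t (f z) h))"
    using t by (intro continuous_intros continuous_Fn continuous_gF bounded_bilinear.continuous_on[OF bounded_bilinear_ip] f) auto
  then have "((\<lambda>z. Fn y t (f z) h - t / 2 * ip (gF y t (f z) h) (gF y t (f z) h)) \<longlongrightarrow> Fn y t (f z) h) (at z)"
    by (auto simp: continuous_on_def h ip_simps dest: spec[of _ z])
  from tendsto_sandwich[OF _ _ this u]
  have "((\<lambda>z. vv y t (f z)) \<longlongrightarrow> Fn y t (f z) h) (at z)" using vv_le[OF t] vv_ge[OF t] by (simp add: always_eventually)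
  then show "((\<lambda>z. vv y t (f z)) \<longlongrightarrow> vv y t (f z)) (at z within UNIV)" by (simp add: h)
qed

end

section \<open>Subharmonicity of the minimal energy along complex one-parameter groups\<close>

context complex_hamiltonian
begin

lemma vv_critical: "t > 0 \<Longrightarrow> gF y t k h = 0 \<Longrightarrow> vv y t k = Fn y t k h"
  using vv_le[of t y k h] vv_ge[of t y k h] by (simp add: ip_simps)

text \<open>The competitor \<open>ex \<zeta> s h\<close> is chosen in the direction in which the gradient stays \<open>o(s)\<close>, so that the
  infimum agrees with the energy of the competitor up to \<open>o(s\<^sup>2)\<close>.\<close>

lemma vv_second_difference:
  fixes y t k h \<zeta> Y
  defines "Z \<equiv> Ad H AH h Y"
  assumes t: "t > 0" and g: "gF y t k h = 0"
    and \<zeta>: "dPhi (actC h y) \<zeta> + (1 / t) *\<^sub>R dXi (h \<otimes>\<^bsub>H\<^esub> k) (\<zeta> + Z) = 0" and e: "e > 0"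
  shows "\<exists>\<delta>>0. \<forall>s. 0 < s \<and> s < \<delta> \<longrightarrow> vv y t (H.ex Y s \<otimes>\<^bsub>H\<^esub> k) + vv y t (H.ex Y (- s) \<otimes>\<^bsub>H\<^esub> k) - 2 * vv y t k \<ge>
    (ip (dPhi (actC h y) \<zeta>) (im \<zeta>) + (ip (Xi (h \<otimes>\<^bsub>H\<^esub> k)) (im (bracket H AH \<zeta> Z)) + ip (dXi (h \<otimes>\<^bsub>H\<^esub> k) (\<zeta> + Z)) (im (\<zeta> + Z))) / t - e) * s\<^sup>2"
proof -
  define c where "c = (\<lambda>s. H.ex \<zeta> s \<otimes>\<^bsub>H\<^esub> h)"
  define \<kappa> where "\<kappa> = (\<lambda>s. H.ex Y s \<otimes>\<^bsub>H\<^esub> k)"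
  define w where "w = (\<lambda>s. c s \<otimes>\<^bsub>H\<^esub> \<kappa> s)"
  define \<theta> where "\<theta> = (\<lambda>s. \<zeta> + Ad H AH (H.ex \<zeta> s) Z)"
  have c0: "c 0 = h" "\<kappa> 0 = k" "w 0 = h \<otimes>\<^bsub>H\<^esub> k" "\<theta> 0 = \<zeta> + Z" by (simp_all add: c_def \<kappa>_def w_def \<theta>_def)
  have dc: "dlog H AH c s \<zeta>" for s unfolding c_def by (rule H.dlog_ex_left)
  have dw: "dlog H AH w s (\<theta> s)" for s
  proof -
    have "dlog H AH (\<lambda>r. H.ex \<zeta> r \<otimes>\<^bsub>H\<^esub> (h \<otimes>\<^bsub>H\<^esub> (H.ex Y r \<otimes>\<^bsub>H\<^esub> k))) s (\<theta> s)"
      unfolding \<theta>_def Z_def by (intro H.dlog_mult H.dlog_ex H.dlog_left H.dlog_ex_left)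
    then show ?thesis by (simp add: w_def c_def \<kappa>_def H.m_assoc)
  qed
  define f where "f = (\<lambda>s. Fn y t (\<kappa> s) (c s))"
  define f' where "f' = (\<lambda>s. ip (Phis (actC (c s) y)) (im \<zeta>) + ip (Xi (w s)) (im (\<theta> s)) / t)"
  define F2 where "F2 = ip (dPhi (actC h y) \<zeta>) (im \<zeta>)
    + (ip (Xi (h \<otimes>\<^bsub>H\<^esub> k)) (im (bracket H AH \<zeta> Z)) + ip (dXi (h \<otimes>\<^bsub>H\<^esub> k) (\<zeta> + Z)) (im (\<zeta> + Z))) / t"
  have df: "(f has_real_derivative f' s) (at s)" for s
  proof -
    have "((\<lambda>s. psi y (c s)) has_real_derivative ip (Phis (actC (c s) y)) (im \<zeta>)) (at s)"
      unfolding c_def by (rule psi_derivative)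
    from DERIV_add[OF this ip_Xi_derivative[OF dw]] show ?thesis
      unfolding f_def f'_def Fn_def by (simp only: w_def)
  qed
  have d\<theta>: "(\<theta> has_vector_derivative bracket H AH \<zeta> Z) (at 0)"
    using has_vector_derivative_add[OF has_vector_derivative_const H.bracket_derivative[of \<zeta> Z]] by (simp add: \<theta>_def)
  have d1: "((\<lambda>s. ip (Phis (actC (c s) y)) (im \<zeta>)) has_real_derivative ip (dPhi (actC h y) \<zeta>) (im \<zeta>)) (at 0)"
    using ip_derivative[OF Phis_derivative[OF dc[of 0], of y] has_vector_derivative_const[of "im \<zeta>"]] by (simp add: c0 ip_simps)
  have d2: "((\<lambda>s. ip (Xi (w s)) (im (\<theta> s))) has_real_derivative
    ip (Xi (h \<otimes>\<^bsub>H\<^esub> k)) (im (bracket H AH \<zeta> Z)) + ip (dXi (h \<otimes>\<^bsub>H\<^esub> k) (\<zeta> + Z)) (im (\<zeta> + Z))) (at 0)"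
    using ip_derivative[OF Xi_derivative[OF dw[of 0]] bounded_linear.has_vector_derivative[OF bounded_linear_im d\<theta>]] by (simp add: c0)
  have df': "(f' has_real_derivative F2) (at 0)"
    unfolding f'_def F2_def by (intro DERIV_add DERIV_cdivide d1 d2)
  define G where "G = (\<lambda>s. gF y t (\<kappa> s) (c s))"
  have G0: "G 0 = 0" by (simp add: G_def c0 g)
  have "((\<lambda>s. Phis (actC (c s) y) + (1 / t) *\<^sub>R Xi (w s)) has_vector_derivative
    dPhi (actC h y) \<zeta> + (1 / t) *\<^sub>R dXi (h \<otimes>\<^bsub>H\<^esub> k) (\<zeta> + Z)) (at 0)"
    using has_vector_derivative_add[OF Phis_derivative[OF dc[of 0], of y]
        bounded_linear.has_vector_derivative[OF bounded_linear_scaleR_right Xi_derivative[OF dw[of 0]]], of "1 / t"]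
    by (simp add: c0)
  then have dG: "(G has_vector_derivative 0) (at 0)" by (simp add: \<zeta> G_def gF_def[abs_def] w_def)
  obtain C0 C where C: "C > 0" "\<And>x. nrm x \<le> C * norm x" using nrm_equiv by metis
  \<comment> \<open>Chosen so that the correction t/2 |G s|^2 is at most (e/4) s^2; the two points
    together lose e/2, and the energy of the competitor the other e/2.\<close>
  define e1 where "e1 = sqrt (e / (2 * t)) / C"
  have e1: "e1 > 0" using e t C(1) by (simp add: e1_def)
  obtain \<delta>1 where \<delta>1: "\<delta>1 > 0" "\<And>s. \<bar>s\<bar> < \<delta>1 \<Longrightarrow> norm (G s) \<le> e1 * \<bar>s\<bar>"
    using dG e1 unfolding has_vector_derivative_def has_derivative_at_alt by (force simp: G0)
  obtain \<delta>2 where \<delta>2: "\<delta>2 > 0" "\<And>s. 0 < s \<and> s < \<delta>2 \<Longrightarrow> f s + f (- s) - 2 * f 0 \<ge> (F2 - e / 2) * s\<^sup>2"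
    using second_difference_ge[OF df zero_less_one df', of "e / 2"] e by auto
  have lower: "vv y t (\<kappa> s) \<ge> f s - e / 4 * s\<^sup>2" if "\<bar>s\<bar> < \<delta>1" for s
  proof -
    have "nrm (G s) \<le> C * (e1 * \<bar>s\<bar>)" using C(2)[of "G s"] mult_left_mono[OF \<delta>1(2)[OF that] less_imp_le[OF C(1)]] by linarith
    then have "(nrm (G s))\<^sup>2 \<le> (C * (e1 * \<bar>s\<bar>))\<^sup>2" by (rule power_mono) simp
    also have "\<dots> = e / (2 * t) * s\<^sup>2" using C(1) e t by (simp add: e1_def power_mult_distrib power_divide)
    finally have "t / 2 * ip (G s) (G s) \<le> t / 2 * (e / (2 * t) * s\<^sup>2)" using t by (intro mult_left_mono) (simp_all add: nrm_sq)
    also have "\<dots> = e / 4 * s\<^sup>2" using t by simp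
    finally show ?thesis using vv_ge[OF t, of y "\<kappa> s" "c s"] by (simp add: f_def G_def)
  qed
  have "vv y t (\<kappa> 0) = f 0" using vv_critical[OF t g] by (simp add: f_def c0)
  then have "vv y t (\<kappa> s) + vv y t (\<kappa> (- s)) - 2 * vv y t (\<kappa> 0) \<ge> (F2 - e) * s\<^sup>2" if "0 < s" "s < min \<delta>1 \<delta>2" for s
    using lower[of s] lower[of "- s"] \<delta>2(2)[of s] that by (auto simp: algebra_simps)
  then show ?thesis using \<delta>1(1) \<delta>2(1) unfolding F2_def[symmetric] c0(2)
    by (intro exI[of _ "min \<delta>1 \<delta>2"]) (simp add: \<kappa>_def)
qed

text \<open>The complex one-parameter group z -> exp(z X); the factors commute.\<close>

definition gam :: "'he \<Rightarrow> complex \<Rightarrow> 'h" where "gam X z = H.ex X (Re z) \<otimes>\<^bsub>H\<^esub> H.ex (j X) (Im z)"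

lemma gam_real: "gam X (of_real s) = H.ex X s"
  by (simp add: gam_def)

lemma gam_commute: "H.ex X r \<otimes>\<^bsub>H\<^esub> H.ex (j X) s = H.ex (j X) s \<otimes>\<^bsub>H\<^esub> H.ex X r"
proof -
  have "H.ex X r \<otimes>\<^bsub>H\<^esub> H.ex (j X) s \<otimes>\<^bsub>H\<^esub> inv\<^bsub>H\<^esub> H.ex X r = H.ex (j X) s"
    by (simp add: H.Ad_ex H.Ad_J H.Ad_ex_self)
  from arg_cong[OF this, of "\<lambda>g. g \<otimes>\<^bsub>H\<^esub> H.ex X r"] show ?thesis by (simp add: H.m_assoc)
qed

lemma gam_add_real: "gam X (z + of_real s) = H.ex X s \<otimes>\<^bsub>H\<^esub> gam X z"
  and gam_add_imag: "gam X (z + \<i> * of_real s) = H.ex (j X) s \<otimes>\<^bsub>H\<^esub> gam X z"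
proof -
  show "gam X (z + of_real s) = H.ex X s \<otimes>\<^bsub>H\<^esub> gam X z"
    by (simp add: gam_def add.commute[of "Re z"] H.ex_add H.m_assoc)
  have "gam X (z + \<i> * of_real s) = (H.ex X (Re z) \<otimes>\<^bsub>H\<^esub> H.ex (j X) s) \<otimes>\<^bsub>H\<^esub> H.ex (j X) (Im z)"
    by (simp add: gam_def add.commute[of "Im z"] H.ex_add H.m_assoc)
  then show "gam X (z + \<i> * of_real s) = H.ex (j X) s \<otimes>\<^bsub>H\<^esub> gam X z"
    unfolding gam_commute by (simp add: gam_def H.m_assoc)
qed

lemma continuous_gam: "continuous_on S (gam X)"
  unfolding gam_def
  by (intro H.continuous_mult continuous_on_compose2[OF H.continuous_ex[of UNIV]] continuous_intros) auto

lemma ex_conj: "P \<otimes>\<^bsub>H\<^esub> (H.ex X s \<otimes>\<^bsub>H\<^esub> g) \<otimes>\<^bsub>H\<^esub> Q = H.ex (Ad H AH P X) s \<otimes>\<^bsub>H\<^esub> (P \<otimes>\<^bsub>H\<^esub> g \<otimes>\<^bsub>H\<^esub> Q)"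
proof -
  have "H.ex (Ad H AH P X) s = P \<otimes>\<^bsub>H\<^esub> H.ex X s \<otimes>\<^bsub>H\<^esub> inv\<^bsub>H\<^esub> P" by (simp add: H.Ad_ex)
  then show ?thesis by (simp add: H.m_assoc)
qed

text \<open>Minimum principle. If the minimizer responds to the direction Z by \<zeta> and to
  \<open>j Z\<close> by \<open>j \<zeta>\<close>, the two second differences add up to complex
  Hessians of \<psi> and of the squared distance, which are nonnegative by \<open>Tphi_psh\<close>
  and \<open>Dx_psh\<close>.\<close>

lemma vv_subharmonic:
  assumes t: "t > 0"
  shows "subharmonic4 (\<lambda>z. vv y t (P \<otimes>\<^bsub>H\<^esub> gam X z \<otimes>\<^bsub>H\<^esub> Q))"
  unfolding subharmonic4_def
proof (intro allI impI)
  fix z and e :: real assume e: "e > 0"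
  define k where "k = P \<otimes>\<^bsub>H\<^esub> gam X z \<otimes>\<^bsub>H\<^esub> Q"
  define Y where "Y = Ad H AH P X"
  have re_line: "P \<otimes>\<^bsub>H\<^esub> gam X (z + of_real s) \<otimes>\<^bsub>H\<^esub> Q = H.ex Y s \<otimes>\<^bsub>H\<^esub> k"
    and im_line: "P \<otimes>\<^bsub>H\<^esub> gam X (z + \<i> * of_real s) \<otimes>\<^bsub>H\<^esub> Q = H.ex (j Y) s \<otimes>\<^bsub>H\<^esub> k" for s
    unfolding gam_add_real gam_add_imag ex_conj by (simp_all add: Y_def k_def H.Ad_J)
  obtain h where h: "gF y t k h = 0" using vv_attained[OF t] by metis
  let ?x = "h \<otimes>\<^bsub>H\<^esub> k" and ?y = "actC h y"
  define Z where "Z = Ad H AH h Y"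
  have jZ: "Ad H AH h (j Y) = j Z" by (simp add: Z_def H.Ad_J)
  have "surj (TT y t k h)"
  proof -
    obtain B1 :: "'ue set" where B1: "findim B1" by (rule U.findim)
    have "inj (TT y t k h)" unfolding linear_injective_0[OF linear_TT]
    proof (intro allI impI, rule ccontr)
      fix b assume b: "TT y t k h b = 0" "b \<noteq> 0"
      then show False using TT_pos[OF t, of b y k h] ip_pos[of b] t by (simp add: ip_simps divide_le_0_iff)
    qed
    then show ?thesis using findim.inj_imp_surj[OF B1 linear_TT] by blast
  qed
  \<comment> \<open>The linearized critical equations for Z and \<open>j Z\<close> constrain only im
    \<zeta> = b and im (j \<zeta>) = a, because the gradient vanishes and moving h by U does not
    change this. The two imaginary parts are independent, so one \<zeta> serves both.\<close>
  then obtain a b where ab: "TT y t k h b = - ((1 / t) *\<^sub>R dXi ?x Z)" "TT y t k h a = - ((1 / t) *\<^sub>R dXi ?x (j Z))"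
    by (metis surjD)
  define \<zeta> where "\<zeta> = i a + j (i b)"
  have [simp]: "re \<zeta> = a" "im \<zeta> = b" by (simp_all add: \<zeta>_def)
  have grad: "dPhi ?y X' + (1 / t) *\<^sub>R dXi ?x X' = TT y t k h (im X')" for X'
  proof -
    have "dPhi ?y X' + (1 / t) *\<^sub>R dXi ?x X' = bracket U A (re X') (gF y t k h) + TT y t k h (im X')"
      by (simp add: gF_def TT_def dPhi_eq dXi_eq U.bracket_simps algebra_simps)
    then show ?thesis by (simp add: h U.bracket_simps)
  qed
  have c1: "dPhi ?y \<zeta> + (1 / t) *\<^sub>R dXi ?x (\<zeta> + Z) = 0"
    using grad[of \<zeta>] ab(1) by (simp add: linear_add[OF linear_dXi] scaleR_add_right flip: add.assoc)
  have c2: "dPhi ?y (j \<zeta>) + (1 / t) *\<^sub>R dXi ?x (j \<zeta> + j Z) = 0"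
    using grad[of "j \<zeta>"] ab(2) by (simp add: linear_add[OF linear_dXi] scaleR_add_right im_j flip: add.assoc)
  let ?F = "\<lambda>\<zeta> Z. ip (dPhi ?y \<zeta>) (im \<zeta>) + (ip (Xi ?x) (im (bracket H AH \<zeta> Z)) + ip (dXi ?x (\<zeta> + Z)) (im (\<zeta> + Z))) / t"
  obtain \<delta>1 where \<delta>1: "\<delta>1 > 0" "\<And>s. 0 < s \<and> s < \<delta>1 \<Longrightarrow>
     vv y t (H.ex Y s \<otimes>\<^bsub>H\<^esub> k) + vv y t (H.ex Y (- s) \<otimes>\<^bsub>H\<^esub> k) - 2 * vv y t k \<ge> (?F \<zeta> Z - e / 2) * s\<^sup>2"
    using vv_second_difference[OF t h, of \<zeta> Y "e / 2"] c1 e by (auto simp: Z_def)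
  obtain \<delta>2 where \<delta>2: "\<delta>2 > 0" "\<And>s. 0 < s \<and> s < \<delta>2 \<Longrightarrow>
     vv y t (H.ex (j Y) s \<otimes>\<^bsub>H\<^esub> k) + vv y t (H.ex (j Y) (- s) \<otimes>\<^bsub>H\<^esub> k) - 2 * vv y t k \<ge> (?F (j \<zeta>) (j Z) - e / 2) * s\<^sup>2"
    using vv_second_difference[OF t h, of "j \<zeta>" "j Y" "e / 2"] c2 e by (auto simp: jZ)
  \<comment> \<open>The two brackets with n add up to - 2 <n, [re X', im X']>, which the hypothesis
    absorbs.\<close>
  have hess: "ip (bracket U A (re X') n + S (im X')) (im X') + ip (bracket U A (re (j X')) n + S (im (j X'))) (im (j X')) \<ge> 0"
    if psh: "\<And>a b. ip (S a) a + ip (S b) b \<ge> 2 * ip n (bracket U A a b)" for X' n and S :: "'ue \<Rightarrow> 'ue"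
    using psh[of "re X'" "im X'"] U.bracket_antisym[of "im X'" "re X'"]
    by (simp add: re_j im_j ip_simps ip_skew U.bracket_simps)
  \<comment> \<open>The terms with [\<zeta>, Z] cancel because [j \<zeta>, j Z] = -
    [\<zeta>, Z].\<close>
  have "?F \<zeta> Z + ?F (j \<zeta>) (j Z) = (ip (dPhi ?y \<zeta>) (im \<zeta>) + ip (dPhi ?y (j \<zeta>)) (im (j \<zeta>)))
      + (ip (dXi ?x (\<zeta> + Z)) (im (\<zeta> + Z)) + ip (dXi ?x (j (\<zeta> + Z))) (im (j (\<zeta> + Z)))) / t"
    by (simp add: H.bracket_J_left H.bracket_J_right linear_neg[OF linear_im] ip_simps linear_add[OF linear_j] add_divide_distrib diff_divide_distrib)
  moreover have n1: "ip (dPhi ?y \<zeta>) (im \<zeta>) + ip (dPhi ?y (j \<zeta>)) (im (j \<zeta>)) \<ge> 0"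
    unfolding dPhi_eq by (rule hess) (rule Tphi_psh)
  moreover have n2: "ip (dXi ?x (\<zeta> + Z)) (im (\<zeta> + Z)) + ip (dXi ?x (j (\<zeta> + Z))) (im (j (\<zeta> + Z))) \<ge> 0"
    unfolding dXi_eq by (rule hess) (rule Dx_psh)
  ultimately have F: "?F \<zeta> Z + ?F (j \<zeta>) (j Z) \<ge> 0"
    using add_nonneg_nonneg[OF n1 divide_nonneg_pos[OF n2 t]] by (simp only:)
  show "\<exists>\<delta>>0. \<forall>s. 0 < s \<and> s < \<delta> \<longrightarrow> - (e * s\<^sup>2)
     \<le> vv y t (P \<otimes>\<^bsub>H\<^esub> gam X (z + of_real s) \<otimes>\<^bsub>H\<^esub> Q) + vv y t (P \<otimes>\<^bsub>H\<^esub> gam X (z - of_real s) \<otimes>\<^bsub>H\<^esub> Q)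
      + vv y t (P \<otimes>\<^bsub>H\<^esub> gam X (z + \<i> * of_real s) \<otimes>\<^bsub>H\<^esub> Q) + vv y t (P \<otimes>\<^bsub>H\<^esub> gam X (z - \<i> * of_real s) \<otimes>\<^bsub>H\<^esub> Q)
      - 4 * vv y t (P \<otimes>\<^bsub>H\<^esub> gam X z \<otimes>\<^bsub>H\<^esub> Q)"
  proof (intro exI[of _ "min \<delta>1 \<delta>2"] conjI allI impI)
    show "min \<delta>1 \<delta>2 > 0" using \<delta>1 \<delta>2 by simp
    fix s :: real assume s: "0 < s \<and> s < min \<delta>1 \<delta>2"
    then have s1: "0 < s \<and> s < \<delta>1" and s2: "0 < s \<and> s < \<delta>2" by simp_all
    have "(?F \<zeta> Z + ?F (j \<zeta>) (j Z)) * s\<^sup>2 \<ge> 0" using F by (intro mult_nonneg_nonneg) auto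
    then have "(?F \<zeta> Z - e / 2) * s\<^sup>2 + (?F (j \<zeta>) (j Z) - e / 2) * s\<^sup>2 \<ge> - (e * s\<^sup>2)" by (simp add: algebra_simps)
    moreover have "z - of_real s = z + of_real (- s)" "z - \<i> * of_real s = z + \<i> * of_real (- s)" by simp_all
    ultimately show "- (e * s\<^sup>2)
     \<le> vv y t (P \<otimes>\<^bsub>H\<^esub> gam X (z + of_real s) \<otimes>\<^bsub>H\<^esub> Q) + vv y t (P \<otimes>\<^bsub>H\<^esub> gam X (z - of_real s) \<otimes>\<^bsub>H\<^esub> Q)
      + vv y t (P \<otimes>\<^bsub>H\<^esub> gam X (z + \<i> * of_real s) \<otimes>\<^bsub>H\<^esub> Q) + vv y t (P \<otimes>\<^bsub>H\<^esub> gam X (z - \<i> * of_real s) \<otimes>\<^bsub>H\<^esub> Q)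
      - 4 * vv y t (P \<otimes>\<^bsub>H\<^esub> gam X z \<otimes>\<^bsub>H\<^esub> Q)"
      using \<delta>1(2)[OF s1] \<delta>2(2)[OF s2] unfolding k_def[symmetric] by (simp only: re_line im_line)
  qed
qed

end

section \<open>Growth of the minimal energy\<close>

context complex_hamiltonian
begin

definition setd :: "'ue set \<Rightarrow> 'ue \<Rightarrow> real" where "setd S x = Inf ((\<lambda>p. nrm (x - p)) ` S)"

lemma setd_le: "p \<in> S \<Longrightarrow> setd S x \<le> nrm (x - p)"
  unfolding setd_def by (rule cInf_lower) (auto intro: bdd_belowI[of _ 0])

lemma setd_attained:
  assumes "compact S" "S \<noteq> {}"
  obtains p where "p \<in> S" "setd S x = nrm (x - p)" "\<And>p'. p' \<in> S \<Longrightarrow> nrm (x - p) \<le> nrm (x - p')"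
proof -
  have "continuous_on S (\<lambda>p. nrm (x - p))"
    by (rule continuous_on_compose2[OF continuous_nrm[of UNIV]]) (auto intro: continuous_intros)
  then obtain p where p: "p \<in> S" "\<And>p'. p' \<in> S \<Longrightarrow> nrm (x - p) \<le> nrm (x - p')"
    using continuous_attains_inf[OF assms] by blast
  then have "setd S x = nrm (x - p)" unfolding setd_def by (intro cInf_eq_minimum) auto
  then show ?thesis using that p by blast
qed

lemma setd_lipschitz:
  assumes "compact S" "S \<noteq> {}"
  shows "setd S x \<le> setd S z + nrm (x - z)"
proof -
  obtain p where p: "p \<in> S" "setd S z = nrm (z - p)" using setd_attained[OF assms] by metis
  have "setd S x \<le> nrm ((x - z) + (z - p))" using setd_le[OF p(1), of x] by simp
  also have "\<dots> \<le> nrm (x - z) + nrm (z - p)" by (rule nrm_triangle)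
  finally show ?thesis by (simp add: p(2))
qed

lemma continuous_setd:
  assumes "compact S" "S \<noteq> {}"
  shows "continuous_on UNIV (setd S)"
proof -
  obtain c C where C: "C > 0" "\<And>x. nrm x \<le> C * norm x" using nrm_equiv by metis
  have "\<bar>setd S x - setd S z\<bar> \<le> C * norm (x - z)" for x z
    using setd_lipschitz[OF assms, of x z] setd_lipschitz[OF assms, of z x] C(2)[of "x - z"] nrm_minus[of "x - z"] by (simp add: abs_le_iff)
  then have "C-lipschitz_on UNIV (setd S)" using C(1) by (intro lipschitz_onI) (auto simp: dist_norm)
  then show ?thesis by (rule lipschitz_on_continuous_on)
qed

lemma nrm_derivative_bound:
  assumes f: "(f has_vector_derivative f') (at s)" and f0: "f s \<noteq> 0" and L: "ip (f s) f' \<le> L * nrm (f s)" and e: "e > 0"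
  shows "\<exists>d>0. \<forall>r. s < r \<and> r < s + d \<longrightarrow> nrm (f r) \<le> nrm (f s) + (L + e) * (r - s)"
proof -
  define n' where "n' = ip (f s) f' / nrm (f s)"
  have n': "n' \<le> L" using L nrm_pos[OF f0] by (simp add: n'_def pos_divide_le_eq)
  have "((\<lambda>r. ip (f r) (f r)) has_real_derivative 2 * ip (f s) f') (at s)"
    using ip_derivative[OF f f] by (simp add: ip_sym[of f'])
  then have r: "((\<lambda>r. sqrt (ip (f r) (f r))) has_real_derivative inverse (sqrt (ip (f s) (f s))) / 2 * (2 * ip (f s) f')) (at s)"
    using ip_pos[OF f0] by (intro DERIV_chain2[OF DERIV_real_sqrt]) auto
  then have d: "((\<lambda>r. nrm (f r)) has_real_derivative n') (at s)"
  proof -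
    have "inverse (sqrt q) / 2 * (2 * a) = a / sqrt q" for q a :: real by (simp add: field_simps)
    then show ?thesis using r unfolding nrm_def n'_def by (simp only:)
  qed
  have "((\<lambda>r. (nrm (f r) - nrm (f s)) / (r - s)) \<longlongrightarrow> n') (at s)"
    using d by (simp add: has_field_derivative_iff)
  then have "\<forall>\<^sub>F r in at s. (nrm (f r) - nrm (f s)) / (r - s) < L + e" using n' e by (intro order_tendstoD) auto
  then obtain \<delta> where \<delta>: "\<delta> > 0" "\<And>r. r \<noteq> s \<Longrightarrow> \<bar>r - s\<bar> < \<delta> \<Longrightarrow> (nrm (f r) - nrm (f s)) / (r - s) < L + e"
    unfolding eventually_at by (auto simp: dist_real_def)
  show ?thesis
  proof (intro exI[of _ \<delta>] conjI allI impI)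
    fix r assume r: "s < r \<and> r < s + \<delta>"
    then have "(nrm (f r) - nrm (f s)) / (r - s) < L + e" by (intro \<delta>(2)) auto
    then show "nrm (f r) \<le> nrm (f s) + (L + e) * (r - s)" using r by (simp add: pos_divide_less_eq)
  qed (rule \<delta>(1))
qed

text \<open>The commutation hypothesis makes \<open>Dx\<close> act trivially on the direction to the nearest point.\<close>

lemma setd_Xi_le:
  fixes X h defines "c \<equiv> \<lambda>s. H.ex X s \<otimes>\<^bsub>H\<^esub> h"
  assumes S: "compact S" "S \<noteq> {}"
    and near: "\<And>s p. p \<in> S \<Longrightarrow> (\<And>p'. p' \<in> S \<Longrightarrow> nrm (Xi (c s) - p) \<le> nrm (Xi (c s) - p')) \<Longrightarrow> bracket U A (Xi (c s)) p = 0"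
  shows "setd S (Xi (H.ex X 1 \<otimes>\<^bsub>H\<^esub> h)) \<le> setd S (Xi h) + nrm (im X)"
proof -
  let ?f = "\<lambda>s. setd S (Xi (c s))"
  have cc: "continuous_on T c" for T unfolding c_def by (intro H.continuous_mult H.continuous_ex continuous_on_const)
  have "?f 1 \<le> ?f 0 + nrm (im X)"
  proof (rule dini_bound)
    show "continuous_on {0..1} ?f"
      by (rule continuous_on_compose2[OF continuous_setd[OF S]]) (auto intro: continuous_Xi cc)
    show "?f s \<ge> 0" for s using setd_attained[OF S, of "Xi (c s)"] nrm_nonneg by metis
    show "nrm (im X) \<ge> 0" by simp
    fix s e :: real assume pos: "?f s > 0" and e: "e > 0"
    obtain p where p: "p \<in> S" "?f s = nrm (Xi (c s) - p)" "\<And>p'. p' \<in> S \<Longrightarrow> nrm (Xi (c s) - p) \<le> nrm (Xi (c s) - p')"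
      using setd_attained[OF S, of "Xi (c s)"] by metis
    let ?n = "Xi (c s) - p"
    have comm: "bracket U A (Xi (c s)) ?n = 0" using near[OF p(1,3)] by (simp add: U.bracket_simps U.bracket_self)
    have "((\<lambda>r. Xi (c r) - p) has_vector_derivative dXi (c s) X - 0) (at s)"
      by (intro has_vector_derivative_diff has_vector_derivative_const Xi_derivative) (unfold c_def, rule H.dlog_ex_left)
    moreover have "ip ?n (dXi (c s) X - 0) \<le> nrm (im X) * nrm ?n"
    proof -
      have "ip (bracket U A (Xi (c s)) (re X)) ?n = 0"
        using ip_skew[of "Xi (c s)" "re X" ?n] by (simp only: comm ip_simps(10) minus_zero)
      then have "ip ?n (bracket U A (re X) (Xi (c s))) = 0"
        unfolding U.bracket_antisym[of "re X" "Xi (c s)"] by (simp only: ip_sym[of ?n] ip_simps(5) minus_zero)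
      then have "ip ?n (dXi (c s) X - 0) = ip (im X) ?n"
        using Dx_centralizer[OF comm, of "im X"] by (simp add: dXi_eq ip_simps(2) ip_sym[of ?n "Dx (c s) (im X)"])
      then show ?thesis using ip_cauchy_schwarz[of "im X" ?n] by simp
    qed
    moreover have "?n \<noteq> 0" using pos p(2) by auto
    ultimately obtain d where "d > 0" "\<And>r. s < r \<and> r < s + d \<Longrightarrow> nrm (Xi (c r) - p) \<le> nrm ?n + (nrm (im X) + e) * (r - s)"
      using nrm_derivative_bound[of "\<lambda>r. Xi (c r) - p" "dXi (c s) X - 0" s "nrm (im X)" e] e by blast
    then have "\<forall>r. s < r \<and> r < s + d \<and> r \<le> 1 \<longrightarrow> ?f r \<le> ?f s + (nrm (im X) + e) * (r - s)"
      unfolding p(2) using setd_le[OF p(1)] order_trans by blast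
    then show "\<exists>d>0. \<forall>r. s < r \<and> r < s + d \<and> r \<le> 1 \<longrightarrow> ?f r \<le> ?f s + (nrm (im X) + e) * (r - s)"
      using \<open>d > 0\<close> by blast
  qed
  then show ?thesis by (simp add: c_def)
qed

text \<open>The triangle inequality of the symmetric space: \<open>setd_Xi_le\<close> for S = {0},
  where the commutation hypothesis is immediate.\<close>

lemma nrm_Xi_mult_le: "nrm (Xi (g \<otimes>\<^bsub>H\<^esub> h)) \<le> nrm (Xi h) + nrm (px g)"
proof -
  have [simp]: "setd {0} x = nrm x" for x by (simp add: setd_def)
  have "g \<otimes>\<^bsub>H\<^esub> h = \<iota> (pu g) \<otimes>\<^bsub>H\<^esub> E (px g) \<otimes>\<^bsub>H\<^esub> h" by simp
  also have "\<dots> = \<iota> (pu g) \<otimes>\<^bsub>H\<^esub> (H.ex (j (i (px g))) 1 \<otimes>\<^bsub>H\<^esub> h)" by (simp only: E_ex H.m_assoc H.carrier_UNIV UNIV_I)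
  finally have "nrm (Xi (g \<otimes>\<^bsub>H\<^esub> h)) = nrm (Xi (H.ex (j (i (px g))) 1 \<otimes>\<^bsub>H\<^esub> h))" by (simp add: Xi_left)
  also have "\<dots> \<le> nrm (Xi h) + nrm (px g)"
    using setd_Xi_le[of "{0}" "j (i (px g))" h] by (simp add: U.bracket_simps)
  finally show ?thesis .
qed

lemma psi_one [simp]: "psi y \<one>\<^bsub>H\<^esub> = 0"
  by (simp add: psi_def blinfun.zero_right)

text \<open>The competitor 1 has displacement at most t |\<eta>| + |px \<gamma>|. Squaring and
  dividing by 2 t leaves a remainder that is uniform in t >= 1.\<close>

lemma Fn_one_bound:
  assumes t: "t \<ge> 1"
  shows "Fn y t (\<gamma> \<otimes>\<^bsub>H\<^esub> E (- (t *\<^sub>R \<eta>))) \<one>\<^bsub>H\<^esub> \<le> t * ip \<eta> \<eta> / 2 + nrm \<eta> * nrm (px \<gamma>) + (nrm (px \<gamma>))\<^sup>2 / 2"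
proof -
  let ?l = "nrm (px \<gamma>)" and ?x = "Xi (\<gamma> \<otimes>\<^bsub>H\<^esub> E (- (t *\<^sub>R \<eta>)))"
  have "nrm ?x \<le> t * nrm \<eta> + ?l" using nrm_Xi_mult_le[of \<gamma> "E (- (t *\<^sub>R \<eta>))"] t by (simp add: nrm_scaleR)
  then have "(nrm ?x)\<^sup>2 \<le> (t * nrm \<eta> + ?l)\<^sup>2" by (rule power_mono) simp
  then have "ip ?x ?x / (2 * t) \<le> (t * nrm \<eta> + ?l)\<^sup>2 / (2 * t)" using t by (intro divide_right_mono) (auto simp: nrm_sq)
  also have "\<dots> = t * ip \<eta> \<eta> / 2 + nrm \<eta> * ?l + ?l\<^sup>2 / (2 * t)"
    using t by (simp add: nrm_sq[symmetric] power2_eq_square field_simps)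
  also have "?l\<^sup>2 / (2 * t) \<le> ?l\<^sup>2 / 2" using t by (intro divide_left_mono) auto
  finally show ?thesis by (simp add: Fn_def)
qed

text \<open>\<open>ww\<close> is normalized so that it is bounded above in \<open>t\<close>; its rate of decay in \<open>t\<close> measures the distance from \<open>\<eta>\<close> to the
  moment image.\<close>

definition ww :: "'m \<Rightarrow> 'ue \<Rightarrow> real \<Rightarrow> 'h \<Rightarrow> real" where
  "ww y \<eta> t \<gamma> = vv y t (\<gamma> \<otimes>\<^bsub>H\<^esub> E (- (t *\<^sub>R \<eta>))) - t * ip \<eta> \<eta> / 2"

lemma ww_upper: "t \<ge> 1 \<Longrightarrow> ww y \<eta> t \<gamma> \<le> nrm \<eta> * nrm (px \<gamma>) + (nrm (px \<gamma>))\<^sup>2 / 2"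
  using Fn_one_bound[of t y \<gamma> \<eta>] vv_le[of t y "\<gamma> \<otimes>\<^bsub>H\<^esub> E (- (t *\<^sub>R \<eta>))" "\<one>\<^bsub>H\<^esub>"] by (simp add: ww_def)

text \<open>At the trial point g the displacement is exactly - t \<eta>, so the gradient is
  \<open>Phis\<close> - \<eta> and the distance term cancels the normalization of
  \<open>ww\<close>.\<close>

lemma ww_lower: "t > 0 \<Longrightarrow> ww y \<eta> t (inv\<^bsub>H\<^esub> g) \<ge> psi y g - t / 2 * (nrm (Phis (actC g y) - \<eta>))\<^sup>2"
proof -
  assume t: "t > 0"
  let ?k = "inv\<^bsub>H\<^esub> g \<otimes>\<^bsub>H\<^esub> E (- (t *\<^sub>R \<eta>))"
  have k: "g \<otimes>\<^bsub>H\<^esub> ?k = E (- (t *\<^sub>R \<eta>))" by (simp add: H.m_assoc[symmetric])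
  have "Fn y t ?k g = psi y g + t * ip \<eta> \<eta> / 2" using t by (simp add: Fn_def k ip_simps)
  moreover have "gF y t ?k g = Phis (actC g y) - \<eta>" using t by (simp add: gF_def k)
  ultimately show ?thesis using vv_ge[OF t, of y ?k g] by (simp add: ww_def nrm_sq)
qed

text \<open>The closure makes the set compact, so that nearest points exist. It still consists of
  \<sigma>-fixed elements, and by \<open>KK_act_closure\<close> its inverses map the orbit of
  \<open>GG\<close> into the closure of that orbit.\<close>

definition KK :: "'u set" where "KK = closure {k. \<iota> k \<in> GG}"

lemma compact_KK: "compact KK"
  using compact_Int_closed[OF ham.compact_U closed_closure] by (simp add: KK_def)

lemma KK_one: "\<one>\<^bsub>U\<^esub> \<in> KK"
  unfolding KK_def by (rule subsetD[OF closure_subset]) (simp add: iota.one GG_one)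

lemma KK_mult: "\<iota> u \<in> GG \<Longrightarrow> k \<in> KK \<Longrightarrow> u \<otimes>\<^bsub>U\<^esub> k \<in> KK"
proof -
  assume u: "\<iota> u \<in> GG" and k: "k \<in> KK"
  have "continuous_on UNIV (\<lambda>k. u \<otimes>\<^bsub>U\<^esub> k)" by (intro U.continuous_mult continuous_intros)
  then have "(\<lambda>k. u \<otimes>\<^bsub>U\<^esub> k) ` closure {k. \<iota> k \<in> GG} \<subseteq> closure ((\<lambda>k. u \<otimes>\<^bsub>U\<^esub> k) ` {k. \<iota> k \<in> GG})"
    by (intro image_closure_subset closure_subset) (auto intro: continuous_on_subset)
  also have "\<dots> \<subseteq> KK" unfolding KK_def by (intro closure_mono) (auto simp: iota.mult GG_mult u)
  finally show ?thesis using k by (auto simp: KK_def)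
qed

lemma KK_fixed: "k \<in> KK \<Longrightarrow> \<sigma> k = k"
proof -
  have "continuous_on UNIV \<sigma>" using ham.smooth_\<sigma> by (simp add: smooth_map_on_def)
  then have "closed {k. \<sigma> k = k}" by (intro closed_Collect_eq continuous_intros)
  moreover have "\<sigma> k = k" if "\<iota> k \<in> GG" for k using GG_polar(1)[OF that] pu_polar[of k 0] by simp
  ultimately have "KK \<subseteq> {k. \<sigma> k = k}" unfolding KK_def by (intro closure_minimal) auto
  then show "k \<in> KK \<Longrightarrow> \<sigma> k = k" by blast
qed

lemma KK_act_closure:
  assumes k: "k \<in> KK" and h: "h \<in> GG"
  shows "actC (\<iota> (inv\<^bsub>U\<^esub> k) \<otimes>\<^bsub>H\<^esub> h) y \<in> closure {actC g y | g. g \<in> GG}"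
proof -
  let ?f = "\<lambda>k. actC (\<iota> (inv\<^bsub>U\<^esub> k) \<otimes>\<^bsub>H\<^esub> h) y"
  have "continuous_on UNIV ?f"
    by (intro continuous_action H.continuous_mult continuous_\<iota> U.continuous_inverse continuous_intros)
  then have "?f ` closure {k. \<iota> k \<in> GG} \<subseteq> closure (?f ` {k. \<iota> k \<in> GG})"
    by (intro image_closure_subset closure_subset) (auto intro: continuous_on_subset)
  also have "\<dots> \<subseteq> closure {actC g y | g. g \<in> GG}"
    by (intro closure_mono) (auto simp: iota.inverse intro!: exI GG_mult GG_inv h)
  finally show ?thesis using k by (auto simp: KK_def)
qed

text \<open>First variation along Ad(exp(r b)) p gives <[b, p], \<xi> - p> = 0 for every b fixed by
  the involution. The choice b = [\<xi>, p] is admissible as \<xi> and p are in \<qq>, and yields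
  |b|^2 = 0.\<close>

lemma nearest_commute:
  assumes \<xi>: "s' \<xi> = - \<xi>" and p: "s' p = - p"
    and near: "\<And>b r. s' b = b \<Longrightarrow> nrm (\<xi> - p) \<le> nrm (\<xi> - Ad U A (U.ex b r) p)"
  shows "bracket U A \<xi> p = 0"
proof -
  define b where "b = bracket U A \<xi> p"
  have sb: "s' b = b" by (simp add: b_def ham.s'_bracket \<xi> p U.bracket_simps)
  have d0: "((\<lambda>r. \<xi> - Ad U A (U.ex b r) p) has_vector_derivative 0 - bracket U A b p) (at 0)"
    by (intro has_vector_derivative_diff has_vector_derivative_const U.bracket_derivative)
  have "((\<lambda>r. ip (\<xi> - Ad U A (U.ex b r) p) (\<xi> - Ad U A (U.ex b r) p)) has_real_derivative - 2 * ip (bracket U A b p) (\<xi> - p)) (at 0)"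
    using ip_derivative[OF d0 d0] by (simp add: ip_simps(5,6) ip_sym[of "\<xi> - p"])
  from DERIV_local_min[OF this zero_less_one]
  have "- 2 * ip (bracket U A b p) (\<xi> - p) = 0"
    using near[OF sb] by (simp add: nrm_sq[symmetric] power_mono)
  then have "ip (bracket U A b p) (\<xi> - p) = 0" by simp
  moreover have "ip (bracket U A b p) p = 0"
    using ip_skew[of b p p] by (simp add: ip_sym[of p])
  ultimately have "ip (bracket U A b p) \<xi> = 0" by (simp add: ip_simps)
  moreover have "ip (bracket U A b p) \<xi> = - ip b (bracket U A \<xi> p)"
    using ip_skew[of p b \<xi>] U.bracket_antisym[of b p] U.bracket_antisym[of p \<xi>] by (simp add: ip_simps)
  ultimately have "ip b b = 0" by (simp add: b_def)
  then show ?thesis using ip_pos[of b] by (auto simp: b_def)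
qed

text \<open>\<open>Xi\<close> itself is not controlled when h moves, since \<open>Dx\<close> is
  bounded below by 1 but not above. Its distance to the orbit of - t \<eta> under \<open>KK\<close>
  is: that orbit is invariant, nearest points commute by \<open>nearest_commute\<close>, and each
  factor exp(i z) then costs at most |z|.\<close>

lemma real_displacement:
  assumes \<eta>: "s' \<eta> = - \<eta>" and x: "s' x = - x" and \<gamma>: "\<gamma> \<in> GG"
  obtains k where "k \<in> KK" "nrm (Xi (E x \<otimes>\<^bsub>H\<^esub> (\<gamma> \<otimes>\<^bsub>H\<^esub> E (- (t *\<^sub>R \<eta>)))) + t *\<^sub>R Ad U A k \<eta>) \<le> nrm x + nrm (px \<gamma>)"
proof -
  define S where "S = (\<lambda>k. - (t *\<^sub>R Ad U A k \<eta>)) ` KK"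
  have S: "compact S" "S \<noteq> {}"
    unfolding S_def using KK_one by (auto intro!: compact_continuous_image continuous_intros U.continuous_Ad compact_KK)
  have sS: "s' p = - p" if "p \<in> S" for p
    using that KK_fixed by (auto simp: S_def linear_neg[OF ham.linear_s'] linear_cmul[OF ham.linear_s'] ham.s'_Ad \<eta> linear_neg[OF U.linear_Ad])
  have AdS: "Ad U A u p \<in> S" if "\<iota> u \<in> GG" "p \<in> S" for u p
    using that KK_mult by (auto simp: S_def linear_neg[OF U.linear_Ad] linear_cmul[OF U.linear_Ad] U.Ad_mult[symmetric])
  have step: "setd S (Xi (E z \<otimes>\<^bsub>H\<^esub> h)) \<le> setd S (Xi h) + nrm z" if z: "s' z = - z" and h: "h \<in> GG" for z h
  proof -
    have "setd S (Xi (H.ex (j (i z)) 1 \<otimes>\<^bsub>H\<^esub> h)) \<le> setd S (Xi h) + nrm (im (j (i z)))"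
    proof (rule setd_Xi_le[OF S])
      fix s p assume p: "p \<in> S" and near: "\<And>p'. p' \<in> S \<Longrightarrow> nrm (Xi (H.ex (j (i z)) s \<otimes>\<^bsub>H\<^esub> h) - p) \<le> nrm (Xi (H.ex (j (i z)) s \<otimes>\<^bsub>H\<^esub> h) - p')"
      have "H.ex (j (i z)) s \<otimes>\<^bsub>H\<^esub> h \<in> GG"
        using GG_E[of "s *\<^sub>R z"] z h by (intro GG_mult) (auto simp: E_scale linear_cmul[OF ham.linear_s'])
      then have "s' (Xi (H.ex (j (i z)) s \<otimes>\<^bsub>H\<^esub> h)) = - Xi (H.ex (j (i z)) s \<otimes>\<^bsub>H\<^esub> h)" by (rule GG_Xi)
      then show "bracket U A (Xi (H.ex (j (i z)) s \<otimes>\<^bsub>H\<^esub> h)) p = 0"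
        by (rule nearest_commute) (use sS[OF p] near AdS[OF GG_\<iota>_ex p] in auto)
    qed
    then show ?thesis by (simp add: E_ex)
  qed
  have inv_le: "setd S (Ad U A u z) \<le> setd S z" if u: "\<iota> u \<in> GG" for u z
  proof -
    obtain p where p: "p \<in> S" "setd S z = nrm (z - p)" using setd_attained[OF S] by metis
    have "setd S (Ad U A u z) \<le> nrm (Ad U A u z - Ad U A u p)" by (rule setd_le[OF AdS[OF u p(1)]])
    also have "\<dots> = nrm (z - p)" by (simp add: linear_diff[OF U.linear_Ad, symmetric])
    finally show ?thesis by (simp add: p(2))
  qed
  let ?e = "E (- (t *\<^sub>R \<eta>))"
  have eG: "?e \<in> GG" by (rule GG_E) (simp add: linear_neg[OF ham.linear_s'] linear_cmul[OF ham.linear_s'] \<eta>)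
  have pxG: "s' (px \<gamma>) = - px \<gamma>" by (rule GG_polar(2)[OF \<gamma>])
  have puG: "\<iota> (pu \<gamma>) \<in> GG"
  proof -
    have "\<iota> (pu \<gamma>) = \<gamma> \<otimes>\<^bsub>H\<^esub> inv\<^bsub>H\<^esub> E (px \<gamma>)"
      using arg_cong[OF polar[of \<gamma>], of "\<lambda>g. g \<otimes>\<^bsub>H\<^esub> inv\<^bsub>H\<^esub> E (px \<gamma>)"] by (simp add: H.m_assoc del: polar)
    then show ?thesis using GG_mult[OF \<gamma> GG_inv[OF GG_E[OF pxG]]] by simp
  qed
  \<comment> \<open>The starting displacement lies in the orbit itself, so the distance starts at
    0.\<close>
  have "- (t *\<^sub>R \<eta>) \<in> S" unfolding S_def by (rule image_eqI[OF _ KK_one]) simp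
  then have "setd S (Xi ?e) \<le> 0" using setd_le[of "- (t *\<^sub>R \<eta>)" S "- (t *\<^sub>R \<eta>)"] by simp
  moreover have "setd S (Xi (E (px \<gamma>) \<otimes>\<^bsub>H\<^esub> ?e)) \<le> setd S (Xi ?e) + nrm (px \<gamma>)" by (rule step[OF pxG eG])
  moreover have "setd S (Xi (\<gamma> \<otimes>\<^bsub>H\<^esub> ?e)) \<le> setd S (Xi (E (px \<gamma>) \<otimes>\<^bsub>H\<^esub> ?e))"
  proof -
    have "\<gamma> \<otimes>\<^bsub>H\<^esub> ?e = \<iota> (pu \<gamma>) \<otimes>\<^bsub>H\<^esub> E (px \<gamma>) \<otimes>\<^bsub>H\<^esub> ?e" by simp
    also have "\<dots> = \<iota> (pu \<gamma>) \<otimes>\<^bsub>H\<^esub> (E (px \<gamma>) \<otimes>\<^bsub>H\<^esub> ?e)" by (simp only: H.m_assoc H.carrier_UNIV UNIV_I)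
    finally show ?thesis using inv_le[OF puG] by (simp add: Xi_left)
  qed
  moreover have "setd S (Xi (E x \<otimes>\<^bsub>H\<^esub> (\<gamma> \<otimes>\<^bsub>H\<^esub> ?e))) \<le> setd S (Xi (\<gamma> \<otimes>\<^bsub>H\<^esub> ?e)) + nrm x"
    by (rule step[OF x GG_mult[OF \<gamma> eG]])
  ultimately have "setd S (Xi (E x \<otimes>\<^bsub>H\<^esub> (\<gamma> \<otimes>\<^bsub>H\<^esub> ?e))) \<le> nrm x + nrm (px \<gamma>)" by linarith
  moreover obtain p where "p \<in> S" "setd S (Xi (E x \<otimes>\<^bsub>H\<^esub> (\<gamma> \<otimes>\<^bsub>H\<^esub> ?e))) = nrm (Xi (E x \<otimes>\<^bsub>H\<^esub> (\<gamma> \<otimes>\<^bsub>H\<^esub> ?e)) - p)"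
    using setd_attained[OF S] by metis
  ultimately show ?thesis using that by (auto simp: S_def)
qed

text \<open>Compared with the competitor 1, the real critical point exp(i x) gains |x|^2 / (2 t).
  The critical equation and \<open>real_displacement\<close> force |x| >= t c - |px \<gamma>|,
  because t times the distance from \<eta> to a moment value on the orbit closure is at most |x| +
  |px \<gamma>|.\<close>

lemma ww_real:
  assumes \<eta>: "s' \<eta> = - \<eta>" and y: "\<tau> y = y" and t: "t \<ge> 1" and \<gamma>: "\<gamma> \<in> GG" and c: "c \<ge> 0"
    and away: "\<And>z. z \<in> closure {actC g y | g. g \<in> GG} \<Longrightarrow> c \<le> nrm (Phis z - \<eta>)"
  shows "ww y \<eta> t \<gamma> \<le> - (t * (c\<^sup>2 / 2)) + (nrm \<eta> + c) * nrm (px \<gamma>) + (nrm (px \<gamma>))\<^sup>2 / 2"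
proof -
  have t0: "t > 0" using t by simp
  let ?e = "E (- (t *\<^sub>R \<eta>))" and ?l = "nrm (px \<gamma>)"
  define k where "k = \<gamma> \<otimes>\<^bsub>H\<^esub> ?e"
  have kG: "k \<in> GG" unfolding k_def
    by (intro GG_mult \<gamma> GG_E) (simp add: linear_neg[OF ham.linear_s'] linear_cmul[OF ham.linear_s'] \<eta>)
  have "closed {x. s' x = - x}" by (intro closed_Collect_eq continuous_intros linear_continuous_on bounded_linear_s')
  then obtain x where x: "s' x = - x" "\<And>x'. s' x' = - x' \<Longrightarrow> Fn y t k (E x) \<le> Fn y t k (E x')"
    using Fn_minimizer[OF t0, of "{x. s' x = - x}" y k] by (auto simp: linear_0[OF ham.linear_s'])
  let ?g = "gF y t k (E x)"
  have ExG: "E x \<in> GG" by (rule GG_E[OF x(1)])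
  have sg: "s' ?g = - ?g"
  proof -
    have "\<tau> (actC (E x) y) = actC (E x) y" using tau_GG[OF ExG, of y] by (simp add: y)
    then show ?thesis unfolding gF_def
      by (simp add: linear_add[OF ham.linear_s'] linear_cmul[OF ham.linear_s'] Phis_tau GG_Xi[OF GG_mult[OF ExG kG]])
  qed
  have "ip ?g (im (j (i ?g))) = 0"
  proof (rule gF_minimizer)
    fix s
    have "H.ex (j (i ?g)) s \<otimes>\<^bsub>H\<^esub> E x \<in> GG"
      using GG_E[of "s *\<^sub>R ?g"] sg by (intro GG_mult ExG) (auto simp: E_scale linear_cmul[OF ham.linear_s'])
    from GG_polar(2)[OF this] show "Fn y t k (E x) \<le> Fn y t k (H.ex (j (i ?g)) s \<otimes>\<^bsub>H\<^esub> E x)"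
      using x(2) Fn_left[of y t k "pu (H.ex (j (i ?g)) s \<otimes>\<^bsub>H\<^esub> E x)" "E (px (H.ex (j (i ?g)) s \<otimes>\<^bsub>H\<^esub> E x))"] by simp
  qed
  \<comment> \<open>The minimum was taken over directions in \<qq> only, but the gradient itself
    lies in \<qq> by symmetry and is one of these directions.\<close>
  then have g0: "?g = 0" using ip_pos[of ?g] by auto
  \<comment> \<open>Strong convexity based at the critical point, in the direction back to the
    identity.\<close>
  have "Fn y t k (E (- x) \<otimes>\<^bsub>H\<^esub> E x) \<ge> Fn y t k (E x) + ip ?g (- x) + ip (- x) (- x) / (2 * t)"
    by (rule Fn_strongly_convex[OF t0])
  then have "vv y t k \<le> Fn y t k \<one>\<^bsub>H\<^esub> - (nrm x)\<^sup>2 / (2 * t)"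
    using vv_le[OF t0, of y k "E x"] by (simp add: g0 ip_simps E_minus nrm_sq)
  moreover have "(nrm x)\<^sup>2 / (2 * t) \<ge> t * (c\<^sup>2 / 2) - c * ?l"
  proof -
    obtain u where u: "u \<in> KK" "nrm (Xi (E x \<otimes>\<^bsub>H\<^esub> k) + t *\<^sub>R Ad U A u \<eta>) \<le> nrm x + ?l"
      unfolding k_def by (rule real_displacement[OF \<eta> x(1) \<gamma>])
    \<comment> \<open>The critical equation: the gradient of the distance term balances the moment
      map.\<close>
    have "Xi (E x \<otimes>\<^bsub>H\<^esub> k) = - (t *\<^sub>R Phis (actC (E x) y))"
    proof -
      have "t *\<^sub>R ?g = t *\<^sub>R Phis (actC (E x) y) + Xi (E x \<otimes>\<^bsub>H\<^esub> k)" using t0 by (simp add: gF_def scaleR_add_right)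
      then show ?thesis by (simp add: g0 eq_neg_iff_add_eq_0 add.commute)
    qed
    then have "Xi (E x \<otimes>\<^bsub>H\<^esub> k) + t *\<^sub>R Ad U A u \<eta> = (- t) *\<^sub>R Ad U A u (Phis (actC (\<iota> (inv\<^bsub>U\<^esub> u) \<otimes>\<^bsub>H\<^esub> E x) y) - \<eta>)"
      by (simp add: actC_mult Phis_\<iota> linear_diff[OF U.linear_Ad] scaleR_diff_right)
    then have "nrm (Xi (E x \<otimes>\<^bsub>H\<^esub> k) + t *\<^sub>R Ad U A u \<eta>) = t * nrm (Phis (actC (\<iota> (inv\<^bsub>U\<^esub> u) \<otimes>\<^bsub>H\<^esub> E x) y) - \<eta>)"
      using t0 by (simp only: nrm_scaleR nrm_Ad abs_minus abs_of_pos)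
    also have "\<dots> \<ge> t * c" using t0 away[OF KK_act_closure[OF u(1) ExG]] by (intro mult_left_mono) auto
    finally have tc: "t * c - ?l \<le> nrm x" using u(2) by linarith
    show ?thesis
    proof (cases "t * c - ?l \<ge> 0")
      case True
      then have "(t * c - ?l)\<^sup>2 / (2 * t) \<le> (nrm x)\<^sup>2 / (2 * t)" using tc t0 by (intro divide_right_mono power_mono) auto
      moreover have "(t * c - ?l)\<^sup>2 / (2 * t) = t * (c\<^sup>2 / 2) - c * ?l + ?l\<^sup>2 / (2 * t)"
        using t0 by (simp add: power2_eq_square field_simps)
      moreover have "?l\<^sup>2 / (2 * t) \<ge> 0" using t0 by simp
      ultimately show ?thesis by linarith
    next
      case False
      then have "c * (t * c) \<le> c * ?l" using c by (intro mult_left_mono) auto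
      moreover have "0 \<le> c * ?l" "0 \<le> (nrm x)\<^sup>2 / (2 * t)" using c t0 by auto
      ultimately show ?thesis by (simp add: power2_eq_square algebra_simps)
    qed
  qed
  ultimately show ?thesis using Fn_one_bound[OF t, of y \<gamma> \<eta>] by (simp add: ww_def k_def algebra_simps)
qed

end

section \<open>Generation of a connected Lie group by exponentials\<close>

context lie_group
begin

text \<open>Coordinates of the second kind: the product of exp(v_b b) over a list of basis vectors,
  as a function of v. By \<open>dlog_word\<close> its derivative at 0 is the identity when the list
  enumerates the basis.\<close>

lemma smooth_word:
  fixes B :: "'ue set"
  assumes B: "findim B"
  shows "smooth_map vspace A (\<lambda>v. foldr (\<lambda>b g. ex b (representation B v b) \<otimes> g) bs \<one>)"
proof (induction bs)
  case Nil show ?case by (simp add: smooth_map_on_const[OF charted_vspace])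
next
  case (Cons b bs)
  have "bounded_linear (\<lambda>v. representation B v b)" by (rule findim.linear_bounded[OF B findim.linear_representation[OF B]])
  then have "smooth_map vspace vspace (\<lambda>v. representation B v b)" by (simp add: smooth_map_on_vspace bounded_linear_smooth_on)
  from smooth_map_on_compose[OF charted_vspace charted_vspace charted findim_real this smooth_ex]
  have "smooth_map vspace A (\<lambda>v. ex b (representation B v b))" by simp
  then show ?case unfolding foldr.simps o_def by (intro smooth_mult_maps charted_vspace open_UNIV Cons)
qed

lemma dlog_word:
  fixes B :: "'ue set"
  assumes B: "findim B"
  shows "dlog U A (\<lambda>s. foldr (\<lambda>b g. ex b (representation B (s *\<^sub>R v) b) \<otimes> g) bs \<one>) 0 (\<Sum>b\<leftarrow>bs. representation B v b *\<^sub>R b)"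
proof (induction bs)
  case Nil show ?case by (simp add: dlog_const)
next
  case (Cons b bs)
  have "dlog U A (\<lambda>s. ex b (representation B (s *\<^sub>R v) b)) 0 (representation B v b *\<^sub>R b)"
  proof -
    have "ex b (representation B (s *\<^sub>R v) b) = ex (representation B v b *\<^sub>R b) s" for s
      using linear_cmul[OF findim.linear_representation[OF B], of s v b] by (simp add: ex_scale)
    then show ?thesis using dlog_ex[of "representation B v b *\<^sub>R b" 0] by (simp only:)
  qed
  from dlog_mult[OF this Cons] show ?case by (simp add: linear_0[OF findim.linear_representation[OF B]])
qed

text \<open>By the inverse function theorem, the products of exponentials of the vectors of a basis fill a neighbourhood of the identity.\<close>

lemma generated_by_exponentials:
  assumes conn: "connected (UNIV :: 'u set)" and S: "span (S :: 'ue set) = UNIV"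
    and one: "\<one> \<in> W" and mult: "\<And>g h. g \<in> W \<Longrightarrow> h \<in> W \<Longrightarrow> g \<otimes> h \<in> W" and inv: "\<And>g. g \<in> W \<Longrightarrow> inv g \<in> W"
    and exW: "\<And>X s. X \<in> S \<Longrightarrow> ex X s \<in> W"
  shows "W = UNIV"
proof -
  interpret charted A by (rule charted)
  obtain B0 :: "'ue set" where "findim B0" by (rule findim)
  then obtain B where B: "B \<subseteq> S" "findim B" using findim_exists_subset S by metis
  interpret B: findim B by (rule B(2))
  obtain bs where bs: "set bs = B" "distinct bs" using finite_distinct_list[OF B.finite_B] by blast
  define \<phi> where "\<phi> = (\<lambda>v. foldr (\<lambda>b g. ex b (representation B v b) \<otimes> g) bs \<one>)"
  have s\<phi>: "smooth_map vspace A \<phi>" unfolding \<phi>_def by (rule smooth_word[OF B(2)])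
  have \<phi>W: "\<phi> v \<in> W" for v
  proof -
    have "set cs \<subseteq> B \<Longrightarrow> foldr (\<lambda>b g. ex b (representation B v b) \<otimes> g) cs \<one> \<in> W" for cs
      by (induction cs) (use one mult exW B(1) in auto)
    then show ?thesis using bs by (simp add: \<phi>_def)
  qed
  have \<phi>0: "\<phi> 0 = \<one>"
    unfolding \<phi>_def by (induction bs) (simp_all add: linear_0[OF B.linear_representation])
  let ?c = "cmap A \<one>" and ?D = "cdom A \<one>"
  define S0 where "S0 = \<phi> -` ?D"
  have cont\<phi>: "continuous_on UNIV \<phi>" using s\<phi> by (simp add: smooth_map_on_def)
  have S0: "open S0" "0 \<in> S0" using open_vimage[OF open_cdom cont\<phi>] mem_cdom[of \<one>] by (auto simp: S0_def \<phi>0)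
  have "smooth_map_on vspace vspace S0 (\<lambda>v. ?c (\<phi> v))"
    by (rule smooth_map_on_compose[OF charted_vspace charted charted_vspace B(2) smooth_map_on_mono[OF s\<phi> subset_UNIV] smooth_cmap S0(1) open_cdom])
      (auto simp: S0_def)
  then have sc: "smooth_on S0 (\<lambda>v. ?c (\<phi> v))" by (simp add: smooth_map_on_vspace)
  have der: "frechet_derivative (\<lambda>v. ?c (\<phi> v)) (at 0) v = v" for v
  proof -
    have "dlog U A (\<lambda>s. \<phi> (s *\<^sub>R v)) 0 (\<Sum>b\<leftarrow>bs. representation B v b *\<^sub>R b)" unfolding \<phi>_def by (rule dlog_word[OF B(2)])
    moreover have "(\<Sum>b\<leftarrow>bs. representation B v b *\<^sub>R b) = v"
      using B.sum_representation[of v] bs by (simp add: sum_list_distinct_conv_sum_set)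
    ultimately have "vel A (\<lambda>s. \<phi> (s *\<^sub>R v)) 0 v" using dlog_one_vel[of "\<lambda>s. \<phi> (s *\<^sub>R v)" 0 v] \<phi>0 by simp
    then have 1: "((\<lambda>s. ?c (\<phi> (s *\<^sub>R v))) has_vector_derivative v) (at 0)" by (simp add: vel_def \<phi>0)
    have "((\<lambda>v. ?c (\<phi> v)) has_derivative frechet_derivative (\<lambda>v. ?c (\<phi> v)) (at 0)) (at (0 *\<^sub>R v))"
      using smooth_on_has_derivative[OF sc S0(2)] by simp
    moreover have "((\<lambda>s. s *\<^sub>R v) has_vector_derivative v) (at 0)" by (auto intro!: derivative_eq_intros)
    ultimately
    have "((\<lambda>s. ?c (\<phi> (s *\<^sub>R v))) has_vector_derivative frechet_derivative (\<lambda>v. ?c (\<phi> v)) (at 0) v) (at 0)"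
      using vector_derivative_diff_chain_within[of "\<lambda>s. s *\<^sub>R v" v 0 UNIV "\<lambda>v. ?c (\<phi> v)"] has_derivative_at_withinI by (fastforce simp: o_def)
    from vector_derivative_unique_at[OF this 1] show ?thesis .
  qed
  obtain d where d: "d > 0" "ball (?c (\<phi> 0)) d \<subseteq> (\<lambda>v. ?c (\<phi> v)) ` S0"
    using B.locally_onto[OF sc S0 der] by blast
  define N where "N = ?D \<inter> ?c -` ball (?c \<one>) d"
  have oN: "open N" unfolding N_def by (rule continuous_open_preimage[OF continuous_cmap open_cdom open_ball])
  have N1: "\<one> \<in> N" using d(1) mem_cdom by (simp add: N_def)
  have NW: "N \<subseteq> W"
  proof
    fix n assume n: "n \<in> N"
    then obtain v where v: "v \<in> S0" "?c n = ?c (\<phi> v)" using d(2) by (auto simp: N_def \<phi>0)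
    have "n = cinv A \<one> (?c n)" using n by (simp add: N_def cinv_cmap)
    also have "\<dots> = \<phi> v" unfolding v(2) using v(1) by (simp add: S0_def cinv_cmap)
    finally show "n \<in> W" using \<phi>W[of v] by simp
  qed
  have nb: "open {h. inv w \<otimes> h \<in> N}" for w
    using open_vimage[OF oN continuous_mult[OF continuous_on_const[of UNIV "inv w"] continuous_on_id]] by (simp add: vimage_def)
  have "open W"
  proof (subst open_subopen, intro ballI)
    fix w assume w: "w \<in> W"
    show "\<exists>T. open T \<and> w \<in> T \<and> T \<subseteq> W"
    proof (intro exI[of _ "{h. inv w \<otimes> h \<in> N}"] conjI nb)
      show "w \<in> {h. inv w \<otimes> h \<in> N}" using N1 by simp
      show "{h. inv w \<otimes> h \<in> N} \<subseteq> W"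
      proof
        fix h assume "h \<in> {h. inv w \<otimes> h \<in> N}"
        then have "inv w \<otimes> h \<in> W" using NW by blast
        then have "w \<otimes> (inv w \<otimes> h) \<in> W" by (rule mult[OF w])
        moreover have "w \<otimes> (inv w \<otimes> h) = h" by (simp add: m_assoc[symmetric])
        ultimately show "h \<in> W" by (simp only:)
      qed
    qed
  qed
  \<comment> \<open>A translate w N with w outside W misses W: if h were in W, then so would be w,
    because w^(-1) h is in N and hence in W.\<close>
  moreover have "open (- W)"
  proof (subst open_subopen, intro ballI)
    fix w assume w: "w \<in> - W"
    show "\<exists>T. open T \<and> w \<in> T \<and> T \<subseteq> - W"
    proof (intro exI[of _ "{h. inv w \<otimes> h \<in> N}"] conjI nb)
      show "w \<in> {h. inv w \<otimes> h \<in> N}" using N1 by simp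
      show "{h. inv w \<otimes> h \<in> N} \<subseteq> - W"
      proof
        fix h assume h: "h \<in> {h. inv w \<otimes> h \<in> N}"
        show "h \<in> - W"
        proof
          assume "h \<in> W"
          moreover have "inv w \<otimes> h \<in> W" using h NW by blast
          ultimately have "h \<otimes> inv (inv w \<otimes> h) \<in> W" using mult inv by simp
          moreover have "h \<otimes> inv (inv w \<otimes> h) = w" by (simp add: inv_mult_group m_assoc[symmetric])
          ultimately show False using w by simp
        qed
      qed
    qed
  qed
  ultimately have "W = {} \<or> W = UNIV" using conn by (auto simp: connected_clopen closed_def)
  then show ?thesis using one by blast
qed

end

lemma (in complexification) connected_H:
  assumes "connected (UNIV :: 'u set)"
  shows "connected (UNIV :: 'h set)"
proof -
  have "continuous_on UNIV (\<lambda>z. \<iota> (fst z) \<otimes>\<^bsub>H\<^esub> E (snd z))"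
    by (intro H.continuous_mult continuous_\<iota> continuous_polar_maps continuous_intros)
  moreover have "connected (UNIV :: ('u \<times> 'ue) set)"
    using connected_Times[OF assms connected_UNIV[where 'a = 'ue]] by simp
  ultimately have "connected ((\<lambda>z. \<iota> (fst z) \<otimes>\<^bsub>H\<^esub> E (snd z)) ` UNIV)" by (rule connected_continuous_image)
  moreover have "(\<lambda>z. \<iota> (fst z) \<otimes>\<^bsub>H\<^esub> E (snd z)) ` UNIV = UNIV"
  proof -
    have "h \<in> (\<lambda>z. \<iota> (fst z) \<otimes>\<^bsub>H\<^esub> E (snd z)) ` UNIV" for h
      by (rule image_eqI[of _ _ "(pu h, px h)"]) simp_all
    then show ?thesis by blast
  qed
  ultimately show ?thesis by simp
qed

lemma subharmonic4_diff_const: "subharmonic4 V \<Longrightarrow> subharmonic4 (\<lambda>z. V z - a)"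
  by (simp add: subharmonic4_def algebra_simps)

section \<open>Propagation of the decay from the real group to its complexification\<close>

context complex_hamiltonian
begin

lemma sH_j: "sH (j X) = - j (sH X)"
  by (rule re_im_eqI)
    (simp_all add: re_j im_j linear_neg[OF linear_re] linear_neg[OF linear_im] linear_neg[OF ham.linear_s'])

lemma sH_sH: "sH (sH X) = X"
  by (rule re_im_eqI) (simp_all add: linear_neg[OF ham.linear_s'])

text \<open>\<gg> is a real form: X is half the sum of X and \<open>sH X\<close> plus half their
  difference, and \<open>j\<close> exchanges the two eigenspaces of the antilinear
  \<open>sH\<close>.\<close>

lemma span_real_form: "span ({X. sH X = X} \<union> j ` {X. sH X = X}) = UNIV"
proof -
  let ?S = "{X. sH X = X} \<union> j ` {X. sH X = X}"
  have "X \<in> span ?S" for X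
  proof -
    define X1 where "X1 = (1/2) *\<^sub>R (X + sH X)"
    define X2 where "X2 = (1/2) *\<^sub>R j (sH X - X)"
    have "sH X1 = X1"
      by (simp add: X1_def linear_cmul[OF linear_sH] linear_add[OF linear_sH] sH_sH add.commute)
    moreover have "sH X2 = X2"
      by (simp add: X2_def linear_cmul[OF linear_sH] linear_diff[OF linear_sH] linear_diff[OF linear_j] sH_j sH_sH)
    moreover have "j X2 = (1/2) *\<^sub>R (X - sH X)"
      by (simp add: X2_def linear_cmul[OF linear_j])
    ultimately have jX2: "j X2 = (1/2) *\<^sub>R (X - sH X)" and "X1 \<in> span ?S" "j X2 \<in> span ?S" by (blast intro: span_base)+
    then have "X1 + j X2 \<in> span ?S" by (intro span_add)
    moreover have "X1 + j X2 = X"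
      by (simp add: X1_def jX2 algebra_simps flip: scaleR_add_left)
    ultimately show ?thesis by simp
  qed
  then show ?thesis by blast
qed

text \<open>Shaped for induction on words. The compact set of right factors in \<open>GG\<close>
  absorbs the real parameter when a further factor exp(z X) is inserted, and all rates strictly
  below \<kappa> are allowed, so a small loss in each step does not change the property.\<close>

definition decays :: "'m \<Rightarrow> 'ue \<Rightarrow> real \<Rightarrow> 'h \<Rightarrow> bool" where
  "decays y \<eta> \<kappa> g \<longleftrightarrow> (\<forall>Q \<kappa>'. compact Q \<longrightarrow> Q \<subseteq> GG \<longrightarrow> 0 < \<kappa>' \<longrightarrow> \<kappa>' < \<kappa> \<longrightarrow>
     (\<exists>C. \<forall>t\<ge>1. \<forall>q\<in>Q. ww y \<eta> t (g \<otimes>\<^bsub>H\<^esub> q) \<le> C - \<kappa>' * t))"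

lemma compact_upper_bound:
  assumes "compact S" "continuous_on S (f :: 'z::topological_space \<Rightarrow> real)"
  obtains C where "\<And>x. x \<in> S \<Longrightarrow> f x \<le> C"
proof (cases "S = {}")
  case False
  then show ?thesis using continuous_attains_sup[OF assms(1) _ assms(2)] that by blast
qed (use that in auto)

lemma decays_one:
  assumes \<eta>: "s' \<eta> = - \<eta>" and y: "\<tau> y = y" and c: "c \<ge> 0"
    and away: "\<And>z. z \<in> closure {actC g y | g. g \<in> GG} \<Longrightarrow> c \<le> nrm (Phis z - \<eta>)"
  shows "decays y \<eta> (c\<^sup>2 / 2) \<one>\<^bsub>H\<^esub>"
  unfolding decays_def
proof (intro allI impI)
  fix Q \<kappa>' assume Q: "compact Q" "Q \<subseteq> GG" and \<kappa>': "0 < \<kappa>'" "\<kappa>' < c\<^sup>2 / 2"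
  have "continuous_on Q (\<lambda>q. (nrm \<eta> + c) * nrm (px q) + (nrm (px q))\<^sup>2 / 2)"
    by (intro continuous_intros continuous_on_compose2[OF continuous_nrm[of UNIV]] continuous_polar_maps) auto
  then obtain C where C: "\<And>q. q \<in> Q \<Longrightarrow> (nrm \<eta> + c) * nrm (px q) + (nrm (px q))\<^sup>2 / 2 \<le> C"
    using compact_upper_bound[OF Q(1)] by blast
  have "ww y \<eta> t (\<one>\<^bsub>H\<^esub> \<otimes>\<^bsub>H\<^esub> q) \<le> C - \<kappa>' * t" if t: "t \<ge> 1" and q: "q \<in> Q" for t q
  proof -
    have "\<kappa>' * t \<le> t * (c\<^sup>2 / 2)" using \<kappa>' t by (subst mult.commute) (intro mult_left_mono, auto)
    moreover have "q \<in> GG" using q Q(2) by blast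
    ultimately show ?thesis using ww_real[OF \<eta> y t _ c away, of q] C[OF q] by simp
  qed
  then show "\<exists>C. \<forall>t\<ge>1. \<forall>q\<in>Q. ww y \<eta> t (\<one>\<^bsub>H\<^esub> \<otimes>\<^bsub>H\<^esub> q) \<le> C - \<kappa>' * t" by blast
qed

lemma gam_GG: "sH X = X \<Longrightarrow> gam X (of_real x) \<in> GG"
  by (simp add: gam_real GG_ex)

text \<open>As a function of w, \<open>ww y \<eta> t (g \<otimes> gam X w \<otimes> q)\<close> is
  bounded uniformly in t on a large disc, and for real w the two right factors lie in a compact part
  of \<open>GG\<close>, where the decay for g applies. \<open>two_constants\<close>
  interpolates.\<close>

lemma decays_gam:
  assumes X: "sH X = X" and g: "decays y \<eta> \<kappa> g"
  shows "decays y \<eta> \<kappa> (g \<otimes>\<^bsub>H\<^esub> gam X z)"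
  unfolding decays_def
proof (intro allI impI)
  fix Q \<kappa>' assume Q: "compact Q" "Q \<subseteq> GG" and \<kappa>': "0 < \<kappa>'" "\<kappa>' < \<kappa>"
  \<comment> \<open>An intermediate rate leaves room for a loss: \<epsilon> below satisfies (1 -
    \<epsilon>) \<kappa>2 = \<kappa>'.\<close>
  define \<kappa>2 where "\<kappa>2 = (\<kappa>' + \<kappa>) / 2"
  have \<kappa>2: "\<kappa>' < \<kappa>2" "\<kappa>2 < \<kappa>" "0 < \<kappa>2" using \<kappa>' by (auto simp: \<kappa>2_def)
  define \<epsilon> where "\<epsilon> = 1 - \<kappa>' / \<kappa>2"
  have \<epsilon>: "0 < \<epsilon>" "\<epsilon> < 1" using \<kappa>' \<kappa>2 by (auto simp: \<epsilon>_def)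
  \<comment> \<open>Large enough that the weight sqrt(2 |z| / R) of the bound on the disc is at most
    \<epsilon>; it is independent of t.\<close>
  define R where "R = 2 * (norm z + 1) / \<epsilon>\<^sup>2"
  have e2: "0 < \<epsilon>\<^sup>2" "\<epsilon>\<^sup>2 < 1" using \<epsilon> power_strict_mono[of \<epsilon> 1 2] by auto
  have R: "R > 0" using e2 by (auto simp: R_def intro!: divide_pos_pos add_nonneg_pos)
  have zR: "norm z \<le> R"
  proof -
    have "norm z * \<epsilon>\<^sup>2 \<le> norm z" using e2 by (intro mult_right_le_one_le) auto
    also have "\<dots> \<le> 2 * (norm z + 1)" by simp
    finally have "norm z * \<epsilon>\<^sup>2 \<le> 2 * (norm z + 1)" .
    then show ?thesis using e2 by (simp add: R_def pos_le_divide_eq)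
  qed
  have small: "sqrt (2 * norm z / R) \<le> \<epsilon>"
  proof -
    have "2 * norm z \<le> \<epsilon>\<^sup>2 * R" using e2 by (simp add: R_def)
    then have "2 * norm z / R \<le> \<epsilon>\<^sup>2" using R by (simp add: pos_divide_le_eq)
    then show ?thesis using \<epsilon> real_sqrt_le_mono[of "2 * norm z / R" "\<epsilon>\<^sup>2"] by simp
  qed
  define Q' where "Q' = (\<lambda>p. gam X (of_real (fst p)) \<otimes>\<^bsub>H\<^esub> snd p) ` ({-R..R} \<times> Q)"
  have Q': "compact Q'" unfolding Q'_def
    by (intro compact_continuous_image compact_Times Q compact_Icc H.continuous_mult
        continuous_on_compose2[OF continuous_gam[of UNIV]] continuous_intros) auto
  have "Q' \<subseteq> GG" using Q(2) gam_GG[OF X] by (auto simp: Q'_def intro!: GG_mult)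
  then obtain C1 where C1: "\<And>t q. t \<ge> 1 \<Longrightarrow> q \<in> Q' \<Longrightarrow> ww y \<eta> t (g \<otimes>\<^bsub>H\<^esub> q) \<le> C1 - \<kappa>2 * t"
    using g Q' \<kappa>2 unfolding decays_def by metis
  let ?k = "\<lambda>p. g \<otimes>\<^bsub>H\<^esub> gam X (fst p) \<otimes>\<^bsub>H\<^esub> snd p"
  have "continuous_on (cball 0 R \<times> Q) (\<lambda>p. nrm \<eta> * nrm (px (?k p)) + (nrm (px (?k p)))\<^sup>2 / 2)"
    by (intro continuous_intros continuous_on_compose2[OF continuous_nrm[of UNIV]] continuous_polar_maps H.continuous_mult
        continuous_on_compose2[OF continuous_gam[of UNIV]]) auto
  then obtain C2 where C2: "\<And>p. p \<in> cball 0 R \<times> Q \<Longrightarrow> nrm \<eta> * nrm (px (?k p)) + (nrm (px (?k p)))\<^sup>2 / 2 \<le> C2"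
    using compact_upper_bound[OF compact_Times[OF compact_cball Q(1)]] by blast
  define C where "C = max C1 C2"
  have "ww y \<eta> t (g \<otimes>\<^bsub>H\<^esub> gam X z \<otimes>\<^bsub>H\<^esub> q) \<le> C - \<kappa>' * t" if t: "t \<ge> 1" and q: "q \<in> Q" for t q
  proof -
    define V where "V = (\<lambda>w. ww y \<eta> t (g \<otimes>\<^bsub>H\<^esub> gam X w \<otimes>\<^bsub>H\<^esub> q))"
    have V: "V = (\<lambda>w. vv y t (g \<otimes>\<^bsub>H\<^esub> gam X w \<otimes>\<^bsub>H\<^esub> (q \<otimes>\<^bsub>H\<^esub> E (- (t *\<^sub>R \<eta>)))) - t * ip \<eta> \<eta> / 2)"
      by (simp add: V_def ww_def H.m_assoc)
    have "subharmonic4 V" unfolding V by (intro subharmonic4_diff_const vv_subharmonic) (use t in simp)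
    moreover have "continuous_on UNIV V"
      unfolding V using t by (intro continuous_intros continuous_vv H.continuous_mult continuous_gam) auto
    moreover have "C - \<kappa>2 * t \<le> C" using \<kappa>2 t by simp
    moreover have "V w \<le> C" if "norm w \<le> R" for w
      using ww_upper[OF t, of y \<eta> "?k (w, q)"] C2[of "(w, q)"] that q by (auto simp: V_def C_def)
    moreover have "V (of_real x) \<le> C - \<kappa>2 * t" if "\<bar>x\<bar> \<le> R" for x
    proof -
      have "gam X (of_real x) \<otimes>\<^bsub>H\<^esub> q \<in> Q'" unfolding Q'_def using that q by (intro image_eqI[of _ _ "(x, q)"]) auto
      from C1[OF t this] show ?thesis by (simp add: V_def C_def H.m_assoc)
    qed
    ultimately have "V z \<le> (C - \<kappa>2 * t) + (C - (C - \<kappa>2 * t)) * sqrt (2 * norm z / R)"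
      using R zR by (intro two_constants) auto
    also have "\<dots> \<le> (C - \<kappa>2 * t) + (C - (C - \<kappa>2 * t)) * \<epsilon>"
      using \<kappa>2 t small by (intro add_left_mono mult_left_mono) auto
    also have "\<dots> = C - \<kappa>' * t" using \<kappa>2 by (simp add: \<epsilon>_def field_simps)
    finally show ?thesis by (simp add: V_def)
  qed
  then show "\<exists>C. \<forall>t\<ge>1. \<forall>q\<in>Q. ww y \<eta> t (g \<otimes>\<^bsub>H\<^esub> gam X z \<otimes>\<^bsub>H\<^esub> q) \<le> C - \<kappa>' * t" by blast
qed

lemma inv_gam: "inv\<^bsub>H\<^esub> gam X z = gam X (- z)"
proof -
  have "inv\<^bsub>H\<^esub> gam X z = H.ex (j X) (- Im z) \<otimes>\<^bsub>H\<^esub> H.ex X (- Re z)"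
    by (simp add: gam_def H.inv_mult_group H.ex_minus)
  then show ?thesis by (simp add: gam_def gam_commute)
qed

text \<open>Since \<open>decays_gam\<close> preserves the threshold \<kappa>, the property passes to
  words of any length in the curves exp(z X) with X in \<gg>, and these generate the connected group
  H because \<gg> and \<open>j\<close> \<gg> span its Lie algebra.\<close>

lemma decays_all:
  assumes one: "decays y \<eta> \<kappa> \<one>\<^bsub>H\<^esub>"
  shows "decays y \<eta> \<kappa> g"
proof -
  define S where "S = {gam X z | X z. sH X = X}"
  have step: "decays y \<eta> \<kappa> (h \<otimes>\<^bsub>H\<^esub> w)" if "w \<in> generate H S" "decays y \<eta> \<kappa> h" for w h
    using that
  proof (induction w arbitrary: h rule: generate.induct)
    case one then show ?case by simp
  next
    case (incl w) then show ?case using decays_gam by (auto simp: S_def)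
  next
    case (inv w) then show ?case using decays_gam by (auto simp: S_def inv_gam)
  next
    case (eng a b)
    have "decays y \<eta> \<kappa> ((h \<otimes>\<^bsub>H\<^esub> a) \<otimes>\<^bsub>H\<^esub> b)" by (intro eng.IH eng.prems)
    then show ?case by (simp add: H.m_assoc)
  qed
  have "generate H S = UNIV"
  proof (rule H.generated_by_exponentials[OF connected_H[OF ham.connected_U] span_real_form])
    show "\<one>\<^bsub>H\<^esub> \<in> generate H S" by (rule generate.one)
    show "a \<otimes>\<^bsub>H\<^esub> b \<in> generate H S" if "a \<in> generate H S" "b \<in> generate H S" for a b using that by (rule generate.eng)
    show "inv\<^bsub>H\<^esub> a \<in> generate H S" if "a \<in> generate H S" for a using that by (intro H.generate_m_inv_closed) auto
    fix X s assume "X \<in> {X. sH X = X} \<union> j ` {X. sH X = X}"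
    then have "H.ex X s \<in> S"
    proof
      assume "X \<in> {X. sH X = X}"
      then show ?thesis unfolding S_def using gam_real[of X s, symmetric] by blast
    next
      assume "X \<in> j ` {X. sH X = X}"
      then obtain Y where Y: "sH Y = Y" "X = j Y" by blast
      have "H.ex X s = gam Y (\<i> * of_real s)" by (simp add: gam_def Y(2))
      then show ?thesis unfolding S_def using Y(1) by blast
    qed
    then show "H.ex X s \<in> generate H S" by (rule generate.incl)
  qed
  then show ?thesis using step[OF _ one, of g] by simp
qed

theorem moment_image_real_form:
  assumes cM: "compact (UNIV :: 'm set)" and \<eta>: "s' \<eta> = - \<eta>" and y: "\<tau> y = y"
    and x: "x \<in> closure (orbit H actC y)" "Phis x = \<eta>"
  shows "\<exists>z \<in> closure {actC g y | g. g \<in> GG}. Phis z = \<eta>"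
proof (rule ccontr)
  let ?O = "{actC g y | g. g \<in> GG}"
  assume none: "\<not> (\<exists>z \<in> closure ?O. Phis z = \<eta>)"
  have cn: "continuous_on S (\<lambda>z. nrm (Phis z - \<eta>))" for S
    by (intro continuous_on_compose2[OF continuous_nrm[of UNIV]] continuous_intros continuous_Phis) auto
  have "compact (closure ?O)" using compact_Int_closed[OF cM closed_closure] by simp
  moreover have "?O \<noteq> {}" using GG_one by blast
  then have "closure ?O \<noteq> {}" by simp
  ultimately obtain z0 where z0: "z0 \<in> closure ?O" "\<And>z. z \<in> closure ?O \<Longrightarrow> nrm (Phis z0 - \<eta>) \<le> nrm (Phis z - \<eta>)"
    using continuous_attains_inf[OF _ _ cn] by blast
  define c where "c = nrm (Phis z0 - \<eta>)"
  have c: "c > 0" using none z0(1) by (auto simp: c_def intro!: nrm_pos)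
  have "open {z. nrm (Phis z - \<eta>) < c / 2}" by (intro open_Collect_less cn continuous_intros)
  moreover have "x \<in> {z. nrm (Phis z - \<eta>) < c / 2}" using c x(2) by simp
  ultimately have "orbit H actC y \<inter> {z. nrm (Phis z - \<eta>) < c / 2} \<noteq> {}"
    using x(1) open_Int_closure_eq_empty by (metis Int_commute disjoint_iff)
  then obtain g where g: "nrm (Phis (actC g y) - \<eta>) < c / 2" by (auto simp: orbit_def)
  have away: "c \<le> nrm (Phis z - \<eta>)" if "z \<in> closure ?O" for z using z0(2)[OF that] by (simp only: c_def)
  have dec: "decays y \<eta> (c\<^sup>2 / 2) (inv\<^bsub>H\<^esub> g)"
    by (rule decays_all[OF decays_one[OF \<eta> y less_imp_le[OF c] away]])
  have "0 < c\<^sup>2 / 4" "c\<^sup>2 / 4 < c\<^sup>2 / 2" using c by simp_all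
  from dec[unfolded decays_def, rule_format, OF compact_sing _ this, of "\<one>\<^bsub>H\<^esub>"]
  obtain C where C: "\<And>t. t \<ge> 1 \<Longrightarrow> ww y \<eta> t (inv\<^bsub>H\<^esub> g \<otimes>\<^bsub>H\<^esub> \<one>\<^bsub>H\<^esub>) \<le> C - c\<^sup>2 / 4 * t"
    using GG_one by auto
  \<comment> \<open>Decay at rate c^2 / 4, admissible since it is below c^2 / 2, meets a lower bound
    that falls at rate at most (c/2)^2 / 2 = c^2 / 8. The difference c^2 / 8 cannot persist for
    large t.\<close>
  have bound: "c\<^sup>2 / 8 * t \<le> C - psi y g" if t: "t \<ge> 1" for t
  proof -
    have "(nrm (Phis (actC g y) - \<eta>))\<^sup>2 \<le> (c / 2)\<^sup>2" using g by (intro power_mono) auto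
    then have "t / 2 * (nrm (Phis (actC g y) - \<eta>))\<^sup>2 \<le> t / 2 * (c / 2)\<^sup>2" using t by (intro mult_left_mono) auto
    also have "\<dots> = c\<^sup>2 / 8 * t" by (simp add: power2_eq_square)
    finally have "t / 2 * (nrm (Phis (actC g y) - \<eta>))\<^sup>2 \<le> c\<^sup>2 / 8 * t" .
    moreover have "ww y \<eta> t (inv\<^bsub>H\<^esub> g) \<le> C - c\<^sup>2 / 4 * t" using C[OF t] by simp
    moreover have "psi y g - t / 2 * (nrm (Phis (actC g y) - \<eta>))\<^sup>2 \<le> ww y \<eta> t (inv\<^bsub>H\<^esub> g)" by (rule ww_lower) (use t in simp)
    ultimately show ?thesis by linarith
  qed
  define t where "t = max 1 ((\<bar>C - psi y g\<bar> + 1) / (c\<^sup>2 / 8))"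
  have "\<bar>C - psi y g\<bar> + 1 \<le> c\<^sup>2 / 8 * t"
  proof -
    have "(\<bar>C - psi y g\<bar> + 1) / (c\<^sup>2 / 8) \<le> t" by (simp add: t_def)
    moreover have "c\<^sup>2 / 8 > 0" using c by simp
    ultimately show ?thesis by (simp only: pos_divide_le_eq mult.commute)
  qed
  moreover have "t \<ge> 1" by (simp add: t_def)
  ultimately show False using bound[of t] by linarith
qed

end

section \<open>Comparison of the two moment images\<close>

theorem corollary5p12:
  fixes U :: "'u::{t2_space, second_countable_topology} monoid"
    and A :: "('u, 'ue::real_normed_vector) charts" and \<sigma> :: "'u \<Rightarrow> 'u"
    and AM :: "('m::{t2_space, second_countable_topology}, 'me::real_normed_vector) charts"
    and \<omega> :: "'m \<Rightarrow> 'me \<Rightarrow> 'me \<Rightarrow> real"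
    and act :: "'u \<Rightarrow> 'm \<Rightarrow> 'm" and \<tau> :: "'m \<Rightarrow> 'm" and \<Phi> :: "'m \<Rightarrow> ('ue \<Rightarrow>\<^sub>L real)"
    and J :: "'m \<Rightarrow> 'me \<Rightarrow> 'me"
    and AL :: "('l::{t2_space, second_countable_topology}, 'le::real_normed_vector) charts"
    and JL :: "'l \<Rightarrow> 'le \<Rightarrow> 'le" and \<pi> :: "'l \<Rightarrow> 'm" and sc :: "complex \<Rightarrow> 'l \<Rightarrow> 'l"
    and h :: "'l \<Rightarrow> 'l \<Rightarrow> complex" and hor :: "'l \<Rightarrow> 'me \<Rightarrow> 'le"
    and actL :: "'u \<Rightarrow> 'l \<Rightarrow> 'l" and \<tau>L :: "'l \<Rightarrow> 'l"
    and UC :: "'h::{t2_space, second_countable_topology} monoid"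
    and AC :: "('h, 'he::real_normed_vector) charts" and JC :: "'h \<Rightarrow> 'he \<Rightarrow> 'he"
    and \<iota> :: "'u \<Rightarrow> 'h" and actC :: "'h \<Rightarrow> 'm \<Rightarrow> 'm"
    and \<aa> \<tt> :: "'ue set" and R'p Rap Rp :: "('ue \<Rightarrow> real) set" and m :: 'm
  assumes compact_M: "compact (UNIV :: 'm set)" and connected_M: "connected (UNIV :: 'm set)"
    and kaehler: "kaehler_hamiltonian_manifold U A \<sigma> AM \<omega> act \<tau> \<Phi> J"
    and prequantum:
      "equivariant_prequantum_bundle U A \<sigma> AM \<omega> act \<tau> \<Phi> J AL JL \<pi> sc h hor actL \<tau>L"
    and complexification: "complexification U A UC AC JC \<iota>"
    and complex_action: "extends_action UC AC JC \<iota> AM J act actC"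
    and \<aa>: "maximal_abelian_in U A (q_space U A \<sigma>) \<aa>"
    and \<tt>: "maximal_abelian_in U A UNIV \<tt>" "\<aa> \<subseteq> \<tt>"
    and R'p: "positive_system \<tt> (roots' U A \<tt> \<aa>) R'p"
    and Rap: "positive_system \<aa> (restricted_roots U A \<tt> \<aa>) Rap"
    and Rp: "Rp = positive_roots U A \<tt> \<aa> R'p Rap"
    and m: "\<tau> m = m"
  shows "moment_Delta U A \<tt> Rp \<Phi> (closure {actC g m | g. g \<in> G_group U A \<sigma> UC AC JC \<iota>}) =
         moment_Delta U A \<tt> Rp \<Phi> (closure (orbit UC actC m)) \<inter> a_dual U A \<sigma> \<tt>"
proof -
  interpret kh: kaehler_hamiltonian_manifold U A \<sigma> AM \<omega> act \<tau> \<Phi> J by (rule kaehler)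
  obtain ip :: "'ue \<Rightarrow> 'ue \<Rightarrow> real" where ip: "bilinear ip" "\<And>x y. ip x y = ip y x" "\<And>x. x \<noteq> 0 \<Longrightarrow> ip x x > 0"
    "\<And>u x y. ip (Ad U A u x) (Ad U A u y) = ip x y"
    "\<And>x y. ip (lie_involution U A \<sigma> x) (lie_involution U A \<sigma> y) = ip x y"
    using kh.invariant_form by metis
  have inner: "inner_complexification U A UC AC JC \<iota> ip"
    by (rule inner_complexification.intro[OF complexification inner_complexification_axioms.intro]) (rule ip; assumption?)+
  interpret complex_hamiltonian U A UC AC JC \<iota> ip \<sigma> AM \<omega> act \<tau> \<Phi> J actC
    by (intro complex_hamiltonian.intro complex_hamiltonian_axioms.intro inner kaehler complex_action ip(5))
  let ?C = "closure {actC g m | g. g \<in> GG}"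
  have sub: "?C \<subseteq> closure (orbit UC actC m)"
    by (rule closure_mono) (auto simp: orbit_def)
  have "\<Phi> ` ?C \<inter> weyl_chamber U A \<tt> Rp = \<Phi> ` closure (orbit UC actC m) \<inter> weyl_chamber U A \<tt> Rp \<inter> a_dual U A \<sigma> \<tt>"
  proof (intro equalityI subsetI)
    fix f assume f: "f \<in> \<Phi> ` ?C \<inter> weyl_chamber U A \<tt> Rp"
    then obtain z where z: "z \<in> ?C" "f = \<Phi> z" by blast
    have "\<Phi> z \<in> a_dual U A \<sigma> \<tt>"
      by (rule moment_in_a_dual[OF tau_closure[OF m z(1)]]) (use f z(2) in \<open>simp add: weyl_chamber_def\<close>)
    moreover have "\<Phi> z \<in> \<Phi> ` closure (orbit UC actC m)" by (rule imageI[OF subsetD[OF sub z(1)]])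
    ultimately show "f \<in> \<Phi> ` closure (orbit UC actC m) \<inter> weyl_chamber U A \<tt> Rp \<inter> a_dual U A \<sigma> \<tt>"
      using f by (simp only: z(2) Int_iff)
  next
    fix f assume f: "f \<in> \<Phi> ` closure (orbit UC actC m) \<inter> weyl_chamber U A \<tt> Rp \<inter> a_dual U A \<sigma> \<tt>"
    then obtain x where x: "x \<in> closure (orbit UC actC m)" "f = \<Phi> x" by blast
    \<comment> \<open>Membership in \<aa>^* enters as the condition that the dual vector lies in
      \<qq>, which is what \<open>moment_image_real_form\<close> asks for. That result returns a
      point with the same moment value, so the chamber condition carries over.\<close>
    have "lie_involution U A \<sigma> (Phis x) = - Phis x"
      by (rule a_dual_in_q[OF \<aa> \<tt>, of f]) (use f x(2) in \<open>simp_all add: ip_Phis\<close>)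
    from moment_image_real_form[OF compact_M this m x(1) refl]
    obtain z where z: "z \<in> ?C" "Phis z = Phis x" by blast
    have "f = \<Phi> z" unfolding x(2) by (rule blinfun_eqI) (simp add: ip_Phis[symmetric] z(2))
    then have "f \<in> \<Phi> ` ?C" using z(1) by (rule image_eqI)
    then show "f \<in> \<Phi> ` ?C \<inter> weyl_chamber U A \<tt> Rp" using f by (simp only: Int_iff)
  qed
  then show ?thesis by (simp add: moment_Delta_def GG_def)
qed

end
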